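(* Let $\Delta$ be the Suzuki-Ree building with apartment $\Sigma$ and root set $\Phi$, and let $\alpha\in\Phi$ and the isomorphism $x_\alpha$ be as in the context. Let $w=x_\alpha(0,1)$ in cases $\mathsf B$ and $\mathsf F$ and $w=x_\alpha(0,0,1)$ in case $\mathsf G$. Let $\psi$ be a valuation of the root datum of $\Delta$ based at $\Sigma$ and let $$\varphi=\psi-\psi_\alpha(w)\,\alpha/(\alpha\cdot\alpha)$$ (so $\varphi$ is a valuation equipollent to $\psi$ with $\varphi_\alpha(w)=0$). Then there exists a unique $\theta$-invariant valuation $\nu$ of $K$, which depends only on the equipollence class of $\psi$, such that $$\varphi_\alpha(x_\alpha(s,t))=\nu\big(R(s,t)\big)$$ for all $(s,t)\in \mathbf S^*$ in cases $\mathsf B$ and $\mathsf F$, and $$\varphi_\alpha(x_\alpha(r,s,t))=\nu\big(N(r,s,t)\big)$$ for all $(r,s,t)\in \mathbf T^*$ in case $\mathsf G$.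
   Context: Conventions: groups act on the right, $g^h=h^{-1}gh$, $[a,b]=a^{-1}b^{-1}ab$; $U^*$ is the set of non-identity elements of a group $U$, and $K^*=K\setminus\{0\}$. Root sets. $\Phi$ denotes a finite set of unit vectors spanning a Euclidean space $\mathbb A$: either an irreducible reduced root system with all roots rescaled to length $1$ (denoted by its usual name), or the set $\mathsf I_2(n)$ of $2n$ unit vectors evenly spaced on a circle. For $\alpha\in\Phi$: $s_\alpha(v)=v-2(v\cdot\alpha)\alpha$, $H_\alpha=\{v: v\cdot\alpha\ge0\}$. Sectors of $\Phi$ are closures of connected components of $\mathbb A$ minus all the fixed hyperplanes of the $s_\alpha$; faces of $\Phi$ are the faces of these cones. They form the Coxeter complex $\Sigma(\Phi)$, whose chambers are the sectors and whose roots are the sets of faces contained in some $H_\alpha$ (so roots correspond to elements of $\Phi$). A building of type $\Phi$ is a spherical building whose apartments are isomorphic to $\Sigma(\Phi)$; for an apartment $\Sigma$ an isomorphism $\Sigma(\Phi)\to\Sigma$ is fixed and identifies $\Phi$ with the set of roots of $\Sigma$. Moufang. In rank $\ge2$, the root group $U_\alpha$ of a root $\alpha$ is the group of automorphisms fixing every chamber contained in some panel that contains two chambers of $\alpha$; the building is Moufang if it is thick and each $U_\alpha$ is transitive on the apartments containing $\alpha$. A rank one building is a set (elements = chambers, apartments = two-element subsets, roots = one-element subsets); a Moufang structure on it relative to an apartment with roots $\alpha,-\alpha$ consists of non-trivial permutation groups $U_\alpha,U_{-\alpha}$ such that each $U_\beta$ ($\beta=\pm\alpha$) fixes $\beta$,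 is sharply transitive on the complement of $\beta$, and is normalized by the stabilizer of $\beta$ in $\langle U_\alpha,U_{-\alpha}\rangle$. For $u\in U_\alpha^*$, $m_\Sigma(u)$ is the unique element of $U_{-\alpha}^*uU_{-\alpha}^*$ mapping $\Sigma$ to itself; it induces $s_\alpha$. Root data and valuations. The root datum of a Moufang building of type $\Phi$ based at an apartment $\Sigma$ is $(\Sigma,(U_\alpha)_{\alpha\in\Phi})$. A valuation of it is a family $\varphi=(\varphi_\alpha)_{\alpha\in\Phi}$ of non-constant maps $\varphi_\alpha:U_\alpha^*\to\mathbb R$ (with $\varphi_\alpha(1)=\infty$) such that (V1) $U_{\alpha,k}=\{u\in U_\alpha:\varphi_\alpha(u)\ge k\}$ is a subgroup for all $\alpha$ and $k\in\mathbb R$; (V2) for $\alpha\ne\pm\beta$ and $k,l\in\mathbb R$, $[U_{\alpha,k},U_{\beta,l}]\subset U_{\gamma_1,p_1k+q_1l}\cdots U_{\gamma_s,p_sk+q_sl}$, where $\gamma_1,\dots,\gamma_s$ are the elements of $\Phi$ of the form $\gamma_i=p_i\alpha+q_i\beta$ with real $p_i,q_i>0$, ordered by increasing angle from $\alpha$ (trivial commutator if $s=0$); (V3) for all $\alpha,\beta\in\Phi$, $u\in U_\alpha^*$, $g\in U_\beta^*$, the quantity $\varphi_{s_\alpha(\beta)}(g^{m_\Sigma(u)})-\varphi_\beta(g)$ is independent of $g$, and equals $-2\varphi_\alpha(u)$ if $\alpha=\beta$. Valuations $\varphi,\psi$ are equipollent if for some $x\in\mathbb A$, $\varphi_\alpha(u)=\psi_\alpha(u)+\alpha\cdot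 x$ for all $\alpha,u$; one writes $\varphi=\psi+x$. A valuation of a field is non-trivial, real-valued and non-archimedean; a valuation $\nu$ of $K$ is $\theta$-invariant if for $x\in K^*$, $\nu(x)\ge0\iff\nu(x^\theta)\ge0$ (equivalently $\nu(x^\theta)=\sqrt p\,\nu(x)$, $p=\mathrm{char}\,K$). Set-up. $K$ is a field of characteristic $p$, with $p=2$ in cases $\mathsf B,\mathsf F$ and $p=3$ in case $\mathsf G$; $\theta$ is a Tits endomorphism of $K$ (i.e. $\theta^2$ is $x\mapsto x^p$); $F=K^\theta$. In case $\mathsf B$, $L$ is an additive subgroup of $K$ with $F\subset L$, $LF\subset L$, generating $K$ as a ring. Put $P=L$ in case $\mathsf B$, $P=K$ otherwise. $\dot\Phi=\mathsf B_2,\mathsf F_4,\mathsf G_2$ respectively, with ambient space $\dot{\mathbb A}$; $S$ is a fixed sector of $\dot\Phi$; $\tau$ is the unique non-trivial isometry of $\dot{\mathbb A}$ mapping $\dot\Phi$ and $S$ to themselves ($\tau^2=1$). $\dot\Delta$ is the unique Moufang building of type $\dot\Phi$ having an apartment $\dot\Sigma$, a chamber $C$ of $\dot\Sigma$ (with $\dot\Phi$ identified with the roots of $\dot\Sigma$ via the type-preserving isomorphism $\dot\psi:\Sigma(\dot\Phi)\to\dot\Sigma$ mapping $S$ to $C$) and isomorphisms $x_\alpha$ from $(P,+)$ to $U_\alpha$ ($\alpha\in\dot\Phi$) such that $x_\beta(t)^{m_{\dot\Sigma}(x_\alpha(1))}=x_{s_\alpha(\beta)}(\pm t)$ for all $\alpha,\beta,t$;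 $[U_\alpha,U_\beta]=1$ if $\angle(\alpha,\beta)\le90^\circ$; in cases $\mathsf B,\mathsf F$, $[x_\alpha(s),x_\beta(t)]=x_{\alpha+\beta}(st)$ if $\angle(\alpha,\beta)=120^\circ$ and $[x_\alpha(s),x_\beta(t)]=x_{\sqrt2\alpha+\beta}(s^\theta t)x_{\alpha+\sqrt2\beta}(st^\theta)$ if $\angle(\alpha,\beta)=135^\circ$; in case $\mathsf G$, numbering the roots clockwise $\alpha_1,\dots,\alpha_{12}$ so that $\alpha_i$ contains $C$ exactly for $1\le i\le6$, and with $x_i=x_{\alpha_i}$: $[x_1(s),x_6(t)]=x_2(-s^\theta t)x_3(-s^2t^\theta)x_4(s^\theta t^2)x_5(st^\theta)$, $[x_1(s),x_5(t)]=x_3(-st)$, $[x_2(s),x_6(t)]=x_4(st)$ (for other pairs of roots at angle $120^\circ$ or $150^\circ$ the analogous relations hold up to signs of the arguments); and such that there is a (necessarily unique) automorphism $\rho$ of $\dot\Delta$ mapping $(C,\dot\Sigma)$ to itself with $x_\alpha(t)^\rho=x_{\tau(\alpha)}(t)$ for all $\alpha\in\dot\Phi,t\in P$. The Suzuki-Ree building $\Delta$ is the set of chambers of $\dot\Delta$ fixed by $\rho$, two being adjacent if they are opposite in a $\rho$-invariant residue of rank two. $\mathbb A$ is the fixed space of $\tau$; $\Phi=\{\ddot\alpha/|\ddot\alpha|:\dot\alpha\in\dot\Phi\}$ with $\ddot\alpha=\dot\alpha+\tau(\dot\alpha)\neq0$ ($\mathsf A_1$ in cases $\mathsf B,\mathsf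 G$; $\mathsf I_2(8)$ in case $\mathsf F$); $\dot\Phi_\alpha$ is the set of $\dot\alpha\in\dot\Phi$ with $\ddot\alpha/|\ddot\alpha|=\alpha$. $\Delta$ is a building of type $\Phi$ with apartment $\Sigma=\dot\Sigma\cap\Delta$; $\alpha\in\Phi$ is identified with the root $\dot\alpha\cap\Sigma$ for any $\dot\alpha\in\dot\Phi_\alpha$; $U_\alpha$ is the centralizer of $\rho$ in $\langle U_{\dot\alpha}\mid\dot\alpha\in\dot\Phi_\alpha\rangle$. These groups are the Moufang structure on $\Delta$ in cases $\mathsf B,\mathsf G$ and the root groups in case $\mathsf F$, where $\Delta$ is Moufang. Groups and norms. Exponents in $\mathbb Z[\theta]$ are read multiplicatively ($x^{\theta+2}=x^\theta x^2$, etc.). In cases $\mathsf B,\mathsf F$: $\mathbf S=P\times P$ with $(s,t)\cdot(u,v)=(s+u,t+v+s^\theta u)$ and $R(s,t)=s^{\theta+2}+st+t^\theta$. In case $\mathsf G$: $\mathbf T=K^3$ with $(r,s,t)\cdot(w,u,v)=(r+w,s+u+r^\theta w,t+v-ru+sw-r^{\theta+1}w)$ and $N(r,s,t)=r^{\theta+1}s^\theta-rt^\theta-r^{\theta+3}s-r^2s^2+s^{\theta+1}+t^2-r^{2\theta+4}$. Here $\alpha\in\Phi$ and $x_\alpha$ are such that: in cases $\mathsf B,\mathsf F$, $x_\alpha:\mathbf S\to U_\alpha$ is an isomorphism with $x_\alpha(u,v)^{h(s,t)}=x_\alpha(R(s,t)^{2-\theta}u,R(s,t)^\theta v)$ for $(u,v)\in\mathbf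 S$, $(s,t)\in\mathbf S^*$, where $h(s,t)=m_\Sigma(x_\alpha(0,1))m_\Sigma(x_\alpha(s,t))$; in case $\mathsf G$, $x_\alpha:\mathbf T\to U_\alpha$ is an isomorphism with $x_\alpha(w,u,v)^{h(r,s,t)}=x_\alpha(N(r,s,t)^{2-\theta}w,N(r,s,t)^{\theta-1}u,N(r,s,t)v)$ for $(w,u,v)\in\mathbf T$, $(r,s,t)\in\mathbf T^*$, where $h(r,s,t)=m_\Sigma(x_\alpha(0,0,1))m_\Sigma(x_\alpha(r,s,t))$. Such $\alpha$, $x_\alpha$ exist. *)

theory Defs
  imports
    "HOL-Analysis.Analysis"
    "HOL-Combinatorics.Permutations"
    "HOL-Algebra.Generated_Groups"
begin

section \<open>Root sets\<close>

definition refl_in :: "'v::euclidean_space \<Rightarrow> 'v \<Rightarrow> 'v" where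
  "refl_in \<alpha> v = v - (2 * (v \<bullet> \<alpha>)) *\<^sub>R \<alpha>"

definition halfspace :: "'v::euclidean_space \<Rightarrow> 'v set" where
  "halfspace \<alpha> = {v. v \<bullet> \<alpha> \<ge> 0}"

(* The angle between two unit vectors. *)
definition angle :: "'v::euclidean_space \<Rightarrow> 'v \<Rightarrow> real" where
  "angle u v = arccos (u \<bullet> v)"

(* Root systems are given in coordinates with respect to an arbitrary orthonormal family;
   the library function sgn rescales a vector to length one. *)
definition orthonormal_family :: "nat \<Rightarrow> (nat \<Rightarrow> 'v::euclidean_space) \<Rightarrow> bool" where
  "orthonormal_family n e \<longleftrightarrow> (\<forall>i<n. \<forall>j<n. e i \<bullet> e j = (if i = j then 1 else 0))"

definition root_set_B2 :: "'v::euclidean_space set \<Rightarrow> bool" where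
  "root_set_B2 \<Phi> \<longleftrightarrow> span \<Phi> = UNIV \<and> (\<exists>e. orthonormal_family 2 e \<and>
     \<Phi> = sgn ` ({c *\<^sub>R e i | c i. c \<in> {1, -1} \<and> i < 2}
                \<union> {c *\<^sub>R e 0 + d *\<^sub>R e 1 | c d. c \<in> {1, -1} \<and> d \<in> {1, -1}}))"

definition root_set_F4 :: "'v::euclidean_space set \<Rightarrow> bool" where
  "root_set_F4 \<Phi> \<longleftrightarrow> span \<Phi> = UNIV \<and> (\<exists>e. orthonormal_family 4 e \<and>
     \<Phi> = sgn ` ({c *\<^sub>R e i | c i. c \<in> {1, -1} \<and> i < 4}
                \<union> {c *\<^sub>R e i + d *\<^sub>R e j | c d i j. c \<in> {1, -1} \<and> d \<in> {1, -1} \<and> i < j \<and> j < 4}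
                \<union> {(1/2) *\<^sub>R (\<Sum>i<4. c i *\<^sub>R e i) | c. \<forall>i<4. c i \<in> {1, -1}}))"

(* a is the short and b the long simple root. *)
definition root_set_G2 :: "'v::euclidean_space set \<Rightarrow> bool" where
  "root_set_G2 \<Phi> \<longleftrightarrow> span \<Phi> = UNIV \<and> (\<exists>a b. a \<bullet> a = 2 \<and> b \<bullet> b = 6 \<and> a \<bullet> b = -3 \<and>
     \<Phi> = sgn ` {c *\<^sub>R v | c v. c \<in> {1, -1} \<and>
            v \<in> {a, b, a + b, 2 *\<^sub>R a + b, 3 *\<^sub>R a + b, 3 *\<^sub>R a + 2 *\<^sub>R b}})"

(* The Euclidean space of a root set \<Phi> is span \<Phi>, possibly a proper subspace of the ambient type. *)
definition sectors :: "'v::euclidean_space set \<Rightarrow> 'v set set" where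
  "sectors \<Phi> = closure ` components (span \<Phi> - (\<Union>\<alpha>\<in>\<Phi>. {v. refl_in \<alpha> v = v}))"

inductive_set weyl :: "'v::euclidean_space set \<Rightarrow> ('v \<Rightarrow> 'v) set" for \<Phi> where
  weyl_id: "id \<in> weyl \<Phi>"
| weyl_refl: "w \<in> weyl \<Phi> \<Longrightarrow> \<alpha> \<in> \<Phi> \<Longrightarrow> refl_in \<alpha> \<circ> w \<in> weyl \<Phi>"

definition wall :: "'v::euclidean_space set \<Rightarrow> 'v \<Rightarrow> 'v set" where
  "wall S \<alpha> = S \<inter> {v. v \<bullet> \<alpha> = 0}"

definition simple_roots :: "'v::euclidean_space set \<Rightarrow> 'v set \<Rightarrow> 'v set" where
  "simple_roots \<Phi> S = {\<alpha> \<in> \<Phi>. S \<subseteq> halfspace \<alpha> \<and> wall S \<alpha> facet_of S}"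


section \<open>Chamber systems and buildings\<close>

record ('c, 'i) chamber_system =
  chambers :: "'c set"
  colors :: "'i set"
  adjacent :: "'i \<Rightarrow> 'c \<Rightarrow> 'c \<Rightarrow> bool"

definition is_chamber_system :: "('c, 'i) chamber_system \<Rightarrow> bool" where
  "is_chamber_system D \<longleftrightarrow>
     (\<forall>i c d. adjacent D i c d \<longrightarrow>
        i \<in> colors D \<and> c \<in> chambers D \<and> d \<in> chambers D \<and> c \<noteq> d \<and> adjacent D i d c) \<and>
     (\<forall>i b c d. adjacent D i b c \<and> adjacent D i c d \<and> b \<noteq> d \<longrightarrow> adjacent D i b d)"

fun gallery :: "('c, 'i) chamber_system \<Rightarrow> 'i list \<Rightarrow> 'c \<Rightarrow> 'c \<Rightarrow> bool" where
  "gallery D [] c d = (c \<in> chambers D \<and> d = c)"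
| "gallery D (i # f) c d = (\<exists>e. adjacent D i c e \<and> gallery D f e d)"

definition gallery_dist :: "('c, 'i) chamber_system \<Rightarrow> 'c \<Rightarrow> 'c \<Rightarrow> nat" where
  "gallery_dist D c d = (LEAST n. \<exists>f. length f = n \<and> gallery D f c d)"

definition residues :: "('c, 'i) chamber_system \<Rightarrow> 'i set \<Rightarrow> 'c set set" where
  "residues D J = {{d. \<exists>f. set f \<subseteq> J \<and> gallery D f c d} | c. c \<in> chambers D}"

definition panels :: "('c, 'i) chamber_system \<Rightarrow> 'c set set" where
  "panels D = (\<Union>i\<in>colors D. residues D {i})"

definition opposite_in :: "('c, 'i) chamber_system \<Rightarrow> 'c set \<Rightarrow> 'c \<Rightarrow> 'c \<Rightarrow> bool" where
  "opposite_in D R c d \<longleftrightarrow> c \<in> R \<and> d \<in> R \<and>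
     (\<forall>c'\<in>R. \<forall>d'\<in>R. gallery_dist D c' d' \<le> gallery_dist D c d)"

definition chamber_iso ::
  "('c, 'i) chamber_system \<Rightarrow> ('d, 'j) chamber_system \<Rightarrow> ('i \<Rightarrow> 'j) \<Rightarrow> ('c \<Rightarrow> 'd) \<Rightarrow> bool" where
  "chamber_iso D E \<sigma> g \<longleftrightarrow> bij_betw \<sigma> (colors D) (colors E) \<and> bij_betw g (chambers D) (chambers E) \<and>
     (\<forall>i\<in>colors D. \<forall>c\<in>chambers D. \<forall>d\<in>chambers D.
        adjacent D i c d \<longleftrightarrow> adjacent E (\<sigma> i) (g c) (g d))"

(* The Coxeter complex \<Sigma>(\<Phi>) as a chamber system: its faces of codimension one have as type
   the unique facet of the base sector S in their Weyl group orbit, and this facet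
   is represented by the corresponding simple root. *)
definition coxeter_complex :: "'v::euclidean_space set \<Rightarrow> 'v set \<Rightarrow> ('v set, 'v) chamber_system" where
  "coxeter_complex \<Phi> S =
     \<lparr>chambers = sectors \<Phi>, colors = simple_roots \<Phi> S,
      adjacent = (\<lambda>i T T'. i \<in> simple_roots \<Phi> S \<and> T \<in> sectors \<Phi> \<and> T' \<in> sectors \<Phi> \<and> T \<noteq> T' \<and>
                    (\<exists>w\<in>weyl \<Phi>. T \<inter> T' = w ` wall S i))\<rparr>"

definition word_value :: "'v::euclidean_space list \<Rightarrow> 'v \<Rightarrow> 'v" where
  "word_value f = foldr (\<lambda>i w. refl_in i \<circ> w) f id"

definition reduced_word :: "'v::euclidean_space set \<Rightarrow> 'v list \<Rightarrow> bool" where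
  "reduced_word I f \<longleftrightarrow> set f \<subseteq> I \<and>
     (\<forall>g. set g \<subseteq> I \<and> word_value g = word_value f \<longrightarrow> length f \<le> length g)"

(* Buildings as chamber systems with a Weyl-group-valued distance function \<delta>; the colors are
   the simple roots of \<Phi> with respect to S, i.e. the Coxeter generators of the Weyl group. *)
definition building :: "'v::euclidean_space set \<Rightarrow> 'v set \<Rightarrow> ('c, 'v) chamber_system \<Rightarrow> bool" where
  "building \<Phi> S D \<longleftrightarrow> is_chamber_system D \<and> colors D = simple_roots \<Phi> S \<and> chambers D \<noteq> {} \<and>
     (\<forall>P\<in>panels D. \<exists>c\<in>P. \<exists>d\<in>P. c \<noteq> d) \<and>
     (\<exists>\<delta>. \<forall>c\<in>chambers D. \<forall>d\<in>chambers D. \<delta> c d \<in> weyl \<Phi> \<and>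
        (\<forall>f. reduced_word (colors D) f \<longrightarrow> (\<delta> c d = word_value f \<longleftrightarrow> gallery D f c d)))"

definition apartments :: "'v::euclidean_space set \<Rightarrow> 'v set \<Rightarrow> ('c, 'v) chamber_system \<Rightarrow> 'c set set" where
  "apartments \<Phi> S D = {A. A \<subseteq> chambers D \<and>
     (\<exists>\<pi>. chamber_iso (coxeter_complex \<Phi> S) (D\<lparr>chambers := A\<rparr>) id \<pi>)}"

(* Roots are represented by their sets of chambers. *)
definition coxeter_root :: "'v::euclidean_space set \<Rightarrow> 'v \<Rightarrow> 'v set set" where
  "coxeter_root \<Phi> \<alpha> = {T \<in> sectors \<Phi>. T \<subseteq> halfspace \<alpha>}"

definition apartment_roots ::
  "'v::euclidean_space set \<Rightarrow> 'v set \<Rightarrow> ('c, 'v) chamber_system \<Rightarrow> 'c set \<Rightarrow> 'c set set" where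
  "apartment_roots \<Phi> S D A = {\<pi> ` coxeter_root \<Phi> \<alpha> | \<pi> \<alpha>.
     \<alpha> \<in> \<Phi> \<and> chamber_iso (coxeter_complex \<Phi> S) (D\<lparr>chambers := A\<rparr>) id \<pi>}"


section \<open>Moufang buildings and root data\<close>

(* Groups act on the right: the product of g and h is g followed by h. Automorphisms may
   permute the colors, and are the identity outside the set of chambers. *)
definition aut_group :: "('c, 'i) chamber_system \<Rightarrow> ('c \<Rightarrow> 'c) monoid" where
  "aut_group D = \<lparr>carrier = {g. g permutes chambers D \<and> (\<exists>\<sigma>. chamber_iso D D \<sigma> g)},
                  mult = (\<lambda>g h. h \<circ> g), one = id\<rparr>"

definition conj_by :: "('g, 'b) monoid_scheme \<Rightarrow> 'g \<Rightarrow> 'g \<Rightarrow> 'g" where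
  "conj_by G g h = inv\<^bsub>G\<^esub> h \<otimes>\<^bsub>G\<^esub> g \<otimes>\<^bsub>G\<^esub> h"

definition comm :: "('g, 'b) monoid_scheme \<Rightarrow> 'g \<Rightarrow> 'g \<Rightarrow> 'g" where
  "comm G a b = inv\<^bsub>G\<^esub> a \<otimes>\<^bsub>G\<^esub> inv\<^bsub>G\<^esub> b \<otimes>\<^bsub>G\<^esub> a \<otimes>\<^bsub>G\<^esub> b"

definition root_group :: "('c, 'i) chamber_system \<Rightarrow> 'c set \<Rightarrow> ('c \<Rightarrow> 'c) set" where
  "root_group D r = {g \<in> carrier (aut_group D).
     \<forall>P\<in>panels D. (\<exists>c\<in>P \<inter> r. \<exists>d\<in>P \<inter> r. c \<noteq> d) \<longrightarrow> (\<forall>c\<in>P. g c = c)}"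

definition thick :: "('c, 'i) chamber_system \<Rightarrow> bool" where
  "thick D \<longleftrightarrow> (\<forall>P\<in>panels D. infinite P \<or> card P \<ge> 3)"

definition moufang_building :: "'v::euclidean_space set \<Rightarrow> 'v set \<Rightarrow> ('c, 'v) chamber_system \<Rightarrow> bool" where
  "moufang_building \<Phi> S D \<longleftrightarrow> building \<Phi> S D \<and> card (colors D) \<ge> 2 \<and> thick D \<and>
     (\<forall>A\<in>apartments \<Phi> S D. \<forall>r\<in>apartment_roots \<Phi> S D A.
        \<forall>A1\<in>apartments \<Phi> S D. \<forall>A2\<in>apartments \<Phi> S D. r \<subseteq> A1 \<and> r \<subseteq> A2 \<longrightarrow>
          (\<exists>g\<in>root_group D r. g ` A1 = A2))"

definition moufang_structure ::
  "'v::euclidean_space set \<Rightarrow> 'v set \<Rightarrow> ('c, 'v) chamber_system \<Rightarrow> ('v \<Rightarrow> 'c set) \<Rightarrow>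
   ('v \<Rightarrow> ('c \<Rightarrow> 'c) set) \<Rightarrow> bool" where
  "moufang_structure \<Phi> S D rt U \<longleftrightarrow> building \<Phi> S D \<and> card (colors D) = 1 \<and>
     (\<forall>\<beta>\<in>\<Phi>. subgroup (U \<beta>) (aut_group D) \<and> U \<beta> \<noteq> {id} \<and>
        (\<exists>b. rt \<beta> = {b} \<and> (\<forall>u\<in>U \<beta>. u b = b) \<and>
           (\<forall>c\<in>chambers D - {b}. \<forall>d\<in>chambers D - {b}. \<exists>!u. u \<in> U \<beta> \<and> u c = d) \<and>
           (\<forall>g\<in>generate (aut_group D) (\<Union>\<gamma>\<in>\<Phi>. U \<gamma>). g b = b \<longrightarrow>
              (\<lambda>u. conj_by (aut_group D) u g) ` U \<beta> = U \<beta>)))"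

(* (A, U) is a root datum based at the apartment A, where rt is the identification of \<Phi> with
   the set of roots of A. In rank one, U is part of the structure; otherwise it is determined. *)
definition root_datum ::
  "'v::euclidean_space set \<Rightarrow> 'v set \<Rightarrow> ('c, 'v) chamber_system \<Rightarrow> 'c set \<Rightarrow> ('v \<Rightarrow> 'c set) \<Rightarrow>
   ('v \<Rightarrow> ('c \<Rightarrow> 'c) set) \<Rightarrow> bool" where
  "root_datum \<Phi> S D A rt U \<longleftrightarrow> A \<in> apartments \<Phi> S D \<and>
     (\<exists>\<sigma> \<pi>. chamber_iso (coxeter_complex \<Phi> S) (D\<lparr>chambers := A\<rparr>) \<sigma> \<pi> \<and>
        (\<forall>\<alpha>\<in>\<Phi>. rt \<alpha> = \<pi> ` coxeter_root \<Phi> \<alpha>)) \<and>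
     (if card (colors D) = 1 then moufang_structure \<Phi> S D rt U
      else moufang_building \<Phi> S D \<and> (\<forall>\<alpha>\<in>\<Phi>. U \<alpha> = root_group D (rt \<alpha>)))"

definition m_elem ::
  "('c, 'i) chamber_system \<Rightarrow> 'c set \<Rightarrow> ('v::euclidean_space \<Rightarrow> ('c \<Rightarrow> 'c) set) \<Rightarrow> 'v \<Rightarrow>
   ('c \<Rightarrow> 'c) \<Rightarrow> 'c \<Rightarrow> 'c" where
  "m_elem D A U \<alpha> u = (THE m.
     (\<exists>a\<in>U (-\<alpha>) - {id}. \<exists>b\<in>U (-\<alpha>) - {id}.
        m = a \<otimes>\<^bsub>aut_group D\<^esub> u \<otimes>\<^bsub>aut_group D\<^esub> b) \<and> m ` A = A)"


section \<open>Valuations of root data\<close>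

definition level_set :: "('v \<Rightarrow> 'g set) \<Rightarrow> ('v \<Rightarrow> 'g \<Rightarrow> ereal) \<Rightarrow> 'v \<Rightarrow> real \<Rightarrow> 'g set" where
  "level_set U \<phi> \<alpha> k = {u \<in> U \<alpha>. \<phi> \<alpha> u \<ge> ereal k}"

(* The roots between \<alpha> and \<beta>, listed by increasing angle from \<alpha>; the root p \<alpha> + q \<beta> is
   represented by (p, q). *)
definition roots_between ::
  "'v::euclidean_space set \<Rightarrow> 'v \<Rightarrow> 'v \<Rightarrow> (real \<times> real) list \<Rightarrow> bool" where
  "roots_between \<Phi> \<alpha> \<beta> pqs \<longleftrightarrow>
     set pqs = {(p, q). p > 0 \<and> q > 0 \<and> p *\<^sub>R \<alpha> + q *\<^sub>R \<beta> \<in> \<Phi>} \<and>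
     sorted_wrt (\<lambda>(p, q) (p', q').
        angle \<alpha> (p *\<^sub>R \<alpha> + q *\<^sub>R \<beta>) < angle \<alpha> (p' *\<^sub>R \<alpha> + q' *\<^sub>R \<beta>)) pqs"

definition valuation_V1 ::
  "'v::euclidean_space set \<Rightarrow> ('c, 'v) chamber_system \<Rightarrow> ('v \<Rightarrow> ('c \<Rightarrow> 'c) set) \<Rightarrow>
   ('v \<Rightarrow> ('c \<Rightarrow> 'c) \<Rightarrow> ereal) \<Rightarrow> bool" where
  "valuation_V1 \<Phi> D U \<phi> \<longleftrightarrow> (\<forall>\<alpha>\<in>\<Phi>. \<forall>k. subgroup (level_set U \<phi> \<alpha> k) (aut_group D))"

definition valuation_V2 ::
  "'v::euclidean_space set \<Rightarrow> ('c, 'v) chamber_system \<Rightarrow> ('v \<Rightarrow> ('c \<Rightarrow> 'c) set) \<Rightarrow>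
   ('v \<Rightarrow> ('c \<Rightarrow> 'c) \<Rightarrow> ereal) \<Rightarrow> bool" where
  "valuation_V2 \<Phi> D U \<phi> \<longleftrightarrow> (\<forall>\<alpha>\<in>\<Phi>. \<forall>\<beta>\<in>\<Phi>. \<forall>k l. \<alpha> \<noteq> \<beta> \<and> \<alpha> \<noteq> -\<beta> \<longrightarrow>
     (\<exists>pqs. roots_between \<Phi> \<alpha> \<beta> pqs \<and>
        generate (aut_group D)
          {comm (aut_group D) a b | a b. a \<in> level_set U \<phi> \<alpha> k \<and> b \<in> level_set U \<phi> \<beta> l}
        \<subseteq> foldr (\<lambda>(p, q) X. level_set U \<phi> (p *\<^sub>R \<alpha> + q *\<^sub>R \<beta>) (p * k + q * l) <#>\<^bsub>aut_group D\<^esub> X)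
             pqs {\<one>\<^bsub>aut_group D\<^esub>}))"

definition valuation_V3 ::
  "'v::euclidean_space set \<Rightarrow> ('c, 'v) chamber_system \<Rightarrow> 'c set \<Rightarrow> ('v \<Rightarrow> ('c \<Rightarrow> 'c) set) \<Rightarrow>
   ('v \<Rightarrow> ('c \<Rightarrow> 'c) \<Rightarrow> ereal) \<Rightarrow> bool" where
  "valuation_V3 \<Phi> D A U \<phi> \<longleftrightarrow> (\<forall>\<alpha>\<in>\<Phi>. \<forall>\<beta>\<in>\<Phi>. \<forall>u\<in>U \<alpha> - {id}. \<exists>c. \<forall>g\<in>U \<beta> - {id}.
     \<phi> (refl_in \<alpha> \<beta>) (conj_by (aut_group D) g (m_elem D A U \<alpha> u)) - \<phi> \<beta> g = c \<and>
     (\<alpha> = \<beta> \<longrightarrow> c = - 2 * \<phi> \<alpha> u))"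

definition root_datum_valuation ::
  "'v::euclidean_space set \<Rightarrow> 'v set \<Rightarrow> ('c, 'v) chamber_system \<Rightarrow> 'c set \<Rightarrow> ('v \<Rightarrow> 'c set) \<Rightarrow>
   ('v \<Rightarrow> ('c \<Rightarrow> 'c) set) \<Rightarrow> ('v \<Rightarrow> ('c \<Rightarrow> 'c) \<Rightarrow> ereal) \<Rightarrow> bool" where
  "root_datum_valuation \<Phi> S D A rt U \<phi> \<longleftrightarrow> root_datum \<Phi> S D A rt U \<and>
     (\<forall>\<alpha>\<in>\<Phi>. \<phi> \<alpha> id = \<infinity> \<and> (\<forall>u\<in>U \<alpha> - {id}. \<bar>\<phi> \<alpha> u\<bar> \<noteq> \<infinity>) \<and>
        (\<exists>u\<in>U \<alpha> - {id}. \<exists>v\<in>U \<alpha> - {id}. \<phi> \<alpha> u \<noteq> \<phi> \<alpha> v)) \<and>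
     valuation_V1 \<Phi> D U \<phi> \<and> valuation_V2 \<Phi> D U \<phi> \<and> valuation_V3 \<Phi> D A U \<phi>"

definition translate ::
  "('v::euclidean_space \<Rightarrow> 'g \<Rightarrow> ereal) \<Rightarrow> 'v \<Rightarrow> 'v \<Rightarrow> 'g \<Rightarrow> ereal" where
  "translate \<psi> x = (\<lambda>\<alpha> u. \<psi> \<alpha> u + ereal (\<alpha> \<bullet> x))"

definition equipollent ::
  "'v::euclidean_space set \<Rightarrow> ('v \<Rightarrow> 'g set) \<Rightarrow> ('v \<Rightarrow> 'g \<Rightarrow> ereal) \<Rightarrow> ('v \<Rightarrow> 'g \<Rightarrow> ereal) \<Rightarrow> bool" where
  "equipollent \<Phi> U \<phi> \<psi> \<longleftrightarrow> (\<exists>x\<in>span \<Phi>. \<forall>\<alpha>\<in>\<Phi>. \<forall>u\<in>U \<alpha>. \<phi> \<alpha> u = translate \<psi> x \<alpha> u)"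


section \<open>Fields with a Tits endomorphism\<close>

definition tits_endomorphism :: "('k::field \<Rightarrow> 'k) \<Rightarrow> bool" where
  "tits_endomorphism \<theta> \<longleftrightarrow> \<theta> 1 = 1 \<and> (\<forall>x y. \<theta> (x + y) = \<theta> x + \<theta> y) \<and>
     (\<forall>x y. \<theta> (x * y) = \<theta> x * \<theta> y) \<and> (\<forall>x. \<theta> (\<theta> x) = x ^ CHAR('k))"

definition field_valuation :: "('k::field \<Rightarrow> ereal) \<Rightarrow> bool" where
  "field_valuation \<nu> \<longleftrightarrow> \<nu> 0 = \<infinity> \<and> (\<forall>x. x \<noteq> 0 \<longrightarrow> \<bar>\<nu> x\<bar> \<noteq> \<infinity>) \<and>
     (\<forall>x y. \<nu> (x * y) = \<nu> x + \<nu> y) \<and> (\<forall>x y. \<nu> (x + y) \<ge> min (\<nu> x) (\<nu> y)) \<and>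
     (\<exists>x. x \<noteq> 0 \<and> \<nu> x \<noteq> 0)"

definition theta_invariant :: "('k::field \<Rightarrow> 'k) \<Rightarrow> ('k \<Rightarrow> ereal) \<Rightarrow> bool" where
  "theta_invariant \<theta> \<nu> \<longleftrightarrow> (\<forall>x. x \<noteq> 0 \<longrightarrow> (\<nu> x \<ge> 0 \<longleftrightarrow> \<nu> (\<theta> x) \<ge> 0))"

definition additive_group :: "'k::ab_group_add set \<Rightarrow> 'k monoid" where
  "additive_group P = \<lparr>carrier = P, mult = (+), one = 0\<rparr>"

definition suzuki_group :: "('k::field \<Rightarrow> 'k) \<Rightarrow> 'k set \<Rightarrow> ('k \<times> 'k) monoid" where
  "suzuki_group \<theta> P = \<lparr>carrier = P \<times> P,
     mult = (\<lambda>(s, t) (u, v). (s + u, t + v + \<theta> s * u)), one = (0, 0)\<rparr>"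

definition suzuki_norm :: "('k::field \<Rightarrow> 'k) \<Rightarrow> 'k \<times> 'k \<Rightarrow> 'k" where
  "suzuki_norm \<theta> = (\<lambda>(s, t). \<theta> s * s^2 + s * t + \<theta> t)"

definition ree_group :: "('k::field \<Rightarrow> 'k) \<Rightarrow> ('k \<times> 'k \<times> 'k) monoid" where
  "ree_group \<theta> = \<lparr>carrier = UNIV,
     mult = (\<lambda>(r, s, t) (w, u, v).
       (r + w, s + u + \<theta> r * w, t + v - r * u + s * w - \<theta> r * r * w)), one = (0, 0, 0)\<rparr>"

definition ree_norm :: "('k::field \<Rightarrow> 'k) \<Rightarrow> 'k \<times> 'k \<times> 'k \<Rightarrow> 'k" where
  "ree_norm \<theta> = (\<lambda>(r, s, t). \<theta> r * r * \<theta> s - r * \<theta> t - \<theta> r * r^3 * s - r^2 * s^2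
                   + \<theta> s * s + t^2 - (\<theta> r)^2 * r^4)"


section \<open>The Suzuki-Ree buildings\<close>

datatype sr_case = Case_B | Case_F | Case_G

definition sr_params :: "sr_case \<Rightarrow> 'k set \<Rightarrow> 'k set" where
  "sr_params X L = (if X = Case_B then L else UNIV)"

definition root_set_of_case :: "sr_case \<Rightarrow> 'v::euclidean_space set \<Rightarrow> bool" where
  "root_set_of_case X \<Phi> = (case X of Case_B \<Rightarrow> root_set_B2 \<Phi> | Case_F \<Rightarrow> root_set_F4 \<Phi> | Case_G \<Rightarrow> root_set_G2 \<Phi>)"

definition commutators_BF ::
  "('k::field \<Rightarrow> 'k) \<Rightarrow> 'k set \<Rightarrow> 'v::euclidean_space set \<Rightarrow> 'g monoid \<Rightarrow> ('v \<Rightarrow> 'k \<Rightarrow> 'g) \<Rightarrow> bool" where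
  "commutators_BF \<theta> P \<Phi> G x \<longleftrightarrow> (\<forall>\<alpha>\<in>\<Phi>. \<forall>\<beta>\<in>\<Phi>. \<forall>s\<in>P. \<forall>t\<in>P.
     (angle \<alpha> \<beta> = 2 * pi / 3 \<longrightarrow> comm G (x \<alpha> s) (x \<beta> t) = x (\<alpha> + \<beta>) (s * t)) \<and>
     (angle \<alpha> \<beta> = 3 * pi / 4 \<longrightarrow> comm G (x \<alpha> s) (x \<beta> t) =
        x (sqrt 2 *\<^sub>R \<alpha> + \<beta>) (\<theta> s * t) \<otimes>\<^bsub>G\<^esub> x (\<alpha> + sqrt 2 *\<^sub>R \<beta>) (s * \<theta> t)))"

(* The first part fixes the signs for the numbering a 1, ..., a 12 of the roots around the
   circle (either sense of rotation may be called clockwise). The remaining parts hold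
   for arbitrary pairs of roots, with signs depending only on the pair. *)
definition commutators_G ::
  "('k::field \<Rightarrow> 'k) \<Rightarrow> 'v::euclidean_space set \<Rightarrow> 'v set \<Rightarrow> 'g monoid \<Rightarrow> ('v \<Rightarrow> 'k \<Rightarrow> 'g) \<Rightarrow> bool" where
  "commutators_G \<theta> \<Phi> S G x \<longleftrightarrow>
     (\<exists>a::nat \<Rightarrow> 'v. bij_betw a {1..12} \<Phi> \<and>
        (\<forall>i\<in>{1..11}. angle (a i) (a (Suc i)) = pi / 6) \<and>
        (\<forall>i\<in>{1..12}. S \<subseteq> halfspace (a i) \<longleftrightarrow> i \<le> 6) \<and>
        (\<forall>s t.
           comm G (x (a 1) s) (x (a 6) t) =
             x (a 2) (- \<theta> s * t) \<otimes>\<^bsub>G\<^esub> x (a 3) (- (s^2) * \<theta> t)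
             \<otimes>\<^bsub>G\<^esub> x (a 4) (\<theta> s * t^2) \<otimes>\<^bsub>G\<^esub> x (a 5) (s * \<theta> t) \<and>
           comm G (x (a 1) s) (x (a 5) t) = x (a 3) (- s * t) \<and>
           comm G (x (a 2) s) (x (a 6) t) = x (a 4) (s * t))) \<and>
     (\<forall>\<alpha>\<in>\<Phi>. \<forall>\<beta>\<in>\<Phi>. angle \<alpha> \<beta> = 2 * pi / 3 \<longrightarrow>
        (\<exists>\<epsilon>\<in>{1, -1}. \<forall>s t. comm G (x \<alpha> s) (x \<beta> t) = x (\<alpha> + \<beta>) (\<epsilon> * s * t))) \<and>
     (\<forall>\<alpha>\<in>\<Phi>. \<forall>\<beta>\<in>\<Phi>. angle \<alpha> \<beta> = 5 * pi / 6 \<longrightarrow>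
        (\<exists>\<epsilon>1\<in>{1, -1}. \<exists>\<epsilon>2\<in>{1, -1}. \<exists>\<epsilon>3\<in>{1, -1}. \<exists>\<epsilon>4\<in>{1, -1}. \<forall>s t.
           comm G (x \<alpha> s) (x \<beta> t) =
             x (sqrt 3 *\<^sub>R \<alpha> + \<beta>) (\<epsilon>1 * \<theta> s * t)
             \<otimes>\<^bsub>G\<^esub> x (2 *\<^sub>R \<alpha> + sqrt 3 *\<^sub>R \<beta>) (\<epsilon>2 * s^2 * \<theta> t)
             \<otimes>\<^bsub>G\<^esub> x (sqrt 3 *\<^sub>R \<alpha> + 2 *\<^sub>R \<beta>) (\<epsilon>3 * \<theta> s * t^2)
             \<otimes>\<^bsub>G\<^esub> x (\<alpha> + sqrt 3 *\<^sub>R \<beta>) (\<epsilon>4 * s * \<theta> t)))"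

(* The data dPhi, dDelta, dSigma, ... are the dotted objects \<Phi>, \<Delta>, \<Sigma>, ... from which the
   Suzuki-Ree building is constructed; C is the chamber d\<psi> S. *)
locale suzuki_ree =
  fixes X :: sr_case
    and \<theta> :: "'k::field \<Rightarrow> 'k"
    and L :: "'k set"
    and dPhi :: "'v::euclidean_space set"
    and S :: "'v set"
    and \<tau> :: "'v \<Rightarrow> 'v"
    and dDelta :: "('c, 'v) chamber_system"
    and dSigma :: "'c set"
    and d\<psi> :: "'v set \<Rightarrow> 'c"
    and x :: "'v \<Rightarrow> 'k \<Rightarrow> 'c \<Rightarrow> 'c"
    and \<rho> :: "'c \<Rightarrow> 'c"
    and P :: "'k set"
    and dU :: "'v \<Rightarrow> ('c \<Rightarrow> 'c) set"
    and G :: "('c \<Rightarrow> 'c) monoid"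
  defines "P \<equiv> sr_params X L"
    and "dU \<equiv> \<lambda>\<alpha>. root_group dDelta (d\<psi> ` coxeter_root dPhi \<alpha>)"
    and "G \<equiv> aut_group dDelta"
  assumes characteristic: "CHAR('k) = (if X = Case_G then 3 else 2)"
    and tits: "tits_endomorphism \<theta>"
    and L_subgroup: "X = Case_B \<Longrightarrow> 0 \<in> L \<and> (\<forall>a\<in>L. \<forall>b\<in>L. a - b \<in> L)"
    and L_F: "X = Case_B \<Longrightarrow> range \<theta> \<subseteq> L \<and> (\<forall>a\<in>L. \<forall>f\<in>range \<theta>. a * f \<in> L)"
    and L_generates: "X = Case_B \<Longrightarrow>
          (\<forall>R. L \<subseteq> R \<and> 1 \<in> R \<and> (\<forall>a\<in>R. \<forall>b\<in>R. a - b \<in> R \<and> a * b \<in> R) \<longrightarrow> R = UNIV)"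
    and roots: "root_set_of_case X dPhi"
    and sector: "S \<in> sectors dPhi"
    and tau: "orthogonal_transformation \<tau>" "\<tau> \<noteq> id" "\<tau> ` dPhi = dPhi" "\<tau> ` S = S"
    and moufang: "moufang_building dPhi S dDelta"
    and apartment: "dSigma \<in> apartments dPhi S dDelta"
    and apartment_iso: "chamber_iso (coxeter_complex dPhi S) (dDelta\<lparr>chambers := dSigma\<rparr>) id d\<psi>"
    and x_iso: "\<And>\<alpha>. \<alpha> \<in> dPhi \<Longrightarrow> x \<alpha> \<in> iso (additive_group P) (G\<lparr>carrier := dU \<alpha>\<rparr>)"
    and x_conj: "\<And>\<alpha> \<beta> t. \<alpha> \<in> dPhi \<Longrightarrow> \<beta> \<in> dPhi \<Longrightarrow> t \<in> P \<Longrightarrow>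
          conj_by G (x \<beta> t) (m_elem dDelta dSigma dU \<alpha> (x \<alpha> 1))
            \<in> {x (refl_in \<alpha> \<beta>) t, x (refl_in \<alpha> \<beta>) (- t)}"
    and x_commute: "\<And>\<alpha> \<beta> g h. \<alpha> \<in> dPhi \<Longrightarrow> \<beta> \<in> dPhi \<Longrightarrow> angle \<alpha> \<beta> \<le> pi / 2 \<Longrightarrow>
          g \<in> dU \<alpha> \<Longrightarrow> h \<in> dU \<beta> \<Longrightarrow> comm G g h = \<one>\<^bsub>G\<^esub>"
    and x_comm_BF: "X \<in> {Case_B, Case_F} \<Longrightarrow> commutators_BF \<theta> P dPhi G x"
    and x_comm_G: "X = Case_G \<Longrightarrow> commutators_G \<theta> dPhi S G x"
    and rho: "\<rho> \<in> carrier G" "\<rho> (d\<psi> S) = d\<psi> S" "\<rho> ` dSigma = dSigma"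
    and x_rho: "\<And>\<alpha> t. \<alpha> \<in> dPhi \<Longrightarrow> t \<in> P \<Longrightarrow> conj_by G (x \<alpha> t) \<rho> = x (\<tau> \<alpha>) t"

definition sr_roots :: "'v::euclidean_space set \<Rightarrow> ('v \<Rightarrow> 'v) \<Rightarrow> 'v set" where
  "sr_roots dPhi \<tau> = (\<lambda>a. sgn (a + \<tau> a)) ` dPhi"

definition sr_fiber :: "'v::euclidean_space set \<Rightarrow> ('v \<Rightarrow> 'v) \<Rightarrow> 'v \<Rightarrow> 'v set" where
  "sr_fiber dPhi \<tau> \<alpha> = {a \<in> dPhi. sgn (a + \<tau> a) = \<alpha>}"

definition sr_sector :: "'v::euclidean_space set \<Rightarrow> ('v \<Rightarrow> 'v) \<Rightarrow> 'v set" where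
  "sr_sector S \<tau> = S \<inter> {v. \<tau> v = v}"

(* The color of an adjacency is the simple root of \<Phi> (with respect to the sector
   S \<inter> \<bbbA>) whose fiber contains the two colors of the rank two residue. *)
definition sr_building ::
  "'v::euclidean_space set \<Rightarrow> 'v set \<Rightarrow> ('v \<Rightarrow> 'v) \<Rightarrow> ('c, 'v) chamber_system \<Rightarrow> ('c \<Rightarrow> 'c) \<Rightarrow>
   ('c, 'v) chamber_system" where
  "sr_building dPhi S \<tau> dDelta \<rho> =
     \<lparr>chambers = {c \<in> chambers dDelta. \<rho> c = c},
      colors = simple_roots (sr_roots dPhi \<tau>) (sr_sector S \<tau>),
      adjacent = (\<lambda>i c d. i \<in> simple_roots (sr_roots dPhi \<tau>) (sr_sector S \<tau>) \<and>
         c \<in> chambers dDelta \<and> \<rho> c = c \<and> d \<in> chambers dDelta \<and> \<rho> d = d \<and>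
         (\<exists>J\<subseteq>colors dDelta. card J = 2 \<and> J \<subseteq> sr_fiber dPhi \<tau> i \<and>
            (\<exists>R\<in>residues dDelta J. \<rho> ` R = R \<and> opposite_in dDelta R c d)))\<rparr>"

definition sr_apartment :: "'c set \<Rightarrow> ('c \<Rightarrow> 'c) \<Rightarrow> 'c set" where
  "sr_apartment dSigma \<rho> = {c \<in> dSigma. \<rho> c = c}"

(* For a in the fiber of \<alpha>, the intersection of the root a with \<Sigma> does not depend on a. *)
definition sr_root ::
  "'v::euclidean_space set \<Rightarrow> ('v \<Rightarrow> 'v) \<Rightarrow> 'c set \<Rightarrow> ('v set \<Rightarrow> 'c) \<Rightarrow> ('c \<Rightarrow> 'c) \<Rightarrow> 'v \<Rightarrow> 'c set" where
  "sr_root dPhi \<tau> dSigma d\<psi> \<rho> \<alpha> =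
     (\<Inter>a\<in>sr_fiber dPhi \<tau> \<alpha>. d\<psi> ` coxeter_root dPhi a \<inter> sr_apartment dSigma \<rho>)"

(* Elements of the centralizer of \<rho> are regarded as permutations of the chambers fixed by \<rho>. *)
definition sr_root_group ::
  "'v::euclidean_space set \<Rightarrow> ('v \<Rightarrow> 'v) \<Rightarrow> ('c, 'v) chamber_system \<Rightarrow> ('v set \<Rightarrow> 'c) \<Rightarrow> ('c \<Rightarrow> 'c) \<Rightarrow>
   'v \<Rightarrow> ('c \<Rightarrow> 'c) set" where
  "sr_root_group dPhi \<tau> dDelta d\<psi> \<rho> \<alpha> =
     (\<lambda>g c. if c \<in> chambers dDelta \<and> \<rho> c = c then g c else c) `
       {g \<in> generate (aut_group dDelta)
              (\<Union>a\<in>sr_fiber dPhi \<tau> \<alpha>. root_group dDelta (d\<psi> ` coxeter_root dPhi a)).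
          g \<otimes>\<^bsub>aut_group dDelta\<^esub> \<rho> = \<rho> \<otimes>\<^bsub>aut_group dDelta\<^esub> g}"

definition suzuki_coordinates ::
  "('k::field \<Rightarrow> 'k) \<Rightarrow> 'k set \<Rightarrow> ('c, 'v::euclidean_space) chamber_system \<Rightarrow> 'c set \<Rightarrow>
   ('v \<Rightarrow> ('c \<Rightarrow> 'c) set) \<Rightarrow> 'v \<Rightarrow> ('k \<times> 'k \<Rightarrow> 'c \<Rightarrow> 'c) \<Rightarrow> bool" where
  "suzuki_coordinates \<theta> P D A U \<alpha> y \<longleftrightarrow>
     y \<in> iso (suzuki_group \<theta> P) ((aut_group D)\<lparr>carrier := U \<alpha>\<rparr>) \<and>
     (\<forall>u\<in>P. \<forall>v\<in>P. \<forall>s\<in>P. \<forall>t\<in>P. (s, t) \<noteq> (0, 0) \<longrightarrow>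
        (let N = suzuki_norm \<theta> (s, t);
             h = m_elem D A U \<alpha> (y (0, 1)) \<otimes>\<^bsub>aut_group D\<^esub> m_elem D A U \<alpha> (y (s, t))
         in conj_by (aut_group D) (y (u, v)) h = y (N^2 / \<theta> N * u, \<theta> N * v)))"

definition ree_coordinates ::
  "('k::field \<Rightarrow> 'k) \<Rightarrow> ('c, 'v::euclidean_space) chamber_system \<Rightarrow> 'c set \<Rightarrow>
   ('v \<Rightarrow> ('c \<Rightarrow> 'c) set) \<Rightarrow> 'v \<Rightarrow> ('k \<times> 'k \<times> 'k \<Rightarrow> 'c \<Rightarrow> 'c) \<Rightarrow> bool" where
  "ree_coordinates \<theta> D A U \<alpha> y \<longleftrightarrow>
     y \<in> iso (ree_group \<theta>) ((aut_group D)\<lparr>carrier := U \<alpha>\<rparr>) \<and>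
     (\<forall>w u v r s t. (r, s, t) \<noteq> (0, 0, 0) \<longrightarrow>
        (let N = ree_norm \<theta> (r, s, t);
             h = m_elem D A U \<alpha> (y (0, 0, 1)) \<otimes>\<^bsub>aut_group D\<^esub> m_elem D A U \<alpha> (y (r, s, t))
         in conj_by (aut_group D) (y (w, u, v)) h = y (N^2 / \<theta> N * w, \<theta> N / N * u, N * v)))"

definition normalize_at :: "'v::euclidean_space \<Rightarrow> 'g \<Rightarrow> ('v \<Rightarrow> 'g \<Rightarrow> ereal) \<Rightarrow> 'v \<Rightarrow> 'g \<Rightarrow> ereal" where
  "normalize_at \<alpha> w \<psi> = translate \<psi> (- (real_of_ereal (\<psi> \<alpha> w) / (\<alpha> \<bullet> \<alpha>)) *\<^sub>R \<alpha>)"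

end

theory Submission
  imports Defs
begin

text \<open>
  Let \<open>\<phi>\<close> be a valuation of the root datum, normalized by \<open>\<phi>\<^sub>\<alpha>(w) = 0\<close>. For each non-trivial element \<open>u\<close> of
  the root group of \<open>\<alpha>\<close> there is exactly one reflecting element \<open>m(u)\<close>, and therefore \<open>m(u)\<close> and
  \<open>m(u\<^sup>-\<^sup>1)\<close> are mutually inverse. Axiom (V3) for \<open>w\<close> and for \<open>u\<^sup>-\<^sup>1\<close> then gives
  \<open>\<phi>\<^sub>\<alpha>(g\<^sup>h) = \<phi>\<^sub>\<alpha>(g) + 2 \<phi>\<^sub>\<alpha>(u)\<close> for \<open>h = m(w) m(u)\<close>, which is lemma \<open>value_conj\<close>. The coordinates describe
  the action of \<open>h\<close>. With \<open>f(v) = \<phi>\<^sub>\<alpha>(x\<^sub>\<alpha>(0, v))\<close> and \<open>R = R(s, t)\<close> one obtains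
  \<open>f(R\<^sup>\<theta> v) = f(v) + 2 \<phi>\<^sub>\<alpha>(x\<^sub>\<alpha>(s, t))\<close>; for the Ree groups \<open>f(N v) = f(v) + 2 \<phi>\<^sub>\<alpha>(x\<^sub>\<alpha>(r, s, t))\<close>, where
  \<open>f(v) = \<phi>\<^sub>\<alpha>(x\<^sub>\<alpha>(0, 0, v))\<close>.
  The case of vanishing leading coordinates reads \<open>f(t\<^sup>2 v) = f(v) + 2 f(t)\<close>. This forces \<open>f\<close> to be
  multiplicative, and (V1) is the ultrametric inequality, so that \<open>x \<mapsto> f(x\<^sup>\<theta>) / 2\<close>, respectively
  \<open>x \<mapsto> f(x) / 2\<close>, is a valuation of \<open>K\<close> with the required property. Its invariance under \<open>\<theta>\<close> follows from
  the ultrametric inequality for the products \<open>(1, 0) (0, t)\<close> and \<open>(1, 0, 0) (0, 0, t)\<close>, and it is unique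
  because all squares are norms (lemmas \<open>suzuki_valuation\<close> and \<open>ree_valuation\<close>).

  It remains to show that \<open>m(u)\<close> exists and is unique. If the building has rank one, this follows
  from sharp transitivity (lemma \<open>reflecting_rank_one\<close>). Otherwise it is a Moufang building whose root set
  comes from F4. There a non-trivial \<open>u\<close> moves the half-apartment of \<open>- \<alpha>\<close> off the apartment, the two
  copies form an apartment again, and the Moufang condition for \<open>- \<alpha>\<close> maps the image to the half-apartment
  of \<open>\<alpha>\<close>; this yields the factors of \<open>m(u)\<close>. They are unique since an automorphism that fixes two opposite
  chambers and all neighbours of one of them is trivial (lemmas \<open>rigidity\<close> and
  \<open>reflecting_element_unique\<close>). This needs a chamber of each half-apartment without a panel on its wall,
  which exists because no root is perpendicular to all others. To verify this, and to see
  that the root set is closed under its reflections, the symmetry \<open>\<tau>\<close> of F4 is made explicit: it is the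
  reversal of the diagram (lemma \<open>sr_roots_F4\<close>).
\<close>

section \<open>Norms of the Suzuki and Ree groups and field valuations\<close>

context
  fixes \<theta> :: "'k::field \<Rightarrow> 'k"
  assumes tits: "tits_endomorphism \<theta>"
begin

lemma tits_one: "\<theta> 1 = 1" and tits_add: "\<theta> (x + y) = \<theta> x + \<theta> y"
  and tits_mult: "\<theta> (x * y) = \<theta> x * \<theta> y" and tits_tits: "\<theta> (\<theta> x) = x ^ CHAR('k)"
  using tits by (auto simp: tits_endomorphism_def)

lemma tits_zero: "\<theta> 0 = 0"
  using tits_add[of 0 0] by (metis add_0 add_cancel_right_right)

lemma tits_eq_0_iff: "\<theta> x = 0 \<longleftrightarrow> x = 0"
proof
  assume "\<theta> x = 0"
  show "x = 0"
  proof (rule ccontr)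
    assume "x \<noteq> 0"
    then have "\<theta> x * \<theta> (inverse x) = 1"
      by (simp add: tits_mult[symmetric] tits_one)
    with \<open>\<theta> x = 0\<close> show False by simp
  qed
qed (simp add: tits_zero)

lemma tits_power: "\<theta> (x ^ n) = \<theta> x ^ n"
  by (induction n) (auto simp: tits_one tits_mult)

end

text \<open>Multiplicativity comes for free from compatibility with squares, because
  \<open>2 f (s t) = f (s\<^sup>2 t\<^sup>2)\<close>.\<close>

lemma field_valuation_of_squares:
  fixes f :: "'k::field \<Rightarrow> real"
  assumes one: "f 1 = 0"
    and square: "\<And>t v. t \<noteq> 0 \<Longrightarrow> v \<noteq> 0 \<Longrightarrow> f (t\<^sup>2 * v) = f v + 2 * f t"
    and add: "\<And>s t. s \<noteq> 0 \<Longrightarrow> t \<noteq> 0 \<Longrightarrow> s + t \<noteq> 0 \<Longrightarrow> f (s + t) \<ge> min (f s) (f t)"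
    and nontriv: "x0 \<noteq> 0" "f x0 \<noteq> 0"
    and c: "c > 0"
  shows "field_valuation (\<lambda>x. if x = 0 then \<infinity> else ereal (c * f x))"
    and "\<And>s t. s \<noteq> 0 \<Longrightarrow> t \<noteq> 0 \<Longrightarrow> f (s * t) = f s + f t"
proof -
  have sq: "f (t\<^sup>2) = 2 * f t" if "t \<noteq> 0" for t
    using square[OF that, of 1] one by simp
  show mult: "f (s * t) = f s + f t" if "s \<noteq> 0" "t \<noteq> 0" for s t
  proof -
    have "2 * f (s * t) = f ((s * t)\<^sup>2)" using sq[of "s * t"] that by simp
    also have "\<dots> = f (s\<^sup>2 * t\<^sup>2)" by (simp add: power_mult_distrib)
    also have "\<dots> = 2 * f t + 2 * f s" using square[of s "t\<^sup>2"] that sq[of t] by simp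
    finally show ?thesis by simp
  qed
  show "field_valuation (\<lambda>x. if x = 0 then \<infinity> else ereal (c * f x))"
    unfolding field_valuation_def
  proof (intro conjI allI)
    fix x y :: 'k
    show "(if x * y = 0 then \<infinity> else ereal (c * f (x * y))) =
          (if x = 0 then \<infinity> else ereal (c * f x)) + (if y = 0 then \<infinity> else ereal (c * f y))"
      using mult[of x y] by (simp add: algebra_simps)
    have "ereal (c * f (x + y)) \<ge> min (ereal (c * f x)) (ereal (c * f y))"
      if "x \<noteq> 0" "y \<noteq> 0" "x + y \<noteq> 0"
      using add[OF that] c by (auto simp: min_le_iff_disj)
    then show "min (if x = 0 then \<infinity> else ereal (c * f x)) (if y = 0 then \<infinity> else ereal (c * f y))
          \<le> (if x + y = 0 then \<infinity> else ereal (c * f (x + y)))"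
      by auto
  qed (use nontriv c in auto)
qed

text \<open>Squares are values of the norm functions, so this lemma yields uniqueness.\<close>

lemma field_valuation_eq_of_squares:
  assumes "field_valuation \<nu>" "field_valuation \<nu>'" "\<And>x. x \<noteq> 0 \<Longrightarrow> \<nu> (x\<^sup>2) = \<nu>' (x\<^sup>2)"
  shows "\<nu> = \<nu>'"
proof
  fix x
  show "\<nu> x = \<nu>' x"
  proof (cases "x = 0")
    case False
    have "\<nu> (x\<^sup>2) = \<nu> x + \<nu> x" "\<nu>' (x\<^sup>2) = \<nu>' x + \<nu>' x"
      using assms(1,2) by (simp_all add: field_valuation_def power2_eq_square)
    then have "\<nu> x + \<nu> x = \<nu>' x + \<nu>' x"
      using assms(3)[OF False] by simp
    moreover obtain a b where "\<nu> x = ereal a" "\<nu>' x = ereal b"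
      using assms(1,2) False by (cases "\<nu> x"; cases "\<nu>' x") (auto simp: field_valuation_def)
    ultimately show ?thesis by simp
  qed (use assms(1,2) in \<open>auto simp: field_valuation_def\<close>)
qed

text \<open>The function \<open>F\<close> stands for the restriction of a valuation to the root group of \<open>\<alpha>\<close>, in
  coordinates and normalized at \<open>(0, 1)\<close>; the value at the identity is irrelevant. The assumption on
  conjugation is the action of \<open>h(s, t)\<close> on the elements with first coordinate \<open>0\<close>. In characteristic
  \<open>2\<close> these elements only run through \<open>P\<close>, hence the valuation of the field is read off
  from \<open>F (0, \<theta> x)\<close>.\<close>

lemma suzuki_valuation:
  fixes \<theta> :: "'k::field \<Rightarrow> 'k" and F :: "'k \<times> 'k \<Rightarrow> real" and P :: "'k set"
  assumes tits: "tits_endomorphism \<theta>" and char2: "CHAR('k) = 2"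
    and zero_P: "0 \<in> P" and range_P: "range \<theta> \<subseteq> P"
    and norm_0_1: "F (0, 1) = 0"
    and conj: "\<And>v s t. v \<in> P \<Longrightarrow> s \<in> P \<Longrightarrow> t \<in> P \<Longrightarrow> v \<noteq> 0 \<Longrightarrow> (s, t) \<noteq> (0, 0) \<Longrightarrow>
       \<theta> (suzuki_norm \<theta> (s, t)) * v \<noteq> 0 \<and>
       F (0, \<theta> (suzuki_norm \<theta> (s, t)) * v) = F (0, v) + 2 * F (s, t)"
    and ultra: "\<And>s t u v. s \<in> P \<Longrightarrow> t \<in> P \<Longrightarrow> u \<in> P \<Longrightarrow> v \<in> P \<Longrightarrow> (s, t) \<noteq> (0, 0) \<Longrightarrow> (u, v) \<noteq> (0, 0) \<Longrightarrow>
       (s + u, t + v + \<theta> s * u) \<noteq> (0, 0) \<Longrightarrow> F (s + u, t + v + \<theta> s * u) \<ge> min (F (s, t)) (F (u, v))"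
    and nonconst: "s0 \<in> P" "t0 \<in> P" "(s0, t0) \<noteq> (0, 0)" "F (s0, t0) \<noteq> 0"
  shows "\<exists>!\<nu>. field_valuation \<nu> \<and> theta_invariant \<theta> \<nu> \<and>
     (\<forall>s\<in>P. \<forall>t\<in>P. (s, t) \<noteq> (0, 0) \<longrightarrow> ereal (F (s, t)) = \<nu> (suzuki_norm \<theta> (s, t)))"
proof -
  note th = tits_one[OF tits] tits_add[OF tits] tits_mult[OF tits] tits_zero[OF tits]
    tits_eq_0_iff[OF tits] tits_power[OF tits]
  have thth: "\<theta> (\<theta> x) = x\<^sup>2" for x using tits_tits[OF tits, of x] char2 by simp
  have mem: "\<theta> x \<in> P" for x using range_P by auto
  have one_P: "1 \<in> P" using mem[of 1] by (simp add: th)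
  have sq_P: "x\<^sup>2 \<in> P" for x using mem[of "\<theta> x"] by (simp add: thth)
  have norm_0: "suzuki_norm \<theta> (0, t) = \<theta> t" for t by (simp add: suzuki_norm_def th)
  define f where "f x = F (0, x)" for x
  have f1: "f 1 = 0" using norm_0_1 by (simp add: f_def)
  have f_sq: "f (t\<^sup>2 * v) = f v + 2 * f t" if "v \<in> P" "t \<in> P" "v \<noteq> 0" "t \<noteq> 0" for v t
    using conj[of v 0 t] that zero_P by (simp add: norm_0 thth f_def)
  have f_add: "f (s + t) \<ge> min (f s) (f t)" if "s \<in> P" "t \<in> P" "s \<noteq> 0" "t \<noteq> 0" "s + t \<noteq> 0" for s t
    using ultra[of 0 s 0 t] that zero_P by (simp add: f_def th)
  have norm_nz: "suzuki_norm \<theta> (s, t) \<noteq> 0" if "s \<in> P" "t \<in> P" "(s, t) \<noteq> (0, 0)" for s t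
    using conj[of 1 s t] that one_P by (auto simp: th)
  have F_norm: "F (s, t) = f (\<theta> (suzuki_norm \<theta> (s, t))) / 2"
    if "s \<in> P" "t \<in> P" "(s, t) \<noteq> (0, 0)" for s t
    using conj[of 1 s t] that one_P f1 by (simp add: f_def)
  define g where "g x = f (\<theta> x)" for x
  have g1: "g 1 = 0" by (simp add: g_def th f1)
  have g_sq: "g (t\<^sup>2 * v) = g v + 2 * g t" if "t \<noteq> 0" "v \<noteq> 0" for t v
    using f_sq[of "\<theta> v" "\<theta> t"] that mem by (simp add: g_def th)
  have g_add: "g (s + t) \<ge> min (g s) (g t)" if "s \<noteq> 0" "t \<noteq> 0" "s + t \<noteq> 0" for s t
    using f_add[OF mem mem, of s t] that
    by (simp add: g_def tits_add[OF tits, symmetric] tits_eq_0_iff[OF tits])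
  have nontriv: "suzuki_norm \<theta> (s0, t0) \<noteq> 0" "g (suzuki_norm \<theta> (s0, t0)) \<noteq> 0"
    using norm_nz[of s0 t0] F_norm[of s0 t0] nonconst by (auto simp: g_def)
  define \<nu> where "\<nu> = (\<lambda>x. if x = 0 then \<infinity> else ereal (1/2 * g x))"
  have val: "field_valuation \<nu>" and g_mult: "\<And>s t. s \<noteq> 0 \<Longrightarrow> t \<noteq> 0 \<Longrightarrow> g (s * t) = g s + g t"
    using field_valuation_of_squares[of g, OF g1 g_sq g_add nontriv, of "1/2"] by (auto simp: \<nu>_def)
  have g_theta: "g (\<theta> t) = 2 * f t" if "t \<in> P" "t \<noteq> 0" for t
    using f_sq[OF one_P that(1)] that f1 by (simp add: g_def thth)
  have two: "(2::'k) = 0" using of_nat_CHAR[where 'a = 'k] char2 by simp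
  have g_minus: "g (- x) = g x" for x
  proof -
    have "x + x = 2 * x" by simp
    also have "\<dots> = 0" by (simp only: two mult_zero_left)
    finally have "- x = x" by (simp only: minus_unique)
    then show ?thesis by (simp only:)
  qed
  have g_ge: "g (x + y) \<ge> 0" if "x = 0 \<or> g x \<ge> 0" "y = 0 \<or> g y \<ge> 0" "x + y \<noteq> 0" for x y
    using g_add[of x y] that by (cases "x = 0 \<or> y = 0") auto
  \<comment> \<open>The inequality for \<open>(1, t) = (1, 0) (0, t)\<close> compares \<open>f\<close> and \<open>g\<close>, since \<open>R(1, t) = 1 + t + t\<^sup>\<theta>\<close>.\<close>
  have fg: "g t \<ge> 0" if t: "t \<in> P" "t \<noteq> 0" "f t \<ge> 0" for t
  proof -
    have R: "suzuki_norm \<theta> (1, t) = 1 + t + \<theta> t" "suzuki_norm \<theta> (1, 0) = 1"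
      by (simp_all add: suzuki_norm_def th)
    have "F (1, 0) = 0" using F_norm[of 1 0] one_P zero_P f1 by (simp add: R th)
    moreover have "F (1, t) \<ge> min (F (1, 0)) (F (0, t))"
      using ultra[of 1 0 0 t] one_P zero_P t by simp
    ultimately have "F (1, t) \<ge> 0" using t(3) by (simp add: f_def min_def split: if_splits)
    then have a: "g (1 + t + \<theta> t) \<ge> 0" and nz: "1 + t + \<theta> t \<noteq> 0"
      using F_norm[of 1 t] norm_nz[of 1 t] one_P t by (auto simp: g_def R)
    have b: "1 + \<theta> t = 0 \<or> g (1 + \<theta> t) \<ge> 0"
      using g_ge[of 1 "\<theta> t"] g1 g_theta[of t] t by auto
    have b': "- (1 + \<theta> t) = 0 \<or> g (- (1 + \<theta> t)) \<ge> 0"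
      using b by (auto simp only: g_minus neg_equal_0_iff_equal)
    have "(1 + t + \<theta> t) + - (1 + \<theta> t) = t" by simp
    with g_ge[OF disjI2[OF a] b'] t(2) show ?thesis by simp
  qed
  have inv: "theta_invariant \<theta> \<nu>"
    unfolding theta_invariant_def
  proof (intro allI impI)
    fix x :: 'k assume x: "x \<noteq> 0"
    have fx: "f (x\<^sup>2) = g (\<theta> x)" by (simp add: g_def thth)
    have "g (\<theta> x) \<ge> 0 \<Longrightarrow> g x \<ge> 0"
      using fg[OF sq_P, of x] g_sq[OF x, of 1] g1 x fx by simp
    moreover have "g x \<ge> 0 \<Longrightarrow> g (\<theta> x) \<ge> 0"
      using fg[OF mem, of x] x by (simp add: g_def th)
    ultimately show "0 \<le> \<nu> x \<longleftrightarrow> 0 \<le> \<nu> (\<theta> x)"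
      using x by (auto simp: \<nu>_def th)
  qed
  have rep: "ereal (F (s, t)) = \<nu> (suzuki_norm \<theta> (s, t))" if "s \<in> P" "t \<in> P" "(s, t) \<noteq> (0, 0)" for s t
    using F_norm[OF that] norm_nz[OF that] by (simp add: \<nu>_def g_def)
  show ?thesis
  proof (rule ex1I[of _ \<nu>])
    fix \<nu>' assume *: "field_valuation \<nu>' \<and> theta_invariant \<theta> \<nu>' \<and>
     (\<forall>s\<in>P. \<forall>t\<in>P. (s, t) \<noteq> (0, 0) \<longrightarrow> ereal (F (s, t)) = \<nu>' (suzuki_norm \<theta> (s, t)))"
    show "\<nu>' = \<nu>"
    proof (rule field_valuation_eq_of_squares)
      fix x :: 'k assume "x \<noteq> 0"
      \<comment> \<open>Squares are norms: \<open>R(0, x\<^sup>\<theta>) = x\<^sup>2\<close>.\<close>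
      then show "\<nu>' (x\<^sup>2) = \<nu> (x\<^sup>2)"
        using * rep[OF zero_P mem, of x] zero_P mem[of x] by (auto simp: norm_0 thth th)
    qed (use * val in auto)
  qed (use val inv rep in auto)
qed

text \<open>Here the valuation of the field is read off from \<open>F (0, 0, x)\<close>.\<close>

lemma ree_valuation:
  fixes \<theta> :: "'k::field \<Rightarrow> 'k" and F :: "'k \<times> 'k \<times> 'k \<Rightarrow> real"
  assumes tits: "tits_endomorphism \<theta>" and char3: "CHAR('k) = 3"
    and norm_0_1: "F (0, 0, 1) = 0"
    and conj: "\<And>v r s t. v \<noteq> 0 \<Longrightarrow> (r, s, t) \<noteq> (0, 0, 0) \<Longrightarrow>
       ree_norm \<theta> (r, s, t) * v \<noteq> 0 \<and>
       F (0, 0, ree_norm \<theta> (r, s, t) * v) = F (0, 0, v) + 2 * F (r, s, t)"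
    and ultra: "\<And>r s t w u v. (r, s, t) \<noteq> (0, 0, 0) \<Longrightarrow> (w, u, v) \<noteq> (0, 0, 0) \<Longrightarrow>
       (r + w, s + u + \<theta> r * w, t + v - r * u + s * w - \<theta> r * r * w) \<noteq> (0, 0, 0) \<Longrightarrow>
       F (r + w, s + u + \<theta> r * w, t + v - r * u + s * w - \<theta> r * r * w) \<ge> min (F (r, s, t)) (F (w, u, v))"
    and nonconst: "(r0, s0, t0) \<noteq> (0, 0, 0)" "F (r0, s0, t0) \<noteq> 0"
  shows "\<exists>!\<nu>. field_valuation \<nu> \<and> theta_invariant \<theta> \<nu> \<and>
     (\<forall>r s t. (r, s, t) \<noteq> (0, 0, 0) \<longrightarrow> ereal (F (r, s, t)) = \<nu> (ree_norm \<theta> (r, s, t)))"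
proof -
  note th = tits_one[OF tits] tits_add[OF tits] tits_mult[OF tits] tits_zero[OF tits]
    tits_eq_0_iff[OF tits] tits_power[OF tits]
  have thth: "\<theta> (\<theta> x) = x ^ 3" for x using tits_tits[OF tits, of x] char3 by simp
  have norm_0: "ree_norm \<theta> (0, 0, t) = t\<^sup>2" for t by (simp add: ree_norm_def th)
  define f where "f x = F (0, 0, x)" for x
  have f1: "f 1 = 0" using norm_0_1 by (simp add: f_def)
  have f_sq: "f (t\<^sup>2 * v) = f v + 2 * f t" if "t \<noteq> 0" "v \<noteq> 0" for v t
    using conj[of v 0 0 t] that by (simp add: norm_0 f_def)
  have f_add: "f (s + t) \<ge> min (f s) (f t)" if "s \<noteq> 0" "t \<noteq> 0" "s + t \<noteq> 0" for s t
    using ultra[of 0 0 s 0 0 t] that by (simp add: f_def th)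
  have norm_nz: "ree_norm \<theta> (r, s, t) \<noteq> 0" if "(r, s, t) \<noteq> (0, 0, 0)" for r s t
    using conj[OF _ that, of 1] by auto
  have F_norm: "F (r, s, t) = f (ree_norm \<theta> (r, s, t)) / 2" if "(r, s, t) \<noteq> (0, 0, 0)" for r s t
    using conj[OF _ that, of 1] f1 by (simp add: f_def)
  have nontriv: "ree_norm \<theta> (r0, s0, t0) \<noteq> 0" "f (ree_norm \<theta> (r0, s0, t0)) \<noteq> 0"
    using norm_nz[OF nonconst(1)] F_norm[OF nonconst(1)] nonconst by auto
  define \<nu> where "\<nu> = (\<lambda>x. if x = 0 then \<infinity> else ereal (1/2 * f x))"
  have val: "field_valuation \<nu>" and f_mult: "\<And>s t. s \<noteq> 0 \<Longrightarrow> t \<noteq> 0 \<Longrightarrow> f (s * t) = f s + f t"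
    using field_valuation_of_squares[of f, OF f1 f_sq f_add nontriv, of "1/2"] by (auto simp: \<nu>_def)
  have f_pow: "f (x ^ n) = n * f x" if "x \<noteq> 0" for x n
    by (induction n) (auto simp: f1 f_mult that algebra_simps)
  have f_minus: "f (- x) = f x" for x
  proof (cases "x = 0")
    case False
    then show ?thesis using f_pow[of "- x" 2] f_pow[of x 2] by simp
  qed simp
  have f_ge: "f (x + y) \<ge> 0" if "x = 0 \<or> f x \<ge> 0" "y = 0 \<or> f y \<ge> 0" "x + y \<noteq> 0" for x y
    using f_add[of x y] that by (cases "x = 0 \<or> y = 0") auto
  \<comment> \<open>The inequality for \<open>(1, 0, t) = (1, 0, 0) (0, 0, t)\<close>, where \<open>N(1, 0, t) = t\<^sup>2 - t\<^sup>\<theta> - 1\<close>.\<close>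
  have theta_ge: "f (\<theta> t) \<ge> 0" if t: "t \<noteq> 0" "f t \<ge> 0" for t
  proof -
    have N: "ree_norm \<theta> (1, 0, t) = t\<^sup>2 - \<theta> t - 1" "ree_norm \<theta> (1, 0, 0) = - 1"
      by (simp_all add: ree_norm_def th)
    have "F (1, 0, 0) = 0" using F_norm[of 1 0 0] f1 by (simp add: N f_minus)
    moreover have "F (1, 0, t) \<ge> min (F (1, 0, 0)) (F (0, 0, t))"
      using ultra[of 1 0 0 0 0 t] t by (simp add: th)
    ultimately have "F (1, 0, t) \<ge> 0" using t(2) by (simp add: f_def min_def split: if_splits)
    then have a: "f (- (t\<^sup>2 - \<theta> t - 1)) \<ge> 0"
      using F_norm[of 1 0 t] by (simp only: N f_minus) simp
    have b: "t\<^sup>2 + - 1 = 0 \<or> f (t\<^sup>2 + - 1) \<ge> 0"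
      using f_ge[of "t\<^sup>2" "- 1"] f_pow[of t 2] t f1 by (auto simp: f_minus)
    have "- (t\<^sup>2 - \<theta> t - 1) + (t\<^sup>2 + - 1) = \<theta> t" by simp
    with f_ge[OF disjI2[OF a] b] t(1) show ?thesis by (simp add: th)
  qed
  have inv: "theta_invariant \<theta> \<nu>"
    unfolding theta_invariant_def
  proof (intro allI impI)
    fix x :: 'k assume x: "x \<noteq> 0"
    have "f (\<theta> x) \<ge> 0 \<Longrightarrow> f x \<ge> 0"
      using theta_ge[of "\<theta> x"] x f_pow[OF x, of 3] by (simp add: thth th)
    then show "0 \<le> \<nu> x \<longleftrightarrow> 0 \<le> \<nu> (\<theta> x)"
      using x theta_ge[OF x] by (auto simp: \<nu>_def th)
  qed
  have rep: "ereal (F (r, s, t)) = \<nu> (ree_norm \<theta> (r, s, t))" if "(r, s, t) \<noteq> (0, 0, 0)" for r s t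
    using F_norm[OF that] norm_nz[OF that] by (simp add: \<nu>_def)
  show ?thesis
  proof (rule ex1I[of _ \<nu>])
    fix \<nu>' assume *: "field_valuation \<nu>' \<and> theta_invariant \<theta> \<nu>' \<and>
     (\<forall>r s t. (r, s, t) \<noteq> (0, 0, 0) \<longrightarrow> ereal (F (r, s, t)) = \<nu>' (ree_norm \<theta> (r, s, t)))"
    show "\<nu>' = \<nu>"
    proof (rule field_valuation_eq_of_squares)
      fix x :: 'k assume "x \<noteq> 0"
      \<comment> \<open>Squares are norms: \<open>N(0, 0, x) = x\<^sup>2\<close>.\<close>
      then show "\<nu>' (x\<^sup>2) = \<nu> (x\<^sup>2)"
        using * rep[of 0 0 x] norm_0[of x] by auto
    qed (use * val in auto)
  qed (use val inv rep in auto)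
qed

section \<open>Finite reflection groups\<close>

lemma linear_refl_in: "linear (refl_in a)"
  by (rule linearI) (simp_all add: refl_in_def inner_add_left algebra_simps)

lemma refl_in_self: "a \<bullet> a = 1 \<Longrightarrow> refl_in a a = - a"
  by (simp add: refl_in_def algebra_simps scaleR_2)

lemma refl_in_refl_in: "a \<bullet> a = 1 \<Longrightarrow> refl_in a (refl_in a v) = v"
  by (simp add: refl_in_def inner_diff_left algebra_simps)

lemma inner_refl_in: "a \<bullet> a = 1 \<Longrightarrow> refl_in a v \<bullet> refl_in a w = v \<bullet> w"
  by (simp add: refl_in_def inner_diff_left inner_diff_right algebra_simps inner_commute)

lemma inner_refl_in_left: "a \<bullet> a = 1 \<Longrightarrow> refl_in a v \<bullet> w = v \<bullet> refl_in a w"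
  by (simp add: refl_in_def inner_diff_left inner_diff_right algebra_simps inner_commute)

lemma refl_in_uminus: "refl_in (- a) = refl_in a"
  by (auto simp: refl_in_def)

lemma refl_in_minus_right: "refl_in a (- v) = - refl_in a v"
  by (auto simp: refl_in_def)

lemma refl_in_conj:
  assumes "linear w" "\<And>u v. w u \<bullet> w v = u \<bullet> v"
  shows "w \<circ> refl_in a = refl_in (w a) \<circ> w"
  using assms by (auto simp: fun_eq_iff refl_in_def linear_diff linear_scale)

lemma refl_in_span: "a \<in> \<Phi> \<Longrightarrow> v \<in> span \<Phi> \<Longrightarrow> refl_in a v \<in> span \<Phi>"
  unfolding refl_in_def by (intro span_diff span_scale) (auto intro: span_base)

lemma word_value_simps [simp]:
  "word_value [] = id" "word_value (i # f) = refl_in i \<circ> word_value f"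
  by (simp_all add: word_value_def)

lemma word_value_append: "word_value (f @ g) = word_value f \<circ> word_value g"
  by (induction f) (auto simp: comp_assoc)

text \<open>The closed chamber that contains the regular vector \<open>q\<close>.\<close>

definition cone_of :: "'v::euclidean_space set \<Rightarrow> 'v \<Rightarrow> 'v set" where
  "cone_of \<Phi> q = {v \<in> span \<Phi>. \<forall>a\<in>\<Phi>. q \<bullet> a > 0 \<longrightarrow> v \<bullet> a \<ge> 0}"

text \<open>Vectors of the ambient space of \<open>\<Phi>\<close> on no reflecting hyperplane.\<close>

definition regular :: "'v::euclidean_space set \<Rightarrow> 'v \<Rightarrow> bool" where
  "regular \<Phi> q \<longleftrightarrow> q \<in> span \<Phi> \<and> (\<forall>a\<in>\<Phi>. q \<bullet> a \<noteq> 0)"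

lemma sectors_eq:
  assumes neg: "\<And>a. a \<in> \<Phi> \<Longrightarrow> - a \<in> \<Phi>" and nz: "0 \<notin> \<Phi>"
  shows "sectors \<Phi> = cone_of \<Phi> ` {q. regular \<Phi> q}"
proof -
  define X where "X = span \<Phi> - (\<Union>\<alpha>\<in>\<Phi>. {v. refl_in \<alpha> v = v})"
  have X: "X = {q. regular \<Phi> q}"
    using nz by (auto simp: X_def regular_def refl_in_def)
  have comp: "connected_component_set X q = {v \<in> span \<Phi>. \<forall>a\<in>\<Phi>. q \<bullet> a > 0 \<longrightarrow> v \<bullet> a > 0}" (is "_ = ?C")
    if q: "regular \<Phi> q" for q
  proof
    show "connected_component_set X q \<subseteq> ?C"
    proof
      fix v assume "v \<in> connected_component_set X q"
      then obtain T where T: "connected T" "T \<subseteq> X" "q \<in> T" "v \<in> T"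
        by (auto simp: connected_component_def)
      have "v \<bullet> a > 0" if a: "a \<in> \<Phi>" "q \<bullet> a > 0" for a
      proof (rule ccontr)
        assume "\<not> v \<bullet> a > 0"
        then obtain z where "z \<in> T" "a \<bullet> z = 0"
          using connected_ivt_hyperplane[OF T(1), of v q a 0] T a by (auto simp: inner_commute)
        then show False using T(2) a by (auto simp: X regular_def inner_commute)
      qed
      then show "v \<in> ?C" using T by (auto simp: X regular_def)
    qed
  next
    have "convex ?C"
    proof (rule convexI)
      fix x y :: 'a and u v :: real
      assume *: "x \<in> ?C" "y \<in> ?C" "0 \<le> u" "0 \<le> v" "u + v = 1"
      have "(u *\<^sub>R x + v *\<^sub>R y) \<bullet> a > 0" if "a \<in> \<Phi>" "q \<bullet> a > 0" for a
      proof (cases "u = 0")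
        case False
        then have "u * (x \<bullet> a) > 0" "v * (y \<bullet> a) \<ge> 0" using * that by (auto simp: less_imp_le)
        then show ?thesis by (simp add: inner_add_left)
      qed (use * that in auto)
      then show "u *\<^sub>R x + v *\<^sub>R y \<in> ?C" using * by (auto intro: span_add span_scale)
    qed
    moreover have "?C \<subseteq> X"
    proof
      fix v assume v: "v \<in> ?C"
      have "v \<bullet> a \<noteq> 0" if a: "a \<in> \<Phi>" for a
      proof (cases "q \<bullet> a > 0")
        case True then show ?thesis using v a by force
      next
        case False
        then have "q \<bullet> (- a) > 0" using q a by (auto simp: regular_def)
        then have "v \<bullet> (- a) > 0" using v neg[OF a] by blast
        then show ?thesis by simp
      qed
      then show "v \<in> X" using v by (auto simp: X regular_def)
    qed
    moreover have "q \<in> ?C" using q by (auto simp: regular_def)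
    ultimately show "?C \<subseteq> connected_component_set X q"
      by (intro connected_component_maximal convex_connected) auto
  qed
  have clos: "closure {v \<in> span \<Phi>. \<forall>a\<in>\<Phi>. q \<bullet> a > 0 \<longrightarrow> v \<bullet> a > 0} = cone_of \<Phi> q" (is "closure ?C = _")
    if q: "regular \<Phi> q" for q
  proof
    have "closed (cone_of \<Phi> q)"
    proof -
      have "cone_of \<Phi> q = span \<Phi> \<inter> (\<Inter>a\<in>{a\<in>\<Phi>. q \<bullet> a > 0}. {v. a \<bullet> v \<ge> 0})"
        by (auto simp: cone_of_def inner_commute)
      then show ?thesis by (auto intro!: closed_Int closed_INT closed_halfspace_ge closed_span)
    qed
    then show "closure ?C \<subseteq> cone_of \<Phi> q"
      by (intro closure_minimal) (auto simp: cone_of_def less_imp_le)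
    show "cone_of \<Phi> q \<subseteq> closure ?C"
    proof
      fix v assume v: "v \<in> cone_of \<Phi> q"
      have "(\<lambda>n. v + (1 / real (Suc n)) *\<^sub>R q) \<longlonglongrightarrow> v + 0 *\<^sub>R q"
        by (intro tendsto_intros LIMSEQ_Suc[OF lim_1_over_n])
      moreover have "v + (1 / real (Suc n)) *\<^sub>R q \<in> ?C" for n
      proof -
        have "(1 / real (Suc n)) * (q \<bullet> a) > 0" if "q \<bullet> a > 0" for a
          using that by (intro mult_pos_pos) auto
        then show ?thesis using v q unfolding cone_of_def regular_def
          by (auto intro!: span_add span_scale add_nonneg_pos simp: inner_add_left simp del: of_nat_Suc)
      qed
      ultimately show "v \<in> closure ?C" unfolding closure_sequential
        by (intro exI[of _ "\<lambda>n. v + (1 / real (Suc n)) *\<^sub>R q"]) auto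
    qed
  qed
  have "sectors \<Phi> = (\<lambda>q. closure (connected_component_set X q)) ` X"
    unfolding sectors_def components_def X_def[symmetric] by (simp only: image_image)
  also have "\<dots> = cone_of \<Phi> ` {q. regular \<Phi> q}"
    using comp clos by (intro image_cong) (auto simp: X)
  finally show ?thesis .
qed

lemma regular_in_cone: "regular \<Phi> q \<Longrightarrow> q \<in> cone_of \<Phi> q"
  by (auto simp: regular_def cone_of_def)

lemma cone_of_halfspace_iff:
  assumes neg: "\<And>a. a \<in> \<Phi> \<Longrightarrow> - a \<in> \<Phi>" and q: "regular \<Phi> q" and a: "a \<in> \<Phi>"
  shows "cone_of \<Phi> q \<subseteq> halfspace a \<longleftrightarrow> q \<bullet> a > 0"
proof
  assume "cone_of \<Phi> q \<subseteq> halfspace a"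
  then have "q \<bullet> a \<ge> 0" using regular_in_cone[OF q] by (auto simp: halfspace_def)
  then show "q \<bullet> a > 0" using q a by (auto simp: regular_def)
qed (use a in \<open>auto simp: cone_of_def halfspace_def\<close>)

text \<open>A finite set of roots with a chamber \<open>S\<close>, given by a vector \<open>q\<close> in its interior. The set is not yet
  assumed to be closed under its reflections.\<close>

locale root_cone =
  fixes \<Phi> :: "'v::euclidean_space set" and q :: 'v and S :: "'v set"
  assumes fin: "finite \<Phi>" and unit: "\<And>a. a \<in> \<Phi> \<Longrightarrow> a \<bullet> a = 1"
    and neg: "\<And>a. a \<in> \<Phi> \<Longrightarrow> - a \<in> \<Phi>"
    and q: "regular \<Phi> q" and S_def: "S = cone_of \<Phi> q"
begin

text \<open>The positive roots, that is, the roots that contain \<open>S\<close>.\<close>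

definition Pos :: "'v set" where "Pos = {a \<in> \<Phi>. q \<bullet> a > 0}"

abbreviation I :: "'v set" where "I \<equiv> simple_roots \<Phi> S"

lemma Pos_sub: "Pos \<subseteq> \<Phi>" by (auto simp: Pos_def)

lemma uminus_Pos: "a \<in> \<Phi> \<Longrightarrow> - a \<in> Pos \<longleftrightarrow> a \<notin> Pos"
  using q neg by (auto simp: Pos_def regular_def)

lemma S_alt: "S = {v \<in> span \<Phi>. \<forall>a\<in>Pos. v \<bullet> a \<ge> 0}"
  by (auto simp: S_def cone_of_def Pos_def)

lemma S_halfspace: "a \<in> \<Phi> \<Longrightarrow> S \<subseteq> halfspace a \<longleftrightarrow> a \<in> Pos"
  unfolding S_def using cone_of_halfspace_iff[OF neg q] by (auto simp: Pos_def)

lemma abs_inner_less_1: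
  assumes "a \<in> \<Phi>" "b \<in> \<Phi>" "a \<noteq> b" "a \<noteq> - b"
  shows "(a \<bullet> b)\<^sup>2 < 1"
proof -
  have "(a - (a \<bullet> b) *\<^sub>R b) \<bullet> (a - (a \<bullet> b) *\<^sub>R b) = 1 - (a \<bullet> b)\<^sup>2"
    using unit[OF assms(1)] unit[OF assms(2)]
    by (simp add: inner_diff_left inner_diff_right power2_eq_square inner_commute)
  moreover have "a - (a \<bullet> b) *\<^sub>R b \<noteq> 0"
  proof
    assume *: "a - (a \<bullet> b) *\<^sub>R b = 0"
    then have "(a \<bullet> b)\<^sup>2 = 1" using calculation by simp
    then have "a \<bullet> b = 1 \<or> a \<bullet> b = - 1" by (simp add: power2_eq_1_iff)
    then show False
    proof
      assume "a \<bullet> b = - 1"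
      with * have "a + b = 0" by simp
      with assms(4) show False by (simp add: eq_neg_iff_add_eq_0)
    qed (use * assms(3) in auto)
  qed
  ultimately show ?thesis by (metis inner_gt_zero_iff diff_gt_0_iff_gt)
qed

text \<open>A vector of the wall of \<open>i\<close> that a second positive root \<open>a\<close> does not annihilate.\<close>

lemma transversal:
  assumes "i \<in> Pos" "a \<in> Pos" "a \<noteq> i"
  shows "(a - (a \<bullet> i) *\<^sub>R i) \<bullet> i = 0" "(a - (a \<bullet> i) *\<^sub>R i) \<bullet> a > 0" "a - (a \<bullet> i) *\<^sub>R i \<in> span \<Phi>"
proof -
  have *: "i \<in> \<Phi>" "a \<in> \<Phi>" "a \<noteq> - i" using assms uminus_Pos[of i] by (auto simp: Pos_def)
  show "(a - (a \<bullet> i) *\<^sub>R i) \<bullet> i = 0" using unit[OF *(1)] by (simp add: inner_diff_left)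
  show "(a - (a \<bullet> i) *\<^sub>R i) \<bullet> a > 0" using unit[OF *(2)] abs_inner_less_1[OF *(2,1) assms(3) *(3)]
    by (simp add: inner_diff_left power2_eq_square inner_commute[of i a])
  show "a - (a \<bullet> i) *\<^sub>R i \<in> span \<Phi>" using * by (intro span_diff span_scale span_base)
qed

lemma wall_alt: "i \<in> Pos \<Longrightarrow> wall S i = {v \<in> span \<Phi>. v \<bullet> i = 0 \<and> (\<forall>a\<in>Pos. v \<bullet> a \<ge> 0)}"
  by (auto simp: wall_def S_alt)

lemma convex_S: "convex S"
  unfolding S_alt convex_def
  by (auto simp: inner_add_left intro!: span_add span_scale add_nonneg_nonneg)

lemma in_span_affine_hull:
  assumes T: "T \<subseteq> span \<Phi>" "T = {v \<in> span \<Phi> \<inter> H. \<forall>a\<in>Pos. v \<bullet> a \<ge> 0}" and H: "subspace H"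
    and p: "p \<in> span \<Phi> \<inter> H" "\<And>a. a \<in> Pos \<Longrightarrow> p \<bullet> a > 0 \<or> (\<forall>v\<in>H. v \<bullet> a = 0)"
  shows "affine hull T = span \<Phi> \<inter> H"
proof -
  have sub: "subspace (span \<Phi> \<inter> H)" using H by (auto intro: subspace_inter)
  have "0 \<in> T" using T H by (auto intro: span_0 subspace_0)
  then have "affine hull T = span T" by (simp add: affine_hull_span_0 hull_inc)
  moreover have "span T \<subseteq> span \<Phi> \<inter> H" using sub T by (intro span_minimal) auto
  moreover have "span \<Phi> \<inter> H \<subseteq> span T"
  proof
    fix v assume v: "v \<in> span \<Phi> \<inter> H"
    have finP: "finite Pos" using fin by (auto simp: Pos_def)
    have "\<exists>e>0. \<forall>a\<in>Pos. (p + e *\<^sub>R v) \<bullet> a \<ge> 0"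
    proof -
      define M where "M = 1 + (\<Sum>a\<in>Pos. \<bar>v \<bullet> a\<bar>)"
      define m where "m = Min (insert 1 ((\<lambda>a. p \<bullet> a) ` {a\<in>Pos. p \<bullet> a > 0}))"
      have m: "m > 0" unfolding m_def using finP by (subst Min_gr_iff) auto
      have M: "M > 0" unfolding M_def by (intro add_pos_nonneg sum_nonneg) auto
      have "(p + (m / M) *\<^sub>R v) \<bullet> a \<ge> 0" if a: "a \<in> Pos" for a
      proof (cases "p \<bullet> a > 0")
        case True
        have "m \<le> p \<bullet> a" unfolding m_def using finP a True by (intro Min_le) auto
        moreover have "\<bar>v \<bullet> a\<bar> \<le> M" unfolding M_def
          using member_le_sum[of a Pos "\<lambda>a. \<bar>v \<bullet> a\<bar>"] a finP by auto
        then have "\<bar>(m / M) * (v \<bullet> a)\<bar> \<le> m" using m M by (simp add: abs_mult field_simps)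
        then have "- ((m / M) * (v \<bullet> a)) \<le> m" by (rule abs_le_D2)
        ultimately show ?thesis by (simp add: inner_add_left)
      next
        case False
        then have "p \<bullet> a = 0" "v \<bullet> a = 0" using p(1) p(2)[OF a] v by auto
        then show ?thesis by (simp add: inner_add_left)
      qed
      then show ?thesis using m M by (intro exI[of _ "m / M"]) auto
    qed
    then obtain e where e: "e > 0" "\<forall>a\<in>Pos. (p + e *\<^sub>R v) \<bullet> a \<ge> 0" by blast
    have "p + e *\<^sub>R v \<in> T" using e p v sub unfolding T(2) by (auto simp: subspace_add subspace_scale H intro: span_add span_scale)
    moreover have "p \<in> T" using p unfolding T(2) by force
    ultimately have "(p + e *\<^sub>R v) - p \<in> span T" by (intro span_diff) (auto intro: span_base)
    then have "e *\<^sub>R v \<in> span T" by simp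
    then have "(1 / e) *\<^sub>R (e *\<^sub>R v) \<in> span T" by (rule span_scale)
    moreover have "(1 / e) *\<^sub>R (e *\<^sub>R v) = v" using e by simp
    ultimately show "v \<in> span T" by (simp only:)
  qed
  ultimately show ?thesis by blast
qed

lemma affine_hull_S: "affine hull S = span \<Phi>"
  using in_span_affine_hull[of S UNIV q] q S_alt by (auto simp: regular_def Pos_def)

text \<open>A combinatorial form of the definition by facets: a positive root is simple if and only if some
  vector of its hyperplane is strictly positive on all other positive roots.\<close>

lemma simple_roots_iff:
  "i \<in> I \<longleftrightarrow> i \<in> Pos \<and> (\<exists>v\<in>span \<Phi>. v \<bullet> i = 0 \<and> (\<forall>a\<in>Pos - {i}. v \<bullet> a > 0))"
proof
  assume "i \<in> I"
  then have i: "i \<in> \<Phi>" "i \<in> Pos" and facet: "wall S i facet_of S"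
    using S_halfspace by (auto simp: simple_roots_def)
  have *: "\<exists>v\<in>wall S i. v \<bullet> a > 0" if a: "a \<in> Pos - {i}" for a
  proof (rule ccontr)
    assume "\<not> ?thesis"
    then have "wall S i \<subseteq> (span \<Phi> \<inter> {x. i \<bullet> x = 0}) \<inter> {x. a \<bullet> x = 0}"
      using a unfolding wall_alt[OF i(2)] by (force simp: inner_commute)
    then have "aff_dim (wall S i) \<le> aff_dim ((span \<Phi> \<inter> {x. i \<bullet> x = 0}) \<inter> {x. a \<bullet> x = 0})"
      by (rule aff_dim_subset)
    also have "\<dots> = aff_dim (span \<Phi> \<inter> {x. i \<bullet> x = 0}) - 1"
    proof -
      have "affine (span \<Phi> \<inter> {x. i \<bullet> x = 0})"
        by (intro affine_Int subspace_imp_affine subspace_span affine_hyperplane)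
      moreover have "0 \<in> span \<Phi> \<inter> {x. i \<bullet> x = 0} \<inter> {x. a \<bullet> x = 0}" by (auto intro: span_0)
      moreover have "a - (a \<bullet> i) *\<^sub>R i \<in> span \<Phi> \<inter> {x. i \<bullet> x = 0} - {x. a \<bullet> x = 0}"
        using transversal[OF i(2), of a] a by (auto simp: inner_commute)
      ultimately show ?thesis by (subst aff_dim_affine_Int_hyperplane) auto
    qed
    also have "aff_dim (span \<Phi> \<inter> {x. i \<bullet> x = 0}) = aff_dim (span \<Phi>) - 1"
    proof -
      have "i \<in> span \<Phi> - {x. i \<bullet> x = 0}" using i unit[OF i(1)] by (auto intro: span_base)
      moreover have "0 \<in> span \<Phi> \<inter> {x. i \<bullet> x = 0}" by (auto intro: span_0)
      ultimately show ?thesis by (subst aff_dim_affine_Int_hyperplane) (auto simp: subspace_imp_affine)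
    qed
    also have "aff_dim (span \<Phi>) = aff_dim S"
      using affine_hull_S by (metis aff_dim_affine_hull)
    finally show False using facet by (simp add: facet_of_def)
  qed
  then obtain v where v: "\<And>a. a \<in> Pos - {i} \<Longrightarrow> v a \<in> wall S i \<and> v a \<bullet> a > 0" by metis
  define p where "p = (\<Sum>a\<in>Pos - {i}. v a)"
  have finP: "finite (Pos - {i})" using fin by (auto simp: Pos_def)
  have "p \<bullet> a > 0" if a: "a \<in> Pos - {i}" for a
    unfolding p_def inner_sum_left
    by (rule sum_pos2[OF finP a]) (use v a in \<open>auto simp: wall_alt[OF i(2)]\<close>)
  moreover have "p \<in> span \<Phi>" unfolding p_def by (rule span_sum) (use v in \<open>auto simp: wall_alt[OF i(2)]\<close>)
  moreover have "p \<bullet> i = 0" unfolding p_def inner_sum_left by (rule sum.neutral) (use v in \<open>auto simp: wall_alt[OF i(2)]\<close>)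
  ultimately show "i \<in> Pos \<and> (\<exists>v\<in>span \<Phi>. v \<bullet> i = 0 \<and> (\<forall>a\<in>Pos - {i}. v \<bullet> a > 0))" using i by blast
next
  assume "i \<in> Pos \<and> (\<exists>v\<in>span \<Phi>. v \<bullet> i = 0 \<and> (\<forall>a\<in>Pos - {i}. v \<bullet> a > 0))"
  then obtain p where i: "i \<in> Pos" and p: "p \<in> span \<Phi>" "p \<bullet> i = 0" "\<And>a. a \<in> Pos - {i} \<Longrightarrow> p \<bullet> a > 0"
    by blast
  then have iPhi: "i \<in> \<Phi>" by (auto simp: Pos_def)
  let ?H = "{x. i \<bullet> x = 0}"
  have "affine hull (wall S i) = span \<Phi> \<inter> ?H"
  proof (rule in_span_affine_hull)
    show "subspace ?H" by (rule subspace_hyperplane)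
    show "p \<bullet> a > 0 \<or> (\<forall>v\<in>?H. v \<bullet> a = 0)" if "a \<in> Pos" for a
      using that p(3)[of a] by (cases "a = i") (auto simp: inner_commute)
  qed (use p in \<open>auto simp: wall_alt[OF i] inner_commute\<close>)
  moreover have "aff_dim (span \<Phi> \<inter> ?H) = aff_dim (span \<Phi>) - 1"
  proof -
    have "i \<in> span \<Phi> - {x. i \<bullet> x = 0}" using unit[OF iPhi] iPhi by (auto intro: span_base)
    moreover have "0 \<in> span \<Phi> \<inter> {x. i \<bullet> x = 0}" by (auto intro: span_0)
    ultimately show ?thesis by (subst aff_dim_affine_Int_hyperplane) (auto simp: subspace_imp_affine)
  qed
  ultimately have "aff_dim (wall S i) = aff_dim S - 1"
    using affine_hull_S by (metis aff_dim_affine_hull)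
  moreover have "wall S i face_of S"
  proof -
    have "wall S i = S \<inter> {x. i \<bullet> x = 0}" by (auto simp: wall_def inner_commute)
    then show ?thesis
      using face_of_Int_supporting_hyperplane_ge[OF convex_S, where a = i and b = 0] i by (auto simp: S_alt inner_commute)
  qed
  moreover have "0 \<in> wall S i" unfolding wall_alt[OF i] by (auto intro: span_0)
  ultimately show "i \<in> I"
    using i iPhi S_halfspace by (auto simp: simple_roots_def facet_of_def)
qed

lemma simple_Pos: "i \<in> I \<Longrightarrow> i \<in> Pos" and simple_root: "i \<in> I \<Longrightarrow> i \<in> \<Phi>"
  using simple_roots_iff by (auto simp: Pos_def)

text \<open>The cone is already cut out by its simple roots.\<close>

lemma S_simple: "S = {v \<in> span \<Phi>. \<forall>i\<in>I. v \<bullet> i \<ge> 0}"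
proof -
  define good where "good = {F. F \<subseteq> Pos \<and> S = {v \<in> span \<Phi>. \<forall>a\<in>F. v \<bullet> a \<ge> 0}}"
  have "Pos \<in> good" by (auto simp: good_def S_alt)
  moreover have "finite good" unfolding good_def using fin by (auto simp: Pos_def)
  ultimately obtain F where F: "F \<in> good" and min: "\<And>F'. F' \<in> good \<Longrightarrow> F' \<subseteq> F \<Longrightarrow> F' = F"
    using finite_has_minimal[of good] by (metis empty_iff)
  have "F \<subseteq> I"
  proof
    fix i assume i: "i \<in> F"
    have iPos: "i \<in> Pos" using F i by (auto simp: good_def)
    have "F - {i} \<notin> good" using min[of "F - {i}"] i by auto
    then obtain z where z: "z \<in> span \<Phi>" "\<And>a. a \<in> F - {i} \<Longrightarrow> z \<bullet> a \<ge> 0" "z \<notin> S"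
      using F unfolding good_def by auto
    then have zi: "z \<bullet> i < 0" using F i by (auto simp: good_def) (metis DiffI linorder_not_less singletonD)
    define t where "t = (q \<bullet> i) / (q \<bullet> i - z \<bullet> i)"
    have qi: "q \<bullet> i > 0" using iPos by (simp add: Pos_def)
    have t: "0 < t" "t < 1" using qi zi by (auto simp: t_def field_simps)
    define p where "p = q + t *\<^sub>R (z - q)"
    have p_span: "p \<in> span \<Phi>" unfolding p_def using q z by (intro span_add span_scale span_diff) (auto simp: regular_def)
    have pi: "p \<bullet> i = 0"
    proof -
      have "p \<bullet> i = q \<bullet> i - t * (q \<bullet> i - z \<bullet> i)" by (simp add: p_def inner_add_left inner_diff_left algebra_simps)
      then show ?thesis using qi zi by (simp add: t_def)
    qed
    have pF: "p \<bullet> a > 0" if "a \<in> F - {i}" for a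
    proof -
      have "p \<bullet> a = (1 - t) * (q \<bullet> a) + t * (z \<bullet> a)"
        by (simp add: p_def inner_add_left inner_diff_left algebra_simps)
      moreover have "q \<bullet> a > 0" using F that by (auto simp: good_def Pos_def)
      ultimately show ?thesis using t z(2)[OF that] by (simp add: add_pos_nonneg)
    qed
    have "p \<in> S" using F p_span pi pF by (auto simp: good_def) (metis DiffI less_imp_le order_refl singletonD)
    have "p \<bullet> a > 0" if a: "a \<in> Pos - {i}" for a
    proof (rule ccontr)
      assume "\<not> p \<bullet> a > 0"
      then have pa: "p \<bullet> a = 0" using \<open>p \<in> S\<close> a by (force simp: S_alt)
      define v where "v = - (a - (a \<bullet> i) *\<^sub>R i)"
      have v: "v \<bullet> i = 0" "v \<bullet> a < 0" "v \<in> span \<Phi>"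
        using transversal[OF iPos, of a] a span_neg[of "a - (a \<bullet> i) *\<^sub>R i" \<Phi>]
        unfolding v_def inner_minus_left by (auto simp del: minus_diff_eq)
      \<comment> \<open>Moving \<open>p\<close> a little within the hyperplane of \<open>i\<close> stays in the cone but leaves the half-space of \<open>a\<close>.\<close>
      have finF: "finite F" using F fin by (auto simp: good_def Pos_def intro: finite_subset)
      define M where "M = 1 + (\<Sum>b\<in>F. \<bar>v \<bullet> b\<bar>)"
      define m where "m = Min (insert 1 ((\<lambda>b. p \<bullet> b) ` (F - {i})))"
      have m: "m > 0" unfolding m_def using finF pF by (subst Min_gr_iff) auto
      have M: "M > 0" unfolding M_def by (intro add_pos_nonneg sum_nonneg) auto
      have "(p + (m / M) *\<^sub>R v) \<bullet> b \<ge> 0" if b: "b \<in> F" for b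
      proof (cases "b = i")
        case False
        have "m \<le> p \<bullet> b" unfolding m_def using finF b False by (intro Min_le) auto
        moreover have "\<bar>v \<bullet> b\<bar> \<le> M" unfolding M_def
          using member_le_sum[of b F "\<lambda>a. \<bar>v \<bullet> a\<bar>"] b finF by auto
        then have "\<bar>(m / M) * (v \<bullet> b)\<bar> \<le> m" using m M by (simp add: abs_mult field_simps)
        then have "- ((m / M) * (v \<bullet> b)) \<le> m" by (rule abs_le_D2)
        ultimately show ?thesis by (simp add: inner_add_left)
      qed (use pi v in \<open>simp add: inner_add_left\<close>)
      then have "p + (m / M) *\<^sub>R v \<in> S"
        using F p_span v by (auto simp: good_def intro: span_add span_scale)
      then have "(p + (m / M) *\<^sub>R v) \<bullet> a \<ge> 0" using a by (auto simp: S_alt)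
      then have "(m / M) * (v \<bullet> a) \<ge> 0" using pa by (simp add: inner_add_left)
      moreover have "(m / M) * (v \<bullet> a) < 0" using m M v(2) by (intro mult_pos_neg) auto
      ultimately show False by linarith
    qed
    then show "i \<in> I" using simple_roots_iff iPos p_span pi by blast
  qed
  then have "{v \<in> span \<Phi>. \<forall>i\<in>I. v \<bullet> i \<ge> 0} \<subseteq> S" using F by (auto simp: good_def)
  moreover have "S \<subseteq> {v \<in> span \<Phi>. \<forall>i\<in>I. v \<bullet> i \<ge> 0}" using simple_Pos by (auto simp: S_alt)
  ultimately show ?thesis by blast
qed

end

text \<open>The roots are closed under their reflections; this is what the theory of Coxeter groups needs.\<close>

locale reflection_system = root_cone +
  assumes closed: "\<And>a b. a \<in> \<Phi> \<Longrightarrow> b \<in> \<Phi> \<Longrightarrow> refl_in a b \<in> \<Phi>"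
begin

lemma weyl_isometry:
  assumes "w \<in> weyl \<Phi>"
  shows "linear w" "w u \<bullet> w v = u \<bullet> v" "a \<in> \<Phi> \<Longrightarrow> w a \<in> \<Phi>" "v \<in> span \<Phi> \<Longrightarrow> w v \<in> span \<Phi>"
proof -
  have "linear w \<and> (\<forall>u v. w u \<bullet> w v = u \<bullet> v) \<and> (\<forall>a\<in>\<Phi>. w a \<in> \<Phi>) \<and> (\<forall>v\<in>span \<Phi>. w v \<in> span \<Phi>)"
    using assms
  proof induction
    case weyl_id
    then show ?case by (simp add: linear_iff)
  next
    case (weyl_refl w a)
    then show ?case
      by (auto intro: linear_compose[unfolded comp_def] linear_refl_in closed refl_in_span simp: inner_refl_in unit)
  qed
  then show "linear w" "w u \<bullet> w v = u \<bullet> v" "a \<in> \<Phi> \<Longrightarrow> w a \<in> \<Phi>" "v \<in> span \<Phi> \<Longrightarrow> w v \<in> span \<Phi>" by auto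
qed

lemma weyl_comp: "w \<in> weyl \<Phi> \<Longrightarrow> w' \<in> weyl \<Phi> \<Longrightarrow> w \<circ> w' \<in> weyl \<Phi>"
  by (induction rule: weyl.induct) (auto simp: comp_assoc intro: weyl.weyl_refl)

lemma weyl_refl_in: "a \<in> \<Phi> \<Longrightarrow> refl_in a \<in> weyl \<Phi>"
  using weyl_refl[OF weyl_id] by fastforce

lemma refl_in_comp_self: "a \<in> \<Phi> \<Longrightarrow> refl_in a \<circ> refl_in a = id"
  by (auto simp: fun_eq_iff refl_in_refl_in unit)

lemma weyl_inverse:
  assumes "w \<in> weyl \<Phi>"
  obtains w' where "w' \<in> weyl \<Phi>" "w' \<circ> w = id" "w \<circ> w' = id"
proof -
  have "\<exists>w'\<in>weyl \<Phi>. w' \<circ> w = id \<and> w \<circ> w' = id"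
    using assms
  proof induction
    case (weyl_refl w a)
    then obtain w' where w': "w' \<in> weyl \<Phi>" "w' \<circ> w = id" "w \<circ> w' = id" by blast
    have "w' (w v) = v" "w (w' v) = v" for v using w' by (metis comp_apply id_apply)+
    then have "(w' \<circ> refl_in a) \<circ> (refl_in a \<circ> w) = id" "(refl_in a \<circ> w) \<circ> (w' \<circ> refl_in a) = id"
      by (simp_all add: fun_eq_iff refl_in_refl_in unit weyl_refl.hyps)
    moreover have "w' \<circ> refl_in a \<in> weyl \<Phi>" using w' weyl_refl by (intro weyl_comp weyl_refl_in)
    ultimately show ?case by blast
  next
    case weyl_id
    show ?case by (rule bexI[OF _ weyl.weyl_id]) simp
  qed
  then show ?thesis using that by blast
qed

lemma weyl_uminus: "w \<in> weyl \<Phi> \<Longrightarrow> w (- v) = - w v"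
  using weyl_isometry(1) by (rule linear_neg)

lemma weyl_refl_conj: "w \<in> weyl \<Phi> \<Longrightarrow> w \<circ> refl_in a = refl_in (w a) \<circ> w"
  using refl_in_conj weyl_isometry by blast

lemma word_weyl: "set f \<subseteq> I \<Longrightarrow> word_value f \<in> weyl \<Phi>"
  by (induction f) (auto intro: weyl.intros simple_root)

lemma regular_weyl:
  assumes w: "w \<in> weyl \<Phi>" and p: "regular \<Phi> p"
  shows "regular \<Phi> (w p)"
  unfolding regular_def
proof
  show "w p \<in> span \<Phi>" using w p weyl_isometry by (auto simp: regular_def)
  obtain w' where w': "w' \<in> weyl \<Phi>" "w' \<circ> w = id" "w \<circ> w' = id" using weyl_inverse[OF w] .
  show "\<forall>a\<in>\<Phi>. w p \<bullet> a \<noteq> 0"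
  proof
    fix a assume a: "a \<in> \<Phi>"
    have "w p \<bullet> a = w' (w p) \<bullet> w' a" using weyl_isometry[OF w'(1)] by simp
    also have "\<dots> = p \<bullet> w' a" using w'(2) by (metis comp_apply id_apply)
    finally show "w p \<bullet> a \<noteq> 0" using p weyl_isometry(3)[OF w'(1) a] by (auto simp: regular_def)
  qed
qed

lemma weyl_cone:
  assumes w: "w \<in> weyl \<Phi>"
  shows "w ` cone_of \<Phi> p = cone_of \<Phi> (w p)"
proof -
  have sub: "w ` cone_of \<Phi> p \<subseteq> cone_of \<Phi> (w p)" if w: "w \<in> weyl \<Phi>" for w p
  proof
    fix x assume "x \<in> w ` cone_of \<Phi> p"
    then obtain v where v: "v \<in> cone_of \<Phi> p" "x = w v" by auto
    obtain w' where w': "w' \<in> weyl \<Phi>" "w' \<circ> w = id" "w \<circ> w' = id" using weyl_inverse[OF w] .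
    have "w u \<bullet> a = u \<bullet> w' a" for u a
      using weyl_isometry(2)[OF w'(1), of "w u" a] w'(2) by (metis comp_apply id_apply)
    then show "x \<in> cone_of \<Phi> (w p)"
      using v weyl_isometry(4)[OF w] weyl_isometry(3)[OF w'(1)] by (auto simp: cone_of_def)
  qed
  obtain w' where w': "w' \<in> weyl \<Phi>" "w' \<circ> w = id" "w \<circ> w' = id" using weyl_inverse[OF w] .
  have "w' ` cone_of \<Phi> (w p) \<subseteq> cone_of \<Phi> p"
    using sub[OF w'(1), of "w p"] fun_cong[OF w'(2), of p] by simp
  then have "w ` w' ` cone_of \<Phi> (w p) \<subseteq> w ` cone_of \<Phi> p" by (rule image_mono)
  then have "cone_of \<Phi> (w p) \<subseteq> w ` cone_of \<Phi> p" by (simp only: image_comp w'(3) image_id id_apply)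
  then show ?thesis using sub[OF w, of p] by blast
qed

lemma cone_of_eq:
  assumes "\<And>a. a \<in> \<Phi> \<Longrightarrow> p \<bullet> a > 0 \<longleftrightarrow> p' \<bullet> a > 0"
  shows "cone_of \<Phi> p = cone_of \<Phi> p'"
  using assms by (auto simp: cone_of_def)

lemma cone_of_eqD:
  assumes "cone_of \<Phi> p = cone_of \<Phi> p'" "regular \<Phi> p" "regular \<Phi> p'" "a \<in> \<Phi>"
  shows "p \<bullet> a > 0 \<longleftrightarrow> p' \<bullet> a > 0"
  using cone_of_halfspace_iff[OF neg] assms by metis

subsection \<open>Length\<close>

lemma S_iff: "v \<in> S \<longleftrightarrow> v \<in> span \<Phi> \<and> (\<forall>i\<in>I. v \<bullet> i \<ge> 0)"
  using S_simple by blast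

text \<open>The number of positive roots that \<open>w\<close> makes negative. It is the length of \<open>w\<close> with
  respect to the simple reflections.\<close>

definition inversions :: "('a \<Rightarrow> 'a) \<Rightarrow> nat" where
  "inversions w = card {a \<in> Pos. w a \<notin> Pos}"

lemma finite_Pos: "finite Pos" using fin by (auto simp: Pos_def)

lemma refl_simple_Pos:
  assumes i: "i \<in> I" and a: "a \<in> Pos" "a \<noteq> i"
  shows "refl_in i a \<in> Pos" "refl_in i a \<noteq> i"
proof -
  obtain v where v: "v \<in> span \<Phi>" "v \<bullet> i = 0" "\<And>a. a \<in> Pos - {i} \<Longrightarrow> v \<bullet> a > 0"
    using i simple_roots_iff by blast
  have mem: "i \<in> \<Phi>" "a \<in> \<Phi>" "refl_in i a \<in> \<Phi>"
    using i a simple_root closed by (auto simp: Pos_def)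
  have pos: "v \<bullet> refl_in i a > 0" using v(2) v(3)[of a] a by (simp add: refl_in_def inner_diff_right)
  have ni: "refl_in i a \<noteq> i" "refl_in i a \<noteq> - i" using pos v(2) by auto
  then show "refl_in i a \<noteq> i" by simp
  show "refl_in i a \<in> Pos"
  proof (rule ccontr)
    assume "refl_in i a \<notin> Pos"
    then have "- refl_in i a \<in> Pos" using uminus_Pos[OF mem(3)] by simp
    moreover have "- refl_in i a \<noteq> i" using ni(2) by (metis add.inverse_inverse)
    ultimately show False using v(3)[of "- refl_in i a"] pos by simp
  qed
qed

lemma inversions_refl:
  assumes w: "w \<in> weyl \<Phi>" and i: "i \<in> I"
  shows "w i \<in> Pos \<Longrightarrow> inversions (w \<circ> refl_in i) = Suc (inversions w)"
    and "w i \<notin> Pos \<Longrightarrow> inversions w = Suc (inversions (w \<circ> refl_in i))"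
proof -
  define A where "A = {a \<in> Pos - {i}. w a \<notin> Pos}"
  define B where "B = {a \<in> Pos - {i}. w (refl_in i a) \<notin> Pos}"
  have fin: "finite A" "finite B" using finite_Pos by (auto simp: A_def B_def)
  have iPos: "i \<in> Pos" "i \<in> \<Phi>" using i simple_Pos simple_root by auto
  have ii: "refl_in i (refl_in i v) = v" for v using unit[OF iPos(2)] by (rule refl_in_refl_in)
  have "bij_betw (refl_in i) B A"
    by (rule bij_betw_byWitness[where f' = "refl_in i"])
       (use refl_simple_Pos[OF i] in \<open>auto simp: A_def B_def ii\<close>)
  then have card: "card B = card A" by (rule bij_betw_same_card)
  have wi: "w (refl_in i i) = - w i" using unit[OF iPos(2)] weyl_uminus[OF w] by (simp add: refl_in_self)
  have wi': "- w i \<in> Pos \<longleftrightarrow> w i \<notin> Pos" using uminus_Pos weyl_isometry(3)[OF w iPos(2)] by blast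
  have "{a \<in> Pos. w a \<notin> Pos} = (if w i \<in> Pos then A else insert i A)"
    using iPos by (auto simp: A_def)
  moreover have "{a \<in> Pos. (w \<circ> refl_in i) a \<notin> Pos} = (if w i \<in> Pos then insert i B else B)"
    using iPos wi wi' by (auto simp: B_def)
  moreover have "i \<notin> A" "i \<notin> B" by (auto simp: A_def B_def)
  ultimately show "w i \<in> Pos \<Longrightarrow> inversions (w \<circ> refl_in i) = Suc (inversions w)"
    "w i \<notin> Pos \<Longrightarrow> inversions w = Suc (inversions (w \<circ> refl_in i))"
    using card fin by (auto simp: inversions_def)
qed

lemma inversions_id: "inversions id = 0"
  by (simp add: inversions_def)

lemma inversions_word_le: "set f \<subseteq> I \<Longrightarrow> inversions (word_value f) \<le> length f"
proof (induction f rule: rev_induct)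
  case (snoc i f)
  then show ?case using inversions_refl[of "word_value f" i] word_weyl[of f]
    by (cases "word_value f i \<in> Pos") (auto simp: word_value_append comp_def)
qed (simp add: inversions_id)

text \<open>If a word sends the simple root \<open>j\<close> to a negative root, then one of its letters can be deleted
  at the price of a multiplication by the reflection in \<open>j\<close>.\<close>

lemma deletion:
  assumes "set f \<subseteq> I" "j \<in> I" "word_value f j \<notin> Pos"
  shows "\<exists>g. set g \<subseteq> I \<and> word_value g = word_value f \<circ> refl_in j \<and> Suc (length g) = length f"
  using assms
proof (induction f)
  case Nil
  then show ?case using simple_Pos by simp
next
  case (Cons i f)
  show ?case
  proof (cases "word_value f j \<in> Pos")
    case False
    then obtain g where "set g \<subseteq> I" "word_value g = word_value f \<circ> refl_in j" "Suc (length g) = length f"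
      using Cons.IH[OF _ Cons.prems(2) False] Cons.prems(1) unfolding list.set insert_subset by blast
    then show ?thesis using Cons.prems by (intro exI[of _ "i # g"]) (auto simp: comp_assoc)
  next
    case True
    then have "word_value f j = i" using refl_simple_Pos(1)[of i "word_value f j"] Cons.prems by auto
    then have "word_value f \<circ> refl_in j = refl_in i \<circ> word_value f"
      using weyl_refl_conj[OF word_weyl, of f j] Cons.prems by simp
    then have "word_value (i # f) \<circ> refl_in j = word_value f"
      using refl_in_comp_self[of i] Cons.prems simple_root[of i] by (simp add: comp_assoc) (simp flip: comp_assoc)
    then show ?thesis using Cons.prems by (intro exI[of _ f]) (auto simp: comp_def)
  qed
qed

lemma word_inversions_0:
  assumes "set f \<subseteq> I" "inversions (word_value f) = 0"
  shows "word_value f = id"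
  using assms
proof (induction "length f" arbitrary: f rule: less_induct)
  case less
  show ?case
  proof (cases f rule: rev_cases)
    case (snoc g j)
    have g: "set g \<subseteq> I" "j \<in> I" using less.prems snoc by auto
    have f: "word_value f = word_value g \<circ> refl_in j" by (simp add: snoc word_value_append)
    have "word_value g j \<notin> Pos"
      using inversions_refl(1)[OF word_weyl[OF g(1)] g(2)] less.prems(2) by (auto simp: f)
    then obtain h where "set h \<subseteq> I" "word_value h = word_value f" "Suc (length h) = length g"
      using deletion[OF g] unfolding f by blast
    then show ?thesis using less.hyps[of h] less.prems(2) snoc by simp
  qed simp
qed

text \<open>If \<open>w\<close> keeps all simple roots positive, then its inverse maps \<open>q\<close> into \<open>S\<close>, so that \<open>w\<close> keeps all
  positive roots positive.\<close>

lemma exists_simple_descent: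
  assumes w: "w \<in> weyl \<Phi>" and pos: "inversions w > 0"
  shows "\<exists>i\<in>I. w i \<notin> Pos"
proof (rule ccontr)
  assume *: "\<not> ?thesis"
  obtain w' where w': "w' \<in> weyl \<Phi>" "w' \<circ> w = id" "w \<circ> w' = id" using weyl_inverse[OF w] .
  have adj: "w' u \<bullet> a = u \<bullet> w a" for u a
    using weyl_isometry(2)[OF w, of "w' u" a] fun_cong[OF w'(3), of u] by simp
  have "w' q \<in> S"
    unfolding S_iff
  proof (intro conjI ballI)
    show "w' q \<in> span \<Phi>" using q weyl_isometry(4)[OF w'(1)] by (simp add: regular_def)
    fix i assume "i \<in> I"
    then have "w i \<in> Pos" using * by blast
    then show "w' q \<bullet> i \<ge> 0" by (simp add: adj Pos_def)
  qed
  have "w a \<in> Pos" if a: "a \<in> Pos" for a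
  proof -
    have "w' q \<bullet> a \<ge> 0" using \<open>w' q \<in> S\<close> a unfolding S_alt by blast
    then have ge: "q \<bullet> w a \<ge> 0" by (simp only: adj)
    have "w a \<in> \<Phi>" using a weyl_isometry(3)[OF w] Pos_sub by blast
    moreover from this have "q \<bullet> w a \<noteq> 0" using q by (simp add: regular_def)
    ultimately show ?thesis using ge by (simp add: Pos_def)
  qed
  then have "{a \<in> Pos. w a \<notin> Pos} = {}" by blast
  then have "inversions w = 0" by (simp only: inversions_def card.empty)
  then show False using pos by simp
qed

text \<open>Every positive root is conjugate to a simple root: reflecting in a simple root
  lowers the height \<open>q \<bullet> a\<close> as long as the root is not simple.\<close>

lemma root_conj_simple_Pos:
  assumes "a \<in> Pos"
  shows "\<exists>f i. set f \<subseteq> I \<and> i \<in> I \<and> a = word_value f i"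
  using assms
proof (induction "card {b \<in> Pos. q \<bullet> b < q \<bullet> a}" arbitrary: a rule: less_induct)
  case less
  show ?case
  proof (cases "a \<in> I")
    case True
    then show ?thesis by (intro exI[of _ "[]"]) auto
  next
    case False
    have a: "a \<in> \<Phi>" using less.prems by (auto simp: Pos_def)
    have "\<exists>i\<in>I. a \<bullet> i > 0"
    proof (rule ccontr)
      assume "\<not> ?thesis"
      then have "- a \<in> S" unfolding S_iff using a by (auto intro: span_neg span_base)
      then have "(- a) \<bullet> a \<ge> 0" using less.prems unfolding S_alt by blast
      then show False using unit[OF a] by simp
    qed
    then obtain i where i: "i \<in> I" "a \<bullet> i > 0" by blast
    have s: "refl_in i a \<in> Pos" using refl_simple_Pos(1)[OF i(1) less.prems] i False by auto
    have "q \<bullet> refl_in i a < q \<bullet> a"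
      using i simple_Pos[OF i(1)] by (simp add: refl_in_def inner_diff_right Pos_def)
    then have "{b \<in> Pos. q \<bullet> b < q \<bullet> refl_in i a} \<subset> {b \<in> Pos. q \<bullet> b < q \<bullet> a}" using s by auto
    then have "card {b \<in> Pos. q \<bullet> b < q \<bullet> refl_in i a} < card {b \<in> Pos. q \<bullet> b < q \<bullet> a}"
      by (intro psubset_card_mono) (use finite_Pos in auto)
    then obtain f j where f: "set f \<subseteq> I" "j \<in> I" "refl_in i a = word_value f j" using less.hyps s by blast
    have "a = word_value (i # f) j" using f(3) refl_in_refl_in[OF unit[OF simple_root[OF i(1)]]]
      by (metis comp_apply word_value_simps(2))
    then show ?thesis using f i by (intro exI[of _ "i # f"] exI[of _ j]) auto
  qed
qed

lemma weyl_refl_simple: "i \<in> I \<Longrightarrow> w \<in> weyl \<Phi> \<Longrightarrow> w \<circ> refl_in i \<in> weyl \<Phi>"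
  by (intro weyl_comp weyl_refl_in simple_root)

lemma weyl_word:
  assumes "w \<in> weyl \<Phi>"
  shows "\<exists>f. set f \<subseteq> I \<and> word_value f = w"
  using assms
proof induction
  case weyl_id
  then show ?case by (intro exI[of _ "[]"]) auto
next
  case (weyl_refl w a)
  obtain b where b: "b \<in> Pos" "refl_in a = refl_in b"
    using uminus_Pos[OF weyl_refl.hyps(2)] refl_in_uminus[of a] by metis
  obtain f i where f: "set f \<subseteq> I" "i \<in> I" "b = word_value f i" using root_conj_simple_Pos[OF b(1)] by blast
  have rev: "word_value f \<circ> word_value (rev f) = id" if "set f \<subseteq> I" for f
    using that
  proof (induction f)
    case (Cons i f)
    have "word_value f (word_value (rev f) v) = v" for v
      using Cons by (metis comp_apply id_apply insert_subset list.simps(15))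
    then show ?case
      using Cons.prems by (simp add: fun_eq_iff word_value_append refl_in_refl_in unit simple_root)
  qed simp
  have "refl_in b \<circ> word_value f = word_value f \<circ> refl_in i"
    using weyl_refl_conj[OF word_weyl[OF f(1)]] f(3) by simp
  then have "refl_in b \<circ> (word_value f \<circ> word_value (rev f)) = word_value f \<circ> refl_in i \<circ> word_value (rev f)"
    by (simp flip: comp_assoc)
  then have rb: "refl_in b = word_value (f @ [i] @ rev f)"
    using rev[OF f(1)] by (simp add: word_value_append comp_assoc)
  obtain g where "set g \<subseteq> I" "word_value g = w" using weyl_refl.IH by blast
  then show ?case using f rb b(2) by (intro exI[of _ "f @ [i] @ rev f @ g"]) (auto simp: word_value_append comp_assoc)
qed

lemma inversions_0_iff: "w \<in> weyl \<Phi> \<Longrightarrow> inversions w = 0 \<longleftrightarrow> w = id"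
  using word_inversions_0 weyl_word inversions_id by metis

lemma exists_short_word:
  assumes "w \<in> weyl \<Phi>"
  shows "\<exists>f. set f \<subseteq> I \<and> word_value f = w \<and> length f = inversions w"
  using assms
proof (induction "inversions w" arbitrary: w)
  case 0
  then show ?case using inversions_0_iff by (intro exI[of _ "[]"]) auto
next
  case (Suc n)
  obtain i where i: "i \<in> I" "w i \<notin> Pos" using exists_simple_descent[OF Suc.prems] Suc.hyps(2) by auto
  have "n = inversions (w \<circ> refl_in i)" using inversions_refl(2)[OF Suc.prems i] Suc.hyps(2) by simp
  from Suc.hyps(1)[OF this weyl_refl_simple[OF i(1) Suc.prems]]
  obtain f where f: "set f \<subseteq> I" "word_value f = w \<circ> refl_in i" "length f = inversions (w \<circ> refl_in i)" by blast
  have "word_value (f @ [i]) = w"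
    using f(2) refl_in_comp_self[OF simple_root[OF i(1)]] by (simp add: word_value_append comp_assoc)
  then show ?case using f i inversions_refl(2)[OF Suc.prems i] by (intro exI[of _ "f @ [i]"]) auto
qed

lemma reduced_word_iff: "reduced_word I f \<longleftrightarrow> set f \<subseteq> I \<and> length f = inversions (word_value f)"
proof
  assume f: "reduced_word I f"
  then have "set f \<subseteq> I" by (simp add: reduced_word_def)
  then obtain g where g: "set g \<subseteq> I" "word_value g = word_value f" "length g = inversions (word_value f)"
    using exists_short_word[OF word_weyl] by metis
  then have "length f \<le> length g" using f by (auto simp: reduced_word_def)
  then show "set f \<subseteq> I \<and> length f = inversions (word_value f)"
    using inversions_word_le[of f] g \<open>set f \<subseteq> I\<close> by auto
next
  assume "set f \<subseteq> I \<and> length f = inversions (word_value f)"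
  then show "reduced_word I f" unfolding reduced_word_def using inversions_word_le by metis
qed

lemma exists_reduced_word: "w \<in> weyl \<Phi> \<Longrightarrow> \<exists>f. reduced_word I f \<and> word_value f = w"
  using exists_short_word reduced_word_iff by metis

lemma reduced_word_snoc:
  assumes f: "reduced_word I f" and i: "i \<in> I" and pos: "word_value f i \<in> Pos"
  shows "reduced_word I (f @ [i])"
  using f inversions_refl(1)[OF word_weyl i pos] i unfolding reduced_word_iff by (auto simp: word_value_append)

lemma exists_reduced_word_snoc:
  assumes w: "w \<in> weyl \<Phi>" and i: "i \<in> I" and pos: "w i \<notin> Pos"
  shows "\<exists>f. reduced_word I f \<and> reduced_word I (f @ [i]) \<and> word_value f = w \<circ> refl_in i \<and> word_value (f @ [i]) = w"
proof -
  obtain f where f: "reduced_word I f" "word_value f = w \<circ> refl_in i"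
    using exists_reduced_word weyl_refl_simple[OF i w] by blast
  have v: "word_value (f @ [i]) = w"
    using f(2) refl_in_comp_self[OF simple_root[OF i]] by (simp add: word_value_append comp_assoc)
  then have "reduced_word I (f @ [i])" using f i inversions_refl(2)[OF w i pos] by (auto simp: reduced_word_iff)
  then show ?thesis using f v by blast
qed

lemma refl_in_simple_inject: "i \<in> I \<Longrightarrow> j \<in> I \<Longrightarrow> refl_in i = refl_in j \<Longrightarrow> i = j"
proof (rule ccontr)
  assume *: "i \<in> I" "j \<in> I" "refl_in i = refl_in j" "i \<noteq> j"
  have "refl_in j i \<in> Pos" using refl_simple_Pos(1)[OF *(2) simple_Pos[OF *(1)]] * by simp
  moreover have "refl_in j i = - i" using *(3) refl_in_self[OF unit[OF simple_root[OF *(1)]]] by simp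
  ultimately show False using uminus_Pos simple_Pos simple_root * by metis
qed

subsection \<open>The Coxeter complex\<close>

lemma zero_notin: "0 \<notin> \<Phi>" using unit by force

lemma regular_transitive:
  assumes p: "regular \<Phi> p"
  shows "\<exists>w\<in>weyl \<Phi>. \<forall>a\<in>Pos. w p \<bullet> a > 0"
  using p
proof (induction "card {a \<in> Pos. p \<bullet> a < 0}" arbitrary: p rule: less_induct)
  case less
  show ?case
  proof (cases "\<exists>i\<in>I. p \<bullet> i < 0")
    case False
    then have "p \<in> S" using less.prems by (auto simp: S_iff regular_def)
    then show ?thesis using less.prems by (intro bexI[OF _ weyl_id]) (force simp: S_alt regular_def Pos_def)
  next
    case True
    then obtain i where i: "i \<in> I" "p \<bullet> i < 0" by blast
    have iPhi: "i \<in> \<Phi>" "i \<in> Pos" using simple_root simple_Pos i by auto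
    have adj: "refl_in i p \<bullet> a = p \<bullet> refl_in i a" for a by (rule inner_refl_in_left[OF unit[OF iPhi(1)]])
    have ii: "refl_in i (refl_in i v) = v" for v using unit[OF iPhi(1)] by (rule refl_in_refl_in)
    have "refl_in i i = - i" using unit[OF iPhi(1)] by (rule refl_in_self)
    then have "refl_in i ` {a \<in> Pos. refl_in i p \<bullet> a < 0} \<subseteq> {a \<in> Pos. p \<bullet> a < 0} - {i}"
    proof safe
      fix a assume a: "a \<in> Pos" "refl_in i p \<bullet> a < 0"
      have "a \<noteq> i" using a(2) i(2) \<open>refl_in i i = - i\<close> by (auto simp: adj)
      then show "refl_in i a \<in> Pos" "refl_in i a = i \<Longrightarrow> False" using refl_simple_Pos[OF i(1) a(1)] by auto
      show "p \<bullet> refl_in i a < 0" using a(2) by (simp add: adj)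
    qed
    moreover have "inj_on (refl_in i) A" for A by (rule inj_onI) (metis ii)
    ultimately have "card {a \<in> Pos. refl_in i p \<bullet> a < 0} \<le> card ({a \<in> Pos. p \<bullet> a < 0} - {i})"
      using finite_Pos by (intro card_inj_on_le[of "refl_in i"]) auto
    also have "\<dots> < card {a \<in> Pos. p \<bullet> a < 0}"
      using i iPhi finite_Pos by (intro card_Diff1_less) auto
    finally obtain w where "w \<in> weyl \<Phi>" "\<forall>a\<in>Pos. w (refl_in i p) \<bullet> a > 0"
      using less.hyps regular_weyl[OF weyl_refl_in[OF iPhi(1)] less.prems] by blast
    then show ?thesis using weyl_comp weyl_refl_in[OF iPhi(1)] by (intro bexI[of _ "w \<circ> refl_in i"]) auto
  qed
qed

lemma cone_of_weyl:
  assumes p: "regular \<Phi> p"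
  obtains w where "w \<in> weyl \<Phi>" "cone_of \<Phi> p = w ` S"
proof -
  obtain w where w: "w \<in> weyl \<Phi>" "\<And>a. a \<in> Pos \<Longrightarrow> w p \<bullet> a > 0" using regular_transitive[OF p] by blast
  have "cone_of \<Phi> (w p) = S"
    unfolding S_def
  proof (rule cone_of_eq)
    fix a assume a: "a \<in> \<Phi>"
    show "w p \<bullet> a > 0 \<longleftrightarrow> q \<bullet> a > 0"
      using w(2)[of a] w(2)[of "- a"] uminus_Pos[OF a] a by (auto simp: Pos_def)
  qed
  then have S: "w ` cone_of \<Phi> p = S" by (simp add: weyl_cone[OF w(1)])
  obtain w' where w': "w' \<in> weyl \<Phi>" "w' \<circ> w = id" "w \<circ> w' = id" using weyl_inverse[OF w(1)] .
  then have "w' ` S = cone_of \<Phi> p" using S[symmetric] by (simp add: image_comp)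
  then show ?thesis using that[of w'] w' by simp
qed

lemma sectors_weyl: "sectors \<Phi> = (\<lambda>w. w ` S) ` weyl \<Phi>"
proof -
  have s: "sectors \<Phi> = cone_of \<Phi> ` {p. regular \<Phi> p}" by (rule sectors_eq[OF neg zero_notin])
  have 1: "cone_of \<Phi> p \<in> (\<lambda>w. w ` S) ` weyl \<Phi>" if p: "regular \<Phi> p" for p
    by (rule cone_of_weyl[OF p]) (simp only: image_eqI)
  have 2: "w ` S \<in> cone_of \<Phi> ` {p. regular \<Phi> p}" if "w \<in> weyl \<Phi>" for w
    unfolding S_def weyl_cone[OF that] by (rule imageI) (simp add: regular_weyl[OF that q])
  show ?thesis
  proof
    show "sectors \<Phi> \<subseteq> (\<lambda>w. w ` S) ` weyl \<Phi>" unfolding s using 1 by (simp only: image_subset_iff mem_Collect_eq) simp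
    show "(\<lambda>w. w ` S) ` weyl \<Phi> \<subseteq> sectors \<Phi>" unfolding s using 2 by (simp only: image_subset_iff) simp
  qed
qed

lemma sector_halfspace_iff:
  assumes w: "w \<in> weyl \<Phi>" and a: "a \<in> \<Phi>"
  shows "w ` S \<subseteq> halfspace a \<longleftrightarrow> w q \<bullet> a > 0"
  unfolding S_def weyl_cone[OF w] using cone_of_halfspace_iff[OF neg regular_weyl[OF w q] a] .

lemma sector_inject:
  assumes "w \<in> weyl \<Phi>" "w' \<in> weyl \<Phi>" "w ` S = w' ` S"
  shows "w = w'"
proof -
  obtain v where v: "v \<in> weyl \<Phi>" "v \<circ> w = id" "w \<circ> v = id" using weyl_inverse[OF assms(1)] .
  have u: "v \<circ> w' \<in> weyl \<Phi>" using weyl_comp v assms by blast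
  have "(v \<circ> w') ` S = (v \<circ> w) ` S" using assms(3) by (metis image_comp)
  then have "(v \<circ> w') ` S = S" by (simp add: v)
  then have "cone_of \<Phi> ((v \<circ> w') q) = cone_of \<Phi> q" unfolding S_def weyl_cone[OF u] .
  then have pos: "(v \<circ> w') q \<bullet> a > 0 \<longleftrightarrow> q \<bullet> a > 0" if "a \<in> \<Phi>" for a
    using cone_of_eqD regular_weyl[OF u q] q that by blast
  have "(v \<circ> w') a \<in> Pos" if "a \<in> Pos" for a
  proof -
    have a: "(v \<circ> w') a \<in> \<Phi>" using weyl_isometry(3)[OF u] that by (auto simp: Pos_def)
    have "(v \<circ> w') q \<bullet> (v \<circ> w') a = q \<bullet> a" using weyl_isometry(2)[OF u] by blast
    then show ?thesis using pos[OF a] a that by (auto simp: Pos_def)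
  qed
  then have "{a \<in> Pos. (v \<circ> w') a \<notin> Pos} = {}" by blast
  then have "inversions (v \<circ> w') = 0" by (simp only: inversions_def card.empty)
  then have "v \<circ> w' = id" using inversions_0_iff[OF u] by simp
  then have "w \<circ> (v \<circ> w') = w" by simp
  then show ?thesis using v(3) by (simp flip: comp_assoc)
qed

lemma sector_Int_simple:
  assumes i: "i \<in> I"
  shows "S \<inter> refl_in i ` S = wall S i"
proof
  have iP: "i \<in> Pos" "i \<in> \<Phi>" using simple_Pos simple_root i by auto
  show "S \<inter> refl_in i ` S \<subseteq> wall S i"
  proof
    fix v assume "v \<in> S \<inter> refl_in i ` S"
    then obtain v' where v': "v \<in> S" "v' \<in> S" "v = refl_in i v'" by auto
    have "v \<bullet> i = v' \<bullet> refl_in i i" using v'(3) inner_refl_in_left[OF unit[OF iP(2)]] by simp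
    then have "v \<bullet> i = - (v' \<bullet> i)" by (simp add: refl_in_self unit iP)
    then show "v \<in> wall S i" using v' iP(1) by (force simp: wall_def S_alt)
  qed
  show "wall S i \<subseteq> S \<inter> refl_in i ` S"
  proof
    fix v assume v: "v \<in> wall S i"
    then have "refl_in i v = v" by (auto simp: wall_def refl_in_def)
    then show "v \<in> S \<inter> refl_in i ` S" using v by (force simp: wall_def)
  qed
qed

text \<open>The sectors are in bijection with the elements of the Weyl group, and adjacency of type \<open>i\<close> is
  right multiplication by the reflection in \<open>i\<close>.\<close>

lemma adjacent_coxeter:
  "adjacent (coxeter_complex \<Phi> S) i T T' \<longleftrightarrow>
     i \<in> I \<and> (\<exists>w\<in>weyl \<Phi>. T = w ` S \<and> T' = (w \<circ> refl_in i) ` S)"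
proof
  assume "adjacent (coxeter_complex \<Phi> S) i T T'"
  then obtain w where i: "i \<in> I" and T: "T \<in> sectors \<Phi>" "T' \<in> sectors \<Phi>" "T \<noteq> T'"
    and w: "w \<in> weyl \<Phi>" "T \<inter> T' = w ` wall S i"
    by (auto simp: coxeter_complex_def)
  have iP: "i \<in> Pos" "i \<in> \<Phi>" using simple_Pos simple_root i by auto
  obtain v where v: "v \<in> span \<Phi>" "v \<bullet> i = 0" "\<And>a. a \<in> Pos - {i} \<Longrightarrow> v \<bullet> a > 0"
    using i simple_roots_iff by blast
  have vw: "v \<in> wall S i" unfolding wall_alt[OF iP(1)] using v(1,2) v(3) by (force simp: less_imp_le)
  have neg_i: "- i \<in> \<Phi>" using neg iP by blast
  have opts: "T1 = w ` S \<or> T1 = (w \<circ> refl_in i) ` S" if T1: "T1 \<in> sectors \<Phi>" "w v \<in> T1" for T1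
  proof -
    obtain u where u: "u \<in> weyl \<Phi>" "T1 = u ` S" using T1(1) by (auto simp: sectors_weyl)
    obtain w' where w': "w' \<in> weyl \<Phi>" "w' \<circ> w = id" "w \<circ> w' = id" using weyl_inverse[OF w(1)] .
    have x: "w' \<circ> u \<in> weyl \<Phi>" using weyl_comp w' u by blast
    let ?p = "(w' \<circ> u) q"
    have p: "regular \<Phi> ?p" by (rule regular_weyl[OF x q])
    have bk: "cone_of \<Phi> ?p = w' ` T1" unfolding u(2) S_def weyl_cone[OF x, symmetric] by (simp add: image_comp)
    then have "w' (w v) \<in> cone_of \<Phi> ?p" using T1 by auto
    then have "v \<in> cone_of \<Phi> ?p" using fun_cong[OF w'(2), of v] by simp
    then have pa: "?p \<bullet> a > 0" if "a \<in> Pos - {i}" for a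
    proof -
      have a: "a \<in> \<Phi>" "- a \<in> \<Phi>" using that neg by (auto simp: Pos_def)
      have "\<not> ?p \<bullet> (- a) > 0" using \<open>v \<in> cone_of \<Phi> ?p\<close> v(3)[OF that] a(2) by (force simp: cone_of_def)
      then show ?thesis using p a by (auto simp: regular_def)
    qed
    have T1w: "T1 = w ` cone_of \<Phi> ?p" unfolding bk using w'(3) by (simp add: image_comp)
    show ?thesis
    proof (cases "?p \<bullet> i > 0")
      case True
      have "cone_of \<Phi> ?p = S" unfolding S_def
      proof (rule cone_of_eq)
        fix a assume a: "a \<in> \<Phi>"
        show "?p \<bullet> a > 0 \<longleftrightarrow> q \<bullet> a > 0"
        proof (cases "a = i \<or> a = - i")
          case True
          then show ?thesis using \<open>?p \<bullet> i > 0\<close> iP(1) by (auto simp: Pos_def)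
        next
          case F: False
          then have "- a \<noteq> i" by (metis add.inverse_inverse)
          then show ?thesis using pa[of a] pa[of "- a"] F uminus_Pos[OF a] a
            by (cases "a \<in> Pos") (auto simp: Pos_def)
        qed
      qed
      then show ?thesis using T1w by simp
    next
      case False
      then have pi: "?p \<bullet> i < 0" using p iP by (auto simp: regular_def)
      have "cone_of \<Phi> ?p = refl_in i ` S"
        unfolding S_def weyl_cone[OF weyl_refl_in[OF iP(2)]]
      proof (rule cone_of_eq)
        fix a assume a: "a \<in> \<Phi>"
        have adj: "refl_in i q \<bullet> a = q \<bullet> refl_in i a" for a by (rule inner_refl_in_left[OF unit[OF iP(2)]])
        have key: "?p \<bullet> a > 0 \<and> q \<bullet> refl_in i a > 0" if "a \<in> Pos" "a \<noteq> i" for a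
          using pa[of a] refl_simple_Pos(1)[OF i that] that by (auto simp: Pos_def)
        have ri: "refl_in i i = - i" "refl_in i (- i) = i"
          using refl_in_self[OF unit[OF iP(2)]] by (auto simp: refl_in_minus_right)
        show "?p \<bullet> a > 0 \<longleftrightarrow> refl_in i q \<bullet> a > 0"
        proof (cases "a = i \<or> a = - i")
          case True
          then show ?thesis unfolding adj using pi iP(1) ri by (auto simp: Pos_def)
        next
          case F: False
          then have "- a \<noteq> i" by (metis add.inverse_inverse)
          then show ?thesis unfolding adj using key[of a] key[of "- a"] F uminus_Pos[OF a]
            by (cases "a \<in> Pos") (auto simp: refl_in_minus_right)
        qed
      qed
      then show ?thesis using T1w by (simp add: image_comp)
    qed
  qed
  have "w v \<in> T" "w v \<in> T'" using w(2) vw by auto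
  then have "T = w ` S \<or> T = (w \<circ> refl_in i) ` S" "T' = w ` S \<or> T' = (w \<circ> refl_in i) ` S"
    using opts T by auto
  then consider "T = w ` S" "T' = (w \<circ> refl_in i) ` S" | "T' = w ` S" "T = (w \<circ> refl_in i) ` S"
    using T(3) by blast
  then show "i \<in> I \<and> (\<exists>w\<in>weyl \<Phi>. T = w ` S \<and> T' = (w \<circ> refl_in i) ` S)"
  proof cases
    case 1
    then show ?thesis using i w(1) by blast
  next
    case 2
    have "w = (w \<circ> refl_in i) \<circ> refl_in i" by (simp add: comp_assoc refl_in_comp_self iP)
    with 2 have "T = (w \<circ> refl_in i) ` S \<and> T' = ((w \<circ> refl_in i) \<circ> refl_in i) ` S" by metis
    then show ?thesis using i weyl_refl_simple[OF i w(1)] by blast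
  qed
next
  assume "i \<in> I \<and> (\<exists>w\<in>weyl \<Phi>. T = w ` S \<and> T' = (w \<circ> refl_in i) ` S)"
  then obtain w where i: "i \<in> I" and w: "w \<in> weyl \<Phi>" "T = w ` S" "T' = (w \<circ> refl_in i) ` S" by blast
  have wi: "w \<circ> refl_in i \<in> weyl \<Phi>" by (rule weyl_refl_simple[OF i w(1)])
  have "inversions w \<noteq> inversions (w \<circ> refl_in i)"
    using inversions_refl[OF w(1) i] by (cases "w i \<in> Pos") auto
  then have "w \<noteq> w \<circ> refl_in i" by (rule contrapos_nn) (erule arg_cong)
  then have "T \<noteq> T'" using sector_inject[OF w(1) wi] unfolding w(2,3) by blast
  moreover have "T \<inter> T' = w ` wall S i"
  proof -
    obtain w' where w': "w' \<in> weyl \<Phi>" "w' \<circ> w = id" "w \<circ> w' = id" using weyl_inverse[OF w(1)] .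
    have "inj w" by (rule inj_on_inverseI[of _ w']) (use fun_cong[OF w'(2)] in simp)
    then have "w ` (S \<inter> refl_in i ` S) = w ` S \<inter> w ` refl_in i ` S" by (rule image_Int)
    then show ?thesis unfolding w(2,3) sector_Int_simple[OF i] by (simp only: image_comp)
  qed
  moreover have "T \<in> sectors \<Phi>" unfolding sectors_weyl w(2) using w(1) by (rule imageI)
  moreover have "T' \<in> sectors \<Phi>" unfolding sectors_weyl w(3) using wi by (rule imageI)
  ultimately show "adjacent (coxeter_complex \<Phi> S) i T T'"
    unfolding coxeter_complex_def chamber_system.simps using i w(1) by blast
qed

lemma chambers_coxeter: "chambers (coxeter_complex \<Phi> S) = sectors \<Phi>"
  and colors_coxeter: "colors (coxeter_complex \<Phi> S) = I"
  by (simp_all add: coxeter_complex_def)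

subsection \<open>The longest element\<close>

lemma longest_element:
  obtains w0 where "w0 \<in> weyl \<Phi>" "\<And>a. a \<in> \<Phi> \<Longrightarrow> w0 a \<in> Pos \<longleftrightarrow> a \<notin> Pos"
proof -
  have "regular \<Phi> (- q)" using q by (auto simp: regular_def intro: span_neg)
  from regular_transitive[OF this] obtain w where w: "w \<in> weyl \<Phi>" "\<And>a. a \<in> Pos \<Longrightarrow> w (- q) \<bullet> a > 0" by blast
  have 1: "a \<notin> Pos" if "w a \<in> Pos" for a
  proof -
    have "w (- q) \<bullet> w a = - q \<bullet> a" by (rule weyl_isometry(2)[OF w(1)])
    then show ?thesis using w(2)[OF that] by (simp add: Pos_def)
  qed
  have "w a \<in> Pos \<longleftrightarrow> a \<notin> Pos" if a: "a \<in> \<Phi>" for a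
  proof
    assume "a \<notin> Pos"
    then have "w (- a) \<notin> Pos" using 1[of "- a"] uminus_Pos[OF a] by blast
    then show "w a \<in> Pos"
      using uminus_Pos[OF weyl_isometry(3)[OF w(1) a]] unfolding weyl_uminus[OF w(1)] by blast
  qed (rule 1)
  then show ?thesis using that w(1) by blast
qed

text \<open>The longest element of the Weyl group, which makes all positive roots negative.\<close>

definition w0 :: "'a \<Rightarrow> 'a" where
  "w0 = (SOME w. w \<in> weyl \<Phi> \<and> (\<forall>a\<in>\<Phi>. w a \<in> Pos \<longleftrightarrow> a \<notin> Pos))"

lemma w0: "w0 \<in> weyl \<Phi>" "a \<in> \<Phi> \<Longrightarrow> w0 a \<in> Pos \<longleftrightarrow> a \<notin> Pos"
proof -
  have "\<exists>w. w \<in> weyl \<Phi> \<and> (\<forall>a\<in>\<Phi>. w a \<in> Pos \<longleftrightarrow> a \<notin> Pos)" by (rule longest_element) blast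
  then have "w0 \<in> weyl \<Phi> \<and> (\<forall>a\<in>\<Phi>. w0 a \<in> Pos \<longleftrightarrow> a \<notin> Pos)"
    unfolding w0_def by (rule someI_ex)
  then show "w0 \<in> weyl \<Phi>" "a \<in> \<Phi> \<Longrightarrow> w0 a \<in> Pos \<longleftrightarrow> a \<notin> Pos" by blast+
qed

text \<open>Conjugation by the longest element permutes the simple reflections.\<close>

lemma w0_conj_simple:
  assumes i: "i \<in> I"
  shows "\<exists>j\<in>I. refl_in i \<circ> w0 = w0 \<circ> refl_in j"
proof -
  obtain w' where w': "w' \<in> weyl \<Phi>" "w' \<circ> w0 = id" "w0 \<circ> w' = id" using weyl_inverse[OF w0(1)] .
  have ww: "w0 (w' v) = v" "w' (w0 v) = v" for v
    using fun_cong[OF w'(3), of v] fun_cong[OF w'(2), of v] by simp_all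
  have sgn': "w' a \<in> Pos \<longleftrightarrow> a \<notin> Pos" if "a \<in> \<Phi>" for a
    using w0(2)[OF weyl_isometry(3)[OF w'(1) that]] unfolding ww by blast
  have iP: "i \<in> Pos" "i \<in> \<Phi>" using simple_Pos simple_root i by auto
  define j where "j = - w' i"
  have w0j: "w0 j = - i" unfolding j_def weyl_uminus[OF w0(1)] ww ..
  have jPos: "j \<in> Pos" unfolding j_def using uminus_Pos[OF weyl_isometry(3)[OF w'(1) iP(2)]] sgn'[OF iP(2)] iP by simp
  obtain v where v: "v \<in> span \<Phi>" "v \<bullet> i = 0" "\<And>a. a \<in> Pos - {i} \<Longrightarrow> v \<bullet> a > 0"
    using i simple_roots_iff by blast
  have adj: "w' u \<bullet> a = u \<bullet> w0 a" for u a using weyl_isometry(2)[OF w0(1), of "w' u" a] unfolding ww by (rule sym)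
  have "- w' v \<bullet> a > 0" if a: "a \<in> Pos - {j}" for a
  proof -
    have aPhi: "a \<in> \<Phi>" using a by (auto simp: Pos_def)
    have "- w0 a \<in> Pos" using uminus_Pos[OF weyl_isometry(3)[OF w0(1) aPhi]] w0(2)[OF aPhi] a by auto
    moreover have "- w0 a \<noteq> i"
    proof
      assume "- w0 a = i"
      then have "w' i = - a" using weyl_uminus[OF w'(1), of "w0 a"] unfolding ww by simp
      then show False using a by (simp add: j_def)
    qed
    ultimately have "v \<bullet> - w0 a > 0" using v(3) by blast
    then show ?thesis by (simp add: adj)
  qed
  moreover have "- w' v \<bullet> j = 0" using v(2) by (simp add: adj w0j)
  moreover have "- w' v \<in> span \<Phi>" using weyl_isometry(4)[OF w'(1) v(1)] by (rule span_neg)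
  ultimately have "j \<in> I" using simple_roots_iff jPos by blast
  moreover have "w0 \<circ> refl_in j = refl_in i \<circ> w0"
    using weyl_refl_conj[OF w0(1), of j] unfolding w0j refl_in_uminus .
  ultimately show ?thesis by (intro bexI[of _ j]) simp_all
qed

end

section \<open>Buildings\<close>

context reflection_system begin

lemma word_value_rev: "set f \<subseteq> I \<Longrightarrow> word_value f \<circ> word_value (rev f) = id"
proof (induction f)
  case (Cons i f)
  have "word_value f (word_value (rev f) v) = v" for v
    using Cons by (metis comp_apply id_apply insert_subset list.simps(15))
  then show ?case
    using Cons.prems by (simp add: fun_eq_iff word_value_append refl_in_refl_in unit simple_root)
qed simp

lemma reduced_word_rev: "reduced_word I f \<Longrightarrow> reduced_word I (rev f)"
proof -
  assume f: "reduced_word I f"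
  then have fI: "set f \<subseteq> I" by (simp add: reduced_word_def)
  have "length f \<le> length g" if g: "set g \<subseteq> I" "word_value g = word_value (rev f)" for g
  proof -
    have "word_value (rev g) = word_value f \<circ> (word_value (rev f) \<circ> word_value (rev g))"
      using word_value_rev[OF fI] by (simp only: comp_assoc[symmetric] id_comp)
    also have "\<dots> = word_value f" using word_value_rev[OF g(1)] by (simp only: g(2)[symmetric] comp_id)
    finally show ?thesis using f g(1) unfolding reduced_word_def by (metis length_rev set_rev)
  qed
  then show ?thesis using fI by (simp add: reduced_word_def)
qed

lemma w0_w0: "w0 \<circ> w0 = id"
proof -
  have w: "w0 \<circ> w0 \<in> weyl \<Phi>" by (rule weyl_comp[OF w0(1) w0(1)])
  have "(w0 \<circ> w0) a \<in> Pos" if "a \<in> Pos" for a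
    using w0(2)[of a] w0(2)[of "w0 a"] weyl_isometry(3)[OF w0(1), of a] that Pos_sub by auto
  then have "{a \<in> Pos. (w0 \<circ> w0) a \<notin> Pos} = {}" by blast
  then have "inversions (w0 \<circ> w0) = 0" by (simp only: inversions_def card.empty)
  then show ?thesis using inversions_0_iff[OF w] by simp
qed

lemma inversions_refl_neq: "w \<in> weyl \<Phi> \<Longrightarrow> i \<in> I \<Longrightarrow> w \<circ> refl_in i \<noteq> w"
  using inversions_refl[of w i] by (cases "w i \<in> Pos") (metis n_not_Suc_n)+

lemma comp_refl_refl: "i \<in> I \<Longrightarrow> (w \<circ> refl_in i) \<circ> refl_in i = w"
  by (simp only: comp_assoc refl_in_comp_self[OF simple_root] comp_id)

lemma comp_refl_Pos:
  assumes "w \<in> weyl \<Phi>" "i \<in> I"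
  shows "(w \<circ> refl_in i) i \<in> Pos \<longleftrightarrow> w i \<notin> Pos"
proof -
  have "(w \<circ> refl_in i) i = - w i"
    using refl_in_self[OF unit[OF simple_root[OF assms(2)]]] weyl_uminus[OF assms(1)] by simp
  then show ?thesis using uminus_Pos[OF weyl_isometry(3)[OF assms(1) simple_root[OF assms(2)]]] by simp
qed

lemma reduced_word_singleton: "i \<in> I \<Longrightarrow> reduced_word I [i]"
  using reduced_word_snoc[of "[]" i] simple_Pos by (simp add: reduced_word_iff inversions_id)

end

locale building_system = reflection_system +
  fixes D :: "('c, 'a) chamber_system"
  assumes building: "building \<Phi> S D"
begin

text \<open>A Weyl-group-valued distance function of the building.\<close>

definition dist :: "'c \<Rightarrow> 'c \<Rightarrow> 'a \<Rightarrow> 'a" where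
  "dist = (SOME \<delta>. \<forall>c\<in>chambers D. \<forall>d\<in>chambers D. \<delta> c d \<in> weyl \<Phi> \<and>
        (\<forall>f. reduced_word (colors D) f \<longrightarrow> (\<delta> c d = word_value f \<longleftrightarrow> gallery D f c d)))"

lemma colors_D: "colors D = I"
  using building by (simp add: building_def)

lemma adj:
  assumes "adjacent D i c d"
  shows "i \<in> I" "c \<in> chambers D" "d \<in> chambers D" "c \<noteq> d" "adjacent D i d c"
  using building assms colors_D unfolding building_def is_chamber_system_def by metis+

lemma adj_trans: "adjacent D i b c \<Longrightarrow> adjacent D i c d \<Longrightarrow> b \<noteq> d \<Longrightarrow> adjacent D i b d"
  using building unfolding building_def is_chamber_system_def by metis

lemma dist_props:
  "\<forall>c\<in>chambers D. \<forall>d\<in>chambers D. dist c d \<in> weyl \<Phi> \<and>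
        (\<forall>f. reduced_word (colors D) f \<longrightarrow> (dist c d = word_value f \<longleftrightarrow> gallery D f c d))"
proof -
  have "\<exists>\<delta>. \<forall>c\<in>chambers D. \<forall>d\<in>chambers D. \<delta> c d \<in> weyl \<Phi> \<and>
        (\<forall>f. reduced_word (colors D) f \<longrightarrow> (\<delta> c d = word_value f \<longleftrightarrow> gallery D f c d))"
    using building unfolding building_def by (elim conjE)
  from someI_ex[OF this] show ?thesis unfolding dist_def .
qed

lemma dist_weyl: "c \<in> chambers D \<Longrightarrow> d \<in> chambers D \<Longrightarrow> dist c d \<in> weyl \<Phi>"
  using dist_props by blast

lemma gallery_chambers: "gallery D f c d \<Longrightarrow> c \<in> chambers D \<and> d \<in> chambers D"
  by (induction f arbitrary: c) (auto dest: adj(2))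

lemma gallery_append: "gallery D (f @ g) c d \<longleftrightarrow> (\<exists>e. gallery D f c e \<and> gallery D g e d)"
  by (induction f arbitrary: c) (auto dest: gallery_chambers)

lemma gallery_singleton: "gallery D [i] c d \<longleftrightarrow> adjacent D i c d"
  by (auto dest: adj)

lemma gallery_rev: "gallery D f c d \<Longrightarrow> gallery D (rev f) d c"
proof (induction f arbitrary: c)
  case (Cons i f)
  then show ?case using adj(5) gallery_singleton by (auto simp: gallery_append) blast
qed auto

lemma dist_gallery:
  assumes "reduced_word I f" "c \<in> chambers D" "d \<in> chambers D"
  shows "dist c d = word_value f \<longleftrightarrow> gallery D f c d"
  using dist_props assms colors_D by metis

lemma gallery_dist: "reduced_word I f \<Longrightarrow> gallery D f c d \<Longrightarrow> dist c d = word_value f"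
  using dist_gallery gallery_chambers by blast

lemma exists_gallery:
  assumes "c \<in> chambers D" "d \<in> chambers D"
  shows "\<exists>f. reduced_word I f \<and> gallery D f c d \<and> word_value f = dist c d"
  using exists_reduced_word[OF dist_weyl[OF assms]] dist_gallery[OF _ assms] by metis

lemma dist_adj: "i \<in> I \<Longrightarrow> c \<in> chambers D \<Longrightarrow> d \<in> chambers D \<Longrightarrow> dist c d = refl_in i \<longleftrightarrow> adjacent D i c d"
  using dist_gallery[OF reduced_word_singleton] gallery_singleton by simp

lemma dist_w0_sym:
  assumes "c \<in> chambers D" "d \<in> chambers D" "dist c d = w0"
  shows "dist d c = w0"
proof -
  obtain f where f: "reduced_word I f" "gallery D f c d" "word_value f = w0"
    using exists_gallery[OF assms(1,2)] unfolding assms(3) by blast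
  have fI: "set f \<subseteq> I" using f(1) by (simp add: reduced_word_def)
  have "dist d c = word_value (rev f)"
    by (rule gallery_dist[OF reduced_word_rev[OF f(1)] gallery_rev[OF f(2)]])
  also have "\<dots> = w0 \<circ> (w0 \<circ> word_value (rev f))"
    by (simp only: comp_assoc[symmetric] w0_w0 id_comp)
  also have "\<dots> = w0" using word_value_rev[OF fI] unfolding f(3) by simp
  finally show ?thesis .
qed

subsection \<open>Panels and projections\<close>

text \<open>The panel of type \<open>j\<close> that contains \<open>y\<close>.\<close>

definition panel :: "'a \<Rightarrow> 'c \<Rightarrow> 'c set" where
  "panel j y = insert y {z. adjacent D j y z}"

lemma panel_self: "y \<in> panel j y" by (simp add: panel_def)

lemma panel_adj: "z \<in> panel j y \<Longrightarrow> z' \<in> panel j y \<Longrightarrow> z \<noteq> z' \<Longrightarrow> adjacent D j z z'"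
  unfolding panel_def using adj(5) adj_trans by blast

lemma panel_chambers: "y \<in> chambers D \<Longrightarrow> z \<in> panel j y \<Longrightarrow> z \<in> chambers D"
  unfolding panel_def using adj(3) by blast

lemma panel_in_panels:
  assumes "j \<in> I" "y \<in> chambers D"
  shows "panel j y \<in> panels D"
proof -
  have "gallery D f y z \<Longrightarrow> set f \<subseteq> {j} \<Longrightarrow> z \<in> panel j y" for f z
  proof (induction f arbitrary: z rule: rev_induct)
    case (snoc i f)
    then obtain e where e: "gallery D f y e" "adjacent D j e z" "set f \<subseteq> {j}"
      by (auto simp: gallery_append simp del: gallery.simps(2) simp: gallery_singleton)
    then have "e \<in> panel j y" using snoc.IH by blast
    then show ?case using e(2) adj_trans[of j y e z] by (auto simp: panel_def)
  qed (simp add: panel_def)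
  moreover have "\<exists>f. set f \<subseteq> {j} \<and> gallery D f y z" if z: "z \<in> panel j y" for z
  proof (cases "z = y")
    case True
    then show ?thesis using assms(2) by (intro exI[of _ "[]"]) simp
  next
    case False
    then have "gallery D [j] y z" unfolding gallery_singleton using z by (simp add: panel_def)
    then show ?thesis by (intro exI[of _ "[j]"]) simp
  qed
  ultimately have "panel j y = {z. \<exists>f. set f \<subseteq> {j} \<and> gallery D f y z}" by blast
  then show ?thesis unfolding panels_def residues_def using assms colors_D by blast
qed

lemma dist_panel_Pos:
  assumes "adjacent D j y z" "x \<in> chambers D" "dist x y j \<in> Pos"
  shows "dist x z = dist x y \<circ> refl_in j"
proof -
  obtain f where f: "reduced_word I f" "gallery D f x y" "word_value f = dist x y"
    using exists_gallery adj[OF assms(1)] assms by metis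
  have "reduced_word I (f @ [j])" using reduced_word_snoc[OF f(1) adj(1)[OF assms(1)]] f assms by simp
  moreover have "gallery D (f @ [j]) x z" unfolding gallery_append gallery_singleton using f assms by blast
  ultimately have "dist x z = word_value (f @ [j])" by (rule gallery_dist)
  then show ?thesis using f(3) by (simp add: word_value_append)
qed

text \<open>Each panel contains a unique chamber nearest to a given chamber \<open>x\<close>;
  it is recognized by the sign of \<open>dist x p j\<close>.\<close>

lemma projection:
  assumes x: "x \<in> chambers D" and y: "y \<in> chambers D" and j: "j \<in> I"
  obtains p where "p \<in> panel j y" "dist x p j \<in> Pos"
    "\<And>z. z \<in> panel j y \<Longrightarrow> z \<noteq> p \<Longrightarrow> dist x z = dist x p \<circ> refl_in j"
proof -
  have "\<exists>p\<in>panel j y. dist x p j \<in> Pos"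
  proof (cases "dist x y j \<in> Pos")
    case True
    then show ?thesis using panel_self by blast
  next
    case False
    obtain f where f: "reduced_word I f" "reduced_word I (f @ [j])" "word_value f = dist x y \<circ> refl_in j"
      "word_value (f @ [j]) = dist x y"
      using exists_reduced_word_snoc[OF dist_weyl[OF x y] j False] by blast
    then have "gallery D (f @ [j]) x y" using dist_gallery[OF f(2) x y] by simp
    then obtain e where e: "gallery D f x e" "adjacent D j e y"
      unfolding gallery_append gallery_singleton by blast
    have "dist x e = dist x y \<circ> refl_in j" using gallery_dist[OF f(1) e(1)] f(3) by simp
    then have "dist x e j \<in> Pos" using comp_refl_Pos[OF dist_weyl[OF x y] j] False by simp
    moreover have "e \<in> panel j y" using adj(5)[OF e(2)] by (simp add: panel_def)
    ultimately show ?thesis by blast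
  qed
  then obtain p where p: "p \<in> panel j y" "dist x p j \<in> Pos" by blast
  show thesis
  proof (rule that[OF p])
    fix z assume "z \<in> panel j y" "z \<noteq> p"
    then show "dist x z = dist x p \<circ> refl_in j"
      using dist_panel_Pos[OF panel_adj[OF p(1)] x p(2)] by blast
  qed
qed

lemma dist_panel_cases:
  assumes "adjacent D j y z" "x \<in> chambers D"
  shows "dist x z = dist x y \<or> dist x z = dist x y \<circ> refl_in j"
proof -
  have y: "y \<in> chambers D" and j: "j \<in> I" using adj[OF assms(1)] by auto
  obtain p where p: "p \<in> panel j y" "dist x p j \<in> Pos"
    "\<And>z. z \<in> panel j y \<Longrightarrow> z \<noteq> p \<Longrightarrow> dist x z = dist x p \<circ> refl_in j"
    using projection[OF assms(2) y j] by blast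
  have z: "z \<in> panel j y" using assms(1) by (simp add: panel_def)
  show ?thesis
    using p(3)[OF z] p(3)[OF panel_self] comp_refl_refl[OF j, of "dist x p"] by metis
qed

subsection \<open>Rigidity\<close>

text \<open>Automorphisms that induce the identity on the colors.\<close>

definition type_preserving :: "('c \<Rightarrow> 'c) \<Rightarrow> bool" where
  "type_preserving g \<longleftrightarrow> g permutes chambers D \<and> (\<forall>i c d. adjacent D i c d \<longrightarrow> adjacent D i (g c) (g d))"

lemma type_preserving_chambers: "type_preserving g \<Longrightarrow> c \<in> chambers D \<Longrightarrow> g c \<in> chambers D"
  unfolding type_preserving_def by (simp add: permutes_in_image)

lemma type_preserving_gallery: "type_preserving g \<Longrightarrow> gallery D f c d \<Longrightarrow> gallery D f (g c) (g d)"
proof (induction f arbitrary: c)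
  case Nil
  then show ?case using type_preserving_chambers by auto
next
  case (Cons i f)
  then show ?case unfolding gallery.simps type_preserving_def by blast
qed

lemma type_preserving_dist:
  assumes "type_preserving g" "c \<in> chambers D" "d \<in> chambers D"
  shows "dist (g c) (g d) = dist c d"
proof -
  obtain f where f: "reduced_word I f" "gallery D f c d" "word_value f = dist c d"
    using exists_gallery[OF assms(2,3)] by blast
  show ?thesis using gallery_dist[OF f(1) type_preserving_gallery[OF assms(1) f(2)]] f(3) by simp
qed

text \<open>A stable panel contains a fixed chamber, namely the projection of any fixed chamber \<open>x\<close>.\<close>

lemma fixes_projection:
  assumes g: "type_preserving g" and x: "x \<in> chambers D" "g x = x" and y: "y \<in> chambers D" "g y \<in> panel j y"
    and j: "j \<in> I" and p: "p \<in> panel j y" "dist x p j \<in> Pos"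
  shows "g p = p"
proof (rule ccontr)
  assume ne: "g p \<noteq> p"
  have pc: "p \<in> chambers D" using panel_chambers y p by blast
  have "g p \<in> panel j y"
  proof (cases "p = y")
    case False
    then have "adjacent D j y p" using p(1) by (simp add: panel_def)
    then have "adjacent D j (g y) (g p)" using g by (simp add: type_preserving_def)
    then show ?thesis using y(2) adj_trans[of j y "g y" "g p"] unfolding panel_def by auto
  qed (use y in simp)
  then have "adjacent D j p (g p)" using panel_adj p(1) ne by metis
  then have "dist x (g p) = dist x p \<circ> refl_in j" by (rule dist_panel_Pos[OF _ x(1) p(2)])
  moreover have "dist x (g p) = dist x p" using type_preserving_dist[OF g x(1) pc] x(2) by simp
  ultimately show False using inversions_refl_neq[OF dist_weyl[OF x(1) pc] j] by simp
qed

text \<open>The automorphism fixes \<open>d\<close> and all chambers adjacent to \<open>d\<close>.\<close>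

definition fixes_nearby :: "('c \<Rightarrow> 'c) \<Rightarrow> 'c \<Rightarrow> bool" where
  "fixes_nearby g d \<longleftrightarrow> d \<in> chambers D \<and> g d = d \<and> (\<forall>i e. adjacent D i d e \<longrightarrow> g e = e)"

lemma w0_simple_descent: "j \<in> I \<Longrightarrow> w0 j \<notin> Pos"
  using w0(2) simple_Pos simple_root by blast

lemma exists_descent_left:
  assumes ij: "i \<in> I" "refl_in i \<circ> w0 = w0 \<circ> refl_in j" "j \<in> I" and d: "d \<in> chambers D" "z \<in> chambers D" "dist d z = w0"
  obtains e where "adjacent D i d e" "dist e z = w0 \<circ> refl_in j"
    "\<And>x. adjacent D i d x \<Longrightarrow> x \<noteq> e \<Longrightarrow> dist x z = w0"
proof -
  obtain f where f: "reduced_word I f" "word_value f = w0 \<circ> refl_in j"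
    using exists_reduced_word weyl_refl_simple[OF ij(3) w0(1)] by blast
  have v: "word_value (i # f) = w0"
  proof -
    have "refl_in i \<circ> (w0 \<circ> refl_in j) = (refl_in i \<circ> refl_in i) \<circ> w0"
      unfolding ij(2)[symmetric] by (simp only: comp_assoc)
    then show ?thesis unfolding word_value_simps f(2) refl_in_comp_self[OF simple_root[OF ij(1)]] by simp
  qed
  have "inversions w0 = Suc (inversions (w0 \<circ> refl_in j))"
    by (rule inversions_refl(2)[OF w0(1) ij(3) w0_simple_descent[OF ij(3)]])
  then have red: "reduced_word I (i # f)" using f ij(1) v by (simp add: reduced_word_iff del: word_value_simps)
  then have "gallery D (i # f) d z" using dist_gallery[OF red d(1,2)] d(3) v by simp
  then obtain e where e: "adjacent D i d e" "gallery D f e z" by auto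
  show thesis
  proof
    show "adjacent D i d e" by fact
    show "dist e z = w0 \<circ> refl_in j" using gallery_dist[OF f(1) e(2)] f(2) by simp
    fix x assume x: "adjacent D i d x" "x \<noteq> e"
    then have "adjacent D i x e" using e(1) adj(5) adj_trans by blast
    then have "gallery D (i # f) x z" using e(2) by auto
    then show "dist x z = w0" using gallery_dist[OF red] v by simp
  qed
qed

text \<open>The panels at opposite chambers \<open>d\<close> and \<open>d'\<close> correspond by projection.\<close>

lemma fixes_nearby_opposite:
  assumes g: "type_preserving g" and d: "fixes_nearby g d" and d': "d' \<in> chambers D" "g d' = d'" "dist d d' = w0"
  shows "fixes_nearby g d'"
  unfolding fixes_nearby_def
proof (intro conjI allI impI)
  fix j z assume z: "adjacent D j d' z"
  have dc: "d \<in> chambers D" "g d = d" using d by (auto simp: fixes_nearby_def)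
  have j: "j \<in> I" and zc: "z \<in> chambers D" using adj[OF z] by auto
  have zp: "z \<in> panel j d'" using z by (simp add: panel_def)
  have gp: "g d' \<in> panel j d'" using d'(2) panel_self by simp
  show "g z = z"
  proof (cases "dist d z j \<in> Pos")
    case True
    show ?thesis by (rule fixes_projection[OF g dc d'(1) gp j zp True])
  next
    case False
    obtain p where p: "p \<in> panel j d'" "dist d p j \<in> Pos"
      "\<And>z. z \<in> panel j d' \<Longrightarrow> z \<noteq> p \<Longrightarrow> dist d z = dist d p \<circ> refl_in j"
      using projection[OF dc(1) d'(1) j] by blast
    have "d' \<noteq> p" "z \<noteq> p" using p(2) False w0_simple_descent[OF j] d'(3) by auto
    then have dz: "dist d z = w0" using p(3)[OF zp] p(3)[OF panel_self] d'(3) by simp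
    obtain i where i: "i \<in> I" "refl_in j \<circ> w0 = w0 \<circ> refl_in i" using w0_conj_simple[OF j] by blast
    have "w0 \<circ> (refl_in j \<circ> w0) \<circ> w0 = w0 \<circ> (w0 \<circ> refl_in i) \<circ> w0" by (simp only: i(2))
    moreover have "w0 \<circ> (refl_in j \<circ> w0) \<circ> w0 = w0 \<circ> refl_in j"
      by (simp only: comp_assoc w0_w0 comp_id)
    moreover have "w0 \<circ> (w0 \<circ> refl_in i) \<circ> w0 = refl_in i \<circ> w0"
      by (simp only: comp_assoc[symmetric] w0_w0 id_comp)
    ultimately have "refl_in i \<circ> w0 = w0 \<circ> refl_in j" by simp
    from exists_descent_left[OF i(1) this j dc(1) zc dz]
    obtain e where e: "adjacent D i d e" "dist e z = w0 \<circ> refl_in j" by blast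
    have "g e = e" using d e(1) by (auto simp: fixes_nearby_def)
    moreover have "dist e z j \<in> Pos" unfolding e(2) comp_refl_Pos[OF w0(1) j] by (rule w0_simple_descent[OF j])
    ultimately show ?thesis using fixes_projection[OF g adj(3)[OF e(1)] _ d'(1) gp j zp] by blast
  qed
qed (use d' in auto)

text \<open>The hypotheses of the next lemma pass from \<open>d\<close> to its neighbours.\<close>

lemma rigidity_step:
  assumes thick: "thick D" and g: "type_preserving g" and d: "fixes_nearby g d"
    and d': "d' \<in> chambers D" "g d' = d'" "dist d d' = w0" and x: "adjacent D i d x"
  shows "fixes_nearby g x \<and> (\<exists>x'\<in>chambers D. g x' = x' \<and> dist x x' = w0)"
proof -
  have near': "fixes_nearby g d'" by (rule fixes_nearby_opposite[OF g d d'])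
  have dc: "d \<in> chambers D" "g d = d" using d by (auto simp: fixes_nearby_def)
  have i: "i \<in> I" and xc: "x \<in> chambers D" using adj[OF x] by auto
  have gx: "g x = x" using d x by (auto simp: fixes_nearby_def)
  obtain j where j: "j \<in> I" "refl_in i \<circ> w0 = w0 \<circ> refl_in j" using w0_conj_simple[OF i] by blast
  obtain p where p: "p \<in> panel j d'" "dist d p j \<in> Pos"
      "\<And>z. z \<in> panel j d' \<Longrightarrow> z \<noteq> p \<Longrightarrow> dist d z = dist d p \<circ> refl_in j"
    using projection[OF dc(1) d'(1) j(1)] by blast
  obtain p' where p': "p' \<in> panel j d'" "dist x p' j \<in> Pos"
      "\<And>z. z \<in> panel j d' \<Longrightarrow> z \<noteq> p' \<Longrightarrow> dist x z = dist x p' \<circ> refl_in j"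
    using projection[OF xc d'(1) j(1)] by blast
  \<comment> \<open>By thickness, some chamber of the panel is opposite to both \<open>d\<close> and \<open>x\<close>.\<close>
  obtain y where y: "y \<in> panel j d'" "y \<noteq> p" "y \<noteq> p'"
  proof -
    have "infinite (panel j d') \<or> card (panel j d') \<ge> 3"
      using thick panel_in_panels[OF j(1) d'(1)] by (auto simp: thick_def)
    moreover have "card {p, p'} \<le> 2" by (cases "p = p'") auto
    ultimately have "\<not> panel j d' \<subseteq> {p, p'}"
      using finite_subset[of "panel j d'" "{p, p'}"] card_mono[of "{p, p'}" "panel j d'"] by auto
    then show thesis using that by blast
  qed
  have yc: "y \<in> chambers D" using panel_chambers[OF d'(1) y(1)] .
  have gy: "g y = y" using y(1) near' by (auto simp: panel_def fixes_nearby_def)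
  have "d' \<noteq> p" using p(2) d'(3) w0_simple_descent[OF j(1)] by auto
  then have dy: "dist d y = w0" using p(3)[OF y(1,2)] p(3)[OF panel_self] d'(3) by simp
  obtain e where e: "dist e d' = w0 \<circ> refl_in j" "\<And>x. adjacent D i d x \<Longrightarrow> x \<noteq> e \<Longrightarrow> dist x d' = w0"
    using exists_descent_left[OF i j(2,1) dc(1) d'(1,3)] by blast
  have xy: "dist x y = w0"
  proof (cases "x = e")
    case True
    have "dist x d' j \<in> Pos" unfolding True e(1) comp_refl_Pos[OF w0(1) j(1)] by (rule w0_simple_descent[OF j(1)])
    then have "d' = p'"
      using p'(3)[OF panel_self] comp_refl_Pos[OF dist_weyl[OF xc panel_chambers[OF d'(1) p'(1)]] j(1)] p'(2) by force
    then show ?thesis using p'(3)[OF y(1,3)] e(1) True comp_refl_refl[OF j(1), of w0] by simp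
  next
    case False
    then have xd: "dist x d' = w0" using e(2) x by blast
    then have "d' \<noteq> p'" using p'(2) w0_simple_descent[OF j(1)] by auto
    then show ?thesis using p'(3)[OF y(1,3)] p'(3)[OF panel_self] xd by simp
  qed
  have "fixes_nearby g y" by (rule fixes_nearby_opposite[OF g d yc gy dy])
  then have "fixes_nearby g x"
    by (rule fixes_nearby_opposite[OF g _ xc gx dist_w0_sym[OF xc yc xy]])
  then show ?thesis using yc gy xy by blast
qed

text \<open>A type-preserving automorphism that fixes two opposite chambers and all neighbours of one of
  them is trivial.\<close>

lemma rigidity:
  assumes thick: "thick D" and g: "type_preserving g" and d: "fixes_nearby g d"
    and d': "d' \<in> chambers D" "g d' = d'" "dist d d' = w0"
  shows "g = id"
proof -
  have *: "gallery D f d x \<Longrightarrow> fixes_nearby g x" for f x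
    using d d'
  proof (induction f arbitrary: d d')
    case (Cons i f)
    obtain e where e: "adjacent D i d e" "gallery D f e x" using Cons.prems(1) by auto
    show ?case
      using rigidity_step[OF thick g Cons.prems(2-5) e(1)] Cons.IH[OF e(2)] by blast
  qed auto
  have dc: "d \<in> chambers D" using d by (auto simp: fixes_nearby_def)
  show ?thesis
  proof
    fix x
    show "g x = id x"
    proof (cases "x \<in> chambers D")
      case True
      then show ?thesis using exists_gallery[OF dc True] * by (auto simp: fixes_nearby_def)
    next
      case False
      then show ?thesis using g permutes_not_in[of g "chambers D" x] by (simp add: type_preserving_def)
    qed
  qed
qed

end

section \<open>Root groups of a building\<close>

subsection \<open>The automorphism group\<close>

lemma chamber_iso_comp:
  assumes "chamber_iso D D \<sigma> g" "chamber_iso D D \<sigma>' h"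
  shows "chamber_iso D D (\<sigma>' \<circ> \<sigma>) (h \<circ> g)"
proof -
  have "bij_betw \<sigma> (colors D) (colors D)" "bij_betw g (chambers D) (chambers D)"
    using assms(1) by (simp_all add: chamber_iso_def)
  then have "i \<in> colors D \<Longrightarrow> \<sigma> i \<in> colors D" "c \<in> chambers D \<Longrightarrow> g c \<in> chambers D" for i c
    by (simp_all add: bij_betw_apply)
  then show ?thesis
    using assms bij_betw_trans unfolding chamber_iso_def comp_apply by metis
qed

lemma chamber_iso_inv:
  assumes iso: "chamber_iso D D \<sigma> g" and g: "g permutes chambers D"
  shows "chamber_iso D D (inv_into (colors D) \<sigma>) (inv_into UNIV g)"
proof -
  have s: "bij_betw \<sigma> (colors D) (colors D)" using iso by (simp add: chamber_iso_def)
  have ig: "inv_into UNIV g permutes chambers D" using g by (rule permutes_inv)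
  have "adjacent D i c d \<longleftrightarrow> adjacent D (inv_into (colors D) \<sigma> i) (inv_into UNIV g c) (inv_into UNIV g d)"
    if "i \<in> colors D" "c \<in> chambers D" "d \<in> chambers D" for i c d
  proof -
    have "inv_into (colors D) \<sigma> i \<in> colors D" "\<sigma> (inv_into (colors D) \<sigma> i) = i"
      using s that(1) by (auto simp: bij_betw_def inv_into_into f_inv_into_f)
    moreover have "inv_into UNIV g c \<in> chambers D" "inv_into UNIV g d \<in> chambers D"
      using that ig by (simp_all add: permutes_in_image)
    moreover have "g (inv_into UNIV g c) = c" "g (inv_into UNIV g d) = d" using g by (simp_all add: permutes_inverses)
    ultimately show ?thesis using iso unfolding chamber_iso_def by metis
  qed
  then show ?thesis
    using bij_betw_inv_into[OF s] permutes_imp_bij[OF ig] by (simp add: chamber_iso_def)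
qed

lemma mult_aut_group: "g \<otimes>\<^bsub>aut_group D\<^esub> h = h \<circ> g" and one_aut_group: "\<one>\<^bsub>aut_group D\<^esub> = id"
  by (simp_all add: aut_group_def)

lemma carrier_aut_group:
  "g \<in> carrier (aut_group D) \<longleftrightarrow> g permutes chambers D \<and> (\<exists>\<sigma>. chamber_iso D D \<sigma> g)"
  by (simp add: aut_group_def)

lemma group_aut_group: "group (aut_group D)"
proof (rule groupI)
  fix g h assume "g \<in> carrier (aut_group D)" "h \<in> carrier (aut_group D)"
  then show "g \<otimes>\<^bsub>aut_group D\<^esub> h \<in> carrier (aut_group D)"
    unfolding carrier_aut_group mult_aut_group using permutes_compose chamber_iso_comp by blast
next
  have "chamber_iso D D id id" by (simp add: chamber_iso_def)
  then show "\<one>\<^bsub>aut_group D\<^esub> \<in> carrier (aut_group D)"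
    unfolding carrier_aut_group one_aut_group using permutes_id by blast
next
  fix g assume g: "g \<in> carrier (aut_group D)"
  then have "inv_into UNIV g \<in> carrier (aut_group D)"
    unfolding carrier_aut_group using permutes_inv chamber_iso_inv by blast
  moreover have "inv_into UNIV g \<otimes>\<^bsub>aut_group D\<^esub> g = \<one>\<^bsub>aut_group D\<^esub>"
    using g unfolding carrier_aut_group mult_aut_group one_aut_group using permutes_inv_o(1) by blast
  ultimately show "\<exists>h\<in>carrier (aut_group D). h \<otimes>\<^bsub>aut_group D\<^esub> g = \<one>\<^bsub>aut_group D\<^esub>" by blast
qed (auto simp: mult_aut_group one_aut_group comp_assoc)

lemma inv_aut_group:
  assumes "g \<in> carrier (aut_group D)"
  shows "inv\<^bsub>aut_group D\<^esub> g = inv_into UNIV g"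
proof -
  have "inv_into UNIV g \<in> carrier (aut_group D)"
    using assms unfolding carrier_aut_group using permutes_inv chamber_iso_inv by blast
  moreover have "inv_into UNIV g \<otimes>\<^bsub>aut_group D\<^esub> g = \<one>\<^bsub>aut_group D\<^esub>"
    using assms unfolding carrier_aut_group mult_aut_group one_aut_group using permutes_inv_o(1) by blast
  ultimately show ?thesis using group.inv_equality[OF group_aut_group] assms by blast
qed

lemma inv_fixes:
  assumes "g permutes X" "g c = c"
  shows "inv_into UNIV g c = c"
  using assms permutes_inverses(2) by metis

lemma subgroup_root_group: "subgroup (root_group D r) (aut_group D)"
proof (rule group.subgroupI[OF group_aut_group])
  show "root_group D r \<subseteq> carrier (aut_group D)" by (auto simp: root_group_def)
  have "\<one>\<^bsub>aut_group D\<^esub> \<in> root_group D r"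
    using group.is_monoid[OF group_aut_group, THEN monoid.one_closed]
    by (simp add: root_group_def one_aut_group)
  then show "root_group D r \<noteq> {}" by blast
next
  fix g assume g: "g \<in> root_group D r"
  then have c: "g \<in> carrier (aut_group D)" by (simp add: root_group_def)
  then have "inv\<^bsub>aut_group D\<^esub> g \<in> carrier (aut_group D)" using group.inv_closed[OF group_aut_group] by blast
  moreover have "g permutes chambers D" using c by (simp add: carrier_aut_group)
  ultimately show "inv\<^bsub>aut_group D\<^esub> g \<in> root_group D r"
    using g inv_fixes[of g "chambers D"] unfolding root_group_def inv_aut_group[OF c] by blast
next
  fix g h assume "g \<in> root_group D r" "h \<in> root_group D r"
  then show "g \<otimes>\<^bsub>aut_group D\<^esub> h \<in> root_group D r"
    using monoid.m_closed[OF group.is_monoid[OF group_aut_group]]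
    unfolding root_group_def mult_aut_group[symmetric] by (auto simp: mult_aut_group)
qed

subsection \<open>Half-apartments\<close>

text \<open>An apartment \<open>A\<close> of a thick building of rank at least two, with a type-preserving isomorphism \<open>\<pi>\<close>
  from the Coxeter complex.\<close>

locale apartment_system = building_system \<Phi> q S D
  for \<Phi> :: "'v::euclidean_space set" and q :: 'v and S :: "'v set" and D :: "('c, 'v) chamber_system" +
  fixes A :: "'c set" and \<pi> :: "'v set \<Rightarrow> 'c"
  assumes A_sub: "A \<subseteq> chambers D"
    and apartment_iso: "chamber_iso (coxeter_complex \<Phi> S) (D\<lparr>chambers := A\<rparr>) id \<pi>"
    and thick: "thick D" and rank: "card I \<ge> 2"
begin

text \<open>The chambers of the apartment are labelled by the Weyl group.\<close>

definition chamber_at :: "('v \<Rightarrow> 'v) \<Rightarrow> 'c" where "chamber_at w = \<pi> (w ` S)"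

text \<open>The root of the apartment that corresponds to \<open>a\<close>, as a set of chambers.\<close>

definition half :: "'v \<Rightarrow> 'c set" where "half a = \<pi> ` coxeter_root \<Phi> a"

lemma \<pi>_bij: "bij_betw \<pi> (sectors \<Phi>) A"
  using apartment_iso by (simp add: chamber_iso_def chambers_coxeter)

lemma \<pi>_adj:
  "i \<in> I \<Longrightarrow> T \<in> sectors \<Phi> \<Longrightarrow> T' \<in> sectors \<Phi> \<Longrightarrow>
     adjacent (coxeter_complex \<Phi> S) i T T' \<longleftrightarrow> adjacent D i (\<pi> T) (\<pi> T')"
  using apartment_iso by (simp add: chamber_iso_def chambers_coxeter colors_coxeter)

lemma sector_mem: "w \<in> weyl \<Phi> \<Longrightarrow> w ` S \<in> sectors \<Phi>"
  unfolding sectors_weyl by (rule imageI)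

lemma A_eq: "A = chamber_at ` weyl \<Phi>"
  using bij_betw_imp_surj_on[OF \<pi>_bij] unfolding sectors_weyl chamber_at_def by (simp only: image_image)

lemma chamber_at_A: "w \<in> weyl \<Phi> \<Longrightarrow> chamber_at w \<in> A"
  unfolding A_eq by (rule imageI)

lemma chamber_at_chambers: "w \<in> weyl \<Phi> \<Longrightarrow> chamber_at w \<in> chambers D"
  using chamber_at_A A_sub by blast

lemma chamber_at_inject:
  "w \<in> weyl \<Phi> \<Longrightarrow> v \<in> weyl \<Phi> \<Longrightarrow> chamber_at w = chamber_at v \<Longrightarrow> w = v"
  unfolding chamber_at_def
  using inj_onD[OF bij_betw_imp_inj_on[OF \<pi>_bij]] sector_mem sector_inject by metis

lemma dist_chamber_at:
  assumes w: "w \<in> weyl \<Phi>" and u: "u \<in> weyl \<Phi>"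
  shows "dist (chamber_at w) (chamber_at (w \<circ> u)) = u"
proof -
  obtain f where f: "reduced_word I f" "word_value f = u" using exists_reduced_word[OF u] by blast
  have fI: "set f \<subseteq> I" using f(1) by (simp add: reduced_word_def)
  have "set f \<subseteq> I \<Longrightarrow> w \<in> weyl \<Phi> \<Longrightarrow> gallery D f (chamber_at w) (chamber_at (w \<circ> word_value f))" for f w
  proof (induction f arbitrary: w)
    case Nil
    then show ?case using chamber_at_chambers by simp
  next
    case (Cons i f)
    then have i: "i \<in> I" and wi: "w \<circ> refl_in i \<in> weyl \<Phi>" using weyl_refl_simple by auto
    have "adjacent (coxeter_complex \<Phi> S) i (w ` S) ((w \<circ> refl_in i) ` S)"
      using adjacent_coxeter i Cons.prems(2) by blast
    then have "adjacent D i (chamber_at w) (chamber_at (w \<circ> refl_in i))"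
      unfolding chamber_at_def using \<pi>_adj[OF i sector_mem[OF Cons.prems(2)] sector_mem[OF wi]] by blast
    moreover have "gallery D f (chamber_at (w \<circ> refl_in i)) (chamber_at ((w \<circ> refl_in i) \<circ> word_value f))"
      by (rule Cons.IH[OF _ wi]) (use Cons.prems in simp)
    ultimately show ?case unfolding gallery.simps word_value_simps comp_assoc by blast
  qed
  from gallery_dist[OF f(1) this[OF fI w]] show ?thesis by (simp add: f(2))
qed

lemma dist_chamber_at':
  assumes w: "w \<in> weyl \<Phi>" and v: "v \<in> weyl \<Phi>"
  obtains u where "u \<in> weyl \<Phi>" "v = w \<circ> u" "dist (chamber_at w) (chamber_at v) = u"
proof -
  obtain w' where w': "w' \<in> weyl \<Phi>" "w' \<circ> w = id" "w \<circ> w' = id" using weyl_inverse[OF w] .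
  have 1: "w' \<circ> v \<in> weyl \<Phi>" by (rule weyl_comp[OF w'(1) v])
  have 2: "v = w \<circ> (w' \<circ> v)" by (simp only: comp_assoc[symmetric] w'(3) id_comp)
  show thesis using that[OF 1 2] dist_chamber_at[OF w 1] 2 by metis
qed

lemma dist_chamber_at_inject:
  assumes w: "w \<in> weyl \<Phi>" and v: "v \<in> weyl \<Phi>" "v' \<in> weyl \<Phi>"
    and eq: "dist (chamber_at w) (chamber_at v) = dist (chamber_at w) (chamber_at v')"
  shows "v = v'"
  using dist_chamber_at'[OF w v(1)] dist_chamber_at'[OF w v(2)] eq by metis

lemma adjacent_chamber_at:
  assumes w: "w \<in> weyl \<Phi>" and v: "v \<in> weyl \<Phi>"
  shows "adjacent D i (chamber_at w) (chamber_at v) \<longleftrightarrow> i \<in> I \<and> v = w \<circ> refl_in i"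
proof
  assume a: "adjacent D i (chamber_at w) (chamber_at v)"
  have i: "i \<in> I" by (rule adj(1)[OF a])
  obtain u where u: "v = w \<circ> u" "dist (chamber_at w) (chamber_at v) = u" using dist_chamber_at'[OF w v] by blast
  have "dist (chamber_at w) (chamber_at v) = refl_in i"
    using dist_adj[OF i chamber_at_chambers[OF w] chamber_at_chambers[OF v]] a by blast
  then show "i \<in> I \<and> v = w \<circ> refl_in i" using u i by simp
next
  assume iv: "i \<in> I \<and> v = w \<circ> refl_in i"
  then have "dist (chamber_at w) (chamber_at v) = refl_in i"
    using dist_chamber_at[OF w weyl_refl_in[OF simple_root]] by blast
  then show "adjacent D i (chamber_at w) (chamber_at v)"
    using dist_adj[OF _ chamber_at_chambers[OF w] chamber_at_chambers[OF v]] iv by blast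
qed

text \<open>On which side of the wall of \<open>a\<close> a chamber lies.\<close>

definition side :: "'v \<Rightarrow> ('v \<Rightarrow> 'v) \<Rightarrow> bool" where "side a w \<longleftrightarrow> w q \<bullet> a > 0"

lemma half_eq:
  assumes "a \<in> \<Phi>" shows "half a = chamber_at ` {w \<in> weyl \<Phi>. side a w}"
proof -
  have "coxeter_root \<Phi> a = (\<lambda>w. w ` S) ` {w \<in> weyl \<Phi>. side a w}"
    unfolding coxeter_root_def sectors_weyl side_def using sector_halfspace_iff[OF _ assms] by blast
  then show ?thesis unfolding half_def chamber_at_def by (simp only: image_image)
qed

lemma chamber_at_half: "a \<in> \<Phi> \<Longrightarrow> w \<in> weyl \<Phi> \<Longrightarrow> chamber_at w \<in> half a \<longleftrightarrow> side a w"
  unfolding half_eq using chamber_at_inject by blast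

lemma halfE:
  assumes "a \<in> \<Phi>" "c \<in> half a"
  obtains w where "w \<in> weyl \<Phi>" "side a w" "c = chamber_at w"
  using assms unfolding half_eq[OF assms(1)] by blast

lemma side_uminus: "a \<in> \<Phi> \<Longrightarrow> w \<in> weyl \<Phi> \<Longrightarrow> side (- a) w \<longleftrightarrow> \<not> side a w"
  using regular_weyl[OF _ q, of w] by (auto simp: side_def regular_def)

lemma side_inverse:
  assumes w: "w \<in> weyl \<Phi>" and v: "v \<circ> w = id" "v \<in> weyl \<Phi>" and a: "a \<in> \<Phi>"
  shows "side a w \<longleftrightarrow> v a \<in> Pos"
proof -
  have "v (w q) \<bullet> v a = w q \<bullet> a" by (rule weyl_isometry(2)[OF v(2)])
  moreover have "v (w q) = q" using fun_cong[OF v(1), of q] by simp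
  ultimately show ?thesis using weyl_isometry(3)[OF v(2) a] by (simp add: side_def Pos_def)
qed

lemma refl_simple_Pos_iff:
  assumes i: "i \<in> I" and b: "b \<in> \<Phi>" "b \<noteq> i" "b \<noteq> - i"
  shows "refl_in i b \<in> Pos \<longleftrightarrow> b \<in> Pos"
proof (cases "b \<in> Pos")
  case True
  then show ?thesis using refl_simple_Pos(1)[OF i True b(2)] by simp
next
  case False
  have "- b \<in> Pos" "- b \<noteq> i" using False uminus_Pos[OF b(1)] b(3) by auto
  then have "- refl_in i b \<in> Pos" using refl_simple_Pos(1)[OF i, of "- b"] by (simp add: refl_in_minus_right)
  then show ?thesis using False uminus_Pos[OF closed[OF simple_root[OF i] b(1)]] by blast
qed

lemma side_same:
  assumes w: "w \<in> weyl \<Phi>" and i: "i \<in> I" and a: "a \<in> \<Phi>" "w i \<noteq> a" "w i \<noteq> - a"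
  shows "side a (w \<circ> refl_in i) \<longleftrightarrow> side a w"
proof -
  obtain v where v: "v \<in> weyl \<Phi>" "v \<circ> w = id" "w \<circ> v = id" using weyl_inverse[OF w] .
  have wv: "w (v x) = x" for x using fun_cong[OF v(3), of x] by simp
  have b: "v a \<in> \<Phi>" "v a \<noteq> i" "v a \<noteq> - i"
    using weyl_isometry(3)[OF v(1) a(1)] a(2,3) wv[of a] weyl_uminus[OF w, of i] by auto
  have "(refl_in i \<circ> v) \<circ> (w \<circ> refl_in i) = refl_in i \<circ> (v \<circ> w) \<circ> refl_in i" by (simp only: comp_assoc)
  then have inv: "(refl_in i \<circ> v) \<circ> (w \<circ> refl_in i) = id" by (simp only: v(2) comp_id refl_in_comp_self[OF simple_root[OF i]])
  have "side a (w \<circ> refl_in i) \<longleftrightarrow> (refl_in i \<circ> v) a \<in> Pos"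
    by (rule side_inverse[OF weyl_refl_simple[OF i w] inv weyl_refl[OF v(1) simple_root[OF i]] a(1)])
  also have "\<dots> \<longleftrightarrow> v a \<in> Pos" using refl_simple_Pos_iff[OF i b] by simp
  also have "\<dots> \<longleftrightarrow> side a w" using side_inverse[OF w v(2,1) a(1)] by blast
  finally show ?thesis .
qed

lemma wall_refl:
  assumes w: "w \<in> weyl \<Phi>" and "w i = a \<or> w i = - a"
  shows "w \<circ> refl_in i = refl_in a \<circ> w"
  using weyl_refl_conj[OF w, of i] assms(2) refl_in_uminus[of a] by auto

lemma side_refl:
  assumes w: "w \<in> weyl \<Phi>" and a: "a \<in> \<Phi>"
  shows "side a (refl_in a \<circ> w) \<longleftrightarrow> \<not> side a w"
proof -
  have "refl_in a (w q) \<bullet> a = w q \<bullet> (- a)"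
    using inner_refl_in_left[OF unit[OF a], of "w q" a] refl_in_self[OF unit[OF a]] by simp
  then show ?thesis using regular_weyl[OF w q] a by (auto simp: side_def regular_def)
qed

lemma side_w0:
  assumes w: "w \<in> weyl \<Phi>" and a: "a \<in> \<Phi>"
  shows "side a (w \<circ> w0) \<longleftrightarrow> \<not> side a w"
proof -
  obtain v where v: "v \<in> weyl \<Phi>" "v \<circ> w = id" "w \<circ> v = id" using weyl_inverse[OF w] .
  have "(w0 \<circ> v) \<circ> (w \<circ> w0) = w0 \<circ> (v \<circ> w) \<circ> w0" by (simp only: comp_assoc)
  then have inv: "(w0 \<circ> v) \<circ> (w \<circ> w0) = id" by (simp only: v(2) comp_id w0_w0)
  have "side a (w \<circ> w0) \<longleftrightarrow> (w0 \<circ> v) a \<in> Pos"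
    by (rule side_inverse[OF weyl_comp[OF w w0(1)] inv weyl_comp[OF w0(1) v(1)] a])
  then show ?thesis
    using w0(2)[OF weyl_isometry(3)[OF v(1) a]] side_inverse[OF w v(2,1) a] by simp
qed

text \<open>A root \<open>a\<close> is called non-isolated if it is not perpendicular to all other roots. Then its
  half-apartment contains a chamber that has no panel on the wall of \<open>a\<close>, namely one whose closure
  contains the vector \<open>a\<close>.\<close>

definition nonisolated :: "'v \<Rightarrow> bool" where
  "nonisolated a \<longleftrightarrow> (\<exists>b\<in>\<Phi>. a \<bullet> b \<noteq> 0 \<and> b \<noteq> a \<and> b \<noteq> - a)"

lemma nonisolated_uminus: "nonisolated (- a) \<longleftrightarrow> nonisolated a"
  unfolding nonisolated_def by auto

lemma interior_chamber:
  assumes a: "a \<in> \<Phi>" "nonisolated a"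
  obtains w where "w \<in> weyl \<Phi>" "side a w" "\<And>i. i \<in> I \<Longrightarrow> w i \<noteq> a \<and> w i \<noteq> - a"
proof -
  \<comment> \<open>The multiple of \<open>a\<close> is so large that it dominates \<open>q\<close> on all roots not perpendicular to \<open>a\<close>; the
    vector \<open>q\<close> decides on the others.\<close>
  define t where "t = 1 + (\<Sum>b\<in>\<Phi>. \<bar>q \<bullet> b\<bar> / \<bar>a \<bullet> b\<bar>)"
  have big: "\<bar>q \<bullet> b\<bar> < t * \<bar>a \<bullet> b\<bar>" if b: "b \<in> \<Phi>" "a \<bullet> b \<noteq> 0" for b
  proof -
    have "\<bar>q \<bullet> b\<bar> / \<bar>a \<bullet> b\<bar> \<le> (\<Sum>b\<in>\<Phi>. \<bar>q \<bullet> b\<bar> / \<bar>a \<bullet> b\<bar>)"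
      by (rule member_le_sum[OF b(1) _ fin]) auto
    then have "\<bar>q \<bullet> b\<bar> / \<bar>a \<bullet> b\<bar> < t" by (simp add: t_def)
    then show ?thesis using b(2) by (simp add: pos_divide_less_eq)
  qed
  define p where "p = q + t *\<^sub>R a"
  have p_pos: "a \<bullet> b > 0 \<Longrightarrow> p \<bullet> b > 0" "a \<bullet> b < 0 \<Longrightarrow> p \<bullet> b < 0" if "b \<in> \<Phi>" for b
    using big[OF that] by (auto simp: p_def inner_add_left)
  have "regular \<Phi> p"
    unfolding regular_def
  proof
    show "p \<in> span \<Phi>" unfolding p_def using q a by (auto simp: regular_def intro: span_add span_scale span_base)
    show "\<forall>b\<in>\<Phi>. p \<bullet> b \<noteq> 0"
    proof
      fix b assume b: "b \<in> \<Phi>"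
      show "p \<bullet> b \<noteq> 0"
      proof (cases "a \<bullet> b = 0")
        case True
        then have "p \<bullet> b = q \<bullet> b" by (simp add: p_def inner_add_left)
        then show ?thesis using q b by (simp add: regular_def)
      next
        case False
        then show ?thesis using p_pos[OF b] by (cases "a \<bullet> b > 0") auto
      qed
    qed
  qed
  from regular_transitive[OF this] obtain v where v: "v \<in> weyl \<Phi>" "\<And>b. b \<in> Pos \<Longrightarrow> v p \<bullet> b > 0" by blast
  obtain w where w: "w \<in> weyl \<Phi>" "w \<circ> v = id" "v \<circ> w = id" using weyl_inverse[OF v(1)] .
  have wv: "w (v x) = x" "v (w x) = x" for x using fun_cong[OF w(2), of x] fun_cong[OF w(3), of x] by simp_all
  have move: "v x \<bullet> b = x \<bullet> w b" for x b using weyl_isometry(2)[OF v(1), of x "w b"] unfolding wv .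
  define k where "k = v a"
  have k: "k \<in> \<Phi>" "w k = a" unfolding k_def using weyl_isometry(3)[OF v(1) a(1)] wv by auto
  have dom: "k \<bullet> b \<ge> 0" if b: "b \<in> Pos" for b
  proof (rule ccontr)
    assume "\<not> ?thesis"
    then have "a \<bullet> w b < 0" by (simp add: k_def move)
    moreover have "w b \<in> \<Phi>" using weyl_isometry(3)[OF w(1)] b Pos_sub by blast
    ultimately have "p \<bullet> w b < 0" using p_pos(2) by blast
    then show False using v(2)[OF b] by (simp add: move)
  qed
  have kPos: "k \<in> Pos"
  proof (rule ccontr)
    assume "k \<notin> Pos"
    then have "- k \<in> Pos" using uminus_Pos[OF k(1)] by blast
    from dom[OF this] show False using unit[OF k(1)] by simp
  qed
  show thesis
  proof (rule that[OF w(1)])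
    show "side a w" using side_inverse[OF w(1) w(3) v(1) a(1)] kPos by (simp add: k_def)
    fix i assume i: "i \<in> I"
    have "k \<noteq> i"
    proof
      assume ki: "k = i"
      obtain b where b: "b \<in> \<Phi>" "a \<bullet> b \<noteq> 0" "b \<noteq> a" "b \<noteq> - a" using a(2) unfolding nonisolated_def by blast
      have c: "v b \<in> \<Phi>" "k \<bullet> v b \<noteq> 0" "v b \<noteq> k" "v b \<noteq> - k"
        using weyl_isometry(3)[OF v(1) b(1)] weyl_isometry(2)[OF v(1), of a b] b(2-4) wv(1)[of b] wv(1)[of a] wv(1)[of "- a"]
          weyl_uminus[OF v(1), of a] unfolding k_def by metis+
      obtain c where c: "c \<in> Pos" "k \<bullet> c \<noteq> 0" "c \<noteq> k"
      proof (cases "v b \<in> Pos")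
        case True then show thesis using that c by blast
      next
        case False
        have "- v b \<noteq> k" using c(4) by auto
        then show thesis using that[of "- v b"] False uminus_Pos[OF c(1)] c(2) by auto
      qed
      then have "k \<bullet> c > 0" using dom[OF c(1)] by simp
      moreover have "refl_in i c \<in> Pos" using refl_simple_Pos(1)[OF i c(1)] c(3) ki by blast
      then have "k \<bullet> refl_in i c \<ge> 0" by (rule dom)
      moreover have "k \<bullet> refl_in i c = - (k \<bullet> c)"
        using unit[OF k(1)] unfolding ki[symmetric] by (simp add: refl_in_def inner_diff_right inner_commute)
      ultimately show False by simp
    qed
    moreover have "k \<noteq> - i" using kPos uminus_Pos[OF simple_root[OF i]] simple_Pos[OF i] by blast
    ultimately show "w i \<noteq> a \<and> w i \<noteq> - a"
      using wv(2)[of i] weyl_uminus[OF v(1), of a] unfolding k_def by (metis add.inverse_inverse)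
  qed
qed

subsection \<open>Elements of root groups\<close>

text \<open>A type-preserving automorphism that fixes two opposite chambers of the apartment fixes the whole
  apartment.\<close>

lemma fixes_apartment:
  assumes g: "type_preserving g" and w: "w \<in> weyl \<Phi>" "g (chamber_at w) = chamber_at w"
    "g (chamber_at (w \<circ> w0)) = chamber_at (w \<circ> w0)" and v: "v \<in> weyl \<Phi>"
  shows "g (chamber_at v) = chamber_at v"
proof -
  \<comment> \<open>One of the two given opposite chambers lies on the required side of each wall,
    and projections of fixed chambers onto stable panels are fixed.\<close>
  have step: "g (chamber_at (y \<circ> refl_in i)) = chamber_at (y \<circ> refl_in i)"
    if y: "y \<in> weyl \<Phi>" "g (chamber_at y) = chamber_at y" and i: "i \<in> I" for y i
  proof -
    let ?x = "y \<circ> refl_in i"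
    have x: "?x \<in> weyl \<Phi>" by (rule weyl_refl_simple[OF i y(1)])
    have xi: "?x i \<in> \<Phi>" using weyl_isometry(3)[OF x simple_root[OF i]] .
    obtain z where z: "z \<in> weyl \<Phi>" "g (chamber_at z) = chamber_at z" "side (?x i) z"
      using w weyl_comp[OF w(1) w0(1)] side_w0[OF w(1) xi] by blast
    obtain z' where z': "z' \<in> weyl \<Phi>" "z' \<circ> z = id" "z \<circ> z' = id" using weyl_inverse[OF z(1)] .
    obtain u where u: "?x = z \<circ> u" "dist (chamber_at z) (chamber_at ?x) = u"
      using dist_chamber_at'[OF z(1) x] by blast
    have "u = z' \<circ> ?x" unfolding u(1) by (simp only: comp_assoc[symmetric] z'(2) id_comp)
    then have "u i = z' (?x i)" by (metis comp_apply)
    then have "u i \<in> Pos" using side_inverse[OF z(1) z'(2,1) xi] z(3) by simp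
    moreover have "adjacent D i (chamber_at y) (chamber_at ?x)" using adjacent_chamber_at[OF y(1) x] i by blast
    then have "chamber_at ?x \<in> panel i (chamber_at y)" unfolding panel_def by blast
    ultimately show ?thesis
      using fixes_projection[OF g chamber_at_chambers[OF z(1)] z(2) chamber_at_chambers[OF y(1)] _ i] u(2) y(2) panel_self
      by metis
  qed
  have "set f \<subseteq> I \<Longrightarrow> g (chamber_at (w \<circ> word_value f)) = chamber_at (w \<circ> word_value f)" for f
  proof (induction f rule: rev_induct)
    case (snoc i f)
    have y: "w \<circ> word_value f \<in> weyl \<Phi>" using weyl_comp[OF w(1) word_weyl] snoc.prems by simp
    have e: "(w \<circ> word_value f) \<circ> refl_in i = w \<circ> word_value (f @ [i])"
      by (simp add: word_value_append comp_assoc)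
    show ?case unfolding e[symmetric] by (rule step[OF y]) (use snoc in \<open>auto simp: comp_def\<close>)
  qed (use w in simp)
  moreover obtain u where u: "u \<in> weyl \<Phi>" "v = w \<circ> u" using dist_chamber_at'[OF w(1) v] by blast
  moreover obtain f where "set f \<subseteq> I" "word_value f = u" using weyl_word[OF u(1)] by blast
  ultimately show ?thesis by blast
qed

lemma root_group_permutes: "u \<in> root_group D r \<Longrightarrow> u permutes chambers D"
  by (auto simp: root_group_def carrier_aut_group)

lemma root_group_fixes_panel:
  assumes a: "a \<in> \<Phi>" and u: "u \<in> root_group D (half a)"
    and w: "w \<in> weyl \<Phi>" "side a w" and i: "i \<in> I" "w i \<noteq> a" "w i \<noteq> - a"
    and c: "c \<in> panel i (chamber_at w)"
  shows "u c = c"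
proof -
  have wi: "w \<circ> refl_in i \<in> weyl \<Phi>" by (rule weyl_refl_simple[OF i(1) w(1)])
  have ad: "adjacent D i (chamber_at w) (chamber_at (w \<circ> refl_in i))"
    using adjacent_chamber_at[OF w(1) wi] i by blast
  have "chamber_at w \<in> panel i (chamber_at w) \<inter> half a" using chamber_at_half[OF a w(1)] w(2) panel_self by blast
  moreover have "chamber_at (w \<circ> refl_in i) \<in> panel i (chamber_at w) \<inter> half a"
    using chamber_at_half[OF a wi] side_same[OF w(1) i(1) a i(2,3)] w(2) ad unfolding panel_def by blast
  moreover have "panel i (chamber_at w) \<in> panels D" by (rule panel_in_panels[OF i(1) chamber_at_chambers[OF w(1)]])
  ultimately show ?thesis using u adj(4)[OF ad] c unfolding root_group_def by blast
qed

lemma root_group_fixes_half: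
  assumes a: "a \<in> \<Phi>" and u: "u \<in> root_group D (half a)" and c: "c \<in> half a"
  shows "u c = c"
proof -
  obtain w where w: "w \<in> weyl \<Phi>" "side a w" "c = chamber_at w" using halfE[OF a c] .
  have "\<exists>i\<in>I. w i \<noteq> a \<and> w i \<noteq> - a"
  proof (rule ccontr)
    assume *: "\<not> ?thesis"
    obtain v where v: "v \<in> weyl \<Phi>" "v \<circ> w = id" "w \<circ> v = id" using weyl_inverse[OF w(1)] .
    have vw: "v (w x) = x" for x using fun_cong[OF v(2), of x] by simp
    have "i = v a \<or> i = - v a" if "i \<in> I" for i
      using * that vw[of i] weyl_uminus[OF v(1), of a] by metis
    then have "i = (if v a \<in> Pos then v a else - v a)" if "i \<in> I" for i
      using that simple_Pos[OF that] uminus_Pos[OF weyl_isometry(3)[OF v(1) a]] by metis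
    then have "I \<subseteq> {if v a \<in> Pos then v a else - v a}" by blast
    then have "card I \<le> 1" using card_mono[of "{if v a \<in> Pos then v a else - v a}" I] by simp
    then show False using rank by simp
  qed
  then show ?thesis unfolding w(3) using root_group_fixes_panel[OF a u w(1,2)] panel_self by blast
qed

lemma root_group_interior:
  assumes a: "a \<in> \<Phi>" "nonisolated a" and u: "u \<in> root_group D (half a)"
  obtains w where "w \<in> weyl \<Phi>" "side a w" "fixes_nearby u (chamber_at w)" "type_preserving u"
proof -
  obtain w where w: "w \<in> weyl \<Phi>" "side a w" "\<And>i. i \<in> I \<Longrightarrow> w i \<noteq> a \<and> w i \<noteq> - a"
    using interior_chamber[OF a] by blast
  have fixp: "u c = c" if "i \<in> I" "c \<in> panel i (chamber_at w)" for i c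
    using root_group_fixes_panel[OF a(1) u w(1,2) that(1)] w(3)[OF that(1)] that(2) by blast
  have near: "fixes_nearby u (chamber_at w)"
    unfolding fixes_nearby_def
  proof (intro conjI allI impI)
    show "chamber_at w \<in> chambers D" by (rule chamber_at_chambers[OF w(1)])
    show "u (chamber_at w) = chamber_at w"
      by (rule root_group_fixes_half[OF a(1) u]) (use chamber_at_half[OF a(1) w(1)] w(2) in blast)
    fix i e assume "adjacent D i (chamber_at w) e"
    then show "u e = e" using fixp[OF adj(1)] unfolding panel_def by blast
  qed
  obtain \<sigma> where \<sigma>: "chamber_iso D D \<sigma> u" using u by (auto simp: root_group_def carrier_aut_group)
  have \<sigma>_id: "\<sigma> i = i" if i: "i \<in> I" for i
  proof -
    have wi: "w \<circ> refl_in i \<in> weyl \<Phi>" by (rule weyl_refl_simple[OF i w(1)])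
    have ad: "adjacent D i (chamber_at w) (chamber_at (w \<circ> refl_in i))"
      using adjacent_chamber_at[OF w(1) wi] i by blast
    have "adjacent D (\<sigma> i) (u (chamber_at w)) (u (chamber_at (w \<circ> refl_in i)))"
      using \<sigma> ad adj(2,3)[OF ad] i colors_D unfolding chamber_iso_def by blast
    then have ad': "adjacent D (\<sigma> i) (chamber_at w) (chamber_at (w \<circ> refl_in i))"
      using near ad unfolding fixes_nearby_def by metis
    then have "refl_in (\<sigma> i) = refl_in i"
      using dist_adj[OF adj(1)[OF ad'] adj(2,3)[OF ad]] dist_adj[OF i adj(2,3)[OF ad]] ad by metis
    then show ?thesis using refl_in_simple_inject[OF adj(1)[OF ad'] i] by blast
  qed
  have "type_preserving u"
    unfolding type_preserving_def
  proof (intro conjI allI impI)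
    show "u permutes chambers D" by (rule root_group_permutes[OF u])
    fix i c d assume ad: "adjacent D i c d"
    then have "adjacent D (\<sigma> i) (u c) (u d)" using \<sigma> adj(1-3)[OF ad] colors_D unfolding chamber_iso_def by blast
    then show "adjacent D i (u c) (u d)" using \<sigma>_id[OF adj(1)[OF ad]] by simp
  qed
  then show thesis using that w near by blast
qed

text \<open>A non-trivial element of a root group fixes no chamber of the opposite half-apartment: together
  with the chamber \<open>w\<close> all of whose panels it fixes, it would satisfy the assumptions of rigidity.\<close>

lemma root_group_rigid:
  assumes a: "a \<in> \<Phi>" "nonisolated a" and u: "u \<in> root_group D (half a)"
    and c: "c \<in> half (- a)" "u c = c"
  shows "u = id"
proof -
  obtain w where w: "w \<in> weyl \<Phi>" "side a w" "fixes_nearby u (chamber_at w)" "type_preserving u"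
    using root_group_interior[OF a u] .
  obtain v where v: "v \<in> weyl \<Phi>" "side (- a) v" "c = chamber_at v" using halfE[OF neg[OF a(1)] c(1)] .
  have vv: "v \<circ> w0 \<in> weyl \<Phi>" "w \<circ> w0 \<in> weyl \<Phi>" using weyl_comp w0(1) v(1) w(1) by blast+
  have "side a (v \<circ> w0)" using side_w0[OF v(1) a(1)] side_uminus[OF a(1) v(1)] v(2) by blast
  then have "u (chamber_at (v \<circ> w0)) = chamber_at (v \<circ> w0)"
    using root_group_fixes_half[OF a(1) u] chamber_at_half[OF a(1) vv(1)] by blast
  then have "u (chamber_at (w \<circ> w0)) = chamber_at (w \<circ> w0)"
    using fixes_apartment[OF w(4) v(1) _ _ vv(2)] c(2) v(3) by blast
  moreover have "dist (chamber_at w) (chamber_at (w \<circ> w0)) = w0" by (rule dist_chamber_at[OF w(1) w0(1)])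
  ultimately show ?thesis using rigidity[OF thick w(4,3) chamber_at_chambers[OF vv(2)]] by blast
qed

subsection \<open>Folding the apartment\<close>

lemma type_preserving_adj_iff:
  assumes g: "type_preserving g" and cd: "c \<in> chambers D" "d \<in> chambers D" and i: "i \<in> I"
  shows "adjacent D i (g c) (g d) \<longleftrightarrow> adjacent D i c d"
  using dist_adj[OF i cd] type_preserving_dist[OF g cd]
    dist_adj[OF i type_preserving_chambers[OF g cd(1)] type_preserving_chambers[OF g cd(2)]] by simp

lemma half_nonempty:
  assumes a: "a \<in> \<Phi>" "nonisolated a"
  obtains w where "w \<in> weyl \<Phi>" "side a w" "chamber_at w \<in> half a"
  using interior_chamber[OF a] chamber_at_half[OF a(1)] by blast

lemma A_half: "a \<in> \<Phi> \<Longrightarrow> A = half a \<union> half (- a)" "a \<in> \<Phi> \<Longrightarrow> half a \<inter> half (- a) = {}"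
proof -
  assume a: "a \<in> \<Phi>"
  show "A = half a \<union> half (- a)"
    unfolding A_eq half_eq[OF a] half_eq[OF neg[OF a]] using side_uminus[OF a] by blast
  show "half a \<inter> half (- a) = {}"
  proof (rule ccontr)
    assume "half a \<inter> half (- a) \<noteq> {}"
    then obtain c where c: "c \<in> half a" "c \<in> half (- a)" by blast
    obtain w where w: "w \<in> weyl \<Phi>" "side a w" "c = chamber_at w" using halfE[OF a c(1)] .
    have "side (- a) w" using c(2) chamber_at_half[OF neg[OF a] w(1)] w(3) by blast
    then show False using side_uminus[OF a w(1)] w(2) by blast
  qed
qed

lemma root_group_inj: "u \<in> root_group D r \<Longrightarrow> inj u"
  using root_group_permutes permutes_inj by blast

text \<open>A non-trivial element of the root group of \<open>a\<close> moves the opposite half-apartment off the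
  apartment.\<close>

lemma moves_off_apartment:
  assumes a: "a \<in> \<Phi>" "nonisolated a" and u: "u \<in> root_group D (half a)" "u \<noteq> id"
    and v: "v \<in> weyl \<Phi>" "\<not> side a v" and w: "w \<in> weyl \<Phi>"
  shows "u (chamber_at v) \<noteq> chamber_at w"
proof
  assume eq: "u (chamber_at v) = chamber_at w"
  show False
  proof (cases "side a w")
    case True
    then have "u (chamber_at w) = chamber_at w"
      using root_group_fixes_half[OF a(1) u(1)] chamber_at_half[OF a(1) w] by blast
    then have "chamber_at v = chamber_at w" using eq injD[OF root_group_inj[OF u(1)]] by metis
    then show False using chamber_at_inject[OF v(1) w] True v(2) by blast
  next
    case False
    obtain z where z: "z \<in> weyl \<Phi>" "side a z" "chamber_at z \<in> half a" using half_nonempty[OF a] .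
    obtain w1 where "type_preserving u" using root_group_interior[OF a u(1)] by blast
    then have "dist (u (chamber_at z)) (u (chamber_at v)) = dist (chamber_at z) (chamber_at v)"
      by (rule type_preserving_dist[OF _ chamber_at_chambers[OF z(1)] chamber_at_chambers[OF v(1)]])
    then have "dist (chamber_at z) (chamber_at w) = dist (chamber_at z) (chamber_at v)"
      unfolding eq root_group_fixes_half[OF a(1) u(1) z(3)] .
    then have "w = v" by (rule dist_chamber_at_inject[OF z(1) w v(1)])
    then have "u (chamber_at v) = chamber_at v" using eq by simp
    moreover have "chamber_at v \<in> half (- a)"
      using chamber_at_half[OF neg[OF a(1)] v(1)] side_uminus[OF a(1) v(1)] v(2) by blast
    ultimately show False using root_group_rigid[OF a u(1)] u(2) by blast
  qed
qed

text \<open>Chambers of the opposite half-apartment are adjacent to chambers of its image under \<open>u\<close> only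
  across the wall of \<open>a\<close>.\<close>

lemma adjacent_fold:
  assumes a: "a \<in> \<Phi>" "nonisolated a" and u: "u \<in> root_group D (half a)" "u \<noteq> id"
    and w: "w \<in> weyl \<Phi>" "\<not> side a w" and v: "v \<in> weyl \<Phi>" "\<not> side a v"
    and ad: "adjacent D i (chamber_at w) (u (chamber_at v))"
  shows "v = w \<and> side a (w \<circ> refl_in i)"
proof -
  have i: "i \<in> I" by (rule adj(1)[OF ad])
  have wi: "w \<circ> refl_in i \<in> weyl \<Phi>" by (rule weyl_refl_simple[OF i w(1)])
  note wc = chamber_at_chambers[OF w(1)] and vc = chamber_at_chambers[OF v(1)]
  have adw: "adjacent D i (chamber_at w) (chamber_at (w \<circ> refl_in i))"
    using adjacent_chamber_at[OF w(1) wi] i by blast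
  obtain z where z: "z \<in> weyl \<Phi>" "side a z" "chamber_at z \<in> half a" using half_nonempty[OF a] .
  have uz: "u (chamber_at z) = chamber_at z" by (rule root_group_fixes_half[OF a(1) u(1) z(3)])
  note zc = chamber_at_chambers[OF z(1)]
  obtain w1 where tp: "type_preserving u" using root_group_interior[OF a u(1)] by blast
  have duv: "dist (chamber_at z) (u (chamber_at v)) = dist (chamber_at z) (chamber_at v)"
    using type_preserving_dist[OF tp zc vc] uz by simp
  obtain y where y: "y \<in> weyl \<Phi>" "w = z \<circ> y" "dist (chamber_at z) (chamber_at w) = y"
    using dist_chamber_at'[OF z(1) w(1)] .
  have dwi: "dist (chamber_at z) (chamber_at (w \<circ> refl_in i)) = y \<circ> refl_in i"
    using dist_chamber_at[OF z(1) weyl_refl_simple[OF i y(1)]] unfolding y(2) comp_assoc .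
  have "dist (chamber_at z) (u (chamber_at v)) = y \<or> dist (chamber_at z) (u (chamber_at v)) = y \<circ> refl_in i"
    using dist_panel_cases[OF ad zc] unfolding y(3) .
  then have vcases: "v = w \<or> v = w \<circ> refl_in i"
    using dist_chamber_at_inject[OF z(1) v(1) w(1)] dist_chamber_at_inject[OF z(1) v(1) wi]
    unfolding duv y(3) dwi by blast
  \<comment> \<open>The panel is stable under \<open>u\<close>, so that its projection of a fixed chamber, which lies in
    the apartment, is fixed.\<close>
  have stable: "u (chamber_at w) \<in> panel i (chamber_at w)"
  proof (cases "v = w")
    case True
    then show ?thesis using ad by (simp add: panel_def)
  next
    case False
    then have "adjacent D i (u (chamber_at v)) (u (chamber_at w))"
      using vcases adj(5)[OF adw] type_preserving_adj_iff[OF tp vc wc i] by blast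
    then show ?thesis using adj_trans[OF ad, of "u (chamber_at w)"] unfolding panel_def by (metis insertCI mem_Collect_eq)
  qed
  have "\<not> \<not> side a (w \<circ> refl_in i)"
  proof
    assume ns: "\<not> side a (w \<circ> refl_in i)"
    have fixF: False if x: "x \<in> weyl \<Phi>" "\<not> side a x" "chamber_at x \<in> panel i (chamber_at w)"
      "dist (chamber_at z) (chamber_at x) i \<in> Pos" for x
      using moves_off_apartment[OF a u x(1,2,1)] fixes_projection[OF tp zc uz wc stable i x(3,4)] by blast
    show False
    proof (cases "y i \<in> Pos")
      case True
      then show False using fixF[OF w panel_self] y(3) by simp
    next
      case False
      then have "dist (chamber_at z) (chamber_at (w \<circ> refl_in i)) i \<in> Pos"
        unfolding dwi comp_refl_Pos[OF y(1) i] .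
      moreover have "chamber_at (w \<circ> refl_in i) \<in> panel i (chamber_at w)" using adw by (simp add: panel_def)
      ultimately show False using fixF[OF wi ns] by blast
    qed
  qed
  then show ?thesis using vcases v(2) by blast
qed

lemma side_crossing:
  assumes "w \<in> weyl \<Phi>" "i \<in> I" "a \<in> \<Phi>" "side a (w \<circ> refl_in i) \<noteq> side a w"
  shows "w \<circ> refl_in i = refl_in a \<circ> w"
  using wall_refl[OF assms(1)] side_same[OF assms(1-3)] assms(4) by blast

lemma refl_comp_cancel: "a \<in> \<Phi> \<Longrightarrow> refl_in a \<circ> (refl_in a \<circ> w) = w"
  by (simp only: comp_assoc[symmetric] refl_in_comp_self id_comp)

text \<open>Replacing the half-apartment of \<open>a\<close> by the image of the opposite one under \<open>u\<close>
  gives an apartment again.\<close>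

lemma folded_apartment:
  assumes a: "a \<in> \<Phi>" "nonisolated a" and u: "u \<in> root_group D (half a)" "u \<noteq> id"
  shows "half (- a) \<union> u ` half (- a) \<in> apartments \<Phi> S D"
proof -
  define p where "p T = (if T \<subseteq> halfspace (- a) then \<pi> T else u (\<pi> (refl_in a ` T)))" for T
  have na: "- a \<in> \<Phi>" by (rule neg[OF a(1)])
  have aw: "refl_in a \<circ> w \<in> weyl \<Phi>" if "w \<in> weyl \<Phi>" for w by (rule weyl_refl[OF that a(1)])
  have nside: "\<not> side a (refl_in a \<circ> w)" if "w \<in> weyl \<Phi>" "side a w" for w
    using side_refl[OF that(1) a(1)] that(2) by blast
  obtain w1 where tp: "type_preserving u" using root_group_interior[OF a u(1)] by blast
  have p1: "p (w ` S) = chamber_at w" if "w \<in> weyl \<Phi>" "\<not> side a w" for w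
    using sector_halfspace_iff[OF that(1) na] side_uminus[OF a(1) that(1)] that(2)
    by (simp add: p_def side_def chamber_at_def)
  have p2: "p (w ` S) = u (chamber_at (refl_in a \<circ> w))" if "w \<in> weyl \<Phi>" "side a w" for w
    using sector_halfspace_iff[OF that(1) na] side_uminus[OF a(1) that(1)] that(2)
    by (simp add: p_def side_def chamber_at_def image_comp)
  have img: "p ` sectors \<Phi> = half (- a) \<union> u ` half (- a)" (is "?B = _")
  proof
    show "?B \<subseteq> half (- a) \<union> u ` half (- a)"
    proof
      fix c assume "c \<in> ?B"
      then obtain w where w: "w \<in> weyl \<Phi>" "c = p (w ` S)" unfolding sectors_weyl by blast
      show "c \<in> half (- a) \<union> u ` half (- a)"
      proof (cases "side a w")
        case False
        then show ?thesis using p1[OF w(1)] w chamber_at_half[OF na w(1)] side_uminus[OF a(1) w(1)] by simp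
      next
        case True
        have "chamber_at (refl_in a \<circ> w) \<in> half (- a)"
          using nside[OF w(1) True] chamber_at_half[OF na aw[OF w(1)]] side_uminus[OF a(1) aw[OF w(1)]] by blast
        then show ?thesis using p2[OF w(1) True] w(2) by blast
      qed
    qed
    show "half (- a) \<union> u ` half (- a) \<subseteq> ?B"
    proof
      fix c assume "c \<in> half (- a) \<union> u ` half (- a)"
      then obtain c' where c': "c' \<in> half (- a)" "c = c' \<or> c = u c'" by blast
      obtain w where w: "w \<in> weyl \<Phi>" "side (- a) w" "c' = chamber_at w" using halfE[OF na c'(1)] .
      have ns: "\<not> side a w" using side_uminus[OF a(1) w(1)] w(2) by blast
      have "c' = p (w ` S)" using p1[OF w(1) ns] w(3) by simp
      moreover have "u c' = p ((refl_in a \<circ> w) ` S)"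
        using p2[OF aw[OF w(1)]] side_refl[OF w(1) a(1)] ns w(3) refl_comp_cancel[OF a(1), of w] by metis
      ultimately show "c \<in> ?B" using c'(2) sector_mem[OF w(1)] sector_mem[OF aw[OF w(1)]] by blast
    qed
  qed
  have half_ch: "half b \<subseteq> chambers D" if "b \<in> \<Phi>" for b
    using A_half(1)[OF that] A_sub by blast
  have sub: "?B \<subseteq> chambers D"
    unfolding img using half_ch[OF na] type_preserving_chambers[OF tp] by blast
  have inj: "inj_on p (sectors \<Phi>)"
  proof (rule inj_onI)
    fix T T' assume T: "T \<in> sectors \<Phi>" "T' \<in> sectors \<Phi>" and eq: "p T = p T'"
    obtain w where w: "w \<in> weyl \<Phi>" "T = w ` S" using T(1) unfolding sectors_weyl by blast
    obtain v where v: "v \<in> weyl \<Phi>" "T' = v ` S" using T(2) unfolding sectors_weyl by blast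
    have "w = v"
    proof (cases "side a w"; cases "side a v")
      assume *: "side a w" "side a v"
      have "u (chamber_at (refl_in a \<circ> w)) = u (chamber_at (refl_in a \<circ> v))"
        using eq p2[OF w(1) *(1)] p2[OF v(1) *(2)] unfolding w(2) v(2) by simp
      then have "refl_in a \<circ> w = refl_in a \<circ> v"
        using injD[OF root_group_inj[OF u(1)]] chamber_at_inject[OF aw[OF w(1)] aw[OF v(1)]] by blast
      then show ?thesis using refl_comp_cancel[OF a(1)] by metis
    next
      assume *: "side a w" "\<not> side a v"
      show ?thesis using eq p2[OF w(1) *(1)] p1[OF v(1) *(2)]
        moves_off_apartment[OF a u aw[OF w(1)] nside[OF w(1) *(1)] v(1)] unfolding w(2) v(2) by simp
    next
      assume *: "\<not> side a w" "side a v"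
      show ?thesis using eq p1[OF w(1) *(1)] p2[OF v(1) *(2)]
        moves_off_apartment[OF a u aw[OF v(1)] nside[OF v(1) *(2)] w(1)] unfolding w(2) v(2) by simp
    next
      assume *: "\<not> side a w" "\<not> side a v"
      show ?thesis using eq p1[OF w(1) *(1)] p1[OF v(1) *(2)] chamber_at_inject[OF w(1) v(1)] unfolding w(2) v(2) by simp
    qed
    then show "T = T'" using w v by simp
  qed
  have mixed: "adjacent D i (p (w ` S)) (p (v ` S)) \<longleftrightarrow> v = w \<circ> refl_in i"
    if i: "i \<in> I" and w: "w \<in> weyl \<Phi>" "\<not> side a w" and v: "v \<in> weyl \<Phi>" "side a v" for i w v
    unfolding p1[OF w] p2[OF v]
  proof
    assume ad: "adjacent D i (chamber_at w) (u (chamber_at (refl_in a \<circ> v)))"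
    have *: "refl_in a \<circ> v = w" "side a (w \<circ> refl_in i)"
      using adjacent_fold[OF a u w aw[OF v(1)] nside[OF v] ad] by auto
    have "w \<circ> refl_in i = refl_in a \<circ> w" by (rule side_crossing[OF w(1) i a(1)]) (use * w in blast)
    then show "v = w \<circ> refl_in i" using *(1) refl_comp_cancel[OF a(1), of v] by metis
  next
    assume vw: "v = w \<circ> refl_in i"
    have "w \<circ> refl_in i = refl_in a \<circ> w" by (rule side_crossing[OF w(1) i a(1)]) (use v w vw in blast)
    then have rv: "refl_in a \<circ> v = w" unfolding vw using refl_comp_cancel[OF a(1)] by metis
    have ad: "adjacent D i (chamber_at w) (chamber_at v)" using adjacent_chamber_at[OF w(1) v(1)] i vw by blast
    have "u (chamber_at v) = chamber_at v"
      by (rule root_group_fixes_half[OF a(1) u(1)]) (use chamber_at_half[OF a(1) v(1)] v(2) in blast)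
    then have "adjacent D i (u (chamber_at w)) (chamber_at v)"
      using ad type_preserving_adj_iff[OF tp chamber_at_chambers[OF w(1)] chamber_at_chambers[OF v(1)] i] by simp
    then have "adjacent D i (chamber_at w) (u (chamber_at w))"
      using adj_trans[OF ad adj(5)] moves_off_apartment[OF a u w w(1)] by metis
    then show "adjacent D i (chamber_at w) (u (chamber_at (refl_in a \<circ> v)))" unfolding rv .
  qed
  have adjac: "adjacent D i (p (w ` S)) (p (v ` S)) \<longleftrightarrow> v = w \<circ> refl_in i"
    if i: "i \<in> I" and w: "w \<in> weyl \<Phi>" and v: "v \<in> weyl \<Phi>" for i w v
  proof (cases "side a w"; cases "side a v")
    assume *: "\<not> side a w" "\<not> side a v"
    show ?thesis unfolding p1[OF w *(1)] p1[OF v *(2)] using adjacent_chamber_at[OF w v] i by blast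
  next
    assume *: "\<not> side a w" "side a v"
    show ?thesis by (rule mixed[OF i w *(1) v *(2)])
  next
    assume *: "side a w" "\<not> side a v"
    have "adjacent D i (p (w ` S)) (p (v ` S)) \<longleftrightarrow> w = v \<circ> refl_in i"
      using mixed[OF i v *(2) w *(1)] adj(5) by blast
    then show ?thesis using comp_refl_refl[OF i] by metis
  next
    assume *: "side a w" "side a v"
    have "adjacent D i (p (w ` S)) (p (v ` S)) \<longleftrightarrow> refl_in a \<circ> v = (refl_in a \<circ> w) \<circ> refl_in i"
      unfolding p2[OF w *(1)] p2[OF v *(2)]
        type_preserving_adj_iff[OF tp chamber_at_chambers[OF aw[OF w]] chamber_at_chambers[OF aw[OF v]] i]
      using adjacent_chamber_at[OF aw[OF w] aw[OF v]] i by blast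
    also have "\<dots> \<longleftrightarrow> v = w \<circ> refl_in i" unfolding comp_assoc using refl_comp_cancel[OF a(1)] by metis
    finally show ?thesis .
  qed
  have "chamber_iso (coxeter_complex \<Phi> S) (D\<lparr>chambers := ?B\<rparr>) id p"
    unfolding chamber_iso_def chambers_coxeter colors_coxeter
  proof (intro conjI ballI)
    show "bij_betw id I (colors (D\<lparr>chambers := ?B\<rparr>))" using colors_D by simp
    show "bij_betw p (sectors \<Phi>) (chambers (D\<lparr>chambers := ?B\<rparr>))" using inj by (simp add: bij_betw_def)
    fix i T T' assume i: "i \<in> I" and T: "T \<in> sectors \<Phi>" "T' \<in> sectors \<Phi>"
    obtain w where w: "w \<in> weyl \<Phi>" "T = w ` S" using T(1) unfolding sectors_weyl by blast
    obtain v where v: "v \<in> weyl \<Phi>" "T' = v ` S" using T(2) unfolding sectors_weyl by blast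
    have "adjacent (coxeter_complex \<Phi> S) i T T' \<longleftrightarrow> adjacent D i (chamber_at w) (chamber_at v)"
      unfolding chamber_at_def w(2) v(2) by (rule \<pi>_adj[OF i sector_mem[OF w(1)] sector_mem[OF v(1)]])
    also have "\<dots> \<longleftrightarrow> adjacent D i (p T) (p T')"
      unfolding w(2) v(2) adjac[OF i w(1) v(1)] using adjacent_chamber_at[OF w(1) v(1)] i by blast
    finally show "adjacent (coxeter_complex \<Phi> S) i T T' \<longleftrightarrow> adjacent (D\<lparr>chambers := ?B\<rparr>) (id i) (p T) (p T')"
      by simp
  qed
  then have "?B \<in> apartments \<Phi> S D" unfolding apartments_def using sub by blast
  then show ?thesis unfolding img .
qed

subsection \<open>The elements that reflect the apartment\<close>

lemma root_group_image_half:
  assumes a: "a \<in> \<Phi>" and u: "u \<in> root_group D (half a)"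
  shows "u ` half a = half a"
  using root_group_fixes_half[OF a u] by force

text \<open>The Moufang condition for the root \<open>- a\<close> maps the folded apartment back to \<open>A\<close>.\<close>

lemma fold_back:
  assumes moufang: "moufang_building \<Phi> S D"
    and a: "a \<in> \<Phi>" "nonisolated a" and u: "u \<in> root_group D (half a)" "u \<noteq> id"
  obtains b where "b \<in> root_group D (half (- a))" "b ` u ` half (- a) = half a"
proof -
  have na: "- a \<in> \<Phi>" by (rule neg[OF a(1)])
  let ?B = "half (- a) \<union> u ` half (- a)"
  have A: "A \<in> apartments \<Phi> S D" unfolding apartments_def using A_sub apartment_iso by blast
  moreover have "half (- a) \<in> apartment_roots \<Phi> S D A"
    unfolding apartment_roots_def half_def using na apartment_iso by blast
  moreover have "?B \<in> apartments \<Phi> S D" by (rule folded_apartment[OF a u])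
  moreover have "half (- a) \<subseteq> A" using A_half(1)[OF a(1)] by blast
  ultimately obtain b where b: "b \<in> root_group D (half (- a))" "b ` ?B = A"
    using moufang unfolding moufang_building_def by (metis Un_upper1)
  have "half (- a) \<inter> u ` half (- a) = {}"
  proof (rule ccontr)
    assume "\<not> ?thesis"
    then obtain c d where c: "c \<in> half (- a)" "d \<in> half (- a)" "c = u d" by blast
    obtain w where w: "w \<in> weyl \<Phi>" "side (- a) w" "c = chamber_at w" using halfE[OF na c(1)] .
    obtain v where v: "v \<in> weyl \<Phi>" "side (- a) v" "d = chamber_at v" using halfE[OF na c(2)] .
    show False using moves_off_apartment[OF a u v(1) _ w(1)] side_uminus[OF a(1) v(1)] v w c(3) by simp
  qed
  then have "b ` half (- a) \<inter> b ` u ` half (- a) = {}" using root_group_inj[OF b(1)] by (metis image_Int image_empty)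
  moreover have "b ` half (- a) \<union> b ` u ` half (- a) = half a \<union> half (- a)"
    using b(2) A_half(1)[OF a(1)] by (simp add: image_Un)
  moreover have "b ` half (- a) = half (- a)" by (rule root_group_image_half[OF na b(1)])
  moreover have "X \<inter> Y = {} \<Longrightarrow> X \<union> Y = H \<union> H' \<Longrightarrow> X = H' \<Longrightarrow> H \<inter> H' = {} \<Longrightarrow> Y = H"
    for X Y H H' :: "'c set" by blast
  ultimately have "b ` u ` half (- a) = half a" using A_half(2)[OF a(1)] by metis
  then show thesis using that b(1) by blast
qed

lemma root_group_transport_unique:
  assumes a: "a \<in> \<Phi>" "nonisolated a" and b: "b \<in> root_group D (half a)" "b' \<in> root_group D (half a)"
    and X: "b ` X = half (- a)" "b' ` X = half (- a)"
  shows "b = b'"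
proof -
  let ?G = "aut_group D" let ?g = "inv\<^bsub>aut_group D\<^esub> b \<otimes>\<^bsub>aut_group D\<^esub> b'"
  note sg = subgroup_root_group[of D "half a"]
  have na: "- a \<in> \<Phi>" by (rule neg[OF a(1)])
  have g: "?g \<in> root_group D (half a)" using subgroup.m_closed[OF sg] subgroup.m_inv_closed[OF sg] b by blast
  have bc: "b \<in> carrier ?G" "b' \<in> carrier ?G" using b by (auto simp: root_group_def)
  have perm: "b permutes chambers D" by (rule root_group_permutes[OF b(1)])
  have geq: "?g = b' \<circ> inv_into UNIV b" by (simp add: inv_aut_group[OF bc(1)] mult_aut_group)
  have "X = inv_into UNIV b ` half (- a)"
    unfolding X(1)[symmetric] image_comp permutes_inv_o(2)[OF perm] by simp
  then have gX: "?g ` half (- a) = half (- a)" unfolding geq image_comp[symmetric] using X(2) by simp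
  obtain z where z: "z \<in> weyl \<Phi>" "side a z" "chamber_at z \<in> half a" using half_nonempty[OF a] .
  obtain c where c: "c \<in> weyl \<Phi>" "side (- a) c" "chamber_at c \<in> half (- a)"
    using half_nonempty[OF na] a(2) nonisolated_uminus by blast
  have "?g (chamber_at c) \<in> half (- a)" using gX c(3) by blast
  then obtain w where w: "w \<in> weyl \<Phi>" "side (- a) w" "?g (chamber_at c) = chamber_at w" using halfE[OF na] by blast
  obtain w1 where tp: "type_preserving ?g" using root_group_interior[OF a g] by blast
  have "dist (chamber_at z) (chamber_at w) = dist (chamber_at z) (chamber_at c)"
    using type_preserving_dist[OF tp chamber_at_chambers[OF z(1)] chamber_at_chambers[OF c(1)]]
    unfolding w(3) root_group_fixes_half[OF a(1) g z(3)] .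
  then have "w = c" by (rule dist_chamber_at_inject[OF z(1) w(1) c(1)])
  then have "?g = id" using root_group_rigid[OF a g c(3)] w(3) by simp
  then have "inv\<^bsub>?G\<^esub> b \<otimes>\<^bsub>?G\<^esub> b' = \<one>\<^bsub>?G\<^esub>" by (simp add: one_aut_group)
  then show ?thesis
    using group.inv_equality[OF group_aut_group _ bc(2) group.inv_closed[OF group_aut_group bc(1)]]
      group.inv_inv[OF group_aut_group bc(1)] group.inv_inv[OF group_aut_group bc(2)] by metis
qed

text \<open>A reflecting element \<open>x u y\<close> interchanges the two half-apartments. This determines \<open>y\<close>, and
  applied to its inverse it determines \<open>x\<close>.\<close>

lemma stabilizer_transport:
  assumes a: "a \<in> \<Phi>" "nonisolated a" and u: "u \<in> root_group D (half a)" "u \<noteq> id"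
    and x: "x \<in> root_group D (half (- a))" and y: "y \<in> root_group D (half (- a))"
    and A: "(y \<circ> u \<circ> x) ` A = A"
  shows "y ` u ` half (- a) = half a"
proof -
  let ?m = "y \<circ> u \<circ> x"
  have na: "- a \<in> \<Phi>" "nonisolated (- a)" using neg[OF a(1)] a(2) nonisolated_uminus by auto
  have mH: "?m ` half (- a) = y ` u ` half (- a)"
    unfolding image_comp[symmetric] root_group_image_half[OF na(1) x] ..
  have off: "y (u (chamber_at v)) \<in> half a" if v: "v \<in> weyl \<Phi>" "\<not> side a v" for v
  proof -
    have vH: "chamber_at v \<in> half (- a)" using chamber_at_half[OF na(1) v(1)] side_uminus[OF a(1) v(1)] v(2) by blast
    then have "y (u (chamber_at v)) \<in> ?m ` half (- a)" unfolding mH by blast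
    then have inA: "y (u (chamber_at v)) \<in> A" using A A_half(1)[OF a(1)] by blast
    have "y (u (chamber_at v)) \<notin> half (- a)"
    proof
      assume *: "y (u (chamber_at v)) \<in> half (- a)"
      then have "y (y (u (chamber_at v))) = y (u (chamber_at v))" by (rule root_group_fixes_half[OF na(1) y])
      then have "y (u (chamber_at v)) = u (chamber_at v)" by (rule injD[OF root_group_inj[OF y]])
      then obtain w where "w \<in> weyl \<Phi>" "u (chamber_at v) = chamber_at w" using * halfE[OF na(1)] by metis
      then show False using moves_off_apartment[OF a u v] by blast
    qed
    then show ?thesis using inA A_half(1)[OF a(1)] by blast
  qed
  obtain w1 where tpu: "type_preserving u" using root_group_interior[OF a u(1)] by blast
  obtain w2 where tpx: "type_preserving x" using root_group_interior[OF na x] by blast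
  obtain w3 where tpy: "type_preserving y" using root_group_interior[OF na y] by blast
  have dm: "dist (?m c) (?m d) = dist c d" if "c \<in> chambers D" "d \<in> chambers D" for c d
    using that type_preserving_dist[OF tpx] type_preserving_dist[OF tpu] type_preserving_dist[OF tpy]
      type_preserving_chambers[OF tpx] type_preserving_chambers[OF tpu] by simp
  show ?thesis
  proof
    show "y ` u ` half (- a) \<subseteq> half a"
    proof
      fix c assume "c \<in> y ` u ` half (- a)"
      then obtain d where d: "d \<in> half (- a)" "c = y (u d)" by blast
      obtain v where v: "v \<in> weyl \<Phi>" "side (- a) v" "d = chamber_at v" using halfE[OF na(1) d(1)] .
      show "c \<in> half a" unfolding d(2) v(3) using off[OF v(1)] side_uminus[OF a(1) v(1)] v(2) by blast
    qed
    show "half a \<subseteq> y ` u ` half (- a)"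
    proof
      fix c assume c: "c \<in> half a"
      then have "c \<in> ?m ` A" using A A_half(1)[OF a(1)] by blast
      then obtain v where v: "v \<in> weyl \<Phi>" "c = ?m (chamber_at v)" unfolding A_eq by blast
      have "\<not> side a v"
      proof
        \<comment> \<open>Otherwise the images of \<open>v\<close> and of its opposite chamber would be opposite chambers of the
          half-apartment.\<close>
        assume s: "side a v"
        have vw: "v \<circ> w0 \<in> weyl \<Phi>" by (rule weyl_comp[OF v(1) w0(1)])
        have ns: "\<not> side a (v \<circ> w0)" using side_w0[OF v(1) a(1)] s by blast
        have "chamber_at (v \<circ> w0) \<in> half (- a)"
          using chamber_at_half[OF na(1) vw] side_uminus[OF a(1) vw] ns by blast
        then have "?m (chamber_at (v \<circ> w0)) = y (u (chamber_at (v \<circ> w0)))"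
          using root_group_fixes_half[OF na(1) x] by simp
        then have o: "?m (chamber_at (v \<circ> w0)) \<in> half a" using off[OF vw ns] by (simp only:)
        obtain w where w: "w \<in> weyl \<Phi>" "side a w" "c = chamber_at w" using halfE[OF a(1) c] .
        obtain w' where w': "w' \<in> weyl \<Phi>" "side a w'" "?m (chamber_at (v \<circ> w0)) = chamber_at w'" using halfE[OF a(1) o] .
        have "dist (chamber_at w) (chamber_at w') = w0"
          using dm[OF chamber_at_chambers[OF v(1)] chamber_at_chambers[OF vw]] dist_chamber_at[OF v(1) w0(1)]
          unfolding w'(3) v(2)[symmetric] w(3) by simp
        then have "w' = w \<circ> w0" using dist_chamber_at'[OF w(1) w'(1)] by metis
        then show False using side_w0[OF w(1) a(1)] w(2) w'(2) by blast
      qed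
      then have "chamber_at v \<in> half (- a)"
        using chamber_at_half[OF na(1) v(1)] side_uminus[OF a(1) v(1)] by blast
      then show "c \<in> y ` u ` half (- a)" unfolding mH[symmetric] v(2) by (rule imageI)
    qed
  qed
qed

lemma reflecting_element_unique:
  assumes moufang: "moufang_building \<Phi> S D"
    and a: "a \<in> \<Phi>" "nonisolated a" and u: "u \<in> root_group D (half a) - {id}"
  shows "\<exists>!m. (\<exists>x\<in>root_group D (half (- a)) - {id}. \<exists>y\<in>root_group D (half (- a)) - {id}.
    m = x \<otimes>\<^bsub>aut_group D\<^esub> u \<otimes>\<^bsub>aut_group D\<^esub> y) \<and> m ` A = A"
proof -
  let ?G = "aut_group D" let ?U = "root_group D (half (- a))"
  let ?H = "half a" let ?H' = "half (- a)"
  have u': "u \<in> root_group D ?H" "u \<noteq> id" using u by auto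
  have na: "- a \<in> \<Phi>" "nonisolated (- a)" using neg[OF a(1)] a(2) nonisolated_uminus by auto
  note sg = subgroup_root_group
  have uc: "u \<in> carrier ?G" using u' by (auto simp: root_group_def)
  have up: "u permutes chambers D" by (rule root_group_permutes[OF u'(1)])
  have iu: "inv_into UNIV u \<in> root_group D ?H" using subgroup.m_inv_closed[OF sg u'(1)] unfolding inv_aut_group[OF uc] .
  have iu_ne: "inv_into UNIV u \<noteq> id"
  proof
    assume "inv_into UNIV u = id"
    then show False using permutes_inv_o(1)[OF up] u'(2) by simp
  qed
  have inv_perm: "inv_into UNIV g ` g ` X = X" "g ` inv_into UNIV g ` X = X" if "g permutes chambers D" for g X
    unfolding image_comp permutes_inv_o[OF that] by simp_all
  have m_eq: "x \<otimes>\<^bsub>?G\<^esub> u \<otimes>\<^bsub>?G\<^esub> y = y \<circ> u \<circ> x" for x y by (simp add: mult_aut_group comp_assoc)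
  have HH': "?H \<noteq> ?H'"
  proof -
    obtain w where "chamber_at w \<in> ?H" using half_nonempty[OF a] by blast
    then show ?thesis using A_half(2)[OF a(1)] by blast
  qed
  have uH: "u ` ?H = ?H" by (rule root_group_image_half[OF a(1) u'(1)])
  obtain y where y: "y \<in> ?U" "y ` u ` ?H' = ?H" using fold_back[OF moufang a u'] .
  obtain z where z: "z \<in> ?U" "z ` inv_into UNIV u ` ?H' = ?H" using fold_back[OF moufang a iu iu_ne] .
  have zc: "z \<in> carrier ?G" and zp: "z permutes chambers D"
    using z(1) root_group_permutes[OF z(1)] by (auto simp: root_group_def)
  \<comment> \<open>The factor \<open>x\<close> is the inverse of the factor that belongs to the inverse of \<open>u\<close>.\<close>
  define x where "x = inv_into UNIV z"
  have x: "x \<in> ?U" using subgroup.m_inv_closed[OF sg z(1)] unfolding inv_aut_group[OF zc] x_def .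
  have xH: "x ` ?H = inv_into UNIV u ` ?H'" unfolding z(2)[symmetric] x_def by (rule inv_perm(1)[OF zp])
  have "y \<noteq> id"
  proof
    assume "y = id"
    then have "inv_into UNIV u ` u ` ?H' = inv_into UNIV u ` u ` ?H" using y(2) uH by simp
    then show False using HH' unfolding inv_perm(1)[OF up] by blast
  qed
  have "x \<noteq> id"
  proof
    assume "x = id"
    then have "u ` ?H = u ` inv_into UNIV u ` ?H'" using xH by simp
    then show False using uH HH' inv_perm(2)[OF up] by simp
  qed
  have mA: "(y \<circ> u \<circ> x) ` A = A"
  proof -
    have "(y \<circ> u \<circ> x) ` ?H = ?H'"
      unfolding image_comp[symmetric] xH inv_perm(2)[OF up] by (rule root_group_image_half[OF na(1) y(1)])
    moreover have "(y \<circ> u \<circ> x) ` ?H' = ?H"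
      unfolding image_comp[symmetric] root_group_image_half[OF na(1) x] by (rule y(2))
    ultimately show ?thesis unfolding A_half(1)[OF a(1)] image_Un by blast
  qed
  have xyex: "\<exists>x'\<in>?U - {id}. \<exists>y'\<in>?U - {id}. y \<circ> u \<circ> x = x' \<otimes>\<^bsub>?G\<^esub> u \<otimes>\<^bsub>?G\<^esub> y'"
    unfolding m_eq by (intro bexI[of _ x] bexI[of _ y]) (use x y(1) \<open>x \<noteq> id\<close> \<open>y \<noteq> id\<close> in simp_all)
  show ?thesis
  proof (rule ex1I[of _ "y \<circ> u \<circ> x"])
    show "(\<exists>x'\<in>?U - {id}. \<exists>y'\<in>?U - {id}. y \<circ> u \<circ> x = x' \<otimes>\<^bsub>?G\<^esub> u \<otimes>\<^bsub>?G\<^esub> y') \<and> (y \<circ> u \<circ> x) ` A = A"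
      using xyex mA by blast
  next
    fix m assume "(\<exists>x'\<in>?U - {id}. \<exists>y'\<in>?U - {id}. m = x' \<otimes>\<^bsub>?G\<^esub> u \<otimes>\<^bsub>?G\<^esub> y') \<and> m ` A = A"
    then obtain x' y' where x': "x' \<in> ?U" and y': "y' \<in> ?U" and m: "m = y' \<circ> u \<circ> x'" "m ` A = A"
      unfolding m_eq by blast
    have yy: "y' ` u ` ?H' = ?H" by (rule stabilizer_transport[OF a u' x' y' m(2)[unfolded m(1)]])
    have "y' = y"
      by (rule root_group_transport_unique[OF na y' y(1), of "u ` ?H'"]) (use yy y(2) in simp_all)
    have cx': "x' \<in> carrier ?G" and px': "x' permutes chambers D"
      using x' root_group_permutes[OF x'] by (auto simp: root_group_def)
    have cy': "y' \<in> carrier ?G" and py': "y' permutes chambers D"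
      using y' root_group_permutes[OF y'] by (auto simp: root_group_def)
    have ix': "inv_into UNIV x' \<in> ?U" using subgroup.m_inv_closed[OF sg x'] unfolding inv_aut_group[OF cx'] .
    have iy': "inv_into UNIV y' \<in> ?U" using subgroup.m_inv_closed[OF sg y'] unfolding inv_aut_group[OF cy'] .
    have "(inv_into UNIV x' \<circ> inv_into UNIV u \<circ> inv_into UNIV y') ` m ` A = A"
      unfolding m(1) image_comp[symmetric] inv_perm(1)[OF py'] inv_perm(1)[OF up] inv_perm(1)[OF px'] ..
    then have "inv_into UNIV x' ` inv_into UNIV u ` ?H' = ?H"
      unfolding m(2) by (rule stabilizer_transport[OF a iu iu_ne iy' ix'])
    then have "inv_into UNIV x' = z"
      by (intro root_group_transport_unique[OF na ix' z(1), of "inv_into UNIV u ` ?H'"]) (use z(2) in simp_all)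
    then have "x' = x" unfolding x_def using permutes_inv_inv[OF px'] by metis
    then show "m = y \<circ> u \<circ> x" unfolding m(1) \<open>y' = y\<close> by simp
  qed
qed

subsection \<open>Independence of the labelling\<close>

text \<open>An isomorphism from the Coxeter complex to the apartment that permutes the colors
  still maps roots to roots: it intertwines reflections.\<close>

lemma half_of_iso:
  assumes iso: "chamber_iso (coxeter_complex \<Phi> S) (D\<lparr>chambers := A\<rparr>) \<sigma> \<pi>1" and a: "a \<in> \<Phi>"
  obtains b where "b \<in> \<Phi>" "\<pi>1 ` coxeter_root \<Phi> a = half b" "\<pi>1 ` coxeter_root \<Phi> (- a) = half (- b)"
proof -
  have bij: "bij_betw \<pi>1 (sectors \<Phi>) A" and \<sigma>I: "i \<in> I \<Longrightarrow> \<sigma> i \<in> I" for i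
    using iso colors_D bij_betw_apply[of \<sigma> I I i] by (simp_all add: chamber_iso_def chambers_coxeter colors_coxeter)
  have "\<exists>v\<in>weyl \<Phi>. chamber_at v = \<pi>1 (w ` S)" if "w \<in> weyl \<Phi>" for w
    using bij_betw_apply[OF bij sector_mem[OF that]] unfolding A_eq by (metis imageE)
  then obtain \<eta> where \<eta>: "\<And>w. w \<in> weyl \<Phi> \<Longrightarrow> \<eta> w \<in> weyl \<Phi>" "\<And>w. w \<in> weyl \<Phi> \<Longrightarrow> chamber_at (\<eta> w) = \<pi>1 (w ` S)"
    by metis
  have \<eta>_step: "\<eta> (w \<circ> refl_in i) = \<eta> w \<circ> refl_in (\<sigma> i)" if w: "w \<in> weyl \<Phi>" and i: "i \<in> I" for w i
  proof -
    have wi: "w \<circ> refl_in i \<in> weyl \<Phi>" by (rule weyl_refl_simple[OF i w])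
    have "adjacent (coxeter_complex \<Phi> S) i (w ` S) ((w \<circ> refl_in i) ` S)" using adjacent_coxeter i w by blast
    then have "adjacent (D\<lparr>chambers := A\<rparr>) (\<sigma> i) (\<pi>1 (w ` S)) (\<pi>1 ((w \<circ> refl_in i) ` S))"
      using iso sector_mem[OF w] sector_mem[OF wi] i unfolding chamber_iso_def chambers_coxeter colors_coxeter by blast
    then have "adjacent D (\<sigma> i) (chamber_at (\<eta> w)) (chamber_at (\<eta> (w \<circ> refl_in i)))"
      unfolding \<eta>(2)[OF w] \<eta>(2)[OF wi] by simp
    then show ?thesis using adjacent_chamber_at[OF \<eta>(1)[OF w] \<eta>(1)[OF wi]] by blast
  qed
  have \<eta>_inj: "w = v" if "w \<in> weyl \<Phi>" "v \<in> weyl \<Phi>" "\<eta> w = \<eta> v" for w v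
  proof -
    have "\<pi>1 (w ` S) = \<pi>1 (v ` S)" using \<eta>(2) that by metis
    then have "w ` S = v ` S" using inj_onD[OF bij_betw_imp_inj_on[OF bij]] sector_mem that by blast
    then show ?thesis by (rule sector_inject[OF that(1,2)])
  qed
  obtain w1 i1 where w1: "w1 \<in> weyl \<Phi>" "i1 \<in> I" "w1 i1 = a \<or> w1 i1 = - a"
  proof (cases "a \<in> Pos")
    case True
    then show thesis using that root_conj_simple_Pos[OF True] word_weyl by metis
  next
    case False
    then have "- a \<in> Pos" using uminus_Pos[OF a] by blast
    then show thesis using that root_conj_simple_Pos[of "- a"] word_weyl by metis
  qed
  define b where "b = \<eta> w1 (\<sigma> i1)"
  have b: "b \<in> \<Phi>" unfolding b_def by (rule weyl_isometry(3)[OF \<eta>(1)[OF w1(1)] simple_root[OF \<sigma>I[OF w1(2)]]])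
  \<comment> \<open>A statement that holds at \<open>w1\<close> and is preserved by adjacency holds everywhere.\<close>
  have conn: "Q v" if Q1: "Q w1" and Qs: "\<And>w i. w \<in> weyl \<Phi> \<Longrightarrow> i \<in> I \<Longrightarrow> Q w \<Longrightarrow> Q (w \<circ> refl_in i)"
    and v: "v \<in> weyl \<Phi>" for Q v
  proof -
    have "set f \<subseteq> I \<Longrightarrow> Q (w1 \<circ> word_value f)" for f
    proof (induction f rule: rev_induct)
      case (snoc i f)
      have "Q ((w1 \<circ> word_value f) \<circ> refl_in i)"
        by (rule Qs) (use snoc weyl_comp[OF w1(1) word_weyl] in \<open>auto simp: comp_def\<close>)
      moreover have "(w1 \<circ> word_value f) \<circ> refl_in i = w1 \<circ> word_value (f @ [i])"
        by (simp add: word_value_append comp_assoc)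
      ultimately show ?case by (simp only:)
    qed (use Q1 in simp)
    moreover obtain u where u: "u \<in> weyl \<Phi>" "v = w1 \<circ> u" using dist_chamber_at'[OF w1(1) v] by blast
    moreover obtain f where "set f \<subseteq> I" "word_value f = u" using weyl_word[OF u(1)] by blast
    ultimately show ?thesis by blast
  qed
  have refl: "\<eta> (refl_in a \<circ> w) = refl_in b \<circ> \<eta> w" if "w \<in> weyl \<Phi>" for w
  proof (rule conn[OF _ _ that])
    have "\<eta> (refl_in a \<circ> w1) = \<eta> w1 \<circ> refl_in (\<sigma> i1)"
      unfolding wall_refl[OF w1(1,3), symmetric] by (rule \<eta>_step[OF w1(1,2)])
    then show "\<eta> (refl_in a \<circ> w1) = refl_in b \<circ> \<eta> w1"
      unfolding b_def using weyl_refl_conj[OF \<eta>(1)[OF w1(1)], of "\<sigma> i1"] by simp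
  next
    fix w i assume w: "w \<in> weyl \<Phi>" and i: "i \<in> I" and IH: "\<eta> (refl_in a \<circ> w) = refl_in b \<circ> \<eta> w"
    have "\<eta> (refl_in a \<circ> (w \<circ> refl_in i)) = \<eta> (refl_in a \<circ> w) \<circ> refl_in (\<sigma> i)"
      unfolding comp_assoc[symmetric] by (rule \<eta>_step[OF weyl_refl[OF w a] i])
    then show "\<eta> (refl_in a \<circ> (w \<circ> refl_in i)) = refl_in b \<circ> \<eta> (w \<circ> refl_in i)"
      unfolding IH \<eta>_step[OF w i] by (simp only: comp_assoc)
  qed
  define b' where "b' = (if side a w1 \<longleftrightarrow> side b (\<eta> w1) then b else - b)"
  have b': "b' \<in> \<Phi>" "refl_in b' = refl_in b" unfolding b'_def using b neg refl_in_uminus by auto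
  have side: "side a w \<longleftrightarrow> side b' (\<eta> w)" if "w \<in> weyl \<Phi>" for w
  proof (rule conn[OF _ _ that])
    show "side a w1 \<longleftrightarrow> side b' (\<eta> w1)" unfolding b'_def using side_uminus[OF b \<eta>(1)[OF w1(1)]] by auto
  next
    fix w i assume w: "w \<in> weyl \<Phi>" and i: "i \<in> I" and IH: "side a w \<longleftrightarrow> side b' (\<eta> w)"
    have wi: "w \<circ> refl_in i \<in> weyl \<Phi>" by (rule weyl_refl_simple[OF i w])
    show "side a (w \<circ> refl_in i) \<longleftrightarrow> side b' (\<eta> (w \<circ> refl_in i))"
    proof (cases "w \<circ> refl_in i = refl_in a \<circ> w")
      case True
      have e: "\<eta> (w \<circ> refl_in i) = refl_in b' \<circ> \<eta> w" unfolding True b'(2) by (rule refl[OF w])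
      show ?thesis unfolding e side_refl[OF \<eta>(1)[OF w] b'(1)] unfolding True side_refl[OF w a] using IH by blast
    next
      case False
      have 1: "side a (w \<circ> refl_in i) = side a w" using side_crossing[OF w i a] False by blast
      have "\<eta> w \<circ> refl_in (\<sigma> i) \<noteq> refl_in b' \<circ> \<eta> w"
        unfolding b'(2) refl[OF w, symmetric] \<eta>_step[OF w i, symmetric]
        using \<eta>_inj[OF wi weyl_refl[OF w a]] False by blast
      then have "side b' (\<eta> w \<circ> refl_in (\<sigma> i)) = side b' (\<eta> w)"
        using side_crossing[OF \<eta>(1)[OF w] \<sigma>I[OF i] b'(1)] by blast
      then show ?thesis unfolding 1 \<eta>_step[OF w i] using IH by blast
    qed
  qed
  have onto: "\<exists>w\<in>weyl \<Phi>. v = \<eta> w" if v: "v \<in> weyl \<Phi>" for v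
  proof -
    have "chamber_at v \<in> \<pi>1 ` sectors \<Phi>"
      unfolding bij_betw_imp_surj_on[OF bij] by (rule chamber_at_A[OF v])
    then obtain T where T: "T \<in> sectors \<Phi>" "chamber_at v = \<pi>1 T" by (elim imageE)
    obtain w where w: "w \<in> weyl \<Phi>" "T = w ` S" using T(1) unfolding sectors_weyl by blast
    have "chamber_at v = chamber_at (\<eta> w)" unfolding \<eta>(2)[OF w(1)] T(2) w(2) ..
    then show ?thesis using chamber_at_inject[OF v \<eta>(1)[OF w(1)]] w(1) by blast
  qed
  have img: "\<pi>1 ` coxeter_root \<Phi> c = half d"
    if cd: "c \<in> \<Phi>" "d \<in> \<Phi>" "\<And>w. w \<in> weyl \<Phi> \<Longrightarrow> side c w \<longleftrightarrow> side d (\<eta> w)" for c d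
  proof -
    have "coxeter_root \<Phi> c = (\<lambda>w. w ` S) ` {w \<in> weyl \<Phi>. side c w}"
      unfolding coxeter_root_def sectors_weyl side_def using sector_halfspace_iff[OF _ cd(1)] by blast
    then have "\<pi>1 ` coxeter_root \<Phi> c = (\<lambda>w. \<pi>1 (w ` S)) ` {w \<in> weyl \<Phi>. side c w}" by (simp only: image_image)
    also have "\<dots> = (\<lambda>w. chamber_at (\<eta> w)) ` {w \<in> weyl \<Phi>. side d (\<eta> w)}"
      by (rule image_cong) (use cd(3) \<eta>(2) in auto)
    also have "\<dots> = half d" unfolding half_eq[OF cd(2)] using onto \<eta>(1) by blast
    finally show ?thesis .
  qed
  have "side (- a) w \<longleftrightarrow> side (- b') (\<eta> w)" if w: "w \<in> weyl \<Phi>" for w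
    using side[OF w] side_uminus[OF a w] side_uminus[OF b'(1) \<eta>(1)[OF w]] by blast
  then show thesis using that[OF b'(1) img[OF a b'(1) side] img[OF neg[OF a] neg[OF b'(1)]]] by blast
qed

end

section \<open>The root set of type F4\<close>

lemma int_sq_le_1: "(k::int)\<^sup>2 \<le> 1 \<Longrightarrow> k = -1 \<or> k = 0 \<or> k = 1"
  using abs_square_le_1[of k] by linarith

lemma sum_four_squares_1:
  fixes a b c d :: int
  assumes "a\<^sup>2 + b\<^sup>2 + c\<^sup>2 + d\<^sup>2 = 1"
  shows "(a\<^sup>2 = 1 \<and> b = 0 \<and> c = 0 \<and> d = 0) \<or> (a = 0 \<and> b\<^sup>2 = 1 \<and> c = 0 \<and> d = 0) \<or>
    (a = 0 \<and> b = 0 \<and> c\<^sup>2 = 1 \<and> d = 0) \<or> (a = 0 \<and> b = 0 \<and> c = 0 \<and> d\<^sup>2 = 1)"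
proof -
  have n: "0 \<le> a\<^sup>2" "0 \<le> b\<^sup>2" "0 \<le> c\<^sup>2" "0 \<le> d\<^sup>2" by simp_all
  have "a\<^sup>2 \<le> 1" "b\<^sup>2 \<le> 1" "c\<^sup>2 \<le> 1" "d\<^sup>2 \<le> 1" using assms n by linarith+
  from int_sq_le_1[OF this(1)] int_sq_le_1[OF this(2)] int_sq_le_1[OF this(3)] int_sq_le_1[OF this(4)] assms
  show ?thesis by (elim disjE) simp_all
qed

lemma sum_four_squares_2:
  fixes a b c d :: int
  assumes "a\<^sup>2 + b\<^sup>2 + c\<^sup>2 + d\<^sup>2 = 2"
  shows "(a\<^sup>2 = 1 \<and> b\<^sup>2 = 1 \<and> c = 0 \<and> d = 0) \<or> (a\<^sup>2 = 1 \<and> b = 0 \<and> c\<^sup>2 = 1 \<and> d = 0) \<or>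
    (a\<^sup>2 = 1 \<and> b = 0 \<and> c = 0 \<and> d\<^sup>2 = 1) \<or> (a = 0 \<and> b\<^sup>2 = 1 \<and> c\<^sup>2 = 1 \<and> d = 0) \<or>
    (a = 0 \<and> b\<^sup>2 = 1 \<and> c = 0 \<and> d\<^sup>2 = 1) \<or> (a = 0 \<and> b = 0 \<and> c\<^sup>2 = 1 \<and> d\<^sup>2 = 1)"
proof -
  have n: "0 \<le> a\<^sup>2" "0 \<le> b\<^sup>2" "0 \<le> c\<^sup>2" "0 \<le> d\<^sup>2" by simp_all
  have le: "x = -1 \<or> x = 0 \<or> x = 1" if "x\<^sup>2 \<le> 2" for x :: int
  proof (rule int_sq_le_1, rule ccontr)
    assume "\<not> x\<^sup>2 \<le> 1"
    then have "x\<^sup>2 = 2" using that by linarith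
    have "\<bar>x\<bar> \<ge> 2"
      using \<open>\<not> x\<^sup>2 \<le> 1\<close> abs_square_le_1[of x] by linarith
    then have "\<bar>x\<bar>\<^sup>2 \<ge> 2\<^sup>2" by (intro power_mono) auto
    then show False using \<open>x\<^sup>2 = 2\<close> by simp
  qed
  have "a\<^sup>2 \<le> 2" "b\<^sup>2 \<le> 2" "c\<^sup>2 \<le> 2" "d\<^sup>2 \<le> 2" using assms n by linarith+
  from le[OF this(1)] le[OF this(2)] le[OF this(3)] le[OF this(4)] assms
  show ?thesis by (elim disjE) simp_all
qed

lemma sum_four_odd_squares:
  fixes a b c d :: int
  assumes "a\<^sup>2 + b\<^sup>2 + c\<^sup>2 + d\<^sup>2 = 4" "odd a" "odd b" "odd c" "odd d"
  shows "a\<^sup>2 = 1 \<and> b\<^sup>2 = 1 \<and> c\<^sup>2 = 1 \<and> d\<^sup>2 = 1"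
proof -
  have "x\<^sup>2 \<ge> 1" if "odd x" for x :: int
  proof -
    have "x \<noteq> 0" using that by auto
    then have "0 < x\<^sup>2" by simp
    then show ?thesis by linarith
  qed
  from this[OF assms(2)] this[OF assms(3)] this[OF assms(4)] this[OF assms(5)] assms(1) show ?thesis by linarith
qed

lemma sq_1_cases: "(k::int)\<^sup>2 = 1 \<Longrightarrow> k = 1 \<or> k = -1"
  by (simp add: power2_eq_1_iff)

text \<open>Coordinates with respect to an orthonormal basis. The short roots are the unit vectors whose
  doubled coordinates are integers of equal parity, the long roots are the unit vectors whose
  coordinates are integral multiples of \<open>1 / \<surd>2\<close>.\<close>

locale frame4 =
  fixes e0 e1 e2 e3 :: "'v::euclidean_space"
  assumes orth: "e0 \<bullet> e0 = 1" "e1 \<bullet> e1 = 1" "e2 \<bullet> e2 = 1" "e3 \<bullet> e3 = 1"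
      "e0 \<bullet> e1 = 0" "e0 \<bullet> e2 = 0" "e0 \<bullet> e3 = 0" "e1 \<bullet> e2 = 0" "e1 \<bullet> e3 = 0" "e2 \<bullet> e3 = 0"
    and expand: "\<And>v. v = (v \<bullet> e0) *\<^sub>R e0 + (v \<bullet> e1) *\<^sub>R e1 + (v \<bullet> e2) *\<^sub>R e2 + (v \<bullet> e3) *\<^sub>R e3"
begin

lemma orth': "e1 \<bullet> e0 = 0" "e2 \<bullet> e0 = 0" "e3 \<bullet> e0 = 0" "e2 \<bullet> e1 = 0" "e3 \<bullet> e1 = 0" "e3 \<bullet> e2 = 0"
  using orth by (simp_all add: inner_commute)

lemma inner_frame: "v \<bullet> w = (v \<bullet> e0) * (w \<bullet> e0) + (v \<bullet> e1) * (w \<bullet> e1) + (v \<bullet> e2) * (w \<bullet> e2) + (v \<bullet> e3) * (w \<bullet> e3)"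
proof -
  have "v \<bullet> w = v \<bullet> ((w \<bullet> e0) *\<^sub>R e0 + (w \<bullet> e1) *\<^sub>R e1 + (w \<bullet> e2) *\<^sub>R e2 + (w \<bullet> e3) *\<^sub>R e3)"
    using expand[of w] by simp
  then show ?thesis by (simp add: inner_add_right mult.commute)
qed

lemma frame_eqI:
  assumes "v \<bullet> e0 = w \<bullet> e0" "v \<bullet> e1 = w \<bullet> e1" "v \<bullet> e2 = w \<bullet> e2" "v \<bullet> e3 = w \<bullet> e3"
  shows "v = w"
  by (subst expand, subst (2) expand) (simp only: assms)

definition short_root :: "'v \<Rightarrow> bool" where
  "short_root v \<longleftrightarrow> v \<bullet> v = 1 \<and> (\<exists>(a::int) (b::int) (c::int) (d::int). v \<bullet> e0 = a / 2 \<and> v \<bullet> e1 = b / 2 \<and> v \<bullet> e2 = c / 2 \<and> v \<bullet> e3 = d / 2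
     \<and> even (a - b) \<and> even (a - c) \<and> even (a - d))"

definition long_root :: "'v \<Rightarrow> bool" where
  "long_root v \<longleftrightarrow> v \<bullet> v = 1 \<and> (\<exists>(a::int) (b::int) (c::int) (d::int). v \<bullet> e0 = a / sqrt 2 \<and> v \<bullet> e1 = b / sqrt 2 \<and>
     v \<bullet> e2 = c / sqrt 2 \<and> v \<bullet> e3 = d / sqrt 2)"

definition F4 :: "'v set" where "F4 = {v. short_root v \<or> long_root v}"

lemma short_root_cases:
  assumes "short_root v"
  obtains (axis) a b c d :: int where "v \<bullet> e0 = a" "v \<bullet> e1 = b" "v \<bullet> e2 = c" "v \<bullet> e3 = d"
      "a\<^sup>2 + b\<^sup>2 + c\<^sup>2 + d\<^sup>2 = 1"
  | (half) a b c d :: int where "v \<bullet> e0 = a / 2" "v \<bullet> e1 = b / 2" "v \<bullet> e2 = c / 2" "v \<bullet> e3 = d / 2"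
      "a\<^sup>2 = 1" "b\<^sup>2 = 1" "c\<^sup>2 = 1" "d\<^sup>2 = 1"
proof -
  obtain a b c d :: int where v: "v \<bullet> v = 1" "v \<bullet> e0 = a / 2" "v \<bullet> e1 = b / 2" "v \<bullet> e2 = c / 2" "v \<bullet> e3 = d / 2"
    and par: "even (a - b)" "even (a - c)" "even (a - d)"
    using assms unfolding short_root_def by blast
  have "(a / 2) * (a / 2) + (b / 2) * (b / 2) + (c / 2) * (c / 2) + (d / 2) * (d / 2) = (1 :: real)"
    using v(1) inner_frame[of v v] by (simp only: v(2-5))
  then have "real_of_int (a\<^sup>2 + b\<^sup>2 + c\<^sup>2 + d\<^sup>2) = real_of_int 4"
    by (simp add: power2_eq_square)
  then have sum: "a\<^sup>2 + b\<^sup>2 + c\<^sup>2 + d\<^sup>2 = 4" by (simp only: of_int_eq_iff)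
  show thesis
  proof (cases "even a")
    case True
    then have "even b" "even c" "even d" using par by auto
    with True obtain a' b' c' d' where e: "a = 2 * a'" "b = 2 * b'" "c = 2 * c'" "d = 2 * d'" by (meson evenE)
    have "a'\<^sup>2 + b'\<^sup>2 + c'\<^sup>2 + d'\<^sup>2 = 1" using sum unfolding e by (simp add: power_mult_distrib)
    then show thesis using axis[of a' b' c' d'] v(2-5) by (simp add: e)
  next
    case False
    then have "odd b" "odd c" "odd d" using par by auto
    then show thesis using half[OF v(2-5)] sum_four_odd_squares[OF sum False] by blast
  qed
qed

lemma long_rootE:
  assumes "long_root v"
  obtains a b c d :: int where "v \<bullet> e0 = a / sqrt 2" "v \<bullet> e1 = b / sqrt 2" "v \<bullet> e2 = c / sqrt 2" "v \<bullet> e3 = d / sqrt 2"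
      "a\<^sup>2 + b\<^sup>2 + c\<^sup>2 + d\<^sup>2 = 2"
proof -
  obtain a b c d :: int where v: "v \<bullet> v = 1" "v \<bullet> e0 = a / sqrt 2" "v \<bullet> e1 = b / sqrt 2" "v \<bullet> e2 = c / sqrt 2" "v \<bullet> e3 = d / sqrt 2"
    using assms unfolding long_root_def by blast
  have "(a / sqrt 2) * (a / sqrt 2) + (b / sqrt 2) * (b / sqrt 2) + (c / sqrt 2) * (c / sqrt 2) + (d / sqrt 2) * (d / sqrt 2) = (1 :: real)"
    using v(1) inner_frame[of v v] by (simp only: v(2-5))
  then have "real_of_int (a\<^sup>2 + b\<^sup>2 + c\<^sup>2 + d\<^sup>2) = real_of_int 2"
    by (simp add: power2_eq_square)
  then have "a\<^sup>2 + b\<^sup>2 + c\<^sup>2 + d\<^sup>2 = 2" by (simp only: of_int_eq_iff)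
  then show thesis using that v by blast
qed

lemma F4_unit: "v \<in> F4 \<Longrightarrow> v \<bullet> v = 1"
  by (auto simp: F4_def short_root_def long_root_def)

lemma F4_refl:
  assumes x: "x \<in> F4" and y: "y \<in> F4"
  shows "refl_in x y \<in> F4"
proof -
  have norm: "refl_in x y \<bullet> refl_in x y = 1" using inner_refl_in[OF F4_unit[OF x]] F4_unit[OF y] by simp
  have co: "refl_in x y \<bullet> w = y \<bullet> w - 2 * (y \<bullet> x) * (x \<bullet> w)" for w
    by (simp add: refl_in_def inner_diff_left)
  consider "short_root x" "short_root y" | "short_root x" "long_root y" | "long_root x" "short_root y" | "long_root x" "long_root y"
    using x y unfolding F4_def by blast
  then show ?thesis
  proof cases
    case 1
    obtain a b c d :: int where X: "x \<bullet> e0 = a / 2" "x \<bullet> e1 = b / 2" "x \<bullet> e2 = c / 2" "x \<bullet> e3 = d / 2"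
      and px: "even (a - b)" "even (a - c)" "even (a - d)" using 1(1) unfolding short_root_def by blast
    obtain a' b' c' d' :: int where Y: "y \<bullet> e0 = a' / 2" "y \<bullet> e1 = b' / 2" "y \<bullet> e2 = c' / 2" "y \<bullet> e3 = d' / 2"
      and py: "even (a' - b')" "even (a' - c')" "even (a' - d')" using 1(2) unfolding short_root_def by blast
    have "even (a' * a + b' * b + c' * c + d' * d)" using px py by (cases "even a"; cases "even a'") auto
    then obtain k where k: "a' * a + b' * b + c' * c + d' * d = 2 * k" by blast
    have "4 * (y \<bullet> x) = real_of_int (a' * a + b' * b + c' * c + d' * d)"
      unfolding inner_frame[of y x] X Y by simp
    then have kx: "2 * (y \<bullet> x) = k" unfolding k by simp
    have "short_root (refl_in x y)"
      unfolding short_root_def co[of e0] co[of e1] co[of e2] co[of e3] kx X Y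
    proof (intro conjI exI)
      show "refl_in x y \<bullet> refl_in x y = 1" by fact
      show "real_of_int a' / 2 - k * (real_of_int a / 2) = real_of_int (a' - k * a) / 2"
        "real_of_int b' / 2 - k * (real_of_int b / 2) = real_of_int (b' - k * b) / 2"
        "real_of_int c' / 2 - k * (real_of_int c / 2) = real_of_int (c' - k * c) / 2"
        "real_of_int d' / 2 - k * (real_of_int d / 2) = real_of_int (d' - k * d) / 2"
        by (simp_all add: diff_divide_distrib)
      show "even (a' - k * a - (b' - k * b))" "even (a' - k * a - (c' - k * c))" "even (a' - k * a - (d' - k * d))"
        using px py by auto
    qed
    then show ?thesis by (simp add: F4_def)
  next
    case 2
    obtain a b c d :: int where X: "x \<bullet> e0 = a / 2" "x \<bullet> e1 = b / 2" "x \<bullet> e2 = c / 2" "x \<bullet> e3 = d / 2"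
      and px: "even (a - b)" "even (a - c)" "even (a - d)" using 2(1) unfolding short_root_def by blast
    obtain a' b' c' d' :: int where Y: "y \<bullet> e0 = a' / sqrt 2" "y \<bullet> e1 = b' / sqrt 2" "y \<bullet> e2 = c' / sqrt 2" "y \<bullet> e3 = d' / sqrt 2"
      and ny: "a'\<^sup>2 + b'\<^sup>2 + c'\<^sup>2 + d'\<^sup>2 = 2" using long_rootE[OF 2(2)] by blast
    define k where "k = a' * a + b' * b + c' * c + d' * d"
    have kx: "2 * (y \<bullet> x) = k / sqrt 2"
      unfolding inner_frame[of y x] X Y k_def by (simp add: add_divide_distrib)
    have "even (a'\<^sup>2 + b'\<^sup>2 + c'\<^sup>2 + d'\<^sup>2)" unfolding ny by simp
    then have "even (a' + b' + c' + d')" by simp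
    then have k2: "even k \<or> even a" unfolding k_def using px by auto
    then have ek: "even (k * a)" "even (k * b)" "even (k * c)" "even (k * d)" using px by auto
    have "long_root (refl_in x y)"
      unfolding long_root_def co[of e0] co[of e1] co[of e2] co[of e3] kx X Y
    proof (intro conjI exI)
      show "refl_in x y \<bullet> refl_in x y = 1" by fact
      show "real_of_int a' / sqrt 2 - k / sqrt 2 * (real_of_int a / 2) = real_of_int (a' - k * a div 2) / sqrt 2"
        "real_of_int b' / sqrt 2 - k / sqrt 2 * (real_of_int b / 2) = real_of_int (b' - k * b div 2) / sqrt 2"
        "real_of_int c' / sqrt 2 - k / sqrt 2 * (real_of_int c / 2) = real_of_int (c' - k * c div 2) / sqrt 2"
        "real_of_int d' / sqrt 2 - k / sqrt 2 * (real_of_int d / 2) = real_of_int (d' - k * d div 2) / sqrt 2"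
        using ek by (simp_all add: diff_divide_distrib real_of_int_div)
    qed
    then show ?thesis by (simp add: F4_def)
  next
    case 3
    obtain a b c d :: int where X: "x \<bullet> e0 = a / sqrt 2" "x \<bullet> e1 = b / sqrt 2" "x \<bullet> e2 = c / sqrt 2" "x \<bullet> e3 = d / sqrt 2"
      and nx: "a\<^sup>2 + b\<^sup>2 + c\<^sup>2 + d\<^sup>2 = 2" using long_rootE[OF 3(1)] by blast
    obtain a' b' c' d' :: int where Y: "y \<bullet> e0 = a' / 2" "y \<bullet> e1 = b' / 2" "y \<bullet> e2 = c' / 2" "y \<bullet> e3 = d' / 2"
      and py: "even (a' - b')" "even (a' - c')" "even (a' - d')" using 3(2) unfolding short_root_def by blast
    define k where "k = a' * a + b' * b + c' * c + d' * d"
    have kx: "2 * (y \<bullet> x) = k / sqrt 2"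
      unfolding inner_frame[of y x] X Y k_def by (simp add: add_divide_distrib)
    have "even (a\<^sup>2 + b\<^sup>2 + c\<^sup>2 + d\<^sup>2)" unfolding nx by simp
    then have "even (a + b + c + d)" by simp
    then have ek: "even k" unfolding k_def using py by (cases "even a'") auto
    have co': "real_of_int k / sqrt 2 * (real_of_int m / sqrt 2) = real_of_int k * real_of_int m / 2" for m
      by simp
    have "short_root (refl_in x y)"
      unfolding short_root_def co[of e0] co[of e1] co[of e2] co[of e3] kx X Y co'
    proof (intro conjI exI)
      show "refl_in x y \<bullet> refl_in x y = 1" by fact
      show "real_of_int a' / 2 - real_of_int k * real_of_int a / 2 = real_of_int (a' - k * a) / 2"
        "real_of_int b' / 2 - real_of_int k * real_of_int b / 2 = real_of_int (b' - k * b) / 2"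
        "real_of_int c' / 2 - real_of_int k * real_of_int c / 2 = real_of_int (c' - k * c) / 2"
        "real_of_int d' / 2 - real_of_int k * real_of_int d / 2 = real_of_int (d' - k * d) / 2"
        by (simp_all add: diff_divide_distrib)
      show "even (a' - k * a - (b' - k * b))" "even (a' - k * a - (c' - k * c))" "even (a' - k * a - (d' - k * d))"
        using ek py by auto
    qed
    then show ?thesis by (simp add: F4_def)
  next
    case 4
    obtain a b c d :: int where X: "x \<bullet> e0 = a / sqrt 2" "x \<bullet> e1 = b / sqrt 2" "x \<bullet> e2 = c / sqrt 2" "x \<bullet> e3 = d / sqrt 2"
      using long_rootE[OF 4(1)] by metis
    obtain a' b' c' d' :: int where Y: "y \<bullet> e0 = a' / sqrt 2" "y \<bullet> e1 = b' / sqrt 2" "y \<bullet> e2 = c' / sqrt 2" "y \<bullet> e3 = d' / sqrt 2"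
      using long_rootE[OF 4(2)] by metis
    define k where "k = a' * a + b' * b + c' * c + d' * d"
    have half: "(p / sqrt 2) * (r / sqrt 2) = p * r / 2" for p r :: real by simp
    have kx: "2 * (y \<bullet> x) = real_of_int k"
      unfolding inner_frame[of y x] X Y k_def half of_int_add of_int_mult by (simp only: distrib_left)
    have "long_root (refl_in x y)"
      unfolding long_root_def co[of e0] co[of e1] co[of e2] co[of e3] kx X Y
    proof (intro conjI exI)
      show "refl_in x y \<bullet> refl_in x y = 1" by fact
      show "real_of_int a' / sqrt 2 - k * (real_of_int a / sqrt 2) = real_of_int (a' - k * a) / sqrt 2"
        "real_of_int b' / sqrt 2 - k * (real_of_int b / sqrt 2) = real_of_int (b' - k * b) / sqrt 2"
        "real_of_int c' / sqrt 2 - k * (real_of_int c / sqrt 2) = real_of_int (c' - k * c) / sqrt 2"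
        "real_of_int d' / sqrt 2 - k * (real_of_int d / sqrt 2) = real_of_int (d' - k * d) / sqrt 2"
        by (simp_all add: diff_divide_distrib)
    qed
    then show ?thesis by (simp add: F4_def)
  qed
qed

text \<open>The simple roots for the chamber \<open>x\<^sub>1 > x\<^sub>2 > x\<^sub>3 > 0\<close>, \<open>x\<^sub>0 > x\<^sub>1 + x\<^sub>2 + x\<^sub>3\<close>.\<close>

definition n1 :: 'v where "n1 = (1 / sqrt 2) *\<^sub>R (e1 - e2)"
definition n2 :: 'v where "n2 = (1 / sqrt 2) *\<^sub>R (e2 - e3)"
definition n3 :: 'v where "n3 = e3"
definition n4 :: 'v where "n4 = (1 / 2) *\<^sub>R (e0 - e1 - e2 - e3)"

lemma coords_n:
  "n1 \<bullet> e0 = 0" "n1 \<bullet> e1 = 1 / sqrt 2" "n1 \<bullet> e2 = - 1 / sqrt 2" "n1 \<bullet> e3 = 0"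
  "n2 \<bullet> e0 = 0" "n2 \<bullet> e1 = 0" "n2 \<bullet> e2 = 1 / sqrt 2" "n2 \<bullet> e3 = - 1 / sqrt 2"
  "n3 \<bullet> e0 = 0" "n3 \<bullet> e1 = 0" "n3 \<bullet> e2 = 0" "n3 \<bullet> e3 = 1"
  "n4 \<bullet> e0 = 1 / 2" "n4 \<bullet> e1 = - 1 / 2" "n4 \<bullet> e2 = - 1 / 2" "n4 \<bullet> e3 = - 1 / 2"
  by (simp_all add: n1_def n2_def n3_def n4_def inner_diff_left orth orth')

lemma inner_n:
  "v \<bullet> n1 = (v \<bullet> e1 - v \<bullet> e2) / sqrt 2" "v \<bullet> n2 = (v \<bullet> e2 - v \<bullet> e3) / sqrt 2"
  "v \<bullet> n3 = v \<bullet> e3" "v \<bullet> n4 = (v \<bullet> e0 - v \<bullet> e1 - v \<bullet> e2 - v \<bullet> e3) / 2"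
  by (simp_all add: n1_def n2_def n3_def n4_def inner_diff_right diff_divide_distrib)

lemma gram:
  "n1 \<bullet> n1 = 1" "n2 \<bullet> n2 = 1" "n3 \<bullet> n3 = 1" "n4 \<bullet> n4 = 1" "n1 \<bullet> n2 = - 1 / 2" "n1 \<bullet> n3 = 0" "n1 \<bullet> n4 = 0"
  "n2 \<bullet> n3 = - 1 / sqrt 2" "n2 \<bullet> n4 = 0" "n3 \<bullet> n4 = - 1 / 2"
  unfolding inner_n coords_n by (simp_all add: field_simps)

lemma n_root: "n1 \<in> F4" "n2 \<in> F4" "n3 \<in> F4" "n4 \<in> F4"
proof -
  have "long_root n1" unfolding long_root_def coords_n gram
    by (intro conjI exI[of _ 0] exI[of _ 1] exI[of _ "-1"] refl) simp_all
  then show "n1 \<in> F4" by (simp add: F4_def)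
  have "long_root n2" unfolding long_root_def coords_n gram
    by (rule conjI[OF refl], rule exI[of _ 0], rule exI[of _ 0], rule exI[of _ 1], rule exI[of _ "-1"]) simp
  then show "n2 \<in> F4" by (simp add: F4_def)
  have "short_root n3" unfolding short_root_def coords_n gram
    by (rule conjI[OF refl], rule exI[of _ 0], rule exI[of _ 0], rule exI[of _ 0], rule exI[of _ 2]) simp
  then show "n3 \<in> F4" by (simp add: F4_def)
  have "short_root n4" unfolding short_root_def coords_n gram
    by (rule conjI[OF refl], rule exI[of _ 1], rule exI[of _ "-1"], rule exI[of _ "-1"], rule exI[of _ "-1"]) simp
  then show "n4 \<in> F4" by (simp add: F4_def)
qed

text \<open>Coordinates with respect to the simple roots.\<close>

definition comb :: "real \<Rightarrow> real \<Rightarrow> real \<Rightarrow> real \<Rightarrow> 'v" where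
  "comb a b c d = a *\<^sub>R n1 + b *\<^sub>R n2 + c *\<^sub>R n3 + d *\<^sub>R n4"

lemma comb_coords:
  "v = comb (sqrt 2 * (v \<bullet> e0 + v \<bullet> e1)) (sqrt 2 * (2 * (v \<bullet> e0) + v \<bullet> e1 + v \<bullet> e2))
     (3 * (v \<bullet> e0) + v \<bullet> e1 + v \<bullet> e2 + v \<bullet> e3) (2 * (v \<bullet> e0))"
  by (rule frame_eqI) (simp_all add: comb_def inner_add_left coords_n)

lemma F4_comb:
  assumes v: "v \<in> F4"
  obtains a b c d where "v = comb a b c d" "(0 \<le> a \<and> 0 \<le> b \<and> 0 \<le> c \<and> 0 \<le> d) \<or> (a \<le> 0 \<and> b \<le> 0 \<and> c \<le> 0 \<and> d \<le> 0)"
proof -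
  define x0 x1 x2 x3 where x: "x0 = v \<bullet> e0" "x1 = v \<bullet> e1" "x2 = v \<bullet> e2" "x3 = v \<bullet> e3"
  have "(0 \<le> x0 + x1 \<and> 0 \<le> 2 * x0 + x1 + x2 \<and> 0 \<le> 3 * x0 + x1 + x2 + x3 \<and> 0 \<le> x0) \<or>
        (x0 + x1 \<le> 0 \<and> 2 * x0 + x1 + x2 \<le> 0 \<and> 3 * x0 + x1 + x2 + x3 \<le> 0 \<and> x0 \<le> 0)" (is "?P x0 x1 x2 x3")
  proof (cases "short_root v")
    case True
    then show ?thesis
    proof (cases rule: short_root_cases)
      case (axis a b c d)
      then show ?thesis unfolding x
        using sum_four_squares_1[OF axis(5)] by (auto dest!: sq_1_cases)
    next
      case (half a b c d)
      then show ?thesis unfolding x using sq_1_cases[of a] sq_1_cases[of b] sq_1_cases[of c] sq_1_cases[of d] by auto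
    qed
  next
    case False
    then have "long_root v" using v by (simp add: F4_def)
    then obtain a b c d :: int where l: "v \<bullet> e0 = a / sqrt 2" "v \<bullet> e1 = b / sqrt 2" "v \<bullet> e2 = c / sqrt 2" "v \<bullet> e3 = d / sqrt 2"
      "a\<^sup>2 + b\<^sup>2 + c\<^sup>2 + d\<^sup>2 = 2" by (rule long_rootE)
    have P: "?P (real_of_int a) (real_of_int b) (real_of_int c) (real_of_int d)"
      using sum_four_squares_2[OF l(5)] by (auto dest!: sq_1_cases)
    have eqs: "x0 = a * (1 / sqrt 2)" "x1 = b * (1 / sqrt 2)" "x2 = c * (1 / sqrt 2)" "x3 = d * (1 / sqrt 2)"
      using l unfolding x by simp_all
    have scale: "?P (p0 * s) (p1 * s) (p2 * s) (p3 * s)" if "?P p0 p1 p2 p3" "s > 0" for p0 p1 p2 p3 s :: real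
    proof -
      have "p0 * s + p1 * s = (p0 + p1) * s" "2 * (p0 * s) + p1 * s + p2 * s = (2 * p0 + p1 + p2) * s"
        "3 * (p0 * s) + p1 * s + p2 * s + p3 * s = (3 * p0 + p1 + p2 + p3) * s" by (simp_all add: algebra_simps)
      then show ?thesis using that by (auto simp: zero_le_mult_iff mult_le_0_iff)
    qed
    show ?thesis unfolding eqs by (rule scale[OF P]) simp
  qed
  then show thesis
    using that[OF comb_coords[of v]] unfolding x[symmetric] by (auto simp: zero_le_mult_iff mult_le_0_iff)
qed

text \<open>A vector in the interior of the chamber.\<close>

definition base_point :: 'v where "base_point = 8 *\<^sub>R e0 + 3 *\<^sub>R e1 + 2 *\<^sub>R e2 + e3"

lemma base_point_n: "base_point \<bullet> n1 > 0" "base_point \<bullet> n2 > 0" "base_point \<bullet> n3 > 0" "base_point \<bullet> n4 > 0"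
  unfolding inner_n base_point_def by (simp_all add: inner_add_left orth orth')

lemma inner_comb: "p \<bullet> comb a b c d = a * (p \<bullet> n1) + b * (p \<bullet> n2) + c * (p \<bullet> n3) + d * (p \<bullet> n4)"
  by (simp add: comb_def inner_add_right)

lemma comb_pos:
  assumes p: "p \<bullet> n1 > 0" "p \<bullet> n2 > 0" "p \<bullet> n3 > 0" "p \<bullet> n4 > 0"
    and a: "0 \<le> a" "0 \<le> b" "0 \<le> c" "0 \<le> d"
  shows "p \<bullet> comb a b c d \<ge> 0" "p \<bullet> comb a b c d = 0 \<Longrightarrow> comb a b c d = 0"
proof -
  have n: "0 \<le> a * (p \<bullet> n1)" "0 \<le> b * (p \<bullet> n2)" "0 \<le> c * (p \<bullet> n3)" "0 \<le> d * (p \<bullet> n4)"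
    using p a by simp_all
  then show "p \<bullet> comb a b c d \<ge> 0" unfolding inner_comb by linarith
  assume "p \<bullet> comb a b c d = 0"
  then have "a * (p \<bullet> n1) = 0" "b * (p \<bullet> n2) = 0" "c * (p \<bullet> n3) = 0" "d * (p \<bullet> n4) = 0"
    using n unfolding inner_comb by linarith+
  then show "comb a b c d = 0" using p by (simp add: comb_def)
qed

lemma comb_uminus: "comb (- a) (- b) (- c) (- d) = - comb a b c d"
  by (simp add: comb_def)

lemma F4_uminus: "v \<in> F4 \<Longrightarrow> - v \<in> F4"
  using F4_refl[of v v] refl_in_self[OF F4_unit[of v]] by simp

lemma F4_pos_comb:
  assumes p: "p \<bullet> n1 > 0" "p \<bullet> n2 > 0" "p \<bullet> n3 > 0" "p \<bullet> n4 > 0" and v: "v \<in> F4"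
  shows "p \<bullet> v \<noteq> 0" "p \<bullet> v > 0 \<Longrightarrow> \<exists>a b c d. v = comb a b c d \<and> 0 \<le> a \<and> 0 \<le> b \<and> 0 \<le> c \<and> 0 \<le> d"
proof -
  obtain a b c d where v': "v = comb a b c d"
    and sgn: "(0 \<le> a \<and> 0 \<le> b \<and> 0 \<le> c \<and> 0 \<le> d) \<or> (a \<le> 0 \<and> b \<le> 0 \<and> c \<le> 0 \<and> d \<le> 0)" using F4_comb[OF v] .
  have nz: "v \<noteq> 0" using F4_unit[OF v] by auto
  have *: "p \<bullet> comb a b c d > 0" if "0 \<le> a" "0 \<le> b" "0 \<le> c" "0 \<le> d" "comb a b c d \<noteq> 0" for a b c d
    using comb_pos[OF p that(1-4)] that(5) by linarith
  have neg: "p \<bullet> v < 0" if "a \<le> 0" "b \<le> 0" "c \<le> 0" "d \<le> 0"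
    using *[of "- a" "- b" "- c" "- d"] that nz unfolding v' comb_uminus by simp
  show "p \<bullet> v \<noteq> 0" using sgn neg *[of a b c d] nz unfolding v' by force
  assume "p \<bullet> v > 0"
  then show "\<exists>a b c d. v = comb a b c d \<and> 0 \<le> a \<and> 0 \<le> b \<and> 0 \<le> c \<and> 0 \<le> d"
    using sgn neg v' by (metis less_asym)
qed

subsection \<open>Symmetries of a chamber\<close>

lemma finite_F4: "finite F4"
proof -
  define Z :: "int set" where "Z = {-2..2}"
  define f where "f s = (\<lambda>(a, b, c, d). (real_of_int a * s) *\<^sub>R e0 + (real_of_int b * s) *\<^sub>R e1 + (real_of_int c * s) *\<^sub>R e2 + (real_of_int d * s) *\<^sub>R e3)" for s
  have Z: "a \<in> Z" if "a\<^sup>2 \<le> 2" for a :: int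
  proof -
    have "\<bar>a\<bar> < 3"
    proof (rule ccontr)
      assume "\<not> \<bar>a\<bar> < 3"
      then have "\<bar>a\<bar>\<^sup>2 \<ge> 3\<^sup>2" by (intro power_mono) auto
      then show False using that by simp
    qed
    then show ?thesis by (auto simp: Z_def)
  qed
  have ex: "v = f s (a, b, c, d)" if "v \<bullet> e0 = real_of_int a * s" "v \<bullet> e1 = real_of_int b * s"
    "v \<bullet> e2 = real_of_int c * s" "v \<bullet> e3 = real_of_int d * s"
    for v and s :: real and a b c d :: int
    unfolding f_def using expand[of v] by (simp only: that prod.case)
  have "F4 \<subseteq> (\<Union>s\<in>{1, 1 / 2, 1 / sqrt 2}. f s ` (Z \<times> Z \<times> Z \<times> Z))"
  proof
    fix v assume v: "v \<in> F4"
    have "\<exists>s\<in>{1, 1 / 2, 1 / sqrt 2}. \<exists>a b c d. v \<bullet> e0 = real_of_int a * s \<and> v \<bullet> e1 = real_of_int b * s \<and> v \<bullet> e2 = real_of_int c * s \<and>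
        v \<bullet> e3 = real_of_int d * s \<and> a\<^sup>2 \<le> 2 \<and> b\<^sup>2 \<le> 2 \<and> c\<^sup>2 \<le> 2 \<and> d\<^sup>2 \<le> 2"
    proof (cases "short_root v")
      case True
      then show ?thesis
      proof (cases rule: short_root_cases)
        case (axis a b c d)
        have "0 \<le> a\<^sup>2" "0 \<le> b\<^sup>2" "0 \<le> c\<^sup>2" "0 \<le> d\<^sup>2" by simp_all
        then have "a\<^sup>2 \<le> 2" "b\<^sup>2 \<le> 2" "c\<^sup>2 \<le> 2" "d\<^sup>2 \<le> 2" using axis(5) by linarith+
        then show ?thesis using axis by (intro bexI[of _ 1] exI[of _ a] exI[of _ b] exI[of _ c] exI[of _ d]) simp_all
      next
        case (half a b c d)
        then show ?thesis by (intro bexI[of _ "1 / 2"] exI[of _ a] exI[of _ b] exI[of _ c] exI[of _ d]) simp_all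
      qed
    next
      case False
      then obtain a b c d :: int where l: "v \<bullet> e0 = a / sqrt 2" "v \<bullet> e1 = b / sqrt 2" "v \<bullet> e2 = c / sqrt 2" "v \<bullet> e3 = d / sqrt 2"
        "a\<^sup>2 + b\<^sup>2 + c\<^sup>2 + d\<^sup>2 = 2" using v long_rootE unfolding F4_def by blast
      have "0 \<le> a\<^sup>2" "0 \<le> b\<^sup>2" "0 \<le> c\<^sup>2" "0 \<le> d\<^sup>2" by simp_all
      then have "a\<^sup>2 \<le> 2" "b\<^sup>2 \<le> 2" "c\<^sup>2 \<le> 2" "d\<^sup>2 \<le> 2" using l(5) by linarith+
      then show ?thesis using l by (intro bexI[of _ "1 / sqrt 2"] exI[of _ a] exI[of _ b] exI[of _ c] exI[of _ d]) simp_all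
    qed
    then obtain s a b c d where "s \<in> {1, 1 / 2, 1 / sqrt 2}" "v = f s (a, b, c, d)" "a \<in> Z" "b \<in> Z" "c \<in> Z" "d \<in> Z"
      using ex Z by metis
    then show "v \<in> (\<Union>s\<in>{1, 1 / 2, 1 / sqrt 2}. f s ` (Z \<times> Z \<times> Z \<times> Z))" by blast
  qed
  moreover have "finite (\<Union>s\<in>{1, 1 / 2, 1 / sqrt 2}. f s ` (Z \<times> Z \<times> Z \<times> Z))" by (simp add: Z_def)
  ultimately show ?thesis by (rule finite_subset)
qed

lemma span_F4: "span F4 = UNIV"
proof -
  have "comb a b c d \<in> span F4" for a b c d
    unfolding comb_def by (intro span_add span_scale) (rule span_base, rule n_root)+
  then have "v \<in> span F4" for v using comb_coords[of v] by metis
  then show ?thesis by blast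
qed

lemma comb_pos_wall1:
  assumes v: "v \<bullet> n1 = 0" "v \<bullet> n2 > 0" "v \<bullet> n3 > 0" "v \<bullet> n4 > 0"
    and c: "0 \<le> a" "0 \<le> b" "0 \<le> c" "0 \<le> d" and x: "x = comb a b c d" "x \<bullet> x = 1" "x \<noteq> n1"
  shows "v \<bullet> x > 0"
proof -
  have n: "0 \<le> b * (v \<bullet> n2)" "0 \<le> c * (v \<bullet> n3)" "0 \<le> d * (v \<bullet> n4)" using v c by simp_all
  have "v \<bullet> x \<noteq> 0"
  proof
    assume "v \<bullet> x = 0"
    then have "b * (v \<bullet> n2) = 0" "c * (v \<bullet> n3) = 0" "d * (v \<bullet> n4) = 0"
      using n unfolding x(1) inner_comb v(1) by linarith+
    then have e: "x = a *\<^sub>R n1" using v by (simp add: x(1) comb_def)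
    then have "a * a = 1" using x(2) by (simp add: gram)
    then have "a = 1" using c by (simp add: square_eq_1_iff)
    then show False using e x(3) by simp
  qed
  moreover have "v \<bullet> x \<ge> 0" using n unfolding x(1) inner_comb v(1) by linarith
  ultimately show ?thesis by linarith
qed

lemma comb_pos_wall2:
  assumes v: "v \<bullet> n2 = 0" "v \<bullet> n1 > 0" "v \<bullet> n3 > 0" "v \<bullet> n4 > 0"
    and c: "0 \<le> a" "0 \<le> b" "0 \<le> c" "0 \<le> d" and x: "x = comb a b c d" "x \<bullet> x = 1" "x \<noteq> n2"
  shows "v \<bullet> x > 0"
proof -
  have n: "0 \<le> a * (v \<bullet> n1)" "0 \<le> c * (v \<bullet> n3)" "0 \<le> d * (v \<bullet> n4)" using v c by simp_all
  have "v \<bullet> x \<noteq> 0"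
  proof
    assume "v \<bullet> x = 0"
    then have "a * (v \<bullet> n1) = 0" "c * (v \<bullet> n3) = 0" "d * (v \<bullet> n4) = 0"
      using n unfolding x(1) inner_comb v(1) by linarith+
    then have e: "x = b *\<^sub>R n2" using v by (simp add: x(1) comb_def)
    then have "b * b = 1" using x(2) by (simp add: gram)
    then have "b = 1" using c by (simp add: square_eq_1_iff)
    then show False using e x(3) by simp
  qed
  moreover have "v \<bullet> x \<ge> 0" using n unfolding x(1) inner_comb v(1) by linarith
  ultimately show ?thesis by linarith
qed

lemma comb_pos_wall3:
  assumes v: "v \<bullet> n3 = 0" "v \<bullet> n1 > 0" "v \<bullet> n2 > 0" "v \<bullet> n4 > 0"
    and c: "0 \<le> a" "0 \<le> b" "0 \<le> c" "0 \<le> d" and x: "x = comb a b c d" "x \<bullet> x = 1" "x \<noteq> n3"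
  shows "v \<bullet> x > 0"
proof -
  have n: "0 \<le> a * (v \<bullet> n1)" "0 \<le> b * (v \<bullet> n2)" "0 \<le> d * (v \<bullet> n4)" using v c by simp_all
  have "v \<bullet> x \<noteq> 0"
  proof
    assume "v \<bullet> x = 0"
    then have "a * (v \<bullet> n1) = 0" "b * (v \<bullet> n2) = 0" "d * (v \<bullet> n4) = 0"
      using n unfolding x(1) inner_comb v(1) by linarith+
    then have e: "x = c *\<^sub>R n3" using v by (simp add: x(1) comb_def)
    then have "c * c = 1" using x(2) by (simp add: gram)
    then have "c = 1" using c by (simp add: square_eq_1_iff)
    then show False using e x(3) by simp
  qed
  moreover have "v \<bullet> x \<ge> 0" using n unfolding x(1) inner_comb v(1) by linarith
  ultimately show ?thesis by linarith
qed

lemma comb_pos_wall4: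
  assumes v: "v \<bullet> n4 = 0" "v \<bullet> n1 > 0" "v \<bullet> n2 > 0" "v \<bullet> n3 > 0"
    and c: "0 \<le> a" "0 \<le> b" "0 \<le> c" "0 \<le> d" and x: "x = comb a b c d" "x \<bullet> x = 1" "x \<noteq> n4"
  shows "v \<bullet> x > 0"
proof -
  have n: "0 \<le> a * (v \<bullet> n1)" "0 \<le> b * (v \<bullet> n2)" "0 \<le> c * (v \<bullet> n3)" using v c by simp_all
  have "v \<bullet> x \<noteq> 0"
  proof
    assume "v \<bullet> x = 0"
    then have "a * (v \<bullet> n1) = 0" "b * (v \<bullet> n2) = 0" "c * (v \<bullet> n3) = 0"
      using n unfolding x(1) inner_comb v(1) by linarith+
    then have e: "x = d *\<^sub>R n4" using v by (simp add: x(1) comb_def)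
    then have "d * d = 1" using x(2) by (simp add: gram)
    then have "d = 1" using c by (simp add: square_eq_1_iff)
    then show False using e x(3) by simp
  qed
  moreover have "v \<bullet> x \<ge> 0" using n unfolding x(1) inner_comb v(1) by linarith
  ultimately show ?thesis by linarith
qed

text \<open>The positive roots with respect to a vector \<open>p\<close> that have a wall, in the intrinsic description.\<close>

definition walled :: "'v \<Rightarrow> 'v \<Rightarrow> bool" where
  "walled p i \<longleftrightarrow> i \<in> F4 \<and> p \<bullet> i > 0 \<and> (\<exists>v. v \<bullet> i = 0 \<and> (\<forall>a\<in>F4. p \<bullet> a > 0 \<longrightarrow> a \<noteq> i \<longrightarrow> v \<bullet> a > 0))"

lemma walled_iff:
  assumes p: "p \<bullet> n1 > 0" "p \<bullet> n2 > 0" "p \<bullet> n3 > 0" "p \<bullet> n4 > 0"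
  shows "walled p i \<longleftrightarrow> i \<in> {n1, n2, n3, n4}"
proof
  assume w: "walled p i"
  then obtain v where i: "i \<in> F4" "p \<bullet> i > 0" and v: "v \<bullet> i = 0" "\<And>a. a \<in> F4 \<Longrightarrow> p \<bullet> a > 0 \<Longrightarrow> a \<noteq> i \<Longrightarrow> v \<bullet> a > 0"
    unfolding walled_def by blast
  obtain a b c d where abcd: "i = comb a b c d" "0 \<le> a" "0 \<le> b" "0 \<le> c" "0 \<le> d"
    using F4_pos_comb(2)[OF p i] by blast
  show "i \<in> {n1, n2, n3, n4}"
  proof (rule ccontr)
    assume "i \<notin> {n1, n2, n3, n4}"
    then have "v \<bullet> n1 > 0" "v \<bullet> n2 > 0" "v \<bullet> n3 > 0" "v \<bullet> n4 > 0" using v(2) n_root p by auto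
    then have "i = 0" using comb_pos(2)[of v a b c d] abcd v(1) by simp
    then show False using F4_unit[OF i(1)] by simp
  qed
next
  assume "i \<in> {n1, n2, n3, n4}"
  then show "walled p i"
  proof (elim insertE emptyE)
    assume i: "i = n1"
    define v where "v = 6 *\<^sub>R e0 + 2 *\<^sub>R e1 + 2 *\<^sub>R e2 + 1 *\<^sub>R e3"
    have v: "v \<bullet> n1 = 0" "v \<bullet> n2 > 0" "v \<bullet> n3 > 0" "v \<bullet> n4 > 0"
      unfolding inner_n v_def by (simp_all add: inner_add_left orth orth')
    have "v \<bullet> a > 0" if a: "a \<in> F4" "p \<bullet> a > 0" "a \<noteq> i" for a
      using F4_pos_comb(2)[OF p a(1,2)] comb_pos_wall1[OF v _ _ _ _ _ F4_unit[OF a(1)] a(3)[unfolded i]] by blast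
    then show ?thesis unfolding walled_def using i v(1) n_root p by blast
  next
    assume i: "i = n2"
    define v where "v = 5 *\<^sub>R e0 + 2 *\<^sub>R e1 + 1 *\<^sub>R e2 + 1 *\<^sub>R e3"
    have v: "v \<bullet> n2 = 0" "v \<bullet> n1 > 0" "v \<bullet> n3 > 0" "v \<bullet> n4 > 0"
      unfolding inner_n v_def by (simp_all add: inner_add_left orth orth')
    have "v \<bullet> a > 0" if a: "a \<in> F4" "p \<bullet> a > 0" "a \<noteq> i" for a
      using F4_pos_comb(2)[OF p a(1,2)] comb_pos_wall2[OF v _ _ _ _ _ F4_unit[OF a(1)] a(3)[unfolded i]] by blast
    then show ?thesis unfolding walled_def using i v(1) n_root p by blast
  next
    assume i: "i = n3"
    define v where "v = 4 *\<^sub>R e0 + 2 *\<^sub>R e1 + 1 *\<^sub>R e2 + 0 *\<^sub>R e3"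
    have v: "v \<bullet> n3 = 0" "v \<bullet> n1 > 0" "v \<bullet> n2 > 0" "v \<bullet> n4 > 0"
      unfolding inner_n v_def by (simp_all add: inner_add_left orth orth')
    have "v \<bullet> a > 0" if a: "a \<in> F4" "p \<bullet> a > 0" "a \<noteq> i" for a
      using F4_pos_comb(2)[OF p a(1,2)] comb_pos_wall3[OF v _ _ _ _ _ F4_unit[OF a(1)] a(3)[unfolded i]] by blast
    then show ?thesis unfolding walled_def using i v(1) n_root p by blast
  next
    assume i: "i = n4"
    define v where "v = 6 *\<^sub>R e0 + 3 *\<^sub>R e1 + 2 *\<^sub>R e2 + 1 *\<^sub>R e3"
    have v: "v \<bullet> n4 = 0" "v \<bullet> n1 > 0" "v \<bullet> n2 > 0" "v \<bullet> n3 > 0"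
      unfolding inner_n v_def by (simp_all add: inner_add_left orth orth')
    have "v \<bullet> a > 0" if a: "a \<in> F4" "p \<bullet> a > 0" "a \<noteq> i" for a
      using F4_pos_comb(2)[OF p a(1,2)] comb_pos_wall4[OF v _ _ _ _ _ F4_unit[OF a(1)] a(3)[unfolded i]] by blast
    then show ?thesis unfolding walled_def using i v(1) n_root p by blast
  qed
qed

text \<open>A non-trivial symmetry of the chamber permutes the simple roots and preserves their angles; since
  only one pair encloses an angle of 135 degrees, it reverses the diagram.\<close>

lemma chamber_symmetry:
  assumes p: "p \<bullet> n1 > 0" "p \<bullet> n2 > 0" "p \<bullet> n3 > 0" "p \<bullet> n4 > 0"
    and \<tau>: "orthogonal_transformation \<tau>" "\<tau> \<noteq> id" "\<tau> ` F4 = F4" "\<tau> ` cone_of F4 p = cone_of F4 p"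
  shows "\<tau> n1 = n4" "\<tau> n2 = n3" "\<tau> n3 = n2" "\<tau> n4 = n1"
proof -
  have lin: "linear \<tau>" and iso: "\<tau> v \<bullet> \<tau> w = v \<bullet> w" for v w
    using \<tau>(1) by (simp_all add: orthogonal_transformation_def)
  have reg: "regular F4 p" using F4_pos_comb(1)[OF p] by (simp add: regular_def span_F4)
  have half: "cone_of F4 p \<subseteq> halfspace a \<longleftrightarrow> p \<bullet> a > 0" if "a \<in> F4" for a
    by (rule cone_of_halfspace_iff[OF F4_uminus reg that])
  have mem: "\<tau> a \<in> F4" if "a \<in> F4" for a using \<tau>(3) that by blast
  have pos: "p \<bullet> \<tau> a > 0 \<longleftrightarrow> p \<bullet> a > 0" if a: "a \<in> F4" for a
  proof -
    have "cone_of F4 p \<subseteq> halfspace (\<tau> a) \<longleftrightarrow> \<tau> ` cone_of F4 p \<subseteq> halfspace (\<tau> a)" by (simp only: \<tau>(4))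
    also have "\<dots> \<longleftrightarrow> cone_of F4 p \<subseteq> halfspace a" unfolding halfspace_def image_subset_iff by (auto simp: iso)
    finally show ?thesis using half[OF a] half[OF mem[OF a]] by blast
  qed
  have wall: "walled p (\<tau> i)" if w: "walled p i" for i
  proof -
    obtain v where i: "i \<in> F4" "p \<bullet> i > 0" and v: "v \<bullet> i = 0" "\<And>a. a \<in> F4 \<Longrightarrow> p \<bullet> a > 0 \<Longrightarrow> a \<noteq> i \<Longrightarrow> v \<bullet> a > 0"
      using w unfolding walled_def by blast
    have "\<tau> v \<bullet> b > 0" if b: "b \<in> F4" "p \<bullet> b > 0" "b \<noteq> \<tau> i" for b
    proof -
      obtain a where a: "a \<in> F4" "b = \<tau> a" using b(1) \<tau>(3) by blast
      then show ?thesis using v(2)[OF a(1)] pos[OF a(1)] b by (auto simp: iso)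
    qed
    moreover have "\<tau> v \<bullet> \<tau> i = 0" using v(1) by (simp add: iso)
    ultimately show ?thesis unfolding walled_def using mem[OF i(1)] pos[OF i(1)] i(2) by blast
  qed
  have N: "\<tau> n1 \<in> {n1, n2, n3, n4}" "\<tau> n2 \<in> {n1, n2, n3, n4}" "\<tau> n3 \<in> {n1, n2, n3, n4}" "\<tau> n4 \<in> {n1, n2, n3, n4}"
    using wall unfolding walled_iff[OF p] by blast+
  have gram': "n2 \<bullet> n1 = - 1 / 2" "n3 \<bullet> n1 = 0" "n4 \<bullet> n1 = 0" "n3 \<bullet> n2 = - 1 / sqrt 2" "n4 \<bullet> n2 = 0" "n4 \<bullet> n3 = - 1 / 2"
    using gram by (simp_all add: inner_commute)
  have "sqrt 2 \<noteq> (2 :: real)" using real_sqrt_less_iff[of 2 4] by simp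
  moreover have "sqrt 2 \<noteq> (- 1 :: real)" using real_sqrt_ge_zero[of 2] by linarith
  ultimately have s2: "sqrt 2 \<noteq> (2 :: real)" "sqrt 2 \<noteq> (- 1 :: real)" by blast+
  have t23: "\<tau> n2 \<bullet> \<tau> n3 = - 1 / sqrt 2" and t12: "\<tau> n1 \<bullet> \<tau> n2 = - 1 / 2" and t34: "\<tau> n3 \<bullet> \<tau> n4 = - 1 / 2"
    unfolding iso gram by simp_all
  have "(\<tau> n2 = n2 \<and> \<tau> n3 = n3) \<or> (\<tau> n2 = n3 \<and> \<tau> n3 = n2)"
    using N(2,3) t23 s2 by (auto simp: gram gram' field_simps)
  then have "\<tau> n1 = n4 \<and> \<tau> n2 = n3 \<and> \<tau> n3 = n2 \<and> \<tau> n4 = n1"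
  proof
    assume 1: "\<tau> n2 = n2 \<and> \<tau> n3 = n3"
    have "\<tau> n1 = n1" using N(1) t12 s2 1 by (auto simp: gram gram' field_simps)
    moreover have "\<tau> n4 = n4" using N(4) t34 s2 1 by (auto simp: gram gram' field_simps)
    ultimately have c: "\<tau> (comb a b c d) = comb a b c d" for a b c d
      using 1 lin by (simp add: comb_def linear_add linear_scale)
    have "\<tau> v = v" for v by (subst (1 2) comb_coords) (rule c)
    then show ?thesis using \<tau>(2) by (auto simp: fun_eq_iff)
  next
    assume 2: "\<tau> n2 = n3 \<and> \<tau> n3 = n2"
    have "\<tau> n1 = n4" using N(1) t12 s2 2 by (auto simp: gram gram' field_simps)
    moreover have "\<tau> n4 = n1" using N(4) t34 s2 2 by (auto simp: gram gram' field_simps)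
    ultimately show ?thesis using 2 by blast
  qed
  then show "\<tau> n1 = n4" "\<tau> n2 = n3" "\<tau> n3 = n2" "\<tau> n4 = n1" by blast+
qed

text \<open>The reversal of the diagram is an involution, and it moves each root to a perpendicular one
  or to one at an angle of 45 or 135 degrees.\<close>

lemma diagram_flip:
  assumes lin: "linear \<tau>" and n: "\<tau> n1 = n4" "\<tau> n2 = n3" "\<tau> n3 = n2" "\<tau> n4 = n1"
  shows "\<tau> (\<tau> v) = v" and "v \<in> F4 \<Longrightarrow> v \<bullet> \<tau> v = 0 \<or> (v \<bullet> \<tau> v)\<^sup>2 = 1 / 2"
proof -
  have c: "\<tau> (comb a b c d) = comb d c b a" for a b c d
    using lin n by (simp add: comb_def linear_add linear_scale)
  have "\<tau> (\<tau> (comb a b c d)) = comb a b c d" for a b c d by (simp only: c)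
  then show "\<tau> (\<tau> v) = v" using comb_coords[of v] by metis
  have \<tau>v: "\<tau> v = comb (2 * (v \<bullet> e0)) (3 * (v \<bullet> e0) + v \<bullet> e1 + v \<bullet> e2 + v \<bullet> e3)
     (sqrt 2 * (2 * (v \<bullet> e0) + v \<bullet> e1 + v \<bullet> e2)) (sqrt 2 * (v \<bullet> e0 + v \<bullet> e1))"
    using comb_coords[of v] c by metis
  define x0 x1 x2 x3 where x: "x0 = v \<bullet> e0" "x1 = v \<bullet> e1" "x2 = v \<bullet> e2" "x3 = v \<bullet> e3"
  define r where "r = 1 / sqrt 2"
  have r2: "sqrt 2 = 2 * r" by (simp add: r_def real_div_sqrt)
  have ci: "comb a b c d \<bullet> e0 = d / 2" "comb a b c d \<bullet> e1 = a * r - d / 2"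
    "comb a b c d \<bullet> e2 = b * r - a * r - d / 2" "comb a b c d \<bullet> e3 = c - b * r - d / 2" for a b c d
    by (simp_all add: comb_def inner_add_left coords_n r_def)
  have tc: "\<tau> v \<bullet> e0 = (x0 + x1) * r" "\<tau> v \<bullet> e1 = (x0 - x1) * r"
    "\<tau> v \<bullet> e2 = (x2 + x3) * r" "\<tau> v \<bullet> e3 = (x2 - x3) * r"
    unfolding \<tau>v x[symmetric] ci r2 by (simp_all add: algebra_simps)
  have "v \<bullet> \<tau> v = (x0\<^sup>2 + 2 * x0 * x1 - x1\<^sup>2 + x2\<^sup>2 + 2 * x2 * x3 - x3\<^sup>2) * r"
    unfolding inner_frame[of v "\<tau> v"] x[symmetric] tc by (simp add: algebra_simps power2_eq_square)
  then have val: "v \<bullet> \<tau> v = (x0\<^sup>2 + 2 * x0 * x1 - x1\<^sup>2 + x2\<^sup>2 + 2 * x2 * x3 - x3\<^sup>2) / sqrt 2"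
    by (simp add: r_def)
  assume v: "v \<in> F4"
  have "\<exists>k::int. (k = 0 \<or> k\<^sup>2 = 1) \<and> x0\<^sup>2 + 2 * x0 * x1 - x1\<^sup>2 + x2\<^sup>2 + 2 * x2 * x3 - x3\<^sup>2 = real_of_int k"
  proof (cases "short_root v")
    case True
    then show ?thesis
    proof (cases rule: short_root_cases)
      case (axis a b c d)
      have "(a\<^sup>2 + 2 * a * b - b\<^sup>2 + c\<^sup>2 + 2 * c * d - d\<^sup>2 = 0) \<or> (a\<^sup>2 + 2 * a * b - b\<^sup>2 + c\<^sup>2 + 2 * c * d - d\<^sup>2)\<^sup>2 = 1"
        using sum_four_squares_1[OF axis(5)] by auto
      then show ?thesis unfolding x axis
        by (intro exI[of _ "a\<^sup>2 + 2 * a * b - b\<^sup>2 + c\<^sup>2 + 2 * c * d - d\<^sup>2"]) simp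
    next
      case (half a b c d)
      have "\<exists>k::int. (k = 0 \<or> k\<^sup>2 = 1) \<and> a * b + c * d = 2 * k"
        using sq_1_cases[OF half(5)] sq_1_cases[OF half(6)] sq_1_cases[OF half(7)] sq_1_cases[OF half(8)]
        by (elim disjE) simp_all
      then obtain k :: int where k: "k = 0 \<or> k\<^sup>2 = 1" "a * b + c * d = 2 * k" by blast
      have sq: "real_of_int a ^ 2 = 1" "real_of_int b ^ 2 = 1" "real_of_int c ^ 2 = 1" "real_of_int d ^ 2 = 1"
        using half(5-8) by (metis of_int_1 of_int_power)+
      have "real_of_int a * b + real_of_int c * d = 2 * real_of_int k" using k(2) by (metis of_int_add of_int_mult of_int_numeral)
      then show ?thesis unfolding x half using k(1) sq
        by (intro exI[of _ k]) (simp add: power_divide)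
    qed
  next
    case False
    then obtain a b c d :: int where l: "v \<bullet> e0 = a / sqrt 2" "v \<bullet> e1 = b / sqrt 2" "v \<bullet> e2 = c / sqrt 2" "v \<bullet> e3 = d / sqrt 2"
        "a\<^sup>2 + b\<^sup>2 + c\<^sup>2 + d\<^sup>2 = 2" using v long_rootE unfolding F4_def by blast
    have "\<exists>k::int. (k = 0 \<or> k\<^sup>2 = 1) \<and> a\<^sup>2 + 2 * a * b - b\<^sup>2 + c\<^sup>2 + 2 * c * d - d\<^sup>2 = 2 * k"
      using sum_four_squares_2[OF l(5)]
    proof (elim disjE conjE)
      assume "a\<^sup>2 = 1" "b\<^sup>2 = 1" "c = 0" "d = 0"
      then show ?thesis by (intro exI[of _ "a * b"]) (simp add: power_mult_distrib)
    next
      assume "a\<^sup>2 = 1" "b = 0" "c\<^sup>2 = 1" "d = 0" then show ?thesis by (intro exI[of _ 1]) simp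
    next
      assume "a\<^sup>2 = 1" "b = 0" "c = 0" "d\<^sup>2 = 1" then show ?thesis by (intro exI[of _ 0]) simp
    next
      assume "a = 0" "b\<^sup>2 = 1" "c\<^sup>2 = 1" "d = 0" then show ?thesis by (intro exI[of _ 0]) simp
    next
      assume "a = 0" "b\<^sup>2 = 1" "c = 0" "d\<^sup>2 = 1" then show ?thesis by (intro exI[of _ "-1"]) simp
    next
      assume "a = 0" "b = 0" "c\<^sup>2 = 1" "d\<^sup>2 = 1"
      then show ?thesis by (intro exI[of _ "c * d"]) (simp add: power_mult_distrib)
    qed
    then obtain k :: int where k: "k = 0 \<or> k\<^sup>2 = 1" "a\<^sup>2 + 2 * a * b - b\<^sup>2 + c\<^sup>2 + 2 * c * d - d\<^sup>2 = 2 * k" by blast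
    have "real_of_int (a\<^sup>2 + 2 * a * b - b\<^sup>2 + c\<^sup>2 + 2 * c * d - d\<^sup>2) = real_of_int (2 * k)" by (simp only: k(2))
    then have "real_of_int a ^ 2 + 2 * a * b - real_of_int b ^ 2 + real_of_int c ^ 2 + 2 * c * d - real_of_int d ^ 2 = 2 * real_of_int k" by simp
    then show ?thesis unfolding x l using k(1)
      by (intro exI[of _ k]) (simp add: power_divide field_simps)
  qed
  then obtain k :: int where k: "k = 0 \<or> k\<^sup>2 = 1" "v \<bullet> \<tau> v = real_of_int k / sqrt 2" unfolding val by metis
  show "v \<bullet> \<tau> v = 0 \<or> (v \<bullet> \<tau> v)\<^sup>2 = 1 / 2"
    using k(1)
  proof
    assume "k\<^sup>2 = 1"
    then have "real_of_int k ^ 2 = 1" by (metis of_int_1 of_int_power)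
    then show ?thesis unfolding k(2) by (simp add: power_divide)
  qed (simp add: k(2))
qed

end

text \<open>A surjective linear isometry maps coordinates, roots and simple roots to such.\<close>

lemma frame4_image:
  assumes "frame4 e0 e1 e2 e3" and w: "linear w" "\<And>u v. w u \<bullet> w v = u \<bullet> v" "\<And>v. w (w' v) = v"
  shows "frame4 (w e0) (w e1) (w e2) (w e3)"
    and "frame4.F4 (w e0) (w e1) (w e2) (w e3) = w ` frame4.F4 e0 e1 e2 e3"
    and "frame4.n1 (w e1) (w e2) = w (frame4.n1 e1 e2)" "frame4.n2 (w e2) (w e3) = w (frame4.n2 e2 e3)"
      "frame4.n3 (w e3) = w (frame4.n3 e3)" "frame4.n4 (w e0) (w e1) (w e2) (w e3) = w (frame4.n4 e0 e1 e2 e3)"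
proof -
  interpret f: frame4 e0 e1 e2 e3 by fact
  have w': "v \<bullet> w u = w' v \<bullet> u" for u v using w(2)[of "w' v" u] by (simp add: w(3))
  show F: "frame4 (w e0) (w e1) (w e2) (w e3)"
  proof
    fix v
    have "v = w (w' v)" by (simp add: w(3))
    also have "\<dots> = w ((w' v \<bullet> e0) *\<^sub>R e0 + (w' v \<bullet> e1) *\<^sub>R e1 + (w' v \<bullet> e2) *\<^sub>R e2 + (w' v \<bullet> e3) *\<^sub>R e3)"
      using f.expand[of "w' v"] by simp
    also have "\<dots> = (v \<bullet> w e0) *\<^sub>R w e0 + (v \<bullet> w e1) *\<^sub>R w e1 + (v \<bullet> w e2) *\<^sub>R w e2 + (v \<bullet> w e3) *\<^sub>R w e3"
      by (simp add: w' linear_add[OF w(1)] linear_scale[OF w(1)])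
    finally show "v = (v \<bullet> w e0) *\<^sub>R w e0 + (v \<bullet> w e1) *\<^sub>R w e1 + (v \<bullet> w e2) *\<^sub>R w e2 + (v \<bullet> w e3) *\<^sub>R w e3" .
  qed (simp_all add: w(2) f.orth)
  interpret g: frame4 "w e0" "w e1" "w e2" "w e3" by (rule F)
  have sh: "g.short_root (w v) \<longleftrightarrow> f.short_root v" "g.long_root (w v) \<longleftrightarrow> f.long_root v" for v
    by (simp_all add: g.short_root_def f.short_root_def g.long_root_def f.long_root_def w(2))
  show "g.F4 = w ` f.F4"
  proof
    show "w ` f.F4 \<subseteq> g.F4" by (auto simp: g.F4_def f.F4_def sh)
    show "g.F4 \<subseteq> w ` f.F4"
    proof
      fix v assume "v \<in> g.F4"
      then have "w' v \<in> f.F4" using sh[of "w' v"] by (auto simp: g.F4_def f.F4_def w(3))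
      then show "v \<in> w ` f.F4" using w(3)[of v] by (metis imageI)
    qed
  qed
  show "g.n1 = w f.n1" "g.n2 = w f.n2" "g.n3 = w f.n3" "g.n4 = w f.n4"
    by (simp_all add: g.n1_def f.n1_def g.n2_def f.n2_def g.n3_def f.n3_def g.n4_def f.n4_def
      linear_diff[OF w(1)] linear_scale[OF w(1)])
qed

lemma root_set_F4_frame:
  assumes "root_set_F4 \<Phi>"
  obtains e0 e1 e2 e3 where "frame4 e0 e1 e2 e3" "\<Phi> = frame4.F4 e0 e1 e2 e3"
proof -
  obtain e where sp: "span \<Phi> = UNIV" and on: "orthonormal_family 4 e"
    and Phi: "\<Phi> = sgn ` ({c *\<^sub>R e i | c i. c \<in> {1, -1} \<and> i < 4}
                \<union> {c *\<^sub>R e i + d *\<^sub>R e j | c d i j. c \<in> {1, -1} \<and> d \<in> {1, -1} \<and> i < j \<and> j < 4}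
                \<union> {(1/2) *\<^sub>R (\<Sum>i<4. c i *\<^sub>R e i) | c. \<forall>i<4. c i \<in> {1, -1}})"
    using assms unfolding root_set_F4_def by blast
  have ee: "e i \<bullet> e j = (if i = j then 1 else 0)" if "i < 4" "j < 4" for i j
    using on that by (simp add: orthonormal_family_def)
  have i4: "i = 0 \<or> i = 1 \<or> i = 2 \<or> i = 3" if "i < 4" for i :: nat using that by linarith
  have sum4: "(\<Sum>i<4. f i) = f 0 + f 1 + f 2 + f 3" for f :: "nat \<Rightarrow> 'a"
    by (simp add: numeral_eq_Suc)
  have sgn_unit: "sgn v = v" if "v \<bullet> v = 1" for v :: 'a using that by (simp add: sgn_div_norm norm_eq_sqrt_inner)
  define proj where "proj v = (v \<bullet> e 0) *\<^sub>R e 0 + (v \<bullet> e 1) *\<^sub>R e 1 + (v \<bullet> e 2) *\<^sub>R e 2 + (v \<bullet> e 3) *\<^sub>R e 3" for v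
  define Q where "Q = {v. proj v = v}"
  have lin: "linear proj"
    by (rule linearI) (simp_all add: proj_def inner_add_left scaleR_add_left scaleR_add_right)
  have Q: "subspace Q"
    unfolding subspace_def Q_def by (auto simp: linear_0[OF lin] linear_add[OF lin] linear_scale[OF lin])
  have eQ: "e i \<in> Q" if "i < 4" for i using i4[OF that] by (elim disjE) (simp_all add: Q_def proj_def ee)
  have "\<Phi> \<subseteq> Q"
  proof
    fix v assume "v \<in> \<Phi>"
    then obtain r where v: "v = sgn r" and r: "r \<in> {c *\<^sub>R e i | c i. c \<in> {1, -1} \<and> i < 4}
                \<union> {c *\<^sub>R e i + d *\<^sub>R e j | c d i j. c \<in> {1, -1} \<and> d \<in> {1, -1} \<and> i < j \<and> j < 4}
                \<union> {(1/2) *\<^sub>R (\<Sum>i<4. c i *\<^sub>R e i) | c. \<forall>i<4. c i \<in> {1, -1}}"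
      unfolding Phi by blast
    have "r \<in> Q" using r by (auto intro!: subspace_add[OF Q] subspace_scale[OF Q] subspace_sum[OF Q] eQ simp del: scaleR_minus1_left)
    then show "v \<in> Q" unfolding v sgn_div_norm by (rule subspace_scale[OF Q])
  qed
  then have QU: "Q = UNIV" using span_minimal[OF _ Q] sp by blast
  have F: "frame4 (e 0) (e 1) (e 2) (e 3)"

  proof
    fix v
    have "proj v = v" using QU by (auto simp: Q_def)
    then show "v = (v \<bullet> e 0) *\<^sub>R e 0 + (v \<bullet> e 1) *\<^sub>R e 1 + (v \<bullet> e 2) *\<^sub>R e 2 + (v \<bullet> e 3) *\<^sub>R e 3"
      unfolding proj_def by (rule sym)
  qed (simp_all add: ee)
  interpret f: frame4 "e 0" "e 1" "e 2" "e 3" by (rule F)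
  have "\<Phi> \<subseteq> f.F4"
  proof
    fix v assume "v \<in> \<Phi>"
    then consider c i where "v = sgn (c *\<^sub>R e i)" "c \<in> {1, -1}" "i < 4"
      | c d i j where "v = sgn (c *\<^sub>R e i + d *\<^sub>R e j)" "c \<in> {1, -1}" "d \<in> {1, -1}" "i < j" "j < 4"
      | c where "v = sgn ((1/2) *\<^sub>R (\<Sum>i<4. c i *\<^sub>R e i))" "\<forall>i<4. c i \<in> {1, -1}"
      unfolding Phi by blast
    then show "v \<in> f.F4"
    proof cases
      case 1
      have "(c *\<^sub>R e i) \<bullet> (c *\<^sub>R e i) = 1" using 1 by (auto simp: ee)
      then have v: "v = c *\<^sub>R e i" "v \<bullet> v = 1" using 1(1) sgn_unit by auto
      have ev: "v \<bullet> e k = real_of_int (if k = i then 2 * (if c = 1 then 1 else -1) else 0) / 2" if "k < 4" for k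
        using 1(2,3) that by (auto simp: v(1) ee)
      have "f.short_root v"
        unfolding f.short_root_def by (intro conjI exI, rule v(2), rule ev, simp, rule ev, simp, rule ev, simp, rule ev, simp) auto
      then show ?thesis unfolding f.F4_def by blast
    next
      case 2
      define r where "r = c *\<^sub>R e i + d *\<^sub>R e j"
      have "r \<bullet> r = 2" using 2 by (auto simp: r_def inner_add_left inner_add_right ee)
      then have v: "v = (1 / sqrt 2) *\<^sub>R r" using 2(1) unfolding r_def[symmetric] by (simp add: sgn_div_norm norm_eq_sqrt_inner inverse_eq_divide)
      have vv: "v \<bullet> v = 1" using \<open>r \<bullet> r = 2\<close> by (simp add: v)
      have ev: "v \<bullet> e k = real_of_int (if k = i then (if c = 1 then 1 else -1) else if k = j then (if d = 1 then 1 else -1) else 0) / sqrt 2" if "k < 4" for k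
        using 2(2-5) that by (auto simp: v r_def inner_add_left ee)
      have "f.long_root v"
        unfolding f.long_root_def by (intro conjI exI, rule vv, rule ev, simp, rule ev, simp, rule ev, simp, rule ev, simp)
      then show ?thesis unfolding f.F4_def by blast
    next
      case 3
      define r where "r = (1/2) *\<^sub>R (\<Sum>i<4. c i *\<^sub>R e i)"
      have re: "r \<bullet> e k = real_of_int (if c k = 1 then 1 else -1) / 2" if "k < 4" for k
      proof -
        have "c k = 1 \<or> c k = -1" using 3(2) that by blast
        moreover have "r \<bullet> e k = c k / 2"
          using i4[OF that] by (elim disjE) (simp_all add: r_def sum4 inner_add_left ee)
        ultimately show ?thesis by auto
      qed
      have "r \<bullet> r = 1" unfolding f.inner_frame[of r r] by (simp add: re)
      then have v: "v = r" using 3(1) sgn_unit unfolding r_def[symmetric] by simp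
      have "f.short_root v"
        unfolding f.short_root_def v by (intro conjI exI, rule \<open>r \<bullet> r = 1\<close>, rule re, simp, rule re, simp, rule re, simp, rule re, simp) auto
      then show ?thesis unfolding f.F4_def by blast
    qed
  qed
  moreover have "f.F4 \<subseteq> \<Phi>"
  proof
    fix v assume v: "v \<in> f.F4"
    have sv: "sgn (s *\<^sub>R v) = v" if "s > 0" for s using that sgn_unit[OF f.F4_unit[OF v]] by (simp add: sgn_scaleR)
    have m1: "v \<in> \<Phi>" if "v = real_of_int k *\<^sub>R e i" "k\<^sup>2 = 1" "i < 4" for k i
    proof -
      have "v = sgn (real_of_int k *\<^sub>R e i)" using sv[of 1] that(1) by simp
      moreover have "real_of_int k \<in> {1, -1}" using sq_1_cases[OF that(2)] by auto
      ultimately show ?thesis unfolding Phi using that(3) by blast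
    qed
    have m2: "v \<in> \<Phi>" if "sqrt 2 *\<^sub>R v = real_of_int k *\<^sub>R e i + real_of_int l *\<^sub>R e j" "k\<^sup>2 = 1" "l\<^sup>2 = 1" "i < j" "j < 4" for k l i j
    proof -
      have "v = sgn (real_of_int k *\<^sub>R e i + real_of_int l *\<^sub>R e j)" using sv[of "sqrt 2"] that(1) by simp
      moreover have "real_of_int k \<in> {1, -1}" "real_of_int l \<in> {1, -1}" using sq_1_cases[OF that(2)] sq_1_cases[OF that(3)] by auto
      ultimately show ?thesis unfolding Phi using that(4,5) by blast
    qed
    show "v \<in> \<Phi>"
    proof (cases "f.short_root v")
      case True
      then show ?thesis
      proof (cases rule: f.short_root_cases)
        case (axis a b c d)
        have "v = real_of_int a *\<^sub>R e 0 + real_of_int b *\<^sub>R e 1 + real_of_int c *\<^sub>R e 2 + real_of_int d *\<^sub>R e 3"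
          using f.expand[of v] by (simp only: axis(1-4))
        then show ?thesis using sum_four_squares_1[OF axis(5)] m1[of a 0] m1[of b 1] m1[of c 2] m1[of d 3] by auto
      next
        case (half a b c d)
        define k where "k i = real_of_int (if i = 0 then a else if i = 1 then b else if i = 2 then c else d)" for i :: nat
        have "v = (1/2) *\<^sub>R (\<Sum>i<4. k i *\<^sub>R e i)"
          unfolding sum4 using f.expand[of v] unfolding half(1-4) by (simp add: k_def scaleR_add_right)
        then have "v = sgn ((1/2) *\<^sub>R (\<Sum>i<4. k i *\<^sub>R e i))" using sv[of 1] by simp
        moreover have "\<forall>i<4. k i \<in> {1, -1}"
          using sq_1_cases[OF half(5)] sq_1_cases[OF half(6)] sq_1_cases[OF half(7)] sq_1_cases[OF half(8)] by (auto simp: k_def)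
        ultimately show ?thesis unfolding Phi by blast
      qed
    next
      case False
      then obtain a b c d :: int where l: "v \<bullet> e 0 = a / sqrt 2" "v \<bullet> e 1 = b / sqrt 2" "v \<bullet> e 2 = c / sqrt 2" "v \<bullet> e 3 = d / sqrt 2"
        "a\<^sup>2 + b\<^sup>2 + c\<^sup>2 + d\<^sup>2 = 2" using v f.long_rootE unfolding f.F4_def by blast
      have "sqrt 2 *\<^sub>R v = sqrt 2 *\<^sub>R ((a / sqrt 2) *\<^sub>R e 0 + (b / sqrt 2) *\<^sub>R e 1 + (c / sqrt 2) *\<^sub>R e 2 + (d / sqrt 2) *\<^sub>R e 3)"
        using f.expand[of v] by (simp only: l(1-4))
      then have "sqrt 2 *\<^sub>R v = real_of_int a *\<^sub>R e 0 + real_of_int b *\<^sub>R e 1 + real_of_int c *\<^sub>R e 2 + real_of_int d *\<^sub>R e 3"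
        by (simp add: scaleR_add_right)
      then show ?thesis using sum_four_squares_2[OF l(5)] m2[of a 0 b 1] m2[of a 0 c 2] m2[of a 0 d 3] m2[of b 1 c 2] m2[of b 1 d 3] m2[of c 2 d 3]
        by (elim disjE conjE) simp_all
    qed
  qed
  ultimately show thesis using that[OF F] by blast
qed

section \<open>The root set of a Suzuki-Ree building\<close>

text \<open>A set of roots with a symmetry \<open>\<tau>\<close> that preserves the chamber \<open>S\<close> of the regular vector \<open>p\<close>. This
  much holds for all three types.\<close>

locale twisted_cone =
  fixes dPhi :: "'v::euclidean_space set" and S :: "'v set" and \<tau> :: "'v \<Rightarrow> 'v" and p :: 'v
  assumes neg: "\<And>a. a \<in> dPhi \<Longrightarrow> - a \<in> dPhi"
    and p: "regular dPhi p" and S: "S = cone_of dPhi p"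
    and \<tau>: "orthogonal_transformation \<tau>" "\<tau> ` dPhi = dPhi" "\<tau> ` S = S"
begin

lemma \<tau>_linear: "linear \<tau>" and \<tau>_inner: "\<tau> v \<bullet> \<tau> w = v \<bullet> w"
  using \<tau>(1) by (simp_all add: orthogonal_transformation_def)

lemma \<tau>_root: "a \<in> dPhi \<Longrightarrow> \<tau> a \<in> dPhi"
  using \<tau>(2) by blast

lemma halfspace_iff: "a \<in> dPhi \<Longrightarrow> S \<subseteq> halfspace a \<longleftrightarrow> p \<bullet> a > 0"
  unfolding S using cone_of_halfspace_iff[OF neg p] .

lemma \<tau>_pos:
  assumes a: "a \<in> dPhi" shows "p \<bullet> \<tau> a > 0 \<longleftrightarrow> p \<bullet> a > 0"
proof -
  have "S \<subseteq> halfspace (\<tau> a) \<longleftrightarrow> \<tau> ` S \<subseteq> halfspace (\<tau> a)" by (simp only: \<tau>(3))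
  also have "\<dots> \<longleftrightarrow> S \<subseteq> halfspace a" unfolding halfspace_def image_subset_iff by (auto simp: \<tau>_inner)
  finally show ?thesis using halfspace_iff[OF a] halfspace_iff[OF \<tau>_root[OF a]] by blast
qed

lemma \<tau>_neg:
  assumes a: "a \<in> dPhi" shows "p \<bullet> \<tau> a < 0 \<longleftrightarrow> p \<bullet> a < 0"
  using \<tau>_pos[OF neg[OF a]] linear_neg[OF \<tau>_linear, of a] by simp

lemma sum_nonzero:
  assumes a: "a \<in> dPhi" shows "a + \<tau> a \<noteq> 0"
proof
  assume "a + \<tau> a = 0"
  then have "\<tau> a = - a" by (simp add: eq_neg_iff_add_eq_0 add.commute)
  then have "p \<bullet> a > 0 \<longleftrightarrow> p \<bullet> a < 0" using \<tau>_pos[OF a] by simp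
  then show False using p a by (auto simp: regular_def)
qed

lemma sr_rootsE:
  assumes "\<alpha> \<in> sr_roots dPhi \<tau>"
  obtains a where "a \<in> dPhi" "\<alpha> = sgn (a + \<tau> a)"
  using assms by (auto simp: sr_roots_def)

lemma sr_unit: "\<alpha> \<in> sr_roots dPhi \<tau> \<Longrightarrow> \<alpha> \<bullet> \<alpha> = 1"
proof -
  assume "\<alpha> \<in> sr_roots dPhi \<tau>"
  then obtain a where a: "a \<in> dPhi" "\<alpha> = sgn (a + \<tau> a)" by (rule sr_rootsE)
  then have "norm \<alpha> = 1" using sum_nonzero[OF a(1)] by (simp add: norm_sgn)
  then show ?thesis by (simp add: norm_eq_1)
qed

lemma sr_neg: "\<alpha> \<in> sr_roots dPhi \<tau> \<Longrightarrow> - \<alpha> \<in> sr_roots dPhi \<tau>"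
proof -
  assume "\<alpha> \<in> sr_roots dPhi \<tau>"
  then obtain a where a: "a \<in> dPhi" "\<alpha> = sgn (a + \<tau> a)" by (rule sr_rootsE)
  have "- a + \<tau> (- a) = - (a + \<tau> a)" using linear_neg[OF \<tau>_linear, of a] by simp
  then have "- \<alpha> = sgn (- a + \<tau> (- a))" unfolding a(2) by (simp only: sgn_minus)
  then show ?thesis unfolding sr_roots_def using neg[OF a(1)] by (rule image_eqI)
qed

end

text \<open>If \<open>a\<close> and \<open>b\<close> enclose an angle of 45 or 135 degrees, then the square of the product of
  their reflections is minus the identity on the plane that they span.\<close>

lemma refl_refl:
  fixes a b v :: "'v::euclidean_space"
  shows "refl_in a (refl_in b v) = v - (2 * (v \<bullet> b)) *\<^sub>R b - (2 * (v \<bullet> a - 2 * (v \<bullet> b) * (a \<bullet> b))) *\<^sub>R a"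
  by (simp add: refl_in_def inner_diff_left inner_commute[of b a] algebra_simps)

lemma refl_refl_square:
  fixes a b v :: "'v::euclidean_space"
  assumes "a \<bullet> a = 1" "b \<bullet> b = 1" "(a \<bullet> b)\<^sup>2 = 1 / 2"
  shows "refl_in a (refl_in b (refl_in a (refl_in b v))) =
    v - (4 * (v \<bullet> a - (a \<bullet> b) * (v \<bullet> b))) *\<^sub>R a - (4 * (v \<bullet> b - (a \<bullet> b) * (v \<bullet> a))) *\<^sub>R b"
proof -
  define c m n where cmn: "c = a \<bullet> b" "m = v \<bullet> a" "n = v \<bullet> b"
  have cc: "c * c = 1 / 2" using assms(3) by (simp add: cmn power2_eq_square)
  define u where "u = v - (2 * n) *\<^sub>R b - (2 * (m - 2 * n * c)) *\<^sub>R a"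
  have "u \<bullet> a = m - 2 * n * c - 2 * (m - 2 * n * c)" "u \<bullet> b = n - 2 * n - 2 * (m - 2 * n * c) * c"
    by (simp_all add: u_def inner_diff_left assms(1,2) cmn inner_commute[of b a])
  moreover have "n - 2 * n - 2 * (m - 2 * n * c) * c = n - 2 * c * m"
  proof -
    have "n - 2 * n - 2 * (m - 2 * n * c) * c = - n - 2 * c * m + 4 * n * (c * c)" by (simp add: algebra_simps)
    then show ?thesis unfolding cc by simp
  qed
  ultimately have ua: "u \<bullet> a = - m + 2 * n * c" and ub: "u \<bullet> b = n - 2 * c * m" by simp_all
  have "u \<bullet> a - 2 * (u \<bullet> b) * c = m"
  proof -
    have "u \<bullet> a - 2 * (u \<bullet> b) * c = - m + 4 * m * (c * c)" unfolding ua ub by (simp add: algebra_simps)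
    then show ?thesis unfolding cc by simp
  qed
  then have "refl_in a (refl_in b u) = u - (2 * (n - 2 * c * m)) *\<^sub>R b - (2 * m) *\<^sub>R a"
    unfolding refl_refl cmn(1)[symmetric] ub by simp
  also have "\<dots> = v - (4 * (m - c * n)) *\<^sub>R a - (4 * (n - c * m)) *\<^sub>R b"
  proof -
    have "4 * (m - c * n) = 2 * (m - 2 * n * c) + 2 * m" "4 * (n - c * m) = 2 * n + 2 * (n - 2 * c * m)"
      by (simp_all add: algebra_simps)
    then show ?thesis by (simp only: u_def scaleR_add_left) (simp add: algebra_simps)
  qed
  finally show ?thesis unfolding refl_refl[of a b v] cmn[symmetric] u_def .
qed

text \<open>The situation of type F4. The condition on the angles is what makes the projections of the roots
  to the fixed space of \<open>\<tau>\<close> closed under reflections.\<close>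

locale twisted_root_system = twisted_cone +
  assumes fin: "finite dPhi" and unit: "\<And>a. a \<in> dPhi \<Longrightarrow> a \<bullet> a = 1"
    and closed: "\<And>a b. a \<in> dPhi \<Longrightarrow> b \<in> dPhi \<Longrightarrow> refl_in a b \<in> dPhi"
    and span: "span dPhi = UNIV"
    and involution: "\<And>v. \<tau> (\<tau> v) = v"
    and angles: "\<And>a. a \<in> dPhi \<Longrightarrow> a \<bullet> \<tau> a = 0 \<or> (a \<bullet> \<tau> a)\<^sup>2 = 1 / 2"
begin

abbreviation "\<Phi> \<equiv> sr_roots dPhi \<tau>"

lemma inner_fixed: "\<tau> v = v \<Longrightarrow> v \<bullet> (a + \<tau> a) = 2 * (v \<bullet> a)"
  using \<tau>_inner[of v a] by (simp add: inner_add_right)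

lemma \<tau>_sum: "\<tau> (a + \<tau> a) = a + \<tau> a"
  by (simp add: linear_add[OF \<tau>_linear] involution)

text \<open>On fixed vectors, the reflection in \<open>a + \<tau> a\<close> agrees with the longest element of the dihedral group
  generated by the reflections in \<open>a\<close> and \<open>\<tau> a\<close>, which has length two or four.\<close>

lemma reflection_of_sum:
  assumes a: "a \<in> dPhi" and b: "b \<in> dPhi"
  shows "\<exists>c\<in>dPhi. c + \<tau> c = refl_in (sgn (a + \<tau> a)) (b + \<tau> b)"
proof -
  define a' c m n where d: "a' = \<tau> a" "c = a \<bullet> a'" "m = b \<bullet> a" "n = b \<bullet> a'"
  have a': "a' \<in> dPhi" "a' \<bullet> a' = 1" "\<tau> a' = a" using \<tau>_root[OF a] unit involution by (auto simp: d)
  have \<tau>sub: "\<tau> (v - x *\<^sub>R a - y *\<^sub>R a') = \<tau> v - x *\<^sub>R a' - y *\<^sub>R a" for v x y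
    by (simp add: linear_diff[OF \<tau>_linear] linear_scale[OF \<tau>_linear] a'(3) d(1)[symmetric])
  have nn: "(a + a') \<bullet> (a + a') = 2 + 2 * c"
    using unit[OF a] a'(2) by (simp add: inner_add_left inner_add_right d(2) inner_commute[of a' a])
  have bb: "(b + \<tau> b) \<bullet> (a + a') = 2 * (m + n)"
    using inner_fixed[OF \<tau>_sum[of b], of a] \<tau>_inner[of b a'] by (simp add: d inner_add_left involution)
  have nz: "2 + 2 * c \<noteq> 0"
  proof -
    have "a + a' \<noteq> 0" using sum_nonzero[OF a] by (simp add: d)
    then show ?thesis using nn by (metis inner_eq_zero_iff)
  qed
  have refl: "refl_in (sgn (a + a')) (b + \<tau> b) = (b + \<tau> b) - (4 * (m + n) / (2 + 2 * c)) *\<^sub>R (a + a')"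
  proof -
    have "norm (a + a') * norm (a + a') = 2 + 2 * c" using nn by (simp add: norm_eq_square[symmetric] dot_square_norm power2_eq_square)
    then have sq: "inverse (norm (a + a')) * inverse (norm (a + a')) = 1 / (2 + 2 * c)"
      by (metis inverse_eq_divide inverse_mult_distrib)
    have "refl_in (sgn (a + a')) (b + \<tau> b) = (b + \<tau> b) - (2 * ((b + \<tau> b) \<bullet> (a + a')) * (inverse (norm (a + a')) * inverse (norm (a + a')))) *\<^sub>R (a + a')"
      unfolding refl_in_def sgn_div_norm inner_scaleR_right scaleR_scaleR by (simp only: mult_ac)
    then show ?thesis unfolding sq bb by simp
  qed
  have shape: "?thesis" if "v = b - x *\<^sub>R a - y *\<^sub>R a'" "v \<in> dPhi" "x + y = 4 * (m + n) / (2 + 2 * c)" for v x y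
  proof (rule bexI[of _ v])
    have "v + \<tau> v = (b + \<tau> b) - (x + y) *\<^sub>R (a + a')"
      unfolding that(1) \<tau>sub by (simp add: algebra_simps)
    then show "v + \<tau> v = refl_in (sgn (a + \<tau> a)) (b + \<tau> b)" unfolding d(1)[symmetric] refl that(3) .
  qed (rule that(2))
  have "c = 0 \<or> c\<^sup>2 = 1 / 2" using angles[OF a] unfolding d .
  then show ?thesis
  proof
    assume c0: "c = 0"
    have "refl_in a (refl_in a' b) = b - (2 * m) *\<^sub>R a - (2 * n) *\<^sub>R a'"
      unfolding refl_refl d(2-4)[symmetric] c0 by (simp add: algebra_simps)
    then show ?thesis
      by (rule shape[OF _ closed[OF a closed[OF a'(1) b]]]) (simp add: c0)
  next
    assume cc: "c\<^sup>2 = 1 / 2"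
    have "(1 - c) * (1 + c) = 1 / 2" using cc by (simp add: algebra_simps power2_eq_square)
    have "refl_in a (refl_in a' (refl_in a (refl_in a' b))) = b - (4 * (m - c * n)) *\<^sub>R a - (4 * (n - c * m)) *\<^sub>R a'"
      using refl_refl_square[OF unit[OF a] a'(2), of b] cc unfolding d(2-4)[symmetric] by blast
    then show ?thesis
    proof (rule shape[OF _ closed[OF a closed[OF a'(1) closed[OF a closed[OF a'(1) b]]]]])
      have "(4 * (m - c * n) + 4 * (n - c * m)) * (2 + 2 * c) = 8 * (m + n) * ((1 - c) * (1 + c))"
        by (simp add: algebra_simps)
      also have "\<dots> = 4 * (m + n)" unfolding \<open>(1 - c) * (1 + c) = 1 / 2\<close> by simp
      finally show "4 * (m - c * n) + 4 * (n - c * m) = 4 * (m + n) / (2 + 2 * c)"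
        unfolding nonzero_eq_divide_eq[OF nz] .
    qed
  qed
qed

lemma span_sr_roots: "span \<Phi> = {v. \<tau> v = v}"
proof
  have "subspace {v. \<tau> v = v}"
    unfolding subspace_def by (auto simp: linear_0[OF \<tau>_linear] linear_add[OF \<tau>_linear] linear_scale[OF \<tau>_linear])
  moreover have "\<Phi> \<subseteq> {v. \<tau> v = v}"
    by (auto simp: sr_roots_def sgn_div_norm linear_scale[OF \<tau>_linear] \<tau>_sum)
  ultimately show "span \<Phi> \<subseteq> {v. \<tau> v = v}" by (intro span_minimal)
  have base: "u + \<tau> u \<in> span \<Phi>" for u
  proof -
    have "subspace {u. u + \<tau> u \<in> span \<Phi>}"
      unfolding subspace_def
    proof (intro conjI ballI allI)
      show "0 \<in> {u. u + \<tau> u \<in> span \<Phi>}" by (simp add: linear_0[OF \<tau>_linear] span_0)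
    next
      fix x y assume "x \<in> {u. u + \<tau> u \<in> span \<Phi>}" "y \<in> {u. u + \<tau> u \<in> span \<Phi>}"
      then have "x + \<tau> x \<in> span \<Phi>" "y + \<tau> y \<in> span \<Phi>" by simp_all
      then have "(x + \<tau> x) + (y + \<tau> y) \<in> span \<Phi>" by (rule span_add)
      then show "x + y \<in> {u. u + \<tau> u \<in> span \<Phi>}" by (simp add: linear_add[OF \<tau>_linear] algebra_simps)
    next
      fix c :: real and x assume "x \<in> {u. u + \<tau> u \<in> span \<Phi>}"
      then have "c *\<^sub>R (x + \<tau> x) \<in> span \<Phi>" by (intro span_scale) auto
      then show "c *\<^sub>R x \<in> {u. u + \<tau> u \<in> span \<Phi>}" by (simp add: linear_scale[OF \<tau>_linear] scaleR_add_right)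
    qed
    moreover have "dPhi \<subseteq> {u. u + \<tau> u \<in> span \<Phi>}"
    proof
      fix a assume a: "a \<in> dPhi"
      have "norm (a + \<tau> a) *\<^sub>R sgn (a + \<tau> a) \<in> span \<Phi>"
        using a by (intro span_scale span_base) (auto simp: sr_roots_def)
      then show "a \<in> {u. u + \<tau> u \<in> span \<Phi>}" using sum_nonzero[OF a] by (simp add: sgn_div_norm)
    qed
    ultimately have "span dPhi \<subseteq> {u. u + \<tau> u \<in> span \<Phi>}" by (intro span_minimal)
    then show ?thesis using span by blast
  qed
  show "{v. \<tau> v = v} \<subseteq> span \<Phi>"
  proof
    fix v assume "v \<in> {v. \<tau> v = v}"
    then have "(1 / 2) *\<^sub>R (v + \<tau> v) = v" by (simp flip: scaleR_2)
    then show "v \<in> span \<Phi>" using span_scale[OF base[of v], of "1 / 2"] by simp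
  qed
qed

lemma inner_sgn_fixed: "\<tau> v = v \<Longrightarrow> v \<bullet> sgn (a + \<tau> a) = (2 / norm (a + \<tau> a)) * (v \<bullet> a)"
  using inner_fixed[of v a] by (simp add: sgn_div_norm divide_inverse)

lemma base_fixed: "\<tau> (p + \<tau> p) = p + \<tau> p"
  by (rule \<tau>_sum)

lemma base_inner:
  assumes a: "a \<in> dPhi"
  shows "(p + \<tau> p) \<bullet> a > 0 \<longleftrightarrow> p \<bullet> a > 0" "(p + \<tau> p) \<bullet> a \<noteq> 0"
proof -
  have e: "(p + \<tau> p) \<bullet> a = p \<bullet> a + p \<bullet> \<tau> a"
    using \<tau>_inner[of p "\<tau> a"] by (simp add: inner_add_left involution)
  have nz: "p \<bullet> a \<noteq> 0" using p a by (simp add: regular_def)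
  show "(p + \<tau> p) \<bullet> a > 0 \<longleftrightarrow> p \<bullet> a > 0" "(p + \<tau> p) \<bullet> a \<noteq> 0"
    unfolding e using \<tau>_pos[OF a] \<tau>_neg[OF a] nz by linarith+
qed

lemma regular_base: "regular \<Phi> (p + \<tau> p)"
  unfolding regular_def
proof
  show "p + \<tau> p \<in> span \<Phi>" unfolding span_sr_roots using base_fixed by simp
  show "\<forall>\<alpha>\<in>\<Phi>. (p + \<tau> p) \<bullet> \<alpha> \<noteq> 0"
  proof
    fix \<alpha> assume "\<alpha> \<in> \<Phi>"
    then obtain a where a: "a \<in> dPhi" "\<alpha> = sgn (a + \<tau> a)" by (rule sr_rootsE)
    show "(p + \<tau> p) \<bullet> \<alpha> \<noteq> 0"
      unfolding a(2) inner_sgn_fixed[OF base_fixed] using base_inner(2)[OF a(1)] sum_nonzero[OF a(1)] by simp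
  qed
qed

lemma sr_sector_cone: "sr_sector S \<tau> = cone_of \<Phi> (p + \<tau> p)"
proof -
  have key: "((p + \<tau> p) \<bullet> sgn (a + \<tau> a) > 0 \<longrightarrow> v \<bullet> sgn (a + \<tau> a) \<ge> 0) \<longleftrightarrow> (p \<bullet> a > 0 \<longrightarrow> v \<bullet> a \<ge> 0)"
    if a: "a \<in> dPhi" and v: "\<tau> v = v" for a v
  proof -
    define k where "k = 2 / norm (a + \<tau> a)"
    have "k > 0" using sum_nonzero[OF a] by (simp add: k_def)
    then show ?thesis unfolding inner_sgn_fixed[OF base_fixed] inner_sgn_fixed[OF v] k_def[symmetric]
      using base_inner(1)[OF a] by (simp add: zero_less_mult_iff zero_le_mult_iff)
  qed
  have "v \<in> sr_sector S \<tau> \<longleftrightarrow> v \<in> cone_of \<Phi> (p + \<tau> p)" for v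
  proof (cases "\<tau> v = v")
    case True
    have "v \<in> cone_of \<Phi> (p + \<tau> p) \<longleftrightarrow> (\<forall>a\<in>dPhi. (p + \<tau> p) \<bullet> sgn (a + \<tau> a) > 0 \<longrightarrow> v \<bullet> sgn (a + \<tau> a) \<ge> 0)"
    proof -
      have "v \<in> span \<Phi>" unfolding span_sr_roots using True by simp
      then have "v \<in> cone_of \<Phi> (p + \<tau> p) \<longleftrightarrow> (\<forall>\<alpha>\<in>\<Phi>. (p + \<tau> p) \<bullet> \<alpha> > 0 \<longrightarrow> v \<bullet> \<alpha> \<ge> 0)"
        by (simp add: cone_of_def)
      then show ?thesis unfolding sr_roots_def by simp
    qed
    also have "\<dots> \<longleftrightarrow> v \<in> sr_sector S \<tau>"
      using key[OF _ True] True by (simp add: sr_sector_def S cone_of_def span)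
    finally show ?thesis by blast
  next
    case False
    then show ?thesis by (simp add: cone_of_def span_sr_roots sr_sector_def)
  qed
  then show ?thesis by blast
qed

lemma reflection_system_sr: "reflection_system \<Phi> (p + \<tau> p) (sr_sector S \<tau>)"
proof
  show "finite \<Phi>" using fin by (simp add: sr_roots_def)
  show "regular \<Phi> (p + \<tau> p)" by (rule regular_base)
  show "sr_sector S \<tau> = cone_of \<Phi> (p + \<tau> p)" by (rule sr_sector_cone)
  fix \<alpha> assume \<alpha>: "\<alpha> \<in> \<Phi>"
  show un: "\<alpha> \<bullet> \<alpha> = 1" by (rule sr_unit[OF \<alpha>])
  show "- \<alpha> \<in> \<Phi>" by (rule sr_neg[OF \<alpha>])
  fix \<beta> assume \<beta>: "\<beta> \<in> \<Phi>"
  obtain a where a: "a \<in> dPhi" "\<alpha> = sgn (a + \<tau> a)" using \<alpha> by (rule sr_rootsE)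
  obtain b where b: "b \<in> dPhi" "\<beta> = sgn (b + \<tau> b)" using \<beta> by (rule sr_rootsE)
  obtain c where c: "c \<in> dPhi" "c + \<tau> c = refl_in \<alpha> (b + \<tau> b)" using reflection_of_sum[OF a(1) b(1)] a(2) by blast
  have "norm (refl_in \<alpha> (b + \<tau> b)) = norm (b + \<tau> b)" by (simp add: norm_eq_sqrt_inner inner_refl_in[OF un])
  then have "sgn (c + \<tau> c) = refl_in \<alpha> \<beta>"
    unfolding c(2) b(2) sgn_div_norm linear_scale[OF linear_refl_in] by simp
  then have "refl_in \<alpha> \<beta> = sgn (c + \<tau> c)" by (rule sym)
  then show "refl_in \<alpha> \<beta> \<in> \<Phi>" unfolding sr_roots_def using c(1) by (rule image_eqI)
qed

text \<open>A root that is perpendicular to all others splits off an orthogonal component.\<close>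

lemma isolated_component:
  assumes a: "a \<in> dPhi" and iso: "\<And>\<beta>. \<beta> \<in> \<Phi> \<Longrightarrow> sgn (a + \<tau> a) \<bullet> \<beta> = 0 \<or> \<beta> = sgn (a + \<tau> a) \<or> \<beta> = - sgn (a + \<tau> a)"
    and b: "b \<in> dPhi" "b \<bullet> (a + \<tau> a) \<noteq> 0"
  shows "sgn (b + \<tau> b) = sgn (a + \<tau> a) \<or> sgn (b + \<tau> b) = - sgn (a + \<tau> a)"
    and "c \<in> dPhi \<Longrightarrow> c \<bullet> (a + \<tau> a) = 0 \<Longrightarrow> b \<bullet> c = 0"
proof -
  let ?\<alpha> = "sgn (a + \<tau> a)"
  have inner: "?\<alpha> \<bullet> sgn (x + \<tau> x) = 0 \<longleftrightarrow> x \<bullet> (a + \<tau> a) = 0" if x: "x \<in> dPhi" for x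
  proof -
    have "(a + \<tau> a) \<bullet> sgn (x + \<tau> x) = (2 / norm (x + \<tau> x)) * ((a + \<tau> a) \<bullet> x)" by (rule inner_sgn_fixed[OF \<tau>_sum])
    then show ?thesis using sum_nonzero[OF x] sum_nonzero[OF a] by (simp add: sgn_div_norm[of "a + \<tau> a"] inner_commute)
  qed
  have par: "sgn (x + \<tau> x) = ?\<alpha> \<or> sgn (x + \<tau> x) = - ?\<alpha>" if x: "x \<in> dPhi" "x \<bullet> (a + \<tau> a) \<noteq> 0" for x
    using iso[of "sgn (x + \<tau> x)"] inner[OF x(1)] x by (auto simp: sr_roots_def)
  then show "sgn (b + \<tau> b) = ?\<alpha> \<or> sgn (b + \<tau> b) = - ?\<alpha>" using b by blast
  have mult: "\<exists>k. x + \<tau> x = k *\<^sub>R ?\<alpha>" if x: "x \<in> dPhi" "x \<bullet> (a + \<tau> a) \<noteq> 0" for x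
  proof -
    have "x + \<tau> x = norm (x + \<tau> x) *\<^sub>R sgn (x + \<tau> x)" using sum_nonzero[OF x(1)] by (simp add: sgn_div_norm)
    then have "x + \<tau> x = norm (x + \<tau> x) *\<^sub>R ?\<alpha> \<or> x + \<tau> x = (- norm (x + \<tau> x)) *\<^sub>R ?\<alpha>"
      using par[OF x] by (metis scaleR_minus_left scaleR_minus_right)
    then show ?thesis by blast
  qed
  assume c: "c \<in> dPhi" "c \<bullet> (a + \<tau> a) = 0"
  show "b \<bullet> c = 0"
  proof (rule ccontr)
    assume bc: "b \<bullet> c \<noteq> 0"
    define d where "d = refl_in b c"
    have dd: "d \<in> dPhi" "c = d + (2 * (c \<bullet> b)) *\<^sub>R b" using closed[OF b(1) c(1)] by (simp_all add: d_def refl_in_def)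
    have "d \<bullet> (a + \<tau> a) = - (2 * (c \<bullet> b)) * (b \<bullet> (a + \<tau> a))" using c(2) by (simp add: d_def refl_in_def inner_diff_left)
    then have "d \<bullet> (a + \<tau> a) \<noteq> 0" using bc b(2) by (simp add: inner_commute)
    then obtain k where k: "d + \<tau> d = k *\<^sub>R ?\<alpha>" using mult[OF dd(1)] by blast
    obtain l where l: "b + \<tau> b = l *\<^sub>R ?\<alpha>" using mult[OF b] by blast
    have "c + \<tau> c = (d + \<tau> d) + (2 * (c \<bullet> b)) *\<^sub>R (b + \<tau> b)"
      by (subst (1 2) dd(2)) (simp add: linear_add[OF \<tau>_linear] linear_scale[OF \<tau>_linear] scaleR_add_right)
    then have e: "c + \<tau> c = (k + 2 * (c \<bullet> b) * l) *\<^sub>R ?\<alpha>" unfolding k l by (simp add: scaleR_add_left)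
    have "?\<alpha> \<bullet> (c + \<tau> c) = 0"
      using inner[OF c(1)] c(2) sum_nonzero[OF c(1)] by (simp add: sgn_div_norm[of "c + \<tau> c"])
    moreover have "?\<alpha> \<bullet> ?\<alpha> = 1" using sr_unit[of ?\<alpha>] a by (auto simp: sr_roots_def)
    ultimately have "k + 2 * (c \<bullet> b) * l = 0" unfolding e by simp
    then show False using e sum_nonzero[OF c(1)] by simp
  qed
qed

end

text \<open>The root set of a Suzuki-Ree building of type F4 is a reflection system without isolated
  roots. By conjugation with the Weyl group, the chamber may be taken to be the standard one.\<close>

lemma sr_roots_F4:
  fixes dPhi :: "'v::euclidean_space set"
  assumes roots: "root_set_F4 dPhi" and S: "S \<in> sectors dPhi"
    and \<tau>: "orthogonal_transformation \<tau>" "\<tau> \<noteq> id" "\<tau> ` dPhi = dPhi" "\<tau> ` S = S"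
  obtains q where "reflection_system (sr_roots dPhi \<tau>) q (sr_sector S \<tau>)"
    "\<And>\<alpha>. \<alpha> \<in> sr_roots dPhi \<tau> \<Longrightarrow> \<exists>\<beta>\<in>sr_roots dPhi \<tau>. \<alpha> \<bullet> \<beta> \<noteq> 0 \<and> \<beta> \<noteq> \<alpha> \<and> \<beta> \<noteq> - \<alpha>"
proof -
  obtain b0 b1 b2 b3 where frame: "frame4 b0 b1 b2 b3" and Phi: "dPhi = frame4.F4 b0 b1 b2 b3"
    using root_set_F4_frame[OF roots] .
  interpret b: frame4 b0 b1 b2 b3 by (rule frame)
  have zero: "0 \<notin> dPhi" using b.F4_unit unfolding Phi by force
  obtain p where p: "regular dPhi p" "S = cone_of dPhi p"
    using S b.F4_uminus zero by (auto simp: sectors_eq Phi)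
  interpret r: reflection_system dPhi b.base_point "cone_of dPhi b.base_point"
    by standard (use b.finite_F4 b.F4_unit b.F4_uminus b.F4_refl b.F4_pos_comb(1)[OF b.base_point_n] in
      \<open>auto simp: Phi regular_def b.span_F4\<close>)
  obtain w where w: "w \<in> weyl dPhi" "cone_of dPhi p = w ` cone_of dPhi b.base_point"
    using r.cone_of_weyl[OF p(1)] .
  obtain w' where w': "w' \<in> weyl dPhi" "w' \<circ> w = id" "w \<circ> w' = id" using r.weyl_inverse[OF w(1)] .
  have wl: "linear w" and wi: "\<And>u v. w u \<bullet> w v = u \<bullet> v" using r.weyl_isometry[OF w(1)] by auto
  have ww: "w (w' v) = v" for v using fun_cong[OF w'(3), of v] by simp
  note img = frame4_image[OF frame wl wi ww]
  interpret f: frame4 "w b0" "w b1" "w b2" "w b3" by (rule img(1))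
  have Phi': "dPhi = f.F4"
  proof -
    have "w ` dPhi \<subseteq> dPhi" using r.weyl_isometry(3)[OF w(1)] by blast
    moreover have "dPhi \<subseteq> w ` dPhi"
      using r.weyl_isometry(3)[OF w'(1)] ww by (metis imageI subsetI)
    ultimately show ?thesis using img(2) Phi by blast
  qed
  have pw: "p \<bullet> w n > 0" if n: "n \<in> dPhi" "b.base_point \<bullet> n > 0" for n
  proof -
    have "p \<in> w ` cone_of dPhi b.base_point" using regular_in_cone[OF p(1)] w(2) by simp
    then obtain s where s: "s \<in> cone_of dPhi b.base_point" "p = w s" by blast
    have "p \<bullet> w n \<ge> 0" unfolding s(2) wi using s(1) n by (simp add: cone_of_def)
    moreover have "p \<bullet> w n \<noteq> 0" using p(1) r.weyl_isometry(3)[OF w(1) n(1)] by (simp add: regular_def)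
    ultimately show ?thesis by simp
  qed
  have pn: "p \<bullet> f.n1 > 0" "p \<bullet> f.n2 > 0" "p \<bullet> f.n3 > 0" "p \<bullet> f.n4 > 0"
    unfolding img(3-6) using pw b.n_root b.base_point_n unfolding Phi by blast+
  have \<tau>': "\<tau> ` f.F4 = f.F4" "\<tau> ` cone_of f.F4 p = cone_of f.F4 p"
    using \<tau>(3,4) unfolding Phi'[symmetric] p(2)[symmetric] by auto
  note flip = f.chamber_symmetry[OF pn \<tau>(1,2) \<tau>']
  have lin: "linear \<tau>" using \<tau>(1) by (simp add: orthogonal_transformation_def)
  note inv = f.diagram_flip[OF lin flip]
  interpret t: twisted_root_system dPhi S \<tau> p
    by standard (use p \<tau> b.finite_F4 f.F4_unit f.F4_uminus f.F4_refl f.span_F4 inv in \<open>auto simp: Phi'[symmetric] b.finite_F4[folded Phi]\<close>)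
  have "\<exists>\<beta>\<in>sr_roots dPhi \<tau>. \<alpha> \<bullet> \<beta> \<noteq> 0 \<and> \<beta> \<noteq> \<alpha> \<and> \<beta> \<noteq> - \<alpha>" if \<alpha>: "\<alpha> \<in> sr_roots dPhi \<tau>" for \<alpha>
  proof (rule ccontr)
    assume no: "\<not> ?thesis"
    obtain a where a: "a \<in> dPhi" "\<alpha> = sgn (a + \<tau> a)" using \<alpha> by (rule t.sr_rootsE)
    have iso: "sgn (a + \<tau> a) \<bullet> \<beta> = 0 \<or> \<beta> = sgn (a + \<tau> a) \<or> \<beta> = - sgn (a + \<tau> a)" if "\<beta> \<in> sr_roots dPhi \<tau>" for \<beta>
      using no that unfolding a(2) by blast
    have comp: "sgn (b + \<tau> b) = sgn (a + \<tau> a) \<or> sgn (b + \<tau> b) = - sgn (a + \<tau> a)"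
      "c \<in> dPhi \<Longrightarrow> c \<bullet> (a + \<tau> a) = 0 \<Longrightarrow> b \<bullet> c = 0"
      if "b \<in> dPhi" "b \<bullet> (a + \<tau> a) \<noteq> 0" for b c
    proof -
      show "sgn (b + \<tau> b) = sgn (a + \<tau> a) \<or> sgn (b + \<tau> b) = - sgn (a + \<tau> a)"
        by (rule t.isolated_component(1)[OF a(1) _ that]) (rule iso)
      show "b \<bullet> c = 0" if "c \<in> dPhi" "c \<bullet> (a + \<tau> a) = 0"
        by (rule t.isolated_component(2)[OF a(1) _ \<open>b \<in> dPhi\<close> \<open>b \<bullet> (a + \<tau> a) \<noteq> 0\<close> that]) (rule iso)
    qed
    let ?P = "\<lambda>n. n \<bullet> (a + \<tau> a) \<noteq> 0"
    have root: "f.n1 \<in> dPhi" "f.n2 \<in> dPhi" "f.n3 \<in> dPhi" "f.n4 \<in> dPhi" using f.n_root Phi' by auto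
    \<comment> \<open>The four simple roots form a connected diagram, so they all belong to the same component.\<close>
    have step: "?P n \<longleftrightarrow> ?P m" if "n \<in> dPhi" "m \<in> dPhi" "n \<bullet> m \<noteq> 0" for n m
      using comp(2)[of n m] comp(2)[of m n] that by (auto simp: inner_commute)
    have eq: "?P f.n1 \<longleftrightarrow> ?P f.n2" "?P f.n2 \<longleftrightarrow> ?P f.n3" "?P f.n3 \<longleftrightarrow> ?P f.n4"
      by (rule step; use root f.gram in simp)+
    have "?P f.n1"
    proof (rule ccontr)
      assume "\<not> ?P f.n1"
      then have "\<not> ?P f.n1" "\<not> ?P f.n2" "\<not> ?P f.n3" "\<not> ?P f.n4" using eq by blast+
      then have "(a + \<tau> a) \<bullet> f.comb x y z t = 0" for x y z t
        unfolding f.inner_comb by (simp add: inner_commute)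
      then have "(a + \<tau> a) \<bullet> (a + \<tau> a) = 0" using f.comb_coords[of "a + \<tau> a"] by metis
      then show False using t.sum_nonzero[OF a(1)] by simp
    qed
    then have "?P f.n2" using eq by blast
    have "sgn (f.n1 + f.n4) = sgn (f.n2 + f.n3) \<or> sgn (f.n1 + f.n4) = - sgn (f.n2 + f.n3)"
      using comp(1)[OF root(1) \<open>?P f.n1\<close>] comp(1)[OF root(2) \<open>?P f.n2\<close>] unfolding flip by auto
    moreover have "sgn (f.n2 + f.n3) \<bullet> w b0 = 0" by (simp add: sgn_div_norm inner_add_left f.coords_n)
    ultimately have z: "sgn (f.n1 + f.n4) \<bullet> w b0 = 0" by auto
    have "(f.n1 + f.n4) \<bullet> w b0 = 1 / 2" by (simp add: inner_add_left f.coords_n)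
    moreover from this have "f.n1 + f.n4 \<noteq> 0" by auto
    ultimately show False using z by (simp add: sgn_div_norm)
  qed
  then show thesis using that[OF t.reflection_system_sr] by blast
qed

subsection \<open>Symmetries of rank two\<close>

text \<open>A non-trivial isometry of a plane with a non-zero fixed vector \<open>q\<close> is the reflection in the line of \<open>q\<close>.\<close>

lemma plane_symmetry:
  fixes \<tau> :: "'v::euclidean_space \<Rightarrow> 'v" and x y q v :: 'v
  assumes plane: "span {x, y} = UNIV" and \<tau>: "orthogonal_transformation \<tau>" "\<tau> \<noteq> id" and q: "\<tau> q = q" "q \<noteq> 0"
  shows "\<exists>k. v + \<tau> v = k *\<^sub>R q"
proof -
  have lin: "linear \<tau>" and iso: "\<tau> v \<bullet> \<tau> w = v \<bullet> w" for v w
    using \<tau>(1) by (simp_all add: orthogonal_transformation_def)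
  define W where "W = {v. q \<bullet> v = 0}"
  have "dim (UNIV :: 'v set) \<le> card {x, y}"
    using dim_le_card[of "UNIV :: 'v set" "{x, y}"] plane by simp
  also have "card {x, y} \<le> 2" by (cases "x = y") auto
  finally have "dim (UNIV :: 'v set) \<le> 2" .
  moreover have "dim W = DIM('v) - 1" unfolding W_def by (rule dim_hyperplane[OF q(2)])
  ultimately have dW: "dim W \<le> 1" by simp
  obtain B where B: "B \<subseteq> W" "independent B" "W \<subseteq> span B" "card B = dim W" using basis_exists[of W] by blast
  have "finite B" using B(2) by (rule independent_imp_finite)
  then obtain u where u: "u \<in> W" "W \<subseteq> span {u}"
  proof (cases "B = {}")
    case True
    have "0 \<in> W" by (simp add: W_def)
    then show thesis using that[of 0] B(3) True by (simp add: span_insert_0)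
  next
    case False
    then have "card B = 1" using B(4) dW \<open>finite B\<close> by (metis card_0_eq le_antisym less_one linorder_not_less)
    then obtain b where "B = {b}" by (auto simp: card_Suc_eq One_nat_def)
    then show thesis using that[of b] B by auto
  qed
  have span_u: "\<exists>k. w = k *\<^sub>R u" if "w \<in> W" for w
    using u(2) that by (auto simp: span_singleton)
  have decomp: "\<exists>k l. v = k *\<^sub>R q + l *\<^sub>R u" for v
  proof -
    have "v - (v \<bullet> q / (q \<bullet> q)) *\<^sub>R q \<in> W"
      using q(2) by (simp add: W_def inner_diff_right inner_commute)
    then obtain l where "v - (v \<bullet> q / (q \<bullet> q)) *\<^sub>R q = l *\<^sub>R u" using span_u by blast
    then have "v = (v \<bullet> q / (q \<bullet> q)) *\<^sub>R q + l *\<^sub>R u" by (simp add: algebra_simps)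
    then show ?thesis by blast
  qed
  have "q \<bullet> \<tau> u = 0" using iso[of q u] q(1) u(1) by (simp add: W_def)
  then obtain c where c: "\<tau> u = c *\<^sub>R u" using span_u[of "\<tau> u"] by (auto simp: W_def)
  have neg: "\<tau> u = - u"
  proof (rule ccontr)
    assume ne: "\<tau> u \<noteq> - u"
    have "u \<bullet> u = (c * c) * (u \<bullet> u)" using iso[of u u] c by simp
    then have "u = 0 \<or> c * c = 1" by auto
    then have "\<tau> u = u" using ne c by (auto simp: square_eq_1_iff)
    have "\<tau> v = v" for v
    proof -
      obtain k l where kl: "v = k *\<^sub>R q + l *\<^sub>R u" using decomp by blast
      show ?thesis unfolding kl using q(1) \<open>\<tau> u = u\<close> by (simp add: linear_add[OF lin] linear_scale[OF lin])
    qed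
    then show False using \<tau>(2) by (auto simp: fun_eq_iff)
  qed
  obtain k l where kl: "v = k *\<^sub>R q + l *\<^sub>R u" using decomp by blast
  have "v + \<tau> v = (2 * k) *\<^sub>R q"
    unfolding kl using q(1) neg by (simp add: linear_add[OF lin] linear_scale[OF lin] algebra_simps flip: scaleR_2)
  then show ?thesis by blast
qed

context twisted_cone begin

text \<open>As \<open>\<tau>\<close> permutes a finite spanning set, the orbit of \<open>p\<close> is finite; its sum is a fixed vector in
  the interior of the chamber.\<close>

lemma fixed_base:
  assumes fin: "finite dPhi" and span: "span dPhi = UNIV"
  obtains q where "\<tau> q = q" "\<And>a. a \<in> dPhi \<Longrightarrow> p \<bullet> a > 0 \<Longrightarrow> q \<bullet> a > 0"
proof -
  define r where "r n = restrict (\<tau> ^^ n) dPhi" for n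
  have pw: "(\<tau> ^^ n) a \<in> dPhi" if "a \<in> dPhi" for n a
    using that by (induction n) (auto intro: \<tau>_root)
  have "range r \<subseteq> dPhi \<rightarrow>\<^sub>E dPhi" using pw by (auto simp: r_def PiE_def)
  then have "finite (range r)" by (rule finite_subset) (rule finite_PiE[OF fin fin])
  then have "\<not> inj r" using finite_imageD[of r UNIV] infinite_UNIV_nat by blast
  then obtain i j where ij: "i < j" "r i = r j" unfolding inj_def by (metis linorder_neqE_nat)
  define N where "N = j - i"
  have lin: "linear (\<tau> ^^ n)" for n
  proof (induction n)
    case 0
    show ?case by (simp add: linear_iff)
  next
    case (Suc n)
    then show ?case using \<tau>_linear by (simp add: linear_iff)
  qed
  have injn: "(\<tau> ^^ n) v = (\<tau> ^^ n) w \<Longrightarrow> v = w" for n v w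
  proof (induction n)
    case (Suc n)
    have "\<tau> x = \<tau> y \<Longrightarrow> x = y" for x y
      using orthogonal_transformation_inj[OF \<tau>(1)] by (simp add: inj_def)
    then show ?case using Suc by auto
  qed simp
  have "(\<tau> ^^ N) a = a" if a: "a \<in> dPhi" for a
  proof -
    have "(\<tau> ^^ i) a = (\<tau> ^^ j) a" using fun_cong[OF ij(2), of a] a by (simp add: r_def)
    also have "j = i + N" using ij(1) by (simp add: N_def)
    also have "(\<tau> ^^ (i + N)) a = (\<tau> ^^ i) ((\<tau> ^^ N) a)" by (simp add: funpow_add)
    finally show ?thesis using injn by metis
  qed
  moreover have "subspace {v. (\<tau> ^^ N) v = v}"
    unfolding subspace_def using lin[of N] by (simp add: linear_0 linear_add linear_scale)
  ultimately have "span dPhi \<subseteq> {v. (\<tau> ^^ N) v = v}" by (intro span_minimal) auto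
  then have per: "(\<tau> ^^ N) p = p" using span by blast
  define q where "q = (\<Sum>k<N. (\<tau> ^^ k) p)"
  have "\<tau> q = (\<Sum>k<N. (\<tau> ^^ Suc k) p)" by (simp add: q_def linear_sum[OF \<tau>_linear])
  also have "\<dots> = q"
  proof -
    have "(\<tau> ^^ 0) p + (\<Sum>k<N. (\<tau> ^^ Suc k) p) = (\<Sum>k<N. (\<tau> ^^ k) p) + (\<tau> ^^ N) p"
      using sum.lessThan_Suc_shift[of "\<lambda>k. (\<tau> ^^ k) p" N] sum.lessThan_Suc[of "\<lambda>k. (\<tau> ^^ k) p" N] by argo
    then show ?thesis using per by (simp add: q_def)
  qed
  finally have fix1: "\<tau> q = q" .
  have pos: "(\<tau> ^^ k) p \<bullet> a > 0" if "a \<in> dPhi" "p \<bullet> a > 0" for k a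
    using that
  proof (induction k arbitrary: a)
    case (Suc k)
    obtain b where b: "b \<in> dPhi" "a = \<tau> b" using Suc.prems(1) \<tau>(2) by blast
    then show ?case using Suc.IH[OF b(1)] Suc.prems(2) \<tau>_pos[OF b(1)] by (simp add: \<tau>_inner)
  qed simp
  have "q \<bullet> a > 0" if "a \<in> dPhi" "p \<bullet> a > 0" for a
  proof -
    have "{..<N} \<noteq> {}" using ij(1) by (simp add: N_def lessThan_empty_iff)
    then show ?thesis unfolding q_def inner_sum_left using pos[OF that] by (intro sum_pos) auto
  qed
  then show thesis using that fix1 by blast
qed

text \<open>For roots in a plane all vectors \<open>a + \<tau> a\<close> lie on one line, so the Suzuki-Ree building has rank one.\<close>

lemma card_simple_roots_plane:
  fixes x y :: 'v
  assumes fin: "finite dPhi" and span: "span dPhi = UNIV" and ne: "\<tau> \<noteq> id" and plane: "span {x, y} = UNIV"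
  shows "card (simple_roots (sr_roots dPhi \<tau>) (sr_sector S \<tau>)) \<le> 1"
proof -
  obtain q where q: "\<tau> q = q" "\<And>a. a \<in> dPhi \<Longrightarrow> p \<bullet> a > 0 \<Longrightarrow> q \<bullet> a > 0"
    using fixed_base[OF fin span] by blast
  have "dPhi \<noteq> {}"
  proof
    assume "dPhi = {}"
    then have z: "v = 0" if "v \<in> span dPhi" for v using that by simp
    have "\<tau> v = id v" for v using z[of v] z[of "\<tau> v"] span by simp
    then have "\<tau> = id" by (rule ext)
    with ne show False by blast
  qed
  then obtain a where a: "a \<in> dPhi" "p \<bullet> a > 0"
  proof -
    obtain b where b: "b \<in> dPhi" using \<open>dPhi \<noteq> {}\<close> by blast
    have "p \<bullet> b \<noteq> 0" using p b by (simp add: regular_def)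
    then show thesis using that[of b] that[of "- b"] b neg[OF b] by (cases "p \<bullet> b > 0") auto
  qed
  then have q0: "q \<noteq> 0" using q(2) by force
  have "simple_roots (sr_roots dPhi \<tau>) (sr_sector S \<tau>) \<subseteq> {sgn q}"
  proof
    fix i assume i: "i \<in> simple_roots (sr_roots dPhi \<tau>) (sr_sector S \<tau>)"
    then have i': "i \<in> sr_roots dPhi \<tau>" "sr_sector S \<tau> \<subseteq> halfspace i" by (auto simp: simple_roots_def)
    obtain b where b: "b \<in> dPhi" "i = sgn (b + \<tau> b)" using i'(1) by (rule sr_rootsE)
    obtain k where k: "b + \<tau> b = k *\<^sub>R q" using plane_symmetry[OF plane \<tau>(1) ne q(1) q0] by blast
    have "q \<in> S" unfolding S cone_of_def using q(2) by (auto simp: span less_imp_le)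
    then have "q \<in> sr_sector S \<tau>" using q(1) by (simp add: sr_sector_def)
    then have "q \<bullet> i \<ge> 0" using i'(2) by (auto simp: halfspace_def)
    moreover have ik: "i = sgn k *\<^sub>R sgn q" unfolding b(2) k by (rule sgn_scaleR)
    moreover have "q \<bullet> sgn q > 0" using q0 by (simp add: sgn_div_norm)
    ultimately have "sgn k \<ge> 0" by (simp add: zero_le_mult_iff)
    moreover have "k \<noteq> 0" using k sum_nonzero[OF b(1)] by auto
    ultimately have "sgn k = 1" by (simp add: sgn_if split: if_splits)
    then show "i \<in> {sgn q}" using ik by simp
  qed
  then show ?thesis using card_mono[of "{sgn q}"] by fastforce
qed

end

lemma sgn_image_neg:
  assumes "\<And>r. r \<in> R \<Longrightarrow> - r \<in> R" "a \<in> sgn ` R"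
  shows "- (a::'v::euclidean_space) \<in> sgn ` R"
  using assms by (auto simp: sgn_minus[symmetric] intro!: imageI)

lemma sgn_image_nonzero: "0 \<notin> R \<Longrightarrow> 0 \<notin> sgn ` (R :: 'v::euclidean_space set)"
  by (auto simp: sgn_zero_iff)

lemma span_sgn_image:
  assumes "R \<subseteq> span Y" "span (sgn ` (R :: 'v::euclidean_space set)) = UNIV" shows "span Y = UNIV"
proof -
  have "sgn ` R \<subseteq> span Y" using assms(1) by (auto simp: sgn_div_norm intro!: span_scale)
  then have "span (sgn ` R) \<subseteq> span Y" by (intro span_minimal) auto
  then show ?thesis using assms(2) by blast
qed

lemma root_set_B2_props:
  fixes \<Phi> :: "'v::euclidean_space set"
  assumes "root_set_B2 \<Phi>"
  shows "finite \<Phi>" "\<And>a. a \<in> \<Phi> \<Longrightarrow> - a \<in> \<Phi>" "0 \<notin> \<Phi>" "\<exists>x y :: 'v. span {x, y} = UNIV"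
proof -
  obtain e :: "nat \<Rightarrow> 'v" where sp: "span \<Phi> = UNIV" and on: "orthonormal_family 2 e"
    and Phi: "\<Phi> = sgn ` ({c *\<^sub>R e i | c i. c \<in> {1, -1} \<and> i < 2}
                \<union> {c *\<^sub>R e 0 + d *\<^sub>R e 1 | c d. c \<in> {1, -1} \<and> d \<in> {1, -1}})"
    using assms unfolding root_set_B2_def by blast
  define R where "R = {e 0, - e 0, e 1, - e 1, e 0 + e 1, e 0 - e 1, - e 0 + e 1, - e 0 - e 1}"
  have i2: "i < 2 \<longleftrightarrow> i = 0 \<or> i = 1" for i :: nat by linarith
  have R: "\<Phi> = sgn ` R"
  proof -
    define M where "M = {c *\<^sub>R e i | c i. c \<in> {1, -1} \<and> i < 2}
                \<union> {c *\<^sub>R e 0 + d *\<^sub>R e 1 | c d. c \<in> {1, -1} \<and> d \<in> {1, -1}}"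
    have "M \<subseteq> R" unfolding M_def R_def i2 by (auto simp del: One_nat_def)
    have single: "c *\<^sub>R e i \<in> M" if "c = 1 \<or> c = -1" "i = 0 \<or> i = 1" for c i
      unfolding M_def using that by (intro UnI1) (auto simp: i2)
    have double: "c *\<^sub>R e 0 + d *\<^sub>R e 1 \<in> M" if "c = 1 \<or> c = -1" "d = 1 \<or> d = -1" for c d
      unfolding M_def using that by (intro UnI2) blast
    have "R \<subseteq> M"
      using single[of 1 0] single[of "-1" 0] single[of 1 1] single[of "-1" 1]
        double[of 1 1] double[of 1 "-1"] double[of "-1" 1] double[of "-1" "-1"]
      unfolding R_def by simp
    with \<open>M \<subseteq> R\<close> show ?thesis unfolding Phi M_def[symmetric] by blast
  qed
  have ee: "e 0 \<bullet> e 0 = 1" "e 1 \<bullet> e 1 = 1" "e 0 \<bullet> e 1 = 0"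
    using on by (auto simp: orthonormal_family_def)
  show "finite \<Phi>" unfolding R R_def by simp
  show "- a \<in> \<Phi>" if "a \<in> \<Phi>" for a
    using that unfolding R by (rule sgn_image_neg[rotated]) (auto simp: R_def)
  have "r \<bullet> e 0 \<noteq> 0 \<or> r \<bullet> e 1 \<noteq> 0" if "r \<in> R" for r
    using that unfolding R_def by (auto simp: inner_add_left inner_diff_left ee inner_commute[of "e 1" "e 0"] ee[unfolded One_nat_def])
  then have "0 \<notin> R" by force
  then show "0 \<notin> \<Phi>" unfolding R by (rule sgn_image_nonzero)
  have "R \<subseteq> span {e 0, e 1}" unfolding R_def
    by (auto intro!: span_add span_diff span_neg intro: span_base)
  then show "\<exists>x y :: 'v. span {x, y} = UNIV" using span_sgn_image sp unfolding R by blast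
qed

lemma root_set_G2_props:
  fixes \<Phi> :: "'v::euclidean_space set"
  assumes "root_set_G2 \<Phi>"
  shows "finite \<Phi>" "\<And>a. a \<in> \<Phi> \<Longrightarrow> - a \<in> \<Phi>" "0 \<notin> \<Phi>" "\<exists>x y :: 'v. span {x, y} = UNIV"
proof -
  obtain a b :: 'v where sp: "span \<Phi> = UNIV" and ab: "a \<bullet> a = 2" "b \<bullet> b = 6" "a \<bullet> b = -3"
    and Phi: "\<Phi> = sgn ` {c *\<^sub>R v | c v. c \<in> {1, -1} \<and>
            v \<in> {a, b, a + b, 2 *\<^sub>R a + b, 3 *\<^sub>R a + b, 3 *\<^sub>R a + 2 *\<^sub>R b}}"
    using assms unfolding root_set_G2_def by blast
  define Q where "Q = {a, b, a + b, 2 *\<^sub>R a + b, 3 *\<^sub>R a + b, 3 *\<^sub>R a + 2 *\<^sub>R b}"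
  define R where "R = Q \<union> uminus ` Q"
  have R: "\<Phi> = sgn ` R"
  proof -
    have "x \<in> {c *\<^sub>R v | c v. c \<in> {1, -1} \<and> v \<in> Q} \<longleftrightarrow> x \<in> R" for x
    proof
      assume "x \<in> R"
      then have "(\<exists>v\<in>Q. x = 1 *\<^sub>R v) \<or> (\<exists>v\<in>Q. x = (-1) *\<^sub>R v)" by (auto simp: R_def)
      then show "x \<in> {c *\<^sub>R v | c v. c \<in> {1, -1} \<and> v \<in> Q}" by blast
    qed (auto simp: R_def)
    then show ?thesis unfolding Phi Q_def[symmetric] by blast
  qed
  show "finite \<Phi>" unfolding R R_def Q_def by simp
  show "- x \<in> \<Phi>" if "x \<in> \<Phi>" for x
    using that unfolding R by (rule sgn_image_neg[rotated]) (auto simp: R_def)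
  have "v \<bullet> v \<noteq> 0" if "v \<in> Q" for v
    using that unfolding Q_def by (auto simp: inner_add_left inner_add_right ab inner_commute[of b a] simp del: inner_eq_zero_iff)
  then have "0 \<notin> R" unfolding R_def by force
  then show "0 \<notin> \<Phi>" unfolding R by (rule sgn_image_nonzero)
  have "Q \<subseteq> span {a, b}" unfolding Q_def
    by (auto intro!: span_add span_scale intro: span_base)
  then have "R \<subseteq> span {a, b}" unfolding R_def by (auto intro: span_neg)
  then show "\<exists>x y :: 'v. span {x, y} = UNIV" using span_sgn_image sp unfolding R by blast
qed

lemma root_set_F4_props:
  assumes "root_set_F4 \<Phi>"
  shows "\<And>a. a \<in> \<Phi> \<Longrightarrow> - a \<in> \<Phi>" "0 \<notin> \<Phi>"
proof -
  obtain b0 b1 b2 b3 where frame: "frame4 b0 b1 b2 b3" and Phi: "\<Phi> = frame4.F4 b0 b1 b2 b3"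
    using root_set_F4_frame[OF assms] .
  interpret b: frame4 b0 b1 b2 b3 by (rule frame)
  show "\<And>a. a \<in> \<Phi> \<Longrightarrow> - a \<in> \<Phi>" unfolding Phi by (rule b.F4_uminus)
  show "0 \<notin> \<Phi>" using b.F4_unit unfolding Phi by force
qed

lemma root_set_of_case_props:
  assumes "root_set_of_case X \<Phi>"
  shows "\<And>a. a \<in> \<Phi> \<Longrightarrow> - a \<in> \<Phi>" "0 \<notin> \<Phi>"
proof -
  have "(\<forall>a\<in>\<Phi>. - a \<in> \<Phi>) \<and> 0 \<notin> \<Phi>"
  proof (cases X)
    case Case_B
    then have "root_set_B2 \<Phi>" using assms by (simp add: root_set_of_case_def)
    from root_set_B2_props(2,3)[OF this] show ?thesis by blast
  next
    case Case_F
    then have "root_set_F4 \<Phi>" using assms by (simp add: root_set_of_case_def)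
    from root_set_F4_props[OF this] show ?thesis by blast
  next
    case Case_G
    then have "root_set_G2 \<Phi>" using assms by (simp add: root_set_of_case_def)
    from root_set_G2_props(2,3)[OF this] show ?thesis by blast
  qed
  then show "\<And>a. a \<in> \<Phi> \<Longrightarrow> - a \<in> \<Phi>" "0 \<notin> \<Phi>" by blast+
qed

section \<open>Reflecting elements of a root datum\<close>

text \<open>The conditions that define \<open>m\<^sub>\<Sigma>(u)\<close>: the element \<open>m\<close> lies in the double coset of \<open>u\<close> and stabilizes the
  apartment.\<close>

definition reflecting :: "('c, 'i) chamber_system \<Rightarrow> 'c set \<Rightarrow> ('v::euclidean_space \<Rightarrow> ('c \<Rightarrow> 'c) set) \<Rightarrow> 'v \<Rightarrow>
    ('c \<Rightarrow> 'c) \<Rightarrow> ('c \<Rightarrow> 'c) \<Rightarrow> bool" where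
  "reflecting D A U \<alpha> u m \<longleftrightarrow> (\<exists>a\<in>U (- \<alpha>) - {id}. \<exists>b\<in>U (- \<alpha>) - {id}.
     m = a \<otimes>\<^bsub>aut_group D\<^esub> u \<otimes>\<^bsub>aut_group D\<^esub> b) \<and> m ` A = A"

text \<open>In rank one the two chambers of the apartment are \<open>b1\<close> and \<open>b2\<close>. A reflecting element has
  to interchange them, which determines the two factors by sharp transitivity.\<close>

lemma reflecting_rank_one:
  assumes neg: "\<And>a. a \<in> \<Phi> \<Longrightarrow> - a \<in> \<Phi>" and nz: "0 \<notin> \<Phi>"
    and moufang: "moufang_structure \<Phi> S D rt U"
    and A: "A \<subseteq> chambers D" and iso: "chamber_iso (coxeter_complex \<Phi> S) (D\<lparr>chambers := A\<rparr>) \<sigma> \<pi>"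
    and rt: "\<And>\<alpha>. \<alpha> \<in> \<Phi> \<Longrightarrow> rt \<alpha> = \<pi> ` coxeter_root \<Phi> \<alpha>"
    and \<alpha>: "\<alpha> \<in> \<Phi>" and u: "u \<in> U \<alpha> - {id}"
  shows "\<exists>!m. reflecting D A U \<alpha> u m"
proof -
  have n\<alpha>: "- \<alpha> \<in> \<Phi>" using neg \<alpha> .
  have str: "subgroup (U \<beta>) (aut_group D) \<and>
        (\<exists>b. rt \<beta> = {b} \<and> (\<forall>u\<in>U \<beta>. u b = b) \<and>
           (\<forall>c\<in>chambers D - {b}. \<forall>d\<in>chambers D - {b}. \<exists>!u. u \<in> U \<beta> \<and> u c = d))" if "\<beta> \<in> \<Phi>" for \<beta>
  proof -
    have M: "subgroup (U \<beta>) (aut_group D) \<and> U \<beta> \<noteq> {id} \<and>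
        (\<exists>b. rt \<beta> = {b} \<and> (\<forall>u\<in>U \<beta>. u b = b) \<and>
           (\<forall>c\<in>chambers D - {b}. \<forall>d\<in>chambers D - {b}. \<exists>!u. u \<in> U \<beta> \<and> u c = d) \<and>
           (\<forall>g\<in>generate (aut_group D) (\<Union>\<gamma>\<in>\<Phi>. U \<gamma>). g b = b \<longrightarrow>
              (\<lambda>u. conj_by (aut_group D) u g) ` U \<beta> = U \<beta>))"
      using moufang that unfolding moufang_structure_def by (elim conjE) (rule bspec)
    then obtain b where "rt \<beta> = {b} \<and> (\<forall>u\<in>U \<beta>. u b = b) \<and>
           (\<forall>c\<in>chambers D - {b}. \<forall>d\<in>chambers D - {b}. \<exists>!u. u \<in> U \<beta> \<and> u c = d)"
      by (elim conjE exE) (rule that, intro conjI)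
    with M show ?thesis by (intro conjI exI[of _ b]) simp_all
  qed
  obtain b1 where b1: "rt \<alpha> = {b1}" "\<And>u. u \<in> U \<alpha> \<Longrightarrow> u b1 = b1"
    "\<And>c d. c \<in> chambers D - {b1} \<Longrightarrow> d \<in> chambers D - {b1} \<Longrightarrow> \<exists>!u. u \<in> U \<alpha> \<and> u c = d"
  proof -
    from str[OF \<alpha>] obtain b where "rt \<alpha> = {b}" "\<forall>u\<in>U \<alpha>. u b = b"
      "\<forall>c\<in>chambers D - {b}. \<forall>d\<in>chambers D - {b}. \<exists>!u. u \<in> U \<alpha> \<and> u c = d"
      by (elim conjE exE)
    then show thesis by (intro that[of b]) simp_all
  qed
  obtain b2 where b2: "rt (- \<alpha>) = {b2}" "\<And>u. u \<in> U (- \<alpha>) \<Longrightarrow> u b2 = b2"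
    "\<And>c d. c \<in> chambers D - {b2} \<Longrightarrow> d \<in> chambers D - {b2} \<Longrightarrow> \<exists>!u. u \<in> U (- \<alpha>) \<and> u c = d"
  proof -
    from str[OF n\<alpha>] obtain b where "rt (- \<alpha>) = {b}" "\<forall>u\<in>U (- \<alpha>). u b = b"
      "\<forall>c\<in>chambers D - {b}. \<forall>d\<in>chambers D - {b}. \<exists>!u. u \<in> U (- \<alpha>) \<and> u c = d"
      by (elim conjE exE)
    then show thesis by (intro that[of b]) simp_all
  qed
  have sg: "subgroup (U \<alpha>) (aut_group D)" "subgroup (U (- \<alpha>)) (aut_group D)" using str[OF \<alpha>] str[OF n\<alpha>] by simp_all
  have id_mem: "id \<in> U \<alpha>" "id \<in> U (- \<alpha>)"
    using subgroup.one_closed[OF sg(1)] subgroup.one_closed[OF sg(2)] by (simp_all add: one_aut_group)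
  have perm: "g permutes chambers D" if "g \<in> U \<alpha> \<or> g \<in> U (- \<alpha>)" for g
    using that subgroup.mem_carrier[OF sg(1)] subgroup.mem_carrier[OF sg(2)] by (auto simp: carrier_aut_group)
  have mapc: "g c \<in> chambers D" if "g \<in> U \<alpha> \<or> g \<in> U (- \<alpha>)" "c \<in> chambers D" for g c
    using permutes_in_image[OF perm[OF that(1)]] that(2) by blast
  have ginj: "c = d" if "g \<in> U \<alpha> \<or> g \<in> U (- \<alpha>)" "g c = g d" for g c d
    using permutes_inj[OF perm[OF that(1)]] that(2) by (simp add: inj_def)
  have bij: "bij_betw \<pi> (sectors \<Phi>) A"
    using iso by (simp add: chamber_iso_def coxeter_complex_def)
  have sec: "sectors \<Phi> = cone_of \<Phi> ` {q. regular \<Phi> q}" by (rule sectors_eq) (use neg nz in auto)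
  have sides: "T \<subseteq> halfspace (- \<alpha>) \<longleftrightarrow> \<not> T \<subseteq> halfspace \<alpha>" if "T \<in> sectors \<Phi>" for T
  proof -
    obtain q where q: "regular \<Phi> q" "T = cone_of \<Phi> q" using \<open>T \<in> sectors \<Phi>\<close> sec by auto
    have "T \<subseteq> halfspace a \<longleftrightarrow> q \<bullet> a > 0" if "a \<in> \<Phi>" for a
      unfolding q(2) by (rule cone_of_halfspace_iff) (use neg q(1) that in auto)
    from this[OF \<alpha>] this[OF n\<alpha>] show ?thesis
      using q(1) \<alpha> by (auto simp: regular_def neq_iff)
  qed
  have AA: "A = rt \<alpha> \<union> rt (- \<alpha>)"
  proof -
    have "sectors \<Phi> = coxeter_root \<Phi> \<alpha> \<union> coxeter_root \<Phi> (- \<alpha>)" unfolding coxeter_root_def using sides by blast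
    then show ?thesis using bij_betw_imp_surj_on[OF bij] rt[OF \<alpha>] rt[OF n\<alpha>] by (simp add: image_Un)
  qed
  have uniq1: "g = h" if "g \<in> U \<alpha>" "h \<in> U \<alpha>" "c \<in> chambers D" "c \<noteq> b1" "g c = h c" for g h c
  proof -
    have "h c \<noteq> b1" using ginj[of h c b1] b1(2)[OF that(2)] that(2,4) by auto
    then have "\<exists>!u. u \<in> U \<alpha> \<and> u c = h c" using that mapc by (intro b1(3)) auto
    then show ?thesis using that by blast
  qed
  have uniq2: "g = h" if "g \<in> U (- \<alpha>)" "h \<in> U (- \<alpha>)" "c \<in> chambers D" "c \<noteq> b2" "g c = h c" for g h c
  proof -
    have "h c \<noteq> b2" using ginj[of h c b2] b2(2)[OF that(2)] that(2,4) by auto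
    then have "\<exists>!u. u \<in> U (- \<alpha>) \<and> u c = h c" using that mapc by (intro b2(3)) auto
    then show ?thesis using that by blast
  qed
  have trans2: "\<exists>u. u \<in> U (- \<alpha>) \<and> u c = d" if "c \<in> chambers D" "c \<noteq> b2" "d \<in> chambers D" "d \<noteq> b2" for c d
    using b2(3)[of c d] that by blast
  have b12: "b1 \<noteq> b2"
  proof
    assume eq: "b1 = b2"
    obtain T where T: "T \<in> coxeter_root \<Phi> \<alpha>" "b1 = \<pi> T" using b1(1) unfolding rt[OF \<alpha>] by blast
    obtain T' where T': "T' \<in> coxeter_root \<Phi> (- \<alpha>)" "b2 = \<pi> T'" using b2(1) unfolding rt[OF n\<alpha>] by blast
    have TT: "T \<in> sectors \<Phi>" "T' \<in> sectors \<Phi>" using T(1) T'(1) by (simp_all add: coxeter_root_def)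
    have "\<pi> T = \<pi> T'" using T(2) T'(2) eq by simp
    then have "T = T'" by (rule inj_onD[OF bij_betw_imp_inj_on[OF bij] _ TT])
    then show False using T(1) T'(1) sides[OF TT(1)] by (simp add: coxeter_root_def)
  qed
  have A12: "A = {b1, b2}" "b1 \<in> chambers D" "b2 \<in> chambers D" using AA b1(1) b2(1) A by auto
  have u': "u \<in> U \<alpha>" "u \<noteq> id" using u by auto
  have ub1: "u b1 = b1" by (rule b1(2)[OF u'(1)])
  have ub2: "u b2 \<noteq> b2"
  proof
    assume "u b2 = b2"
    then have "u = id" using uniq1[OF u'(1) id_mem(1) A12(3)] b12 by simp
    then show False using u'(2) by blast
  qed
  have ub2': "u b2 \<noteq> b1" using ginj[of u b2 b1] u'(1) ub1 b12 by auto
  obtain d where d: "u d = b2" "d \<in> chambers D"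
  proof -
    have "b2 \<in> u ` chambers D" using permutes_image[OF perm[of u]] u'(1) A12(3) by blast
    then show thesis using that by blast
  qed
  have d2: "d \<noteq> b2" "d \<noteq> b1" using d(1) ub2 ub1 b12 by auto
  obtain y where y: "y \<in> U (- \<alpha>)" "y (u b2) = b1"
    using trans2[of "u b2" b1] mapc[of u b2] u'(1) A12(2,3) ub2 b12 by blast
  obtain x where x: "x \<in> U (- \<alpha>)" "x b1 = d"
    using trans2[of b1 d] A12(2,3) b12 d d2 by blast
  have m_eq: "x \<otimes>\<^bsub>aut_group D\<^esub> u \<otimes>\<^bsub>aut_group D\<^esub> y = y \<circ> u \<circ> x" for x y
    by (simp add: mult_aut_group comp_assoc)
  show ?thesis
  proof (rule ex1I[of _ "y \<circ> u \<circ> x"])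
    have "x \<noteq> id" using x(2) d2(2) by auto
    moreover have "y \<noteq> id" using y(2) ub2' by auto
    moreover have "(y \<circ> u \<circ> x) ` A = A"
      unfolding A12(1) by (simp add: x(2) d(1) b2(2)[OF x(1)] b2(2)[OF y(1)] y(2) insert_commute)
    ultimately show "reflecting D A U \<alpha> u (y \<circ> u \<circ> x)" unfolding reflecting_def m_eq using x(1) y(1) by blast
  next
    fix m assume "reflecting D A U \<alpha> u m"
    then obtain x' y' where x': "x' \<in> U (- \<alpha>)" and y': "y' \<in> U (- \<alpha>)" and m: "m = y' \<circ> u \<circ> x'" "m ` A = A"
      unfolding reflecting_def m_eq by blast
    have m2: "m b2 = y' (u b2)" using m(1) b2(2)[OF x'] by simp
    have "m b2 \<in> {b1, b2}" "m b1 \<in> {b1, b2}" using m(2) unfolding A12(1) by blast+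
    moreover have "m b2 \<noteq> b2"
      using m2 ginj[of y' "u b2" b2] y' b2(2)[OF y'] ub2 by auto
    ultimately have mb2: "m b2 = b1" by blast
    have "m b1 \<noteq> b1"
    proof
      assume "m b1 = b1"
      then have "y' (u (x' b1)) = y' (u (x' b2))" using m(1) mb2 by simp
      then show False using ginj[of y' "u (x' b1)" "u (x' b2)"] ginj[of u "x' b1" "x' b2"] ginj[of x' b1 b2]
          x' y' u'(1) b12 by simp
    qed
    then have mb1: "m b1 = b2" using \<open>m b1 \<in> {b1, b2}\<close> by blast
    have "y' = y" using uniq2[OF y' y(1) _ ub2] mapc[of u b2] u'(1) A12(3) y(2) m2 mb2 by simp
    moreover have "x' b1 = d"
    proof -
      have "y' (u (x' b1)) = y' b2" using mb1 m(1) b2(2)[OF y'] by simp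
      then have "u (x' b1) = u d" using ginj[of y' "u (x' b1)" b2] y' d(1) by simp
      then show ?thesis using ginj[of u "x' b1" d] u'(1) by simp
    qed
    then have "x' = x" using uniq2[OF x' x(1) A12(2) b12] x(2) by simp
    ultimately show "m = y \<circ> u \<circ> x" using m(1) by simp
  qed
qed

text \<open>In rank one the root groups are a Moufang structure; otherwise the root set is of type F4.\<close>

lemma (in suzuki_ree) reflecting_unique:
  assumes rd: "root_datum (sr_roots dPhi \<tau>) (sr_sector S \<tau>) Delta A rt U"
    and \<alpha>: "\<alpha> \<in> sr_roots dPhi \<tau>"
  shows "subgroup (U \<alpha>) (aut_group Delta)" "subgroup (U (- \<alpha>)) (aut_group Delta)" "\<alpha> \<bullet> \<alpha> = 1"
    and "\<And>u. u \<in> U \<alpha> - {id} \<Longrightarrow> \<exists>!m. reflecting Delta A U \<alpha> u m"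
proof -
  let ?\<Phi> = "sr_roots dPhi \<tau>" let ?S = "sr_sector S \<tau>"
  note props = root_set_of_case_props[OF roots]
  obtain p where p: "regular dPhi p" "S = cone_of dPhi p"
  proof -
    have "sectors dPhi = cone_of dPhi ` {q. regular dPhi q}" by (rule sectors_eq) (use props in auto)
    then show thesis using sector that by auto
  qed
  interpret t: twisted_cone dPhi S \<tau> p
    by standard (use props p tau in auto)
  have neg: "- a \<in> ?\<Phi>" if "a \<in> ?\<Phi>" for a using t.sr_neg that .
  have nz: "0 \<notin> ?\<Phi>" using t.sr_unit by force
  show "\<alpha> \<bullet> \<alpha> = 1" by (rule t.sr_unit[OF \<alpha>])
  have A: "A \<in> apartments ?\<Phi> ?S Delta" using rd by (simp add: root_datum_def)
  then have Asub: "A \<subseteq> chambers Delta" by (simp add: apartments_def)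
  obtain \<sigma> \<pi> where iso: "chamber_iso (coxeter_complex ?\<Phi> ?S) (Delta\<lparr>chambers := A\<rparr>) \<sigma> \<pi>"
    and rt: "\<And>\<alpha>. \<alpha> \<in> ?\<Phi> \<Longrightarrow> rt \<alpha> = \<pi> ` coxeter_root ?\<Phi> \<alpha>"
    using rd unfolding root_datum_def by blast
  have "(subgroup (U \<alpha>) (aut_group Delta) \<and> subgroup (U (- \<alpha>)) (aut_group Delta)) \<and>
    (\<forall>u \<in> U \<alpha> - {id}. \<exists>!m. reflecting Delta A U \<alpha> u m)"
  proof (cases "card (colors Delta) = 1")
    case True
    then have m: "moufang_structure ?\<Phi> ?S Delta rt U" using rd by (simp add: root_datum_def)
    then have "subgroup (U \<beta>) (aut_group Delta)" if "\<beta> \<in> ?\<Phi>" for \<beta>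
      using that by (simp add: moufang_structure_def)
    then show ?thesis
      using reflecting_rank_one[OF neg nz m Asub iso rt \<alpha>] \<alpha> neg[OF \<alpha>] by blast
  next
    case False
    then have m: "moufang_building ?\<Phi> ?S Delta" and U: "\<And>\<alpha>. \<alpha> \<in> ?\<Phi> \<Longrightarrow> U \<alpha> = root_group Delta (rt \<alpha>)"
      using rd by (simp_all add: root_datum_def)
    have col: "card (simple_roots ?\<Phi> ?S) \<ge> 2" and bld: "building ?\<Phi> ?S Delta" and thick: "thick Delta"
    proof -
      show bld: "building ?\<Phi> ?S Delta" and "thick Delta" using m unfolding moufang_building_def by blast+
      have "colors Delta = simple_roots ?\<Phi> ?S" using bld unfolding building_def by blast
      then show "card (simple_roots ?\<Phi> ?S) \<ge> 2" using m unfolding moufang_building_def by metis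
    qed
    have "X = Case_F"
    proof (rule ccontr)
      assume "X \<noteq> Case_F"
      then have "root_set_B2 dPhi \<or> root_set_G2 dPhi" using roots by (cases X) (simp_all add: root_set_of_case_def)
      then have fin: "finite dPhi" and sp: "span dPhi = UNIV" and pl: "\<exists>x y :: 'v. span {x, y} = UNIV"
      proof -
        have "finite dPhi \<and> span dPhi = UNIV \<and> (\<exists>x y :: 'v. span {x, y} = UNIV)"
          using \<open>root_set_B2 dPhi \<or> root_set_G2 dPhi\<close>
        proof
          assume B: "root_set_B2 dPhi"
          then have "span dPhi = UNIV" unfolding root_set_B2_def by (rule conjunct1)
          then show ?thesis using root_set_B2_props(1,4)[OF B] by (intro conjI)
        next
          assume G: "root_set_G2 dPhi"
          then have "span dPhi = UNIV" unfolding root_set_G2_def by (rule conjunct1)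
          then show ?thesis using root_set_G2_props(1,4)[OF G] by (intro conjI)
        qed
        then show "finite dPhi" "span dPhi = UNIV" "\<exists>x y :: 'v. span {x, y} = UNIV" by simp_all
      qed
      then obtain x y :: 'v where "span {x, y} = UNIV" by blast
      then show False using t.card_simple_roots_plane[OF fin sp tau(2)] col by fastforce
    qed
    then have F4: "root_set_F4 dPhi" using roots by (simp add: root_set_of_case_def)
    obtain q where rs: "reflection_system ?\<Phi> q ?S"
      and ni: "\<And>\<alpha>. \<alpha> \<in> ?\<Phi> \<Longrightarrow> \<exists>\<beta>\<in>?\<Phi>. \<alpha> \<bullet> \<beta> \<noteq> 0 \<and> \<beta> \<noteq> \<alpha> \<and> \<beta> \<noteq> - \<alpha>"
      using sr_roots_F4[OF F4 sector tau] by blast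
    obtain \<pi>0 where iso0: "chamber_iso (coxeter_complex ?\<Phi> ?S) (Delta\<lparr>chambers := A\<rparr>) id \<pi>0"
      using A unfolding apartments_def by blast
    interpret ap: apartment_system ?\<Phi> q ?S Delta A \<pi>0
      using rs bld Asub iso0 thick col
      by (intro apartment_system.intro building_system.intro building_system_axioms.intro apartment_system_axioms.intro)
    obtain \<beta> where \<beta>: "\<beta> \<in> ?\<Phi>" "\<pi> ` coxeter_root ?\<Phi> \<alpha> = ap.half \<beta>" "\<pi> ` coxeter_root ?\<Phi> (- \<alpha>) = ap.half (- \<beta>)"
      using ap.half_of_iso[OF iso \<alpha>] .
    have UU: "U \<alpha> = root_group Delta (ap.half \<beta>)" "U (- \<alpha>) = root_group Delta (ap.half (- \<beta>))"
      using U[OF \<alpha>] U[OF neg[OF \<alpha>]] rt[OF \<alpha>] rt[OF neg[OF \<alpha>]] \<beta> by simp_all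
    have "ap.nonisolated \<beta>" unfolding ap.nonisolated_def by (rule ni[OF \<beta>(1)])
    have "\<exists>!m. reflecting Delta A U \<alpha> u m" if "u \<in> U \<alpha> - {id}" for u
      unfolding reflecting_def UU(2)
      by (rule ap.reflecting_element_unique) (use m \<beta>(1) \<open>ap.nonisolated \<beta>\<close> that[unfolded UU(1)] in simp_all)
    moreover have "subgroup (U \<alpha>) (aut_group Delta)" "subgroup (U (- \<alpha>)) (aut_group Delta)"
      unfolding UU by (rule subgroup_root_group)+
    ultimately show ?thesis by blast
  qed
  then show "subgroup (U \<alpha>) (aut_group Delta)" "subgroup (U (- \<alpha>)) (aut_group Delta)"
    "\<And>u. u \<in> U \<alpha> - {id} \<Longrightarrow> \<exists>!m. reflecting Delta A U \<alpha> u m" by simp_all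
qed

section \<open>Valuations along one root\<close>

text \<open>A valuation \<open>\<phi>\<close> and a root \<open>\<alpha>\<close> for which the elements \<open>m\<^sub>\<Sigma>(u)\<close> exist and are unique.\<close>

locale valued_root =
  fixes \<Phi> :: "'v::euclidean_space set" and S :: "'v set" and D :: "('c, 'v) chamber_system"
    and A :: "'c set" and rt :: "'v \<Rightarrow> 'c set" and U :: "'v \<Rightarrow> ('c \<Rightarrow> 'c) set"
    and \<phi> :: "'v \<Rightarrow> ('c \<Rightarrow> 'c) \<Rightarrow> ereal" and \<alpha> :: 'v
  assumes valuation: "root_datum_valuation \<Phi> S D A rt U \<phi>"
    and root: "\<alpha> \<in> \<Phi>" and unit: "\<alpha> \<bullet> \<alpha> = 1"
    and subgroups: "subgroup (U \<alpha>) (aut_group D)" "subgroup (U (- \<alpha>)) (aut_group D)"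
    and reflecting_ex1: "\<And>u. u \<in> U \<alpha> - {id} \<Longrightarrow> \<exists>!m. reflecting D A U \<alpha> u m"
begin

sublocale G: group "aut_group D" by (rule group_aut_group)

lemma value_finite: "u \<in> U \<alpha> - {id} \<Longrightarrow> \<bar>\<phi> \<alpha> u\<bar> \<noteq> \<infinity>"
  and value_nonconstant: "\<exists>u\<in>U \<alpha> - {id}. \<exists>v\<in>U \<alpha> - {id}. \<phi> \<alpha> u \<noteq> \<phi> \<alpha> v"
  and level_subgroup: "subgroup (level_set U \<phi> \<alpha> k) (aut_group D)"
  using valuation root by (simp_all add: root_datum_valuation_def valuation_V1_def)

lemma in_carrier: "u \<in> U \<alpha> \<Longrightarrow> u \<in> carrier (aut_group D)"
  "u \<in> U (- \<alpha>) \<Longrightarrow> u \<in> carrier (aut_group D)"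
  by (fact subgroup.mem_carrier[OF subgroups(1)], fact subgroup.mem_carrier[OF subgroups(2)])

lemma inv_nontrivial:
  assumes "u \<in> U \<beta> - {id}" "subgroup (U \<beta>) (aut_group D)"
  shows "inv\<^bsub>aut_group D\<^esub> u \<in> U \<beta> - {id}"
proof -
  have "u \<in> carrier (aut_group D)" using subgroup.mem_carrier[OF assms(2)] assms(1) by simp
  moreover have "inv\<^bsub>aut_group D\<^esub> u \<in> U \<beta>" using assms by (simp add: subgroup.m_inv_closed)
  ultimately show ?thesis using assms(1) G.inv_eq_1_iff[of u] by (simp add: one_aut_group)
qed

lemma value_mult:
  assumes "u \<in> U \<alpha> - {id}" "v \<in> U \<alpha> - {id}"
  shows "min (\<phi> \<alpha> u) (\<phi> \<alpha> v) \<le> \<phi> \<alpha> (u \<otimes>\<^bsub>aut_group D\<^esub> v)"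
proof -
  obtain a b where ab: "\<phi> \<alpha> u = ereal a" "\<phi> \<alpha> v = ereal b"
    using value_finite[OF assms(1)] value_finite[OF assms(2)] by auto
  have "u \<in> level_set U \<phi> \<alpha> (min a b)" "v \<in> level_set U \<phi> \<alpha> (min a b)"
    using assms ab by (auto simp: level_set_def)
  then have "u \<otimes>\<^bsub>aut_group D\<^esub> v \<in> level_set U \<phi> \<alpha> (min a b)"
    by (rule subgroup.m_closed[OF level_subgroup])
  then show ?thesis using ab by (simp add: level_set_def min_def split: if_splits)
qed

lemma value_inv:
  assumes "u \<in> U \<alpha> - {id}"
  shows "\<phi> \<alpha> (inv\<^bsub>aut_group D\<^esub> u) = \<phi> \<alpha> u"
proof -
  have le: "\<phi> \<alpha> v \<le> \<phi> \<alpha> (inv\<^bsub>aut_group D\<^esub> v)" if v: "v \<in> U \<alpha> - {id}" for v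
  proof -
    obtain a where a: "\<phi> \<alpha> v = ereal a" using value_finite[OF v] by auto
    then have "v \<in> level_set U \<phi> \<alpha> a" using v by (simp add: level_set_def)
    then have "inv\<^bsub>aut_group D\<^esub> v \<in> level_set U \<phi> \<alpha> a"
      by (rule subgroup.m_inv_closed[OF level_subgroup])
    then show ?thesis using a by (simp add: level_set_def)
  qed
  have "u \<in> carrier (aut_group D)" using assms in_carrier(1) by simp
  then have "inv\<^bsub>aut_group D\<^esub> (inv\<^bsub>aut_group D\<^esub> u) = u" by simp
  then show ?thesis using le[OF assms] le[OF inv_nontrivial[OF assms subgroups(1)]] by simp
qed

lemma m_elem_reflecting:
  assumes "u \<in> U \<alpha> - {id}" shows "reflecting D A U \<alpha> u (m_elem D A U \<alpha> u)"
  using theI'[OF reflecting_ex1[OF assms]] unfolding m_elem_def reflecting_def .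

lemma m_elem_eq: "u \<in> U \<alpha> - {id} \<Longrightarrow> reflecting D A U \<alpha> u m \<Longrightarrow> m_elem D A U \<alpha> u = m"
  using reflecting_ex1[of u] m_elem_reflecting[of u] by blast

lemma m_elem_carrier:
  assumes "u \<in> U \<alpha> - {id}" shows "m_elem D A U \<alpha> u \<in> carrier (aut_group D)"
proof -
  obtain a b where "a \<in> U (- \<alpha>) - {id}" "b \<in> U (- \<alpha>) - {id}"
    "m_elem D A U \<alpha> u = a \<otimes>\<^bsub>aut_group D\<^esub> u \<otimes>\<^bsub>aut_group D\<^esub> b"
    using m_elem_reflecting[OF assms] unfolding reflecting_def by (elim conjE bexE)
  then show ?thesis using assms in_carrier by simp
qed

text \<open>If \<open>m = a u b\<close> is the reflecting element of \<open>u\<close>, then its inverse is of the required form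
  for the inverse of \<open>u\<close>.\<close>

lemma m_elem_inv:
  assumes u: "u \<in> U \<alpha> - {id}"
  shows "m_elem D A U \<alpha> (inv\<^bsub>aut_group D\<^esub> u) = inv\<^bsub>aut_group D\<^esub> (m_elem D A U \<alpha> u)"
proof (rule m_elem_eq[OF inv_nontrivial[OF u subgroups(1)]])
  let ?m = "m_elem D A U \<alpha> u"
  obtain a b where a: "a \<in> U (- \<alpha>) - {id}" and b: "b \<in> U (- \<alpha>) - {id}"
    and m: "?m = a \<otimes>\<^bsub>aut_group D\<^esub> u \<otimes>\<^bsub>aut_group D\<^esub> b" and mA: "?m ` A = A"
    using m_elem_reflecting[OF u] unfolding reflecting_def by (elim conjE bexE)
  have c: "a \<in> carrier (aut_group D)" "u \<in> carrier (aut_group D)" "b \<in> carrier (aut_group D)"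
    using a b u in_carrier by auto
  have "inv\<^bsub>aut_group D\<^esub> ?m
      = inv\<^bsub>aut_group D\<^esub> b \<otimes>\<^bsub>aut_group D\<^esub> inv\<^bsub>aut_group D\<^esub> u \<otimes>\<^bsub>aut_group D\<^esub> inv\<^bsub>aut_group D\<^esub> a"
    unfolding m using c by (simp add: G.inv_mult_group G.m_assoc)
  moreover have "(inv\<^bsub>aut_group D\<^esub> ?m) ` A = A"
  proof -
    have inj: "inj ?m" using m_elem_carrier[OF u] unfolding carrier_aut_group by (elim conjE) (rule permutes_inj)
    have "inv_into UNIV ?m ` (?m ` A) = A" by (simp add: image_image inj)
    then show ?thesis unfolding mA inv_aut_group[OF m_elem_carrier[OF u]] .
  qed
  ultimately show "reflecting D A U \<alpha> (inv\<^bsub>aut_group D\<^esub> u) (inv\<^bsub>aut_group D\<^esub> ?m)"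
    unfolding reflecting_def using inv_nontrivial[OF a subgroups(2)] inv_nontrivial[OF b subgroups(2)] by blast
qed

lemma value_reflected:
  assumes "u \<in> U \<alpha> - {id}" "g \<in> U \<alpha> - {id}"
  shows "\<phi> (- \<alpha>) (conj_by (aut_group D) g (m_elem D A U \<alpha> u)) = \<phi> \<alpha> g - 2 * \<phi> \<alpha> u"
proof -
  have "refl_in \<alpha> \<alpha> = - \<alpha>" using unit by (simp add: refl_in_def algebra_simps flip: scaleR_2)
  moreover have "valuation_V3 \<Phi> D A U \<phi>" using valuation by (simp add: root_datum_valuation_def)
  ultimately have "\<phi> (- \<alpha>) (conj_by (aut_group D) g (m_elem D A U \<alpha> u)) - \<phi> \<alpha> g = - 2 * \<phi> \<alpha> u"
    using root assms unfolding valuation_V3_def by metis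
  then show ?thesis using value_finite[OF assms(1)] value_finite[OF assms(2)]
    by (cases "\<phi> (- \<alpha>) (conj_by (aut_group D) g (m_elem D A U \<alpha> u))"; cases "\<phi> \<alpha> g"; cases "\<phi> \<alpha> u") auto
qed

lemma conj_nontrivial:
  assumes "g \<in> carrier (aut_group D)" "h \<in> carrier (aut_group D)" "g \<noteq> id"
  shows "conj_by (aut_group D) g h \<noteq> id"
proof
  assume triv: "conj_by (aut_group D) g h = id"
  have "g = (h \<otimes>\<^bsub>aut_group D\<^esub> inv\<^bsub>aut_group D\<^esub> h) \<otimes>\<^bsub>aut_group D\<^esub> g \<otimes>\<^bsub>aut_group D\<^esub> (h \<otimes>\<^bsub>aut_group D\<^esub> inv\<^bsub>aut_group D\<^esub> h)"
    using assms(1,2) by simp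
  also have "\<dots> = h \<otimes>\<^bsub>aut_group D\<^esub> conj_by (aut_group D) g h \<otimes>\<^bsub>aut_group D\<^esub> inv\<^bsub>aut_group D\<^esub> h"
    unfolding conj_by_def using assms(1,2) by (simp only: G.m_assoc G.m_closed G.inv_closed)
  also have "\<dots> = id" unfolding triv using assms(2) G.r_one[of h] G.r_inv[of h] by (simp add: one_aut_group)
  finally show False using assms(3) by simp
qed

text \<open>With \<open>h\<close> the product of \<open>m(w)\<close> and \<open>m(u)\<close>, the conjugate \<open>g\<^sup>h\<close> becomes \<open>g\<close> conjugated by \<open>m(w)\<close> if it is
  conjugated by the inverse of \<open>m(u)\<close>, which is the reflecting element of the inverse of \<open>u\<close>. Hence
  both sides can be evaluated in the root group of \<open>- \<alpha>\<close>.\<close>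

lemma value_conj:
  assumes w: "w \<in> U \<alpha> - {id}" and u: "u \<in> U \<alpha> - {id}" and g: "g \<in> U \<alpha> - {id}"
    and g': "g' = conj_by (aut_group D) g (m_elem D A U \<alpha> w \<otimes>\<^bsub>aut_group D\<^esub> m_elem D A U \<alpha> u)" "g' \<in> U \<alpha>"
  shows "g' \<noteq> id" "\<phi> \<alpha> g' = \<phi> \<alpha> g + 2 * \<phi> \<alpha> u - 2 * \<phi> \<alpha> w"
proof -
  let ?G = "aut_group D" let ?m = "m_elem D A U \<alpha>"
  have c: "?m w \<in> carrier ?G" "?m u \<in> carrier ?G" "g \<in> carrier ?G"
    using m_elem_carrier w u g in_carrier by auto
  show ne: "g' \<noteq> id" unfolding g'(1) by (rule conj_nontrivial) (use c g in auto)
  have "conj_by ?G g' (?m (inv\<^bsub>?G\<^esub> u)) = conj_by ?G g (?m w)"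
  proof -
    have "?m u \<otimes>\<^bsub>?G\<^esub> g' \<otimes>\<^bsub>?G\<^esub> inv\<^bsub>?G\<^esub> ?m u
        = ?m u \<otimes>\<^bsub>?G\<^esub> inv\<^bsub>?G\<^esub> ?m u \<otimes>\<^bsub>?G\<^esub> (inv\<^bsub>?G\<^esub> ?m w \<otimes>\<^bsub>?G\<^esub> g \<otimes>\<^bsub>?G\<^esub> ?m w) \<otimes>\<^bsub>?G\<^esub> (?m u \<otimes>\<^bsub>?G\<^esub> inv\<^bsub>?G\<^esub> ?m u)"
      unfolding g'(1) conj_by_def using c by (simp only: G.inv_mult_group G.m_assoc G.m_closed G.inv_closed)
    also have "\<dots> = inv\<^bsub>?G\<^esub> ?m w \<otimes>\<^bsub>?G\<^esub> g \<otimes>\<^bsub>?G\<^esub> ?m w" using c by simp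
    finally show ?thesis unfolding conj_by_def m_elem_inv[OF u] using c by simp
  qed
  then have "\<phi> \<alpha> g' - 2 * \<phi> \<alpha> (inv\<^bsub>?G\<^esub> u) = \<phi> \<alpha> g - 2 * \<phi> \<alpha> w"
    using value_reflected[OF inv_nontrivial[OF u subgroups(1)], of g'] value_reflected[OF w g] g'(2) ne by simp
  then show "\<phi> \<alpha> g' = \<phi> \<alpha> g + 2 * \<phi> \<alpha> u - 2 * \<phi> \<alpha> w"
    unfolding value_inv[OF u]
    using value_finite[OF u] value_finite[OF w] value_finite[OF g] value_finite[of g'] g'(2) ne
    by (cases "\<phi> \<alpha> u"; cases "\<phi> \<alpha> w"; cases "\<phi> \<alpha> g"; cases "\<phi> \<alpha> g'") auto
qed

lemma iso_facts:
  assumes y: "y \<in> iso H ((aut_group D)\<lparr>carrier := U \<alpha>\<rparr>)" and one: "e \<in> carrier H" "e \<otimes>\<^bsub>H\<^esub> e = e"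
  shows "y e = id" "\<And>z. z \<in> carrier H \<Longrightarrow> z \<noteq> e \<Longrightarrow> y z \<in> U \<alpha> - {id}"
    "\<And>z z'. z \<in> carrier H \<Longrightarrow> z' \<in> carrier H \<Longrightarrow> y (z \<otimes>\<^bsub>H\<^esub> z') = y z \<otimes>\<^bsub>aut_group D\<^esub> y z'"
    "\<And>u. u \<in> U \<alpha> - {id} \<Longrightarrow> \<exists>z\<in>carrier H. z \<noteq> e \<and> u = y z"
proof -
  have hom: "y (z \<otimes>\<^bsub>H\<^esub> z') = y z \<otimes>\<^bsub>aut_group D\<^esub> y z'" if "z \<in> carrier H" "z' \<in> carrier H" for z z'
    using y that by (simp add: iso_def hom_def)
  have bij: "bij_betw y (carrier H) (U \<alpha>)" using y by (simp add: iso_def)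
  have mem: "y z \<in> U \<alpha>" if "z \<in> carrier H" for z using bij_betwE[OF bij] that by blast
  have "y e \<otimes>\<^bsub>aut_group D\<^esub> y e = y e" using hom[OF one(1) one(1)] one(2) by simp
  moreover have "y e \<in> carrier (aut_group D)" by (rule in_carrier(1)[OF mem[OF one(1)]])
  ultimately show e: "y e = id" using G.l_cancel_one[of "y e" "y e"] by (simp add: one_aut_group)
  show "y z \<in> U \<alpha> - {id}" if "z \<in> carrier H" "z \<noteq> e" for z
    using mem[OF that(1)] inj_onD[OF bij_betw_imp_inj_on[OF bij], of z e] that one(1) e by auto
  show "y (z \<otimes>\<^bsub>H\<^esub> z') = y z \<otimes>\<^bsub>aut_group D\<^esub> y z'" if "z \<in> carrier H" "z' \<in> carrier H" for z z'
    by (rule hom[OF that])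
  show "\<exists>z\<in>carrier H. z \<noteq> e \<and> u = y z" if "u \<in> U \<alpha> - {id}" for u
  proof -
    have "u \<in> y ` carrier H" using bij_betw_imp_surj_on[OF bij] that by simp
    then obtain z where z: "z \<in> carrier H" "u = y z" by (rule imageE)
    then have "z \<noteq> e" using that e by auto
    with z show ?thesis by blast
  qed
qed

lemma suzuki_values:
  fixes \<theta> :: "'k::field \<Rightarrow> 'k" and P :: "'k set"
  assumes tits: "tits_endomorphism \<theta>" and char2: "CHAR('k) = 2"
    and P: "0 \<in> P" "range \<theta> \<subseteq> P" "\<And>a b. a \<in> P \<Longrightarrow> b \<in> P \<Longrightarrow> a + b \<in> P" "\<And>a b. a \<in> P \<Longrightarrow> \<theta> b * a \<in> P"
    and coords: "suzuki_coordinates \<theta> P D A U \<alpha> y" and norm: "\<phi> \<alpha> (y (0, 1)) = 0"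
  shows "\<exists>!\<nu>. field_valuation \<nu> \<and> theta_invariant \<theta> \<nu> \<and>
     (\<forall>s\<in>P. \<forall>t\<in>P. (s, t) \<noteq> (0, 0) \<longrightarrow> \<phi> \<alpha> (y (s, t)) = \<nu> (suzuki_norm \<theta> (s, t)))"
proof -
  let ?H = "suzuki_group \<theta> P"
  have iso: "y \<in> iso ?H ((aut_group D)\<lparr>carrier := U \<alpha>\<rparr>)" using coords by (simp add: suzuki_coordinates_def)
  have car: "(s, t) \<in> carrier ?H \<longleftrightarrow> s \<in> P \<and> t \<in> P" for s t by (simp add: suzuki_group_def)
  have mult: "(s, t) \<otimes>\<^bsub>?H\<^esub> (u, v) = (s + u, t + v + \<theta> s * u)" for s t u v by (simp add: suzuki_group_def)
  have e: "(0, 0) \<in> carrier ?H" "(0, 0) \<otimes>\<^bsub>?H\<^esub> (0, 0) = (0, 0)" using P(1) by (simp_all add: car mult)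
  have one_P: "1 \<in> P" using P(2) tits_one[OF tits] by (metis rangeI subsetD)
  note facts = iso_facts[OF iso e]
  have nontriv: "y (s, t) \<in> U \<alpha> - {id}" if "s \<in> P" "t \<in> P" "(s, t) \<noteq> (0, 0)" for s t
    using facts(2)[of "(s, t)"] that by (simp add: car)
  define F where "F z = real_of_ereal (\<phi> \<alpha> (y z))" for z
  have F: "\<phi> \<alpha> (y (s, t)) = ereal (F (s, t))" if "s \<in> P" "t \<in> P" "(s, t) \<noteq> (0, 0)" for s t
    using value_finite[OF nontriv[OF that]] by (auto simp: F_def)
  have conj: "\<theta> (suzuki_norm \<theta> (s, t)) * v \<noteq> 0 \<and> F (0, \<theta> (suzuki_norm \<theta> (s, t)) * v) = F (0, v) + 2 * F (s, t)"
    if v: "v \<in> P" "v \<noteq> 0" and st: "s \<in> P" "t \<in> P" "(s, t) \<noteq> (0, 0)" for v s t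
  proof -
    let ?N = "suzuki_norm \<theta> (s, t)"
    let ?h = "m_elem D A U \<alpha> (y (0, 1)) \<otimes>\<^bsub>aut_group D\<^esub> m_elem D A U \<alpha> (y (s, t))"
    have Nv: "\<theta> ?N * v \<in> P" by (rule P(4)[OF v(1)])
    have "conj_by (aut_group D) (y (0, v)) ?h = y (?N\<^sup>2 / \<theta> ?N * 0, \<theta> ?N * v)"
      by (rule conjunct2[OF coords[unfolded suzuki_coordinates_def Let_def], rule_format, OF P(1) v(1) st])
    then have eq: "y (0, \<theta> ?N * v) = conj_by (aut_group D) (y (0, v)) ?h" by simp
    have mem: "y (0, \<theta> ?N * v) \<in> U \<alpha>"
      using nontriv[of 0 "\<theta> ?N * v"] P(1) Nv facts(1) subgroup.one_closed[OF subgroups(1)]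
      by (cases "\<theta> ?N * v = 0") (auto simp: one_aut_group)
    have w: "y (0, 1) \<in> U \<alpha> - {id}" and g: "y (0, v) \<in> U \<alpha> - {id}"
      using nontriv P(1) one_P v by auto
    note vc = value_conj[OF w nontriv[OF st] g eq mem]
    have nz: "\<theta> ?N * v \<noteq> 0" using vc(1) facts(1) by metis
    have "ereal (F (0, \<theta> ?N * v)) = ereal (F (0, v)) + 2 * ereal (F (s, t)) - 2 * 0"
      using vc(2) F[of 0 "\<theta> ?N * v"] F[of 0 v] F[OF st] norm P(1) Nv v nz by simp
    then show ?thesis using nz by simp
  qed
  have ultra: "F (s + u, t + v + \<theta> s * u) \<ge> min (F (s, t)) (F (u, v))"
    if "s \<in> P" "t \<in> P" "u \<in> P" "v \<in> P" "(s, t) \<noteq> (0, 0)" "(u, v) \<noteq> (0, 0)" "(s + u, t + v + \<theta> s * u) \<noteq> (0, 0)"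
    for s t u v
  proof -
    have "y (s + u, t + v + \<theta> s * u) = y (s, t) \<otimes>\<^bsub>aut_group D\<^esub> y (u, v)"
      using facts(3)[of "(s, t)" "(u, v)"] that by (simp add: car mult)
    then have "min (\<phi> \<alpha> (y (s, t))) (\<phi> \<alpha> (y (u, v))) \<le> \<phi> \<alpha> (y (s + u, t + v + \<theta> s * u))"
      using value_mult[OF nontriv[of s t] nontriv[of u v]] that by simp
    moreover have "\<phi> \<alpha> (y (s + u, t + v + \<theta> s * u)) = ereal (F (s + u, t + v + \<theta> s * u))"
      by (rule F) (use that P in auto)
    ultimately show ?thesis using F[of s t] F[of u v] that by (simp add: min_def split: if_splits)
  qed
  obtain s0 t0 where st0: "s0 \<in> P" "t0 \<in> P" "(s0, t0) \<noteq> (0, 0)" "F (s0, t0) \<noteq> 0"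
  proof -
    obtain u where u: "u \<in> U \<alpha> - {id}" "\<phi> \<alpha> u \<noteq> 0" using value_nonconstant by metis
    obtain s t where st: "(s, t) \<in> carrier ?H" "(s, t) \<noteq> (0, 0)" "u = y (s, t)"
      using facts(4)[OF u(1)] by (metis surj_pair)
    then show thesis using that[of s t] F[of s t] u(2) by (auto simp: car)
  qed
  have "F (0, 1) = 0" using norm by (simp add: F_def)
  then have "\<exists>!\<nu>. field_valuation \<nu> \<and> theta_invariant \<theta> \<nu> \<and>
     (\<forall>s\<in>P. \<forall>t\<in>P. (s, t) \<noteq> (0, 0) \<longrightarrow> ereal (F (s, t)) = \<nu> (suzuki_norm \<theta> (s, t)))"
    by (rule suzuki_valuation[where F = F, OF tits char2 P(1,2) _ _ _ st0]) (use conj ultra in blast)+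
  moreover have "(\<forall>s\<in>P. \<forall>t\<in>P. (s, t) \<noteq> (0, 0) \<longrightarrow> \<phi> \<alpha> (y (s, t)) = \<nu> (suzuki_norm \<theta> (s, t))) \<longleftrightarrow>
      (\<forall>s\<in>P. \<forall>t\<in>P. (s, t) \<noteq> (0, 0) \<longrightarrow> ereal (F (s, t)) = \<nu> (suzuki_norm \<theta> (s, t)))" for \<nu>
    using F by simp
  ultimately show ?thesis by simp
qed

lemma ree_values:
  fixes \<theta> :: "'k::field \<Rightarrow> 'k"
  assumes tits: "tits_endomorphism \<theta>" and char3: "CHAR('k) = 3"
    and coords: "ree_coordinates \<theta> D A U \<alpha> y" and norm: "\<phi> \<alpha> (y (0, 0, 1)) = 0"
  shows "\<exists>!\<nu>. field_valuation \<nu> \<and> theta_invariant \<theta> \<nu> \<and>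
     (\<forall>r s t. (r, s, t) \<noteq> (0, 0, 0) \<longrightarrow> \<phi> \<alpha> (y (r, s, t)) = \<nu> (ree_norm \<theta> (r, s, t)))"
proof -
  let ?H = "ree_group \<theta>"
  have iso: "y \<in> iso ?H ((aut_group D)\<lparr>carrier := U \<alpha>\<rparr>)" using coords by (simp add: ree_coordinates_def)
  have car: "z \<in> carrier ?H" for z by (simp add: ree_group_def)
  have mult: "(r, s, t) \<otimes>\<^bsub>?H\<^esub> (w, u, v) = (r + w, s + u + \<theta> r * w, t + v - r * u + s * w - \<theta> r * r * w)"
    for r s t w u v by (simp add: ree_group_def)
  have e: "(0, 0, 0) \<in> carrier ?H" "(0, 0, 0) \<otimes>\<^bsub>?H\<^esub> (0, 0, 0) = (0, 0, 0)" by (simp_all add: car mult)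
  note facts = iso_facts[OF iso e]
  have nontriv: "y z \<in> U \<alpha> - {id}" if "z \<noteq> (0, 0, 0)" for z
    using facts(2)[OF car that] .
  define F where "F z = real_of_ereal (\<phi> \<alpha> (y z))" for z
  have F: "\<phi> \<alpha> (y z) = ereal (F z)" if "z \<noteq> (0, 0, 0)" for z
    using value_finite[OF nontriv[OF that]] by (auto simp: F_def)
  have conj: "ree_norm \<theta> (r, s, t) * v \<noteq> 0 \<and> F (0, 0, ree_norm \<theta> (r, s, t) * v) = F (0, 0, v) + 2 * F (r, s, t)"
    if v: "v \<noteq> 0" and st: "(r, s, t) \<noteq> (0, 0, 0)" for v r s t
  proof -
    let ?N = "ree_norm \<theta> (r, s, t)"
    let ?h = "m_elem D A U \<alpha> (y (0, 0, 1)) \<otimes>\<^bsub>aut_group D\<^esub> m_elem D A U \<alpha> (y (r, s, t))"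
    have "conj_by (aut_group D) (y (0, 0, v)) ?h = y (?N\<^sup>2 / \<theta> ?N * 0, \<theta> ?N / ?N * 0, ?N * v)"
      by (rule conjunct2[OF coords[unfolded ree_coordinates_def Let_def], rule_format, OF st])
    then have eq: "y (0, 0, ?N * v) = conj_by (aut_group D) (y (0, 0, v)) ?h" by simp
    have mem: "y (0, 0, ?N * v) \<in> U \<alpha>"
      using nontriv[of "(0, 0, ?N * v)"] facts(1) subgroup.one_closed[OF subgroups(1)]
      by (cases "?N * v = 0") (auto simp: one_aut_group)
    have w: "y (0, 0, 1) \<in> U \<alpha> - {id}" and g: "y (0, 0, v) \<in> U \<alpha> - {id}"
      by (rule nontriv, use v in simp)+
    note vc = value_conj[OF w nontriv[OF st] g eq mem]
    have nz: "?N * v \<noteq> 0" using vc(1) facts(1) by metis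
    have "ereal (F (0, 0, ?N * v)) = ereal (F (0, 0, v)) + 2 * ereal (F (r, s, t)) - 2 * 0"
      using vc(2) F[of "(0, 0, ?N * v)"] F[of "(0, 0, v)"] F[OF st] norm v nz by simp
    then show ?thesis using nz by simp
  qed
  have ultra: "F (r + w, s + u + \<theta> r * w, t + v - r * u + s * w - \<theta> r * r * w) \<ge> min (F (r, s, t)) (F (w, u, v))"
    if "(r, s, t) \<noteq> (0, 0, 0)" "(w, u, v) \<noteq> (0, 0, 0)"
      "(r + w, s + u + \<theta> r * w, t + v - r * u + s * w - \<theta> r * r * w) \<noteq> (0, 0, 0)"
    for r s t w u v
    using value_mult[OF nontriv[OF that(1)] nontriv[OF that(2)]]
    unfolding facts(3)[OF car car, symmetric] mult F[OF that(1)] F[OF that(2)] F[OF that(3)]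
    by (simp add: min_def split: if_splits)
  obtain r0 s0 t0 where st0: "(r0, s0, t0) \<noteq> (0, 0, 0)" "F (r0, s0, t0) \<noteq> 0"
  proof -
    obtain u where u: "u \<in> U \<alpha> - {id}" "\<phi> \<alpha> u \<noteq> 0" using value_nonconstant by metis
    obtain r s t where st: "(r, s, t) \<noteq> (0, 0, 0)" "u = y (r, s, t)"
      using facts(4)[OF u(1)] by (metis surj_pair)
    then show thesis using that[of r s t] F[of "(r, s, t)"] u(2) by auto
  qed
  have "F (0, 0, 1) = 0" using norm by (simp add: F_def)
  then have "\<exists>!\<nu>. field_valuation \<nu> \<and> theta_invariant \<theta> \<nu> \<and>
     (\<forall>r s t. (r, s, t) \<noteq> (0, 0, 0) \<longrightarrow> ereal (F (r, s, t)) = \<nu> (ree_norm \<theta> (r, s, t)))"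
    by (rule ree_valuation[where F = F, OF tits char3 _ _ _ st0]) (use conj ultra in blast)+
  moreover have "(\<forall>r s t. (r, s, t) \<noteq> (0, 0, 0) \<longrightarrow> \<phi> \<alpha> (y (r, s, t)) = \<nu> (ree_norm \<theta> (r, s, t))) \<longleftrightarrow>
      (\<forall>r s t. (r, s, t) \<noteq> (0, 0, 0) \<longrightarrow> ereal (F (r, s, t)) = \<nu> (ree_norm \<theta> (r, s, t)))" for \<nu>
    using F by simp
  ultimately show ?thesis by simp
qed

end

section \<open>Translations and the theorem\<close>

lemma level_set_translate: "level_set U (translate \<psi> x) \<alpha> k = level_set U \<psi> \<alpha> (k - \<alpha> \<bullet> x)"
proof -
  have "ereal k \<le> z + ereal a \<longleftrightarrow> ereal (k - a) \<le> z" for z a by (cases z) auto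
  then show ?thesis by (simp add: level_set_def translate_def)
qed

lemma valuation_translate:
  assumes val: "root_datum_valuation \<Phi> S D A rt U \<psi>" and unit: "\<And>\<alpha>. \<alpha> \<in> \<Phi> \<Longrightarrow> \<alpha> \<bullet> \<alpha> = 1"
  shows "root_datum_valuation \<Phi> S D A rt U (translate \<psi> x)"
proof -
  have rd: "root_datum \<Phi> S D A rt U" and V1: "valuation_V1 \<Phi> D U \<psi>" and V2: "valuation_V2 \<Phi> D U \<psi>"
    and V3: "valuation_V3 \<Phi> D A U \<psi>"
    using val by (simp_all add: root_datum_valuation_def)
  have top: "\<psi> \<alpha> id = \<infinity>" and fin: "u \<in> U \<alpha> - {id} \<Longrightarrow> \<bar>\<psi> \<alpha> u\<bar> \<noteq> \<infinity>"
    and nonconst: "\<exists>u\<in>U \<alpha> - {id}. \<exists>v\<in>U \<alpha> - {id}. \<psi> \<alpha> u \<noteq> \<psi> \<alpha> v" if "\<alpha> \<in> \<Phi>" for \<alpha> u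
    using val that by (simp_all add: root_datum_valuation_def)
  have "\<bar>translate \<psi> x \<alpha> u\<bar> \<noteq> \<infinity>" if "\<alpha> \<in> \<Phi>" "u \<in> U \<alpha> - {id}" for \<alpha> u
    using fin[OF that] by (cases "\<psi> \<alpha> u") (auto simp: translate_def)
  moreover have "\<exists>u\<in>U \<alpha> - {id}. \<exists>v\<in>U \<alpha> - {id}. translate \<psi> x \<alpha> u \<noteq> translate \<psi> x \<alpha> v" if a: "\<alpha> \<in> \<Phi>" for \<alpha>
  proof -
    obtain u v where uv: "u \<in> U \<alpha> - {id}" "v \<in> U \<alpha> - {id}" "\<psi> \<alpha> u \<noteq> \<psi> \<alpha> v" using nonconst[OF a] by blast
    then have "translate \<psi> x \<alpha> u \<noteq> translate \<psi> x \<alpha> v"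
      using fin[OF a uv(1)] fin[OF a uv(2)] by (cases "\<psi> \<alpha> u"; cases "\<psi> \<alpha> v") (auto simp: translate_def)
    with uv show ?thesis by blast
  qed
  moreover have "valuation_V1 \<Phi> D U (translate \<psi> x)"
    using V1 unfolding valuation_V1_def level_set_translate by blast
  moreover have "valuation_V2 \<Phi> D U (translate \<psi> x)"
    unfolding valuation_V2_def
  proof (intro ballI allI impI)
    fix \<alpha> \<beta> and k l :: real
    assume ab: "\<alpha> \<in> \<Phi>" "\<beta> \<in> \<Phi>" "\<alpha> \<noteq> \<beta> \<and> \<alpha> \<noteq> - \<beta>"
    have shift: "level_set U (translate \<psi> x) (p *\<^sub>R \<alpha> + q *\<^sub>R \<beta>) (p * k + q * l)
        = level_set U \<psi> (p *\<^sub>R \<alpha> + q *\<^sub>R \<beta>) (p * (k - \<alpha> \<bullet> x) + q * (l - \<beta> \<bullet> x))" for p q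
      unfolding level_set_translate
      by (rule arg_cong[where f = "level_set U \<psi> (p *\<^sub>R \<alpha> + q *\<^sub>R \<beta>)"]) (simp add: inner_add_left algebra_simps)
    show "\<exists>pqs. roots_between \<Phi> \<alpha> \<beta> pqs \<and>
        generate (aut_group D) {comm (aut_group D) a b | a b.
          a \<in> level_set U (translate \<psi> x) \<alpha> k \<and> b \<in> level_set U (translate \<psi> x) \<beta> l}
        \<subseteq> foldr (\<lambda>(p, q) X. level_set U (translate \<psi> x) (p *\<^sub>R \<alpha> + q *\<^sub>R \<beta>) (p * k + q * l) <#>\<^bsub>aut_group D\<^esub> X)
             pqs {\<one>\<^bsub>aut_group D\<^esub>}"
      unfolding shift unfolding level_set_translate
      using V2 ab unfolding valuation_V2_def by blast
  qed
  moreover have "valuation_V3 \<Phi> D A U (translate \<psi> x)"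
    unfolding valuation_V3_def
  proof (intro ballI)
    fix \<alpha> \<beta> u assume ab: "\<alpha> \<in> \<Phi>" "\<beta> \<in> \<Phi>" "u \<in> U \<alpha> - {id}"
    let ?g = "\<lambda>g. conj_by (aut_group D) g (m_elem D A U \<alpha> u)"
    let ?d = "refl_in \<alpha> \<beta> \<bullet> x - \<beta> \<bullet> x"
    have "\<exists>c. \<forall>g\<in>U \<beta> - {id}.
        \<psi> (refl_in \<alpha> \<beta>) (?g g) - \<psi> \<beta> g = c \<and> (\<alpha> = \<beta> \<longrightarrow> c = - 2 * \<psi> \<alpha> u)"
      using V3 ab unfolding valuation_V3_def by blast
    then obtain c where "\<forall>g\<in>U \<beta> - {id}.
        \<psi> (refl_in \<alpha> \<beta>) (?g g) - \<psi> \<beta> g = c \<and> (\<alpha> = \<beta> \<longrightarrow> c = - 2 * \<psi> \<alpha> u)"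
      by (elim exE)
    note c = bspec[OF this]
    show "\<exists>c. \<forall>g\<in>U \<beta> - {id}. translate \<psi> x (refl_in \<alpha> \<beta>) (?g g) - translate \<psi> x \<beta> g = c \<and>
        (\<alpha> = \<beta> \<longrightarrow> c = - 2 * translate \<psi> x \<alpha> u)"
    proof (intro exI ballI conjI impI)
      fix g assume g: "g \<in> U \<beta> - {id}"
      show "translate \<psi> x (refl_in \<alpha> \<beta>) (?g g) - translate \<psi> x \<beta> g = c + ereal ?d"
        unfolding translate_def conjunct1[OF c[OF g], symmetric] using fin[OF ab(2) g]
        by (cases "\<psi> (refl_in \<alpha> \<beta>) (?g g)"; cases "\<psi> \<beta> g") auto
      assume "\<alpha> = \<beta>"
      moreover from this have "?d = - 2 * (\<alpha> \<bullet> x)"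
        using unit[OF ab(1)] by (simp add: refl_in_def inner_diff_left)
      ultimately show "c + ereal ?d = - 2 * translate \<psi> x \<alpha> u"
        using c[OF g] fin[OF ab(1,3)] by (cases "\<psi> \<alpha> u") (auto simp: translate_def)
    qed
  qed
  ultimately show ?thesis using rd top by (simp add: root_datum_valuation_def translate_def)
qed

lemma normalize_equipollent:
  assumes "\<alpha> \<in> \<Phi>" shows "equipollent \<Phi> U (normalize_at \<alpha> w \<psi>) \<psi>"
  unfolding equipollent_def normalize_at_def
  by (intro bexI[of _ "- (real_of_ereal (\<psi> \<alpha> w) / (\<alpha> \<bullet> \<alpha>)) *\<^sub>R \<alpha>"] span_scale span_base assms) simp

lemma normalize_at_value:
  "\<alpha> \<bullet> \<alpha> = 1 \<Longrightarrow> normalize_at \<alpha> w \<psi> \<alpha> u = \<psi> \<alpha> u - ereal (real_of_ereal (\<psi> \<alpha> w))"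
  by (cases "\<psi> \<alpha> u") (simp_all add: normalize_at_def translate_def)

text \<open>Normalization removes the translation by which equipollent valuations differ.\<close>

lemma normalize_at_equipollent:
  assumes eq: "equipollent \<Phi> U \<psi>' \<psi>" and \<alpha>: "\<alpha> \<in> \<Phi>" "\<alpha> \<bullet> \<alpha> = 1"
    and wu: "w \<in> U \<alpha>" "u \<in> U \<alpha>" and fin: "\<bar>\<psi> \<alpha> w\<bar> \<noteq> \<infinity>"
  shows "normalize_at \<alpha> w \<psi>' \<alpha> u = normalize_at \<alpha> w \<psi> \<alpha> u"
proof -
  obtain x where "\<psi>' \<alpha> w = \<psi> \<alpha> w + ereal (\<alpha> \<bullet> x)" "\<psi>' \<alpha> u = \<psi> \<alpha> u + ereal (\<alpha> \<bullet> x)"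
    using eq \<alpha>(1) wu unfolding equipollent_def translate_def by blast
  then show ?thesis unfolding normalize_at_value[OF \<alpha>(2)] using fin
    by (cases "\<psi> \<alpha> w"; cases "\<psi> \<alpha> u") auto
qed

lemma sr_params_closed:
  assumes "suzuki_ree X \<theta> L dPhi S \<tau> dDelta dSigma d\<psi> x \<rho>"
  shows "0 \<in> sr_params X L" "range \<theta> \<subseteq> sr_params X L"
    and "a \<in> sr_params X L \<Longrightarrow> b \<in> sr_params X L \<Longrightarrow> a + b \<in> sr_params X L"
    and "a \<in> sr_params X L \<Longrightarrow> \<theta> c * a \<in> sr_params X L"
proof -
  interpret suzuki_ree X \<theta> L dPhi S \<tau> dDelta dSigma d\<psi> x \<rho>
    "sr_params X L" "\<lambda>\<alpha>. root_group dDelta (d\<psi> ` coxeter_root dPhi \<alpha>)" "aut_group dDelta"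
    by (rule assms)
  have add: "a + b \<in> L" if "X = Case_B" "a \<in> L" "b \<in> L" for a b
  proof -
    have "a - (0 - b) \<in> L" using L_subgroup[OF that(1)] that(2,3) by blast
    then show ?thesis by simp
  qed
  have mult: "\<theta> c * a \<in> L" if "X = Case_B" "a \<in> L" for a c
    using L_F[OF that(1)] that(2) by (simp add: mult.commute)
  show "0 \<in> sr_params X L" "range \<theta> \<subseteq> sr_params X L" using L_subgroup L_F by (auto simp: sr_params_def)
  show "a \<in> sr_params X L \<Longrightarrow> b \<in> sr_params X L \<Longrightarrow> a + b \<in> sr_params X L"
    using add by (auto simp: sr_params_def)
  show "a \<in> sr_params X L \<Longrightarrow> \<theta> c * a \<in> sr_params X L"
    using mult by (auto simp: sr_params_def)
qed

theorem theorem7p1: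
  fixes X :: sr_case
    and \<theta> :: "'k::field \<Rightarrow> 'k"
    and L :: "'k set"
    and dPhi :: "'v::euclidean_space set"
    and S :: "'v set"
    and \<tau> :: "'v \<Rightarrow> 'v"
    and dDelta :: "('c, 'v) chamber_system"
    and dSigma :: "'c set"
    and d\<psi> :: "'v set \<Rightarrow> 'c"
    and x :: "'v \<Rightarrow> 'k \<Rightarrow> 'c \<Rightarrow> 'c"
    and \<rho> :: "'c \<Rightarrow> 'c"
    and P :: "'k set"
    and \<Phi> :: "'v set"
    and Delta :: "('c, 'v) chamber_system"
    and Sigma0 :: "'c set"
    and rt :: "'v \<Rightarrow> 'c set"
    and U :: "'v \<Rightarrow> ('c \<Rightarrow> 'c) set"
    and valuation :: "('v \<Rightarrow> ('c \<Rightarrow> 'c) \<Rightarrow> ereal) \<Rightarrow> bool"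
    and \<psi> :: "'v \<Rightarrow> ('c \<Rightarrow> 'c) \<Rightarrow> ereal"
  assumes data: "suzuki_ree X \<theta> L dPhi S \<tau> dDelta dSigma d\<psi> x \<rho>"
    and P_def: "P = sr_params X L"
    and Phi_def: "\<Phi> = sr_roots dPhi \<tau>"
    and Delta_def: "Delta = sr_building dPhi S \<tau> dDelta \<rho>"
    and Sigma_def: "Sigma0 = sr_apartment dSigma \<rho>"
    and rt_def: "rt = sr_root dPhi \<tau> dSigma d\<psi> \<rho>"
    and U_def: "U = sr_root_group dPhi \<tau> dDelta d\<psi> \<rho>"
    and valuation_def: "valuation = root_datum_valuation \<Phi> (sr_sector S \<tau>) Delta Sigma0 rt U"
    and psi: "valuation \<psi>"
  shows
    "(X \<in> {Case_B, Case_F} \<longrightarrow>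
       (\<forall>\<alpha>\<in>\<Phi>. \<forall>y. suzuki_coordinates \<theta> P Delta Sigma0 U \<alpha> y \<longrightarrow>
          (let w = y (0, 1);
               represents = (\<lambda>\<psi>' \<nu>. field_valuation \<nu> \<and> theta_invariant \<theta> \<nu> \<and>
                 (\<forall>s\<in>P. \<forall>t\<in>P. (s, t) \<noteq> (0, 0) \<longrightarrow>
                    normalize_at \<alpha> w \<psi>' \<alpha> (y (s, t)) = \<nu> (suzuki_norm \<theta> (s, t))))
           in valuation (normalize_at \<alpha> w \<psi>) \<and> equipollent \<Phi> U (normalize_at \<alpha> w \<psi>) \<psi> \<and>
              normalize_at \<alpha> w \<psi> \<alpha> w = 0 \<and>
              (\<exists>!\<nu>. represents \<psi> \<nu>) \<and>
              (\<forall>\<psi>' \<nu>. valuation \<psi>' \<and> equipollent \<Phi> U \<psi>' \<psi> \<longrightarrow> represents \<psi>' \<nu> = represents \<psi> \<nu>)))) \<and>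
     (X = Case_G \<longrightarrow>
       (\<forall>\<alpha>\<in>\<Phi>. \<forall>y. ree_coordinates \<theta> Delta Sigma0 U \<alpha> y \<longrightarrow>
          (let w = y (0, 0, 1);
               represents = (\<lambda>\<psi>' \<nu>. field_valuation \<nu> \<and> theta_invariant \<theta> \<nu> \<and>
                 (\<forall>r s t. (r, s, t) \<noteq> (0, 0, 0) \<longrightarrow>
                    normalize_at \<alpha> w \<psi>' \<alpha> (y (r, s, t)) = \<nu> (ree_norm \<theta> (r, s, t))))
           in valuation (normalize_at \<alpha> w \<psi>) \<and> equipollent \<Phi> U (normalize_at \<alpha> w \<psi>) \<psi> \<and>
              normalize_at \<alpha> w \<psi> \<alpha> w = 0 \<and>
              (\<exists>!\<nu>. represents \<psi> \<nu>) \<and>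
              (\<forall>\<psi>' \<nu>. valuation \<psi>' \<and> equipollent \<Phi> U \<psi>' \<psi> \<longrightarrow> represents \<psi>' \<nu> = represents \<psi> \<nu>))))"
proof -
  let ?val = "root_datum_valuation \<Phi> (sr_sector S \<tau>) Delta Sigma0 rt U"
  have char: "CHAR('k) = (if X = Case_G then 3 else 2)" and tits: "tits_endomorphism \<theta>"
    using data by (simp_all add: suzuki_ree_def)
  note closed = sr_params_closed[OF data, folded P_def]
  have rd: "root_datum (sr_roots dPhi \<tau>) (sr_sector S \<tau>) Delta Sigma0 rt U"
    using psi unfolding valuation_def root_datum_valuation_def Phi_def by (rule conjunct1)
  note reflecting = suzuki_ree.reflecting_unique[OF data rd, folded Phi_def]
  have rooted: "valued_root \<Phi> (sr_sector S \<tau>) Delta Sigma0 rt U \<phi> \<alpha>" if "?val \<phi>" "\<alpha> \<in> \<Phi>" for \<phi> \<alpha>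
    by (rule valued_root.intro[OF that reflecting(3,1,2,4)[OF that(2)]])
  have normalized: "valuation (normalize_at \<alpha> w \<psi>)" for \<alpha> w
    using psi reflecting(3) unfolding valuation_def normalize_at_def by (rule valuation_translate)
  have normal: "normalize_at \<alpha> w \<psi> \<alpha> w = 0"
    and invariant: "valuation \<psi>' \<and> equipollent \<Phi> U \<psi>' \<psi> \<Longrightarrow> u \<in> U \<alpha> \<Longrightarrow>
          normalize_at \<alpha> w \<psi>' \<alpha> u = normalize_at \<alpha> w \<psi> \<alpha> u"
    if \<alpha>: "\<alpha> \<in> \<Phi>" and w: "w \<in> U \<alpha> - {id}" for \<alpha> w \<psi>' u
  proof -
    interpret v: valued_root \<Phi> "sr_sector S \<tau>" Delta Sigma0 rt U \<psi> \<alpha>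
      using psi \<alpha> unfolding valuation_def by (rule rooted)
    show "normalize_at \<alpha> w \<psi> \<alpha> w = 0"
      using v.value_finite[OF w] unfolding normalize_at_value[OF v.unit] by (cases "\<psi> \<alpha> w") auto
    show "normalize_at \<alpha> w \<psi>' \<alpha> u = normalize_at \<alpha> w \<psi> \<alpha> u"
      if "valuation \<psi>' \<and> equipollent \<Phi> U \<psi>' \<psi>" "u \<in> U \<alpha>"
      using that w by (intro normalize_at_equipollent[where \<Phi> = \<Phi> and U = U] \<alpha> v.unit v.value_finite) auto
  qed
  show ?thesis
  proof (intro conjI impI ballI allI)
    fix \<alpha> y
    assume X: "X \<in> {Case_B, Case_F}" and \<alpha>: "\<alpha> \<in> \<Phi>" and coords: "suzuki_coordinates \<theta> P Delta Sigma0 U \<alpha> y"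
    let ?\<phi> = "normalize_at \<alpha> (y (0, 1)) \<psi>"
    interpret n: valued_root \<Phi> "sr_sector S \<tau>" Delta Sigma0 rt U ?\<phi> \<alpha>
      using normalized \<alpha> unfolding valuation_def by (rule rooted)
    have "1 \<in> P" using closed(2) tits_one[OF tits] by (metis rangeI subsetD)
    have nontriv: "y (s, t) \<in> U \<alpha> - {id}" if "s \<in> P" "t \<in> P" "(s, t) \<noteq> (0, 0)" for s t
    proof (rule n.iso_facts(2)[where e = "(0, 0)"])
      show "y \<in> iso (suzuki_group \<theta> P) ((aut_group Delta)\<lparr>carrier := U \<alpha>\<rparr>)"
        using coords by (simp add: suzuki_coordinates_def)
    qed (use that closed(1) in \<open>simp_all add: suzuki_group_def\<close>)
    have w: "y (0, 1) \<in> U \<alpha> - {id}" using nontriv[of 0 1] closed(1) \<open>1 \<in> P\<close> by simp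
    have char2: "CHAR('k) = 2" using char X by auto
    have ex1: "\<exists>!\<nu>. field_valuation \<nu> \<and> theta_invariant \<theta> \<nu> \<and>
        (\<forall>s\<in>P. \<forall>t\<in>P. (s, t) \<noteq> (0, 0) \<longrightarrow> ?\<phi> \<alpha> (y (s, t)) = \<nu> (suzuki_norm \<theta> (s, t)))"
      by (rule n.suzuki_values[OF tits char2 closed coords normal[OF \<alpha> w]])
    have "normalize_at \<alpha> (y (0, 1)) \<psi>' \<alpha> (y (s, t)) = ?\<phi> \<alpha> (y (s, t))"
      if "valuation \<psi>' \<and> equipollent \<Phi> U \<psi>' \<psi>" "s \<in> P" "t \<in> P" "(s, t) \<noteq> (0, 0)" for \<psi>' s t
      using invariant[OF \<alpha> w that(1)] nontriv[OF that(2-4)] by simp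
    with normalized normalize_equipollent[OF \<alpha>] normal[OF \<alpha> w] ex1
    show "let w = y (0, 1);
               represents = (\<lambda>\<psi>' \<nu>. field_valuation \<nu> \<and> theta_invariant \<theta> \<nu> \<and>
                 (\<forall>s\<in>P. \<forall>t\<in>P. (s, t) \<noteq> (0, 0) \<longrightarrow>
                    normalize_at \<alpha> w \<psi>' \<alpha> (y (s, t)) = \<nu> (suzuki_norm \<theta> (s, t))))
           in valuation (normalize_at \<alpha> w \<psi>) \<and> equipollent \<Phi> U (normalize_at \<alpha> w \<psi>) \<psi> \<and>
              normalize_at \<alpha> w \<psi> \<alpha> w = 0 \<and>
              (\<exists>!\<nu>. represents \<psi> \<nu>) \<and>
              (\<forall>\<psi>' \<nu>. valuation \<psi>' \<and> equipollent \<Phi> U \<psi>' \<psi> \<longrightarrow> represents \<psi>' \<nu> = represents \<psi> \<nu>)"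
      unfolding Let_def by (intro conjI allI impI) simp_all
  next
    fix \<alpha> y
    assume X: "X = Case_G" and \<alpha>: "\<alpha> \<in> \<Phi>" and coords: "ree_coordinates \<theta> Delta Sigma0 U \<alpha> y"
    let ?\<phi> = "normalize_at \<alpha> (y (0, 0, 1)) \<psi>"
    interpret n: valued_root \<Phi> "sr_sector S \<tau>" Delta Sigma0 rt U ?\<phi> \<alpha>
      using normalized \<alpha> unfolding valuation_def by (rule rooted)
    have nontriv: "y z \<in> U \<alpha> - {id}" if "z \<noteq> (0, 0, 0)" for z
    proof (rule n.iso_facts(2)[where e = "(0, 0, 0)"])
      show "y \<in> iso (ree_group \<theta>) ((aut_group Delta)\<lparr>carrier := U \<alpha>\<rparr>)"
        using coords by (simp add: ree_coordinates_def)
    qed (use that in \<open>simp_all add: ree_group_def\<close>)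
    have w: "y (0, 0, 1) \<in> U \<alpha> - {id}" by (rule nontriv) simp
    have char3: "CHAR('k) = 3" using char X by simp
    have ex1: "\<exists>!\<nu>. field_valuation \<nu> \<and> theta_invariant \<theta> \<nu> \<and>
        (\<forall>r s t. (r, s, t) \<noteq> (0, 0, 0) \<longrightarrow> ?\<phi> \<alpha> (y (r, s, t)) = \<nu> (ree_norm \<theta> (r, s, t)))"
      by (rule n.ree_values[OF tits char3 coords normal[OF \<alpha> w]])
    have "normalize_at \<alpha> (y (0, 0, 1)) \<psi>' \<alpha> (y z) = ?\<phi> \<alpha> (y z)"
      if "valuation \<psi>' \<and> equipollent \<Phi> U \<psi>' \<psi>" "z \<noteq> (0, 0, 0)" for \<psi>' z
      using invariant[OF \<alpha> w that(1)] nontriv[OF that(2)] by simp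
    with normalized normalize_equipollent[OF \<alpha>] normal[OF \<alpha> w] ex1
    show "let w = y (0, 0, 1);
               represents = (\<lambda>\<psi>' \<nu>. field_valuation \<nu> \<and> theta_invariant \<theta> \<nu> \<and>
                 (\<forall>r s t. (r, s, t) \<noteq> (0, 0, 0) \<longrightarrow>
                    normalize_at \<alpha> w \<psi>' \<alpha> (y (r, s, t)) = \<nu> (ree_norm \<theta> (r, s, t))))
           in valuation (normalize_at \<alpha> w \<psi>) \<and> equipollent \<Phi> U (normalize_at \<alpha> w \<psi>) \<psi> \<and>
              normalize_at \<alpha> w \<psi> \<alpha> w = 0 \<and>
              (\<exists>!\<nu>. represents \<psi> \<nu>) \<and>
              (\<forall>\<psi>' \<nu>. valuation \<psi>' \<and> equipollent \<Phi> U \<psi>' \<psi> \<longrightarrow> represents \<psi>' \<nu> = represents \<psi> \<nu>)"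
      unfolding Let_def by (intro conjI allI impI) simp_all
  qed
qed

end
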